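(* Let $\delta>-1$ and let $(\mathcal{T}_n)_{n\ge 1}$ be the self-reinforced preferential attachment trees with parameter $\delta$. Then, as $n\to\infty$, $\mathcal{T}_n$ converges in probability in the extended fringe sense (local convergence in probability) to the unique infinite random sin-tree $\mathcal{T}_\infty$ with fringe distribution $\varpi_\delta$, where $\varpi_\delta$ is the law of $\mathrm{BP}_\delta(T_1)$. In particular, with $N_k(n)$ the number of vertices of degree exactly $k$ in $\mathcal{T}_n$, $$\frac{N_k(n)}{n}\ \stackrel{\mathbb{P}}{\longrightarrow}\ p_\delta(k):=\mathbb{P}\Big(\sum_{j=1}^{k-1}E_j\le T_1<\sum_{j=1}^{k}E_j\Big),\qquad k\ge 1,$$ where $(E_j)_{j\ge 1}$ are the inter-arrival times of the point process $\mathcal{P}_\delta$ and $T_1$ is a rate-$1$ exponential random variable independent of $(E_j)_{j\ge1}$.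
   Context: **The trees.** Fix $\delta>-1$. $\mathcal{T}_n$ is a random tree on vertices $v_0,\dots,v_n$, rooted at $v_0$. $\mathcal{T}_1$ is the single edge $\{v_0,v_1\}$, and by convention $\mathcal{T}_0=\mathcal{T}_1$. Let $d(v_i,m)$ be the degree of $v_i$ in $\mathcal{T}_m$ for $m\ge i$ (by the convention, $d(v_0,0)=1$), and let $$\theta(v_i,n)=\sum_{m=i}^{n}\big(d(v_i,m)+\delta\big),\qquad 0\le i\le n .$$ For $n\ge1$, given $\mathcal{T}_1,\dots,\mathcal{T}_n$, the tree $\mathcal{T}_{n+1}$ is obtained by attaching the new vertex $v_{n+1}$ by a single edge to $v_i$ with conditional probability $\theta(v_i,n)/\sum_{j=0}^n\theta(v_j,n)$, $0\le i\le n$. **The point process $\mathcal{P}_\delta$.** It is the point process on $(0,\infty)$ with points $\sigma_k=\sum_{i=1}^k E_i$, $k\ge1$ ($\sigma_0=0$), where the inter-arrival times $E_k>0$ are defined recursively: given $E_1,\dots,E_{k-1}$, the variable $E_k$ has hazard rate $$h_k(x)=\frac{1+\delta}{1+\frac12\delta}\big(1-e^{-(x+\sigma_{k-1})}\big)+\frac{1}{1+\frac12\delta}\sum_{j=1}^{k-1}\big(1-e^{-(\sigma_{k-1}-\sigma_j+x)}\big),\quad x\ge 0,$$ i.e. $\mathbb{P}(E_k>s\mid \sigma_1,\dots,\sigma_{k-1})=\exp(-\int_0^s h_k(x)\,dx)$. **The law $\varpi_\delta$.** $\mathrm{BP}_\delta(\cdot)$ is the continuous-time branching process started from one individual at time $0$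 in which each individual lives forever and has children at the times (measured from its own birth) given by an independent copy of $\mathcal{P}_\delta$. $T_1\sim\exp(1)$ is independent of $\mathrm{BP}_\delta$. $\varpi_\delta$ is the law of $\mathrm{BP}_\delta(T_1)$, the genealogical tree of all individuals born by time $T_1$, viewed as a finite rooted tree, rooted at the initial individual. **Fringes and sin-trees.** Let $\mathbb{T}$ be the countable set of finite rooted trees (including the empty tree $\emptyset$) up to root-preserving isomorphism, with the discrete topology. For a finite rooted tree $\mathbf{t}$ with root $\rho$ and $v\in\mathbf{t}$ with path $(v_0'=v,v_1',\dots,v_h'=\rho)$ to the root, let $f_0(v,\mathbf{t})$ be the subtree of $v$ and its descendants, rooted at $v$. For $1\le i\le h$ let $f_i(v,\mathbf{t})$ be the subtree rooted at $v_i'$ of all vertices whose path from the root passes through $v_i'$ but not through $v_{i-1}'$. Put $f_i(v,\mathbf{t})=\emptyset$ for $i>h$. Let $F_k(v,\mathbf{t})=(f_0(v,\mathbf{t}),\dots,f_k(v,\mathbf{t}))$. A sin-tree is an infinite locally finite tree with a single infinite path $0,1,2,\dots$ and root $0$. It is described by the sequence $(\mathbf{t}_0,\mathbf{t}_1,\dots)$ of non-empty finite trees, where $\mathbf{t}_i$ is rooted at $i$ and hangs off the path at $i$; write $F_k(0,\cdot)=(\mathbf{t}_0,\dots,\mathbf{t}_k)$. Its monotone representation is $(\bar{\mathbf{t}}_0,\bar{\mathbf{t}}_1,\dots)$, where $\bar{\mathbf{t}}_i$ is the tree rooted at $i$ formed by $\mathbf{t}_0,\dots,\mathbf{t}_i$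 and the path edges between $0,\dots,i$. For $\mathbf{s},\mathbf{t}\in\mathbb{T}$ let $\mathbf{Q}(\mathbf{s},\mathbf{t})$ be the number of children $u$ of the root of $\mathbf{s}$ such that the subtree of $u$ and its descendants is isomorphic to $\mathbf{t}$. A probability measure $\varpi$ on $\mathbb{T}$ is a fringe distribution if $\sum_{\mathbf{s}}\varpi(\mathbf{s})\mathbf{Q}(\mathbf{s},\mathbf{t})=\varpi(\mathbf{t})$ for all $\mathbf{t}$. The sin-tree with fringe distribution $\varpi$ is the random sin-tree $\mathcal{T}_\infty$ whose law is determined by requiring, for its monotone representation and all $i\ge0$, $$\mathbb{P}\big((\bar{\mathbf{t}}_0(\mathcal{T}_\infty),\dots,\bar{\mathbf{t}}_i(\mathcal{T}_\infty))=(\bar{\mathbf{t}}_0,\dots,\bar{\mathbf{t}}_i)\big)=\varpi(\bar{\mathbf{t}}_i)\prod_{j=1}^i\mathbf{Q}(\bar{\mathbf{t}}_j,\bar{\mathbf{t}}_{j-1}).$$ **Convergence.** $\mathcal{T}_n$ converges in probability in the extended fringe sense to $\mathcal{T}_\infty$ if for every $k\ge0$ the random empirical measure $\frac{1}{n+1}\sum_{v\in\mathcal{T}_n}\delta_{F_k(v,\mathcal{T}_n)}$ on $\mathbb{T}^{k+1}$ ($\delta_{\{\cdot\}}$ here being a Dirac mass) converges in probability, in the weak topology, to the law of $F_k(0,\mathcal{T}_\infty)$. *)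

theory Defs
  imports "HOL-Probability.Probability" "HOL-Library.Multiset"
begin

section \<open>Finite rooted trees up to isomorphism\<close>

text \<open>
  Since multisets forget the order of the children, the elements of the following datatype are
  exactly the root-preserving isomorphism classes of non-empty finite rooted trees.
\<close>

datatype rtree = Node (subtrees: "rtree multiset")

text \<open>
  The set of all finite rooted trees including the empty one is \<open>rtree option\<close>, with
  \<open>None\<close> as the empty tree.

  \<open>has_shape C v t\<close>: the tree consisting of \<open>v\<close> and its descendants, where
  \<open>C u\<close> is the set of children of \<open>u\<close>, is finite and belongs to the class \<open>t\<close>.
\<close>

inductive has_shape :: "('v \<Rightarrow> 'v set) \<Rightarrow> 'v \<Rightarrow> rtree \<Rightarrow> bool" for C where
  "finite (C v) \<Longrightarrow> (\<forall>u\<in>C v. has_shape C u (g u)) \<Longrightarrow>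
     has_shape C v (Node (image_mset g (mset_set (C v))))"

lemma has_shape_unique:
  assumes "has_shape C v s" "has_shape C v t"
  shows "s = t"
  using assms
proof (induction arbitrary: t rule: has_shape.induct)
  case (1 v g)
  from 1(3) obtain g' where fin: "finite (C v)" and g': "\<forall>u\<in>C v. has_shape C u (g' u)"
    and t: "t = Node (image_mset g' (mset_set (C v)))"
    by (cases rule: has_shape.cases) auto
  have "g u = g' u" if "u \<in> C v" for u
    using 1(2) g' that by blast
  then have "image_mset g (mset_set (C v)) = image_mset g' (mset_set (C v))"
    using fin by (intro image_mset_cong) simp
  then show ?case
    using t by simp
qed

text \<open>
  By the lemma above the description is unique when it exists; an infinite tree of descendants
  has no class, and then the junk value is \<open>None\<close>.
\<close>

definition tree_class :: "('v \<Rightarrow> 'v set) \<Rightarrow> 'v \<Rightarrow> rtree option" where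
  "tree_class C v = (if \<exists>t. has_shape C v t then Some (THE t. has_shape C v t) else None)"

text \<open>
  Concrete rooted trees are given by their vertex set \<open>V\<close>, their root \<open>r\<close> and the parent
  map \<open>p\<close>, whose value at \<open>r\<close> is irrelevant.
\<close>

definition children :: "'v set \<Rightarrow> 'v \<Rightarrow> ('v \<Rightarrow> 'v) \<Rightarrow> 'v \<Rightarrow> 'v set" where
  "children V r p u = {w \<in> V. w \<noteq> r \<and> p w = u}"

text \<open>
  The tree \<open>f_i(v, t)\<close>. The \<open>i\<close>-th vertex on the path from \<open>v\<close> to the root is
  \<open>(p ^^ i) v\<close>, and \<open>i\<close> exceeds the height of \<open>v\<close> iff the root is met at some \<open>j < i\<close>.
  For \<open>i \<ge> 1\<close> the branch containing \<open>v\<close> is cut off.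
\<close>

definition fringe_tree :: "'v set \<Rightarrow> 'v \<Rightarrow> ('v \<Rightarrow> 'v) \<Rightarrow> 'v \<Rightarrow> nat \<Rightarrow> rtree option" where
  "fringe_tree V r p v i =
     (if i = 0 then tree_class (children V r p) v
      else if \<exists>j<i. (p ^^ j) v = r then None
      else tree_class (\<lambda>u. children V r p u - {(p ^^ (i - 1)) v}) ((p ^^ i) v))"

text \<open>The tuple \<open>F_k(v, t) = (f_0(v, t), \<dots>, f_k(v, t))\<close>, as a list of length \<open>k + 1\<close>.\<close>

definition fringe_upto :: "'v set \<Rightarrow> 'v \<Rightarrow> ('v \<Rightarrow> 'v) \<Rightarrow> 'v \<Rightarrow> nat \<Rightarrow> rtree option list" where
  "fringe_upto V r p v k = map (fringe_tree V r p v) [0..<Suc k]"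


section \<open>Fringe distributions and sin-trees\<close>

fun Q_count :: "rtree option \<Rightarrow> rtree option \<Rightarrow> nat" where
  "Q_count (Some s) (Some t) = count (subtrees s) t"
| "Q_count None _ = 0"
| "Q_count _ None = 0"

definition fringe_distribution :: "rtree option measure \<Rightarrow> bool" where
  "fringe_distribution D \<longleftrightarrow>
     prob_space D \<and> sets D = sets (count_space UNIV) \<and>
     (\<forall>t. ((\<lambda>s. measure D {s} * real (Q_count s t)) has_sum measure D {t}) UNIV)"

text \<open>
  A sin-tree is a sequence \<open>\<tau>\<close> of non-empty finite trees, \<open>\<tau> i\<close> hanging off the infinite
  path at \<open>i\<close>. In its monotone representation the tree at \<open>i + 1\<close> arises from
  \<open>\<tau> (i + 1)\<close> by making the tree at \<open>i\<close> a further subtree of the root.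
\<close>

type_synonym sin_tree = "nat \<Rightarrow> rtree"

primrec monotone_rep :: "sin_tree \<Rightarrow> nat \<Rightarrow> rtree" where
  "monotone_rep \<tau> 0 = \<tau> 0"
| "monotone_rep \<tau> (Suc i) = Node (add_mset (monotone_rep \<tau> i) (subtrees (\<tau> (Suc i))))"

definition sin_tree_space :: "sin_tree measure" where
  "sin_tree_space = (\<Pi>\<^sub>M i\<in>UNIV. count_space UNIV)"

definition sin_tree_law :: "rtree option measure \<Rightarrow> sin_tree measure \<Rightarrow> bool" where
  "sin_tree_law D \<mu> \<longleftrightarrow>
     prob_space \<mu> \<and> sets \<mu> = sets sin_tree_space \<and>
     (\<forall>i t. measure \<mu> {\<tau> \<in> space \<mu>. \<forall>j\<le>i. Some (monotone_rep \<tau> j) = t j} =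
        measure D {t i} * (\<Prod>j=1..i. real (Q_count (t j) (t (j - 1)))))"

text \<open>The law of \<open>F_k(0, T)\<close> for a random sin-tree \<open>T\<close> with law \<open>\<mu>\<close>.\<close>

definition sin_fringe_law :: "sin_tree measure \<Rightarrow> nat \<Rightarrow> rtree option list measure" where
  "sin_fringe_law \<mu> k =
     distr \<mu> (count_space UNIV) (\<lambda>\<tau>. map (\<lambda>i. Some (\<tau> i)) [0..<Suc k])"


section \<open>Convergence in probability\<close>

text \<open>
  Measurability is part of the definition, because the measure of a non-measurable set is
  \<open>0\<close> by convention.
\<close>

definition conv_in_prob :: "'a measure \<Rightarrow> (nat \<Rightarrow> 'a \<Rightarrow> real) \<Rightarrow> real \<Rightarrow> bool" where
  "conv_in_prob M X c \<longleftrightarrow>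
     (\<forall>n. X n \<in> borel_measurable M) \<and>
     (\<forall>\<epsilon>>0. (\<lambda>n. \<P>(\<omega> in M. \<bar>X n \<omega> - c\<bar> > \<epsilon>)) \<longlonglongrightarrow> 0)"

text \<open>
  Convergence in probability of random measures on a discrete space to a deterministic one, for
  the weak topology, i.e. the coarsest topology making the integrals of all bounded continuous
  functions continuous. On a discrete space every function is continuous. Basic neighbourhoods
  involve finitely many test functions, so one may test them one at a time.
\<close>

definition weak_conv_in_prob ::
    "'a measure \<Rightarrow> (nat \<Rightarrow> 'a \<Rightarrow> 's measure) \<Rightarrow> 's measure \<Rightarrow> bool" where
  "weak_conv_in_prob M \<nu> \<mu> \<longleftrightarrow>
     (\<forall>f :: 's \<Rightarrow> real. bounded (range f) \<longrightarrow>
        conv_in_prob M (\<lambda>n \<omega>. \<integral>x. f x \<partial>\<nu> n \<omega>) (\<integral>x. f x \<partial>\<mu>))"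


section \<open>The self-reinforced preferential attachment trees\<close>

text \<open>
  The vertex \<open>v_i\<close> is the number \<open>i\<close>, and \<open>a j\<close> is the vertex to which \<open>j \<ge> 1\<close> is
  attached. Hence \<open>T_m\<close> is determined by \<open>a 1, \<dots>, a m\<close>; the root is \<open>0\<close>. The
  convention \<open>T_0 = T_1\<close> is the \<open>max\<close> below.
\<close>

definition tree_edges :: "(nat \<Rightarrow> nat) \<Rightarrow> nat \<Rightarrow> nat set set" where
  "tree_edges a m = (\<lambda>j. {a j, j}) ` {1..max 1 m}"

definition tree_degree :: "(nat \<Rightarrow> nat) \<Rightarrow> nat \<Rightarrow> nat \<Rightarrow> nat" where
  "tree_degree a m v = card {e \<in> tree_edges a m. v \<in> e}"

definition attach_weight :: "real \<Rightarrow> (nat \<Rightarrow> nat) \<Rightarrow> nat \<Rightarrow> nat \<Rightarrow> real" where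
  "attach_weight \<delta> a n i = (\<Sum>m=i..n. real (tree_degree a m i) + \<delta>)"

text \<open>
  The history \<open>T_1, \<dots>, T_n\<close> is the history of the attachments \<open>A 1, \<dots>, A n\<close>. The bound
  \<open>A (n + 1) \<le> n\<close> forces \<open>A 1 = 0\<close>.
\<close>

definition reinforced_pa_trees :: "real \<Rightarrow> 'a measure \<Rightarrow> (nat \<Rightarrow> 'a \<Rightarrow> nat) \<Rightarrow> bool" where
  "reinforced_pa_trees \<delta> M A \<longleftrightarrow>
     prob_space M \<and>
     (\<forall>n\<ge>1. A n \<in> measurable M (count_space UNIV)) \<and>
     (\<forall>n. \<forall>\<omega>\<in>space M. A (n + 1) \<omega> \<le> n) \<and>
     (\<forall>n\<ge>1. \<forall>a. \<P>(\<omega> in M. \<forall>j\<in>{1..n}. A j \<omega> = a j) > 0 \<longrightarrow>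
        (\<forall>i\<le>n. \<P>(\<omega> in M. A (n + 1) \<omega> = i \<bar> \<forall>j\<in>{1..n}. A j \<omega> = a j) =
           attach_weight \<delta> a n i / (\<Sum>j=0..n. attach_weight \<delta> a n j)))"

definition empirical_fringe :: "(nat \<Rightarrow> nat) \<Rightarrow> nat \<Rightarrow> nat \<Rightarrow> rtree option list measure" where
  "empirical_fringe a n k =
     measure_pmf (map_pmf (\<lambda>v. fringe_upto {0..n} 0 a v k) (pmf_of_set {0..n}))"

definition extended_fringe_conv ::
    "'a measure \<Rightarrow> (nat \<Rightarrow> 'a \<Rightarrow> nat) \<Rightarrow> sin_tree measure \<Rightarrow> bool" where
  "extended_fringe_conv M A \<mu> \<longleftrightarrow>
     (\<forall>k. weak_conv_in_prob M (\<lambda>n \<omega>. empirical_fringe (\<lambda>j. A j \<omega>) n k) (sin_fringe_law \<mu> k))"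

definition degree_count :: "(nat \<Rightarrow> nat) \<Rightarrow> nat \<Rightarrow> nat \<Rightarrow> nat" where
  "degree_count a n k = card {v \<in> {0..n}. tree_degree a n v = k}"


section \<open>The point process and the branching process\<close>

text \<open>Inter-arrival times \<open>e k\<close> are indexed by \<open>k \<ge> 1\<close>; the value \<open>e 0\<close> is never used.\<close>

definition arrival :: "(nat \<Rightarrow> real) \<Rightarrow> nat \<Rightarrow> real" where
  "arrival e k = (\<Sum>i=1..k. e i)"

text \<open>The hazard rate \<open>h_k\<close>, in terms of the points \<open>\<sigma>\<close> with \<open>\<sigma> 0 = 0\<close>.\<close>

definition hazard :: "real \<Rightarrow> (nat \<Rightarrow> real) \<Rightarrow> nat \<Rightarrow> real \<Rightarrow> real" where
  "hazard \<delta> \<sigma> k x =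
     (1 + \<delta>) / (1 + \<delta> / 2) * (1 - exp (- (x + \<sigma> (k - 1)))) +
     1 / (1 + \<delta> / 2) * (\<Sum>j=1..k-1. 1 - exp (- (\<sigma> (k - 1) - \<sigma> j + x)))"

definition past_points :: "'a measure \<Rightarrow> (nat \<Rightarrow> 'a \<Rightarrow> real) \<Rightarrow> nat \<Rightarrow> 'a measure" where
  "past_points M E k =
     vimage_algebra (space M) (\<lambda>\<omega>. \<lambda>j\<in>{1..<k}. arrival (\<lambda>i. E i \<omega>) j) (\<Pi>\<^sub>M j\<in>{1..<k}. borel)"

definition interarrivals :: "real \<Rightarrow> 'a measure \<Rightarrow> (nat \<Rightarrow> 'a \<Rightarrow> real) \<Rightarrow> bool" where
  "interarrivals \<delta> M E \<longleftrightarrow>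
     prob_space M \<and>
     (\<forall>k\<ge>1. E k \<in> borel_measurable M \<and> (AE \<omega> in M. E k \<omega> > 0)) \<and>
     (\<forall>k\<ge>1. \<forall>s\<ge>0. AE \<omega> in M.
        real_cond_exp M (past_points M E k) (indicator {\<omega>' \<in> space M. E k \<omega>' > s}) \<omega> =
        exp (- integral {0..s} (hazard \<delta> (arrival (\<lambda>i. E i \<omega>)) k)))"

text \<open>
  Independence of two random elements as independence of the generated sigma-algebras
  (\<open>indep_var\<close> would require both to take values in the same type).
\<close>

definition indep_elements ::
    "'a measure \<Rightarrow> 's measure \<Rightarrow> ('a \<Rightarrow> 's) \<Rightarrow> 't measure \<Rightarrow> ('a \<Rightarrow> 't) \<Rightarrow> bool" where
  "indep_elements M S Y S' Z \<longleftrightarrow>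
     Y \<in> measurable M S \<and> Z \<in> measurable M S' \<and>
     prob_space.indep_set M (sets (vimage_algebra (space M) Y S))
       (sets (vimage_algebra (space M) Z S'))"

text \<open>
  Individuals carry Ulam-Harris labels, the initial one being \<open>[]\<close> and the \<open>k\<close>-th child of
  \<open>u\<close> being \<open>u @ [k]\<close>, \<open>k \<ge> 1\<close>. The \<open>k\<close>-th inter-arrival time in the point process of
  the children of \<open>u\<close> is \<open>x u k\<close>.
\<close>

definition labels :: "nat list set" where
  "labels = lists {1..}"

definition birth_time :: "(nat list \<Rightarrow> nat \<Rightarrow> real) \<Rightarrow> nat list \<Rightarrow> real" where
  "birth_time x u = (\<Sum>i<length u. arrival (x (take i u)) (u ! i))"

definition born_by :: "(nat list \<Rightarrow> nat \<Rightarrow> real) \<Rightarrow> real \<Rightarrow> nat list set" where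
  "born_by x t = {u \<in> labels. birth_time x u \<le> t}"

definition BP_tree :: "(nat list \<Rightarrow> nat \<Rightarrow> real) \<Rightarrow> real \<Rightarrow> rtree option" where
  "BP_tree x t = tree_class (children (born_by x t) [] butlast) []"

text \<open>
  A realisation on \<open>M\<close> of the branching process together with an independent rate-1
  exponential time.
\<close>

definition BP_realisation ::
    "real \<Rightarrow> 'b measure \<Rightarrow> (nat list \<Rightarrow> nat \<Rightarrow> 'b \<Rightarrow> real) \<Rightarrow> ('b \<Rightarrow> real) \<Rightarrow> bool" where
  "BP_realisation \<delta> M X T \<longleftrightarrow>
     prob_space M \<and>
     (\<forall>u\<in>labels. interarrivals \<delta> M (X u)) \<and>
     prob_space.indep_vars M (\<lambda>u. \<Pi>\<^sub>M k\<in>{1..}. borel) (\<lambda>u \<omega>. \<lambda>k\<in>{1..}. X u k \<omega>) labels \<and>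
     distributed M lborel T (exponential_density 1) \<and>
     indep_elements M
       (\<Pi>\<^sub>M u\<in>labels. \<Pi>\<^sub>M k\<in>{1..}. borel) (\<lambda>\<omega>. \<lambda>u\<in>labels. \<lambda>k\<in>{1..}. X u k \<omega>)
       borel T"

definition BP_law ::
    "'b measure \<Rightarrow> (nat list \<Rightarrow> nat \<Rightarrow> 'b \<Rightarrow> real) \<Rightarrow> ('b \<Rightarrow> real) \<Rightarrow> rtree option measure" where
  "BP_law M X T = distr M (count_space UNIV) (\<lambda>\<omega>. BP_tree (\<lambda>u k. X u k \<omega>) (T \<omega>))"

definition interarrivals_with_exp ::
    "real \<Rightarrow> 'c measure \<Rightarrow> (nat \<Rightarrow> 'c \<Rightarrow> real) \<Rightarrow> ('c \<Rightarrow> real) \<Rightarrow> bool" where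
  "interarrivals_with_exp \<delta> M E T \<longleftrightarrow>
     interarrivals \<delta> M E \<and>
     distributed M lborel T (exponential_density 1) \<and>
     indep_elements M (\<Pi>\<^sub>M k\<in>{1..}. borel) (\<lambda>\<omega>. \<lambda>k\<in>{1..}. E k \<omega>) borel T"

definition limit_degree_prob :: "'c measure \<Rightarrow> (nat \<Rightarrow> 'c \<Rightarrow> real) \<Rightarrow> ('c \<Rightarrow> real) \<Rightarrow> nat \<Rightarrow> real" where
  "limit_degree_prob M E T k =
     \<P>(\<omega> in M. (\<Sum>j=1..k-1. E j \<omega>) \<le> T \<omega> \<and> T \<omega> < (\<Sum>j=1..k. E j \<omega>))"

end

theory Submission
  imports Defs
begin

text \<open>The trees are studied through the subtrees of their vertices. The sum of all attachment weights is
deterministic, about \<open>(1 + \<delta>/2) n\<^sup>2\<close>. Hence the attachments involving a fixed finite set of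
vertices almost decouple from the rest of the tree: at each step they happen with probabilities
that depend only on the subtrees formed so far. The probability that the subtree of \<open>i\<close> and that of
\<open>j\<close> are prescribed disjoint trees is therefore at most \<open>1 + o(1)\<close> times a product of explicit weights
(\<open>pair_prob_le\<close>). Pairs of vertices with intersecting subtrees are nested and too few to matter. So the
second moment of the frequency of a plane shape \<open>t\<close> is at most \<open>u\<^sup>2 + o(1)\<close>, where \<open>u\<close> is the limit of
the averaged weights.

This limit is computed as an iterated integral over rescaled labels \<open>z = i / n\<close>
(\<open>Fsum_average_tendsto\<close>). With \<open>z = exp (- s)\<close> the rescaled attachment rate becomes the hazard rate of
the point process, \<open>s\<close> is the age of the vertex, and a uniformly chosen vertex has an exponential age.
The iterated integral is thus bounded by the probability that the branching process at an exponential
time has shape \<open>t\<close> (\<open>Flim_le_qq\<close>, \<open>KK_formula\<close>, \<open>pv_prob\<close>).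

Upper bounds suffice. Since the expected size of the subtree of a vertex \<open>i >= \<epsilon> n\<close> is bounded
(\<open>expected_card_desc\<close>), no mass of the frequencies escapes to large shapes; their limits are at most
probabilities of disjoint events; so all inequalities are equalities, the variances vanish in the
limit and the frequencies converge in probability (\<open>freq_conv\<close>).

Passing to isomorphism classes gives convergence of the law of the fringe to \<open>\<varpi>\<close>. In a finite tree the
number of pairs (vertex, child with subtree \<open>t\<close>) is at most the number of vertices with subtree \<open>t\<close>, so
\<open>\<Sum>s. \<varpi> s * Q s t <= \<varpi> t\<close> in the limit. Summed over \<open>t\<close> the two sides are the mean number of
children under \<open>\<varpi>\<close> and one, so equality for all \<open>t\<close> follows once this mean is at least one. With \<open>a = (1 + \<delta>) / (1 + \<delta>/2)\<close> and \<open>b = 1 / (1 + \<delta>/2)\<close>, the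
compensator formula gives \<open>m >= a / 2 + (b / 2) m\<close> for this mean \<open>m\<close> if it is finite, and
\<open>a / 2 + b / 2 = 1\<close> (\<open>mean_points_ge_1\<close>).

The tuple \<open>F_k(v)\<close> determines and is determined by the subtrees of the first \<open>k\<close> ancestors of \<open>v\<close>.
Counting downwards from the top ancestor, the number of vertices with a given tuple is exactly the
number of vertices with the given top subtree, times a product of the numbers \<open>Q\<close>
(\<open>card_fringe_upto\<close>). This is the formula that defines the sin-tree, so its law is the limit of the
empirical law of \<open>F_k\<close>. The sin-tree itself exists by the Ionescu-Tulcea theorem: conditionally on the
first trees, the next one has a law whose total mass is one by the fringe property.\<close>

section \<open>Trees as attachment histories\<close>

text \<open>By the handshake lemma the sum over \<open>m <= n\<close> of all degrees is \<open>n (n + 1) + 1\<close>; the final \<open>1\<close> comes from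
the convention \<open>T_0 = T_1\<close> for the degree of the root at time 0.\<close>

definition total_weight :: "real => nat => real" where
  "total_weight \<delta> n = real n * (real n + 1) + \<delta> * (real n + 1) * (real n + 2) / 2 + 1"

text \<open>Setting \<open>a j = 0\<close> off \<open>{1..n}\<close> makes the set of histories finite, so that their law is a discrete one.\<close>

definition history :: "nat => (nat => nat) => bool" where
  "history n a \<longleftrightarrow> (\<forall>j\<ge>1. a j < j) & (\<forall>j. j \<notin> {1..n} --> a j = 0)"

lemma historyD: "history n a ==> 1 <= j ==> a j < j"
  by (simp add: history_def)

lemma history_zero: "history n a ==> a 0 = 0"
  by (simp add: history_def)

lemma tree_degree_card:
  assumes "\<forall>j\<ge>1. a j < j"
  shows "tree_degree a m v = card {j \<in> {1..max 1 m}. a j = v \<or> j = v}"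
proof -
  have inj: "inj_on (\<lambda>j. {a j, j}) {j \<in> {1..max 1 m}. a j = v \<or> j = v}"
  proof (rule inj_onI)
    fix j k assume "j \<in> {j \<in> {1..max 1 m}. a j = v \<or> j = v}"
      "k \<in> {j \<in> {1..max 1 m}. a j = v \<or> j = v}" and eq: "{a j, j} = {a k, k}"
    then have "a j < j" "a k < k" using assms by auto
    then show "j = k" using eq by (auto simp: doubleton_eq_iff)
  qed
  have "{e \<in> tree_edges a m. v \<in> e} = (\<lambda>j. {a j, j}) ` {j \<in> {1..max 1 m}. a j = v \<or> j = v}"
    unfolding tree_edges_def by auto
  then show ?thesis
    unfolding tree_degree_def using card_image[OF inj] by simp
qed

lemma tree_degree_children:
  assumes a: "\<forall>j\<ge>1. a j < j" and v: "1 <= v" "v <= m"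
  shows "tree_degree a m v = 1 + card {w \<in> {v<..m}. a w = v}"
proof -
  have "{j \<in> {1..max 1 m}. a j = v \<or> j = v} = insert v {w \<in> {v<..m}. a w = v}"
  proof (intro equalityI subsetI)
    fix j assume "j \<in> {j \<in> {1..max 1 m}. a j = v \<or> j = v}"
    then show "j \<in> insert v {w \<in> {v<..m}. a w = v}"
      using v a[rule_format, of j] by (auto simp: max_def split: if_splits)
  qed (use v in auto)
  moreover have "v \<notin> {w \<in> {v<..m}. a w = v}" by simp
  ultimately show ?thesis
    unfolding tree_degree_card[OF a] by simp
qed

lemma tree_degree_root:
  assumes a: "\<forall>j\<ge>1. a j < j"
  shows "tree_degree a m 0 = card {w \<in> {0<..max 1 m}. a w = 0}"
proof -
  have "{j \<in> {1..max 1 m}. a j = 0 \<or> j = 0} = {w \<in> {0<..max 1 m}. a w = 0}"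
    by auto
  then show ?thesis unfolding tree_degree_card[OF a] by simp
qed

lemma tree_degree_pos:
  assumes a: "\<forall>j\<ge>1. a j < j" and v: "v <= m"
  shows "tree_degree a m v >= 1"
proof -
  have "{if v = 0 then 1 else v} \<subseteq> {j \<in> {1..max 1 m}. a j = v \<or> j = v}"
    using v a[rule_format, of 1] by auto
  then have "card {if v = 0 then 1 else v} <= card {j \<in> {1..max 1 m}. a j = v \<or> j = v}"
    by (intro card_mono) auto
  then show ?thesis unfolding tree_degree_card[OF a] by simp
qed

lemma sum_tree_degree:
  assumes a: "\<forall>j\<ge>1. a j < j" and m: "m >= 1"
  shows "(\<Sum>v\<le>m. tree_degree a m v) = 2 * m"
proof -
  have card_of_bool: "card {x \<in> S. P x} = (\<Sum>x\<in>S. of_bool (P x))" if "finite S" for S :: "nat set" and P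
    using that by (simp del: of_bool_eq_iff add: Int_def)
  have "max 1 m = m" using m by simp
  then have "(\<Sum>v\<le>m. tree_degree a m v) = (\<Sum>v\<le>m. \<Sum>j\<in>{1..m}. of_bool (a j = v \<or> j = v))"
    unfolding tree_degree_card[OF a] by (simp only: card_of_bool finite_atLeastAtMost)
  also have "... = (\<Sum>j\<in>{1..m}. \<Sum>v\<le>m. of_bool (a j = v \<or> j = v))"
    by (rule sum.swap)
  also have "... = (\<Sum>j\<in>{1..m}. 2)"
  proof (rule sum.cong)
    fix j assume j: "j \<in> {1..m}"
    then have aj: "a j < j" using a by auto
    have "{v \<in> {..m}. a j = v \<or> j = v} = {a j, j}" using j aj by auto
    then have "card {v \<in> {..m}. a j = v \<or> j = v} = 2" using aj by simp
    then show "(\<Sum>v\<le>m. of_bool (a j = v \<or> j = v)) = (2::nat)"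
      by (subst card_of_bool[symmetric]) simp_all
  qed simp
  finally show ?thesis by simp
qed

lemma sum_attach_weight:
  assumes a: "\<forall>j\<ge>1. a j < j"
  shows "(\<Sum>j=0..n. attach_weight \<delta> a n j) = total_weight \<delta> n"
proof (induction n)
  case 0
  have "{w \<in> {0<..1}. a w = 0} = {1}"
    using a[rule_format, of 1] by auto
  then have "card {w \<in> {0<..1}. a w = 0} = 1" by simp
  then show ?case
    by (simp add: attach_weight_def tree_degree_root[OF a] total_weight_def)
next
  case (Suc n)
  have "(\<Sum>j=0..Suc n. attach_weight \<delta> a (Suc n) j)
      = (\<Sum>j=0..n. attach_weight \<delta> a n j + (real (tree_degree a (Suc n) j) + \<delta>)) + (real (tree_degree a (Suc n) (Suc n)) + \<delta>)"
    by (simp add: attach_weight_def)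
  also have "... = total_weight \<delta> n + (\<Sum>j\<le>Suc n. real (tree_degree a (Suc n) j) + \<delta>)"
    using Suc.IH by (simp add: sum.distrib atLeast0AtMost algebra_simps)
  also have "(\<Sum>j\<le>Suc n. real (tree_degree a (Suc n) j) + \<delta>) = real (2 * Suc n) + \<delta> * (real n + 2)"
  proof -
    have "(\<Sum>j\<le>Suc n. real (tree_degree a (Suc n) j)) = real (2 * Suc n)"
      using sum_tree_degree[OF a, of "Suc n"] by (metis Suc_leI of_nat_sum zero_less_Suc One_nat_def)
    moreover have "(\<Sum>j\<le>Suc n. \<delta>) = \<delta> * (real n + 2)"
      by (simp add: algebra_simps)
    ultimately show ?thesis unfolding sum.distrib by simp
  qed
  also have "total_weight \<delta> n + ... = total_weight \<delta> (Suc n)"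
    by (simp add: total_weight_def field_simps)
  finally show ?case .
qed

definition ch :: "(nat => nat) => nat => nat => nat list" where
  "ch a n v = sorted_list_of_set {w \<in> {v<..n}. a w = v}"

lemma set_ch [simp]: "set (ch a n v) = {w \<in> {v<..n}. a w = v}"
  by (simp add: ch_def)

lemma distinct_ch [simp]: "distinct (ch a n v)"
  by (simp add: ch_def)

text \<open>The weight of a vertex \<open>v\<close> at time \<open>m\<close> when its children are \<open>js\<close>: a child \<open>j\<close> contributes one unit of
degree at each of the times \<open>j, ..., m\<close>; truncated subtraction discards children born later.\<close>

definition th :: "real => nat => nat list => nat => real" where
  "th \<delta> v js m = (1 + \<delta>) * real (m + 1 - v) + (\<Sum>j\<leftarrow>js. real (m + 1 - j))"

lemma attach_weight_th:
  assumes a: "\<forall>j\<ge>1. a j < j" and v: "1 <= v" "v <= m" "m <= n"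
  shows "attach_weight \<delta> a m v = th \<delta> v (ch a n v) m"
proof -
  have th: "th \<delta> v (ch a n v) k = (1 + \<delta>) * real (k + 1 - v) + (\<Sum>j | j \<in> {v<..n} & a j = v. real (k + 1 - j))" for k
    unfolding th_def by (subst sum_list_distinct_conv_sum_set) auto
  show ?thesis using v(2,3)
  proof (induction m rule: dec_induct)
    case base
    have "(\<Sum>j | j \<in> {v<..n} & a j = v. real (v + 1 - j)) = 0"
      by (intro sum.neutral) auto
    then show ?case
      unfolding th using tree_degree_children[OF a v(1), of v] by (simp add: attach_weight_def)
  next
    case (step m)
    have *: "(\<Sum>j | j \<in> {v<..n} & a j = v. real (Suc m + 1 - j))
        = (\<Sum>j | j \<in> {v<..n} & a j = v. real (m + 1 - j)) + (\<Sum>j | j \<in> {v<..n} & a j = v. of_bool (j <= Suc m))"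
      unfolding sum.distrib[symmetric] by (intro sum.cong) auto
    have "{w \<in> {v<..Suc m}. a w = v} = {j \<in> {j. j \<in> {v<..n} & a j = v}. j <= Suc m}"
      using step by auto
    then have "(\<Sum>j | j \<in> {v<..n} & a j = v. of_bool (j <= Suc m)) = real (card {w \<in> {v<..Suc m}. a w = v})"
      by (simp add: Int_def)
    then show ?case
      using step * tree_degree_children[OF a v(1), of "Suc m"]
      by (simp add: attach_weight_def th Suc_diff_le algebra_simps)
  qed
qed

locale reinforcement =
  fixes \<delta> :: real
  assumes delta: "\<delta> > -1"
begin

lemma total_weight_ge: "total_weight \<delta> n >= (1 + \<delta>) / 2 * (real n + 1) ^ 2"
proof -
  have "total_weight \<delta> n - (1 + \<delta>) / 2 * ((real n + 1) * (real n + 2)) = real n * (real n - 1) / 2"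
    by (simp add: total_weight_def field_simps)
  moreover have "real n * (real n - 1) / 2 >= 0"
    by (cases n) auto
  moreover have "(1 + \<delta>) / 2 * ((real n + 1) * (real n + 2)) >= (1 + \<delta>) / 2 * (real n + 1) ^ 2"
  proof (rule mult_left_mono)
    show "(real n + 1)\<^sup>2 <= (real n + 1) * (real n + 2)"
      unfolding power2_eq_square by (rule mult_left_mono) auto
    show "0 <= (1 + \<delta>) / 2" using delta by simp
  qed
  ultimately show ?thesis by linarith
qed

lemma total_weight_pos: "total_weight \<delta> n > 0"
proof (rule less_le_trans[OF _ total_weight_ge])
  have "0 < (1 + \<delta>) / 2" using delta by simp
  moreover have "0 < (real n + 1)\<^sup>2" by simp
  ultimately show "0 < (1 + \<delta>) / 2 * (real n + 1)\<^sup>2" by (rule mult_pos_pos)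
qed

lemma th_nonneg: "th \<delta> v js m >= 0"
proof -
  have "0 <= (1 + \<delta>) * real (m + 1 - v)" using delta by simp
  moreover have "0 <= (\<Sum>j\<leftarrow>js. real (m + 1 - j))" by (intro sum_list_nonneg) auto
  ultimately show ?thesis unfolding th_def by simp
qed

lemma attach_weight_nonneg:
  assumes "\<forall>j\<ge>1. a j < j"
  shows "attach_weight \<delta> a n i >= 0"
  unfolding attach_weight_def
proof (intro sum_nonneg)
  fix m assume "m \<in> {i..n}"
  then have "tree_degree a m i >= 1" using tree_degree_pos[OF assms] by auto
  then have "1 <= real (tree_degree a m i)" by simp
  then show "0 <= real (tree_degree a m i) + \<delta>" using delta by simp
qed

definition attach_pmf :: "(nat => nat) => nat => nat pmf" where
  "attach_pmf a n = embed_pmf (\<lambda>i. if i <= n then attach_weight \<delta> a n i / total_weight \<delta> n else 0)"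

lemma pmf_attach:
  assumes a: "\<forall>j\<ge>1. a j < j"
  shows "pmf (attach_pmf a n) i = (if i <= n then attach_weight \<delta> a n i / total_weight \<delta> n else 0)"
  unfolding attach_pmf_def
proof (rule pmf_embed_pmf)
  show "0 <= (if i <= n then attach_weight \<delta> a n i / total_weight \<delta> n else 0)" for i
    using attach_weight_nonneg[OF a] total_weight_pos by (simp add: less_imp_le)
  have "(\<integral>\<^sup>+ x. ennreal (if x <= n then attach_weight \<delta> a n x / total_weight \<delta> n else 0) \<partial>count_space UNIV)
     = (\<integral>\<^sup>+ x. ennreal (attach_weight \<delta> a n x / total_weight \<delta> n) * indicator {..n} x \<partial>count_space UNIV)"
    by (intro nn_integral_cong) (auto simp: indicator_def)
  also have "... = (\<Sum>x\<le>n. ennreal (attach_weight \<delta> a n x / total_weight \<delta> n))"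
    by (subst nn_integral_count_space_indicator[symmetric]) (auto simp: nn_integral_count_space_finite)
  also have "... = ennreal (\<Sum>x\<le>n. attach_weight \<delta> a n x / total_weight \<delta> n)"
    using attach_weight_nonneg[OF a] total_weight_pos by (intro sum_ennreal) (simp add: less_imp_le)
  also have "(\<Sum>x\<le>n. attach_weight \<delta> a n x / total_weight \<delta> n) = 1"
    using sum_attach_weight[OF a, of \<delta> n] total_weight_pos[of n]
    by (simp flip: sum_divide_distrib add: atLeast0AtMost)
  finally show "(\<integral>\<^sup>+ x. ennreal (if x <= n then attach_weight \<delta> a n x / total_weight \<delta> n else 0) \<partial>count_space UNIV) = 1"
    by simp
qed

lemma set_attach_pmf:
  assumes a: "\<forall>j\<ge>1. a j < j"
  shows "set_pmf (attach_pmf a n) \<subseteq> {..n}"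
proof
  fix i assume "i \<in> set_pmf (attach_pmf a n)"
  then have "pmf (attach_pmf a n) i > 0" by (rule pmf_positive)
  then show "i \<in> {..n}" by (simp add: pmf_attach[OF a] split: if_splits)
qed

text \<open>The growth of the tree as an explicit Markov chain on histories.\<close>

primrec hist :: "nat => (nat => nat) pmf" where
  "hist 0 = return_pmf (\<lambda>_. 0)"
| "hist (Suc n) = bind_pmf (hist n) (\<lambda>a. map_pmf (\<lambda>i. a(Suc n := i)) (attach_pmf a n))"

declare hist.simps(2) [simp del]

lemma history_hist: "a \<in> set_pmf (hist n) ==> history n a"
proof (induction n arbitrary: a)
  case 0
  then show ?case by (simp add: history_def)
next
  case (Suc n)
  then obtain b i where b: "b \<in> set_pmf (hist n)" "i \<in> set_pmf (attach_pmf b n)" "a = b(Suc n := i)"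
    by (auto simp: hist.simps(2))
  have "history n b" using Suc b by auto
  moreover from this have "i <= n" using b(2) set_attach_pmf[of b n] by (auto simp: history_def)
  ultimately show ?case using b(3) by (auto simp: history_def)
qed

lemma finite_history: "finite {a. history n a}"
proof (rule finite_subset)
  show "{a. history n a} \<subseteq> (\<lambda>f j. if j \<in> {1..n} then f j else 0) ` ({1..n} \<rightarrow>\<^sub>E {..n})"
  proof
    fix a assume "a \<in> {a. history n a}"
    then have h: "history n a" by simp
    have "restrict a {1..n} \<in> {1..n} \<rightarrow>\<^sub>E {..n}" using h by (force simp: history_def)
    moreover have "a = (\<lambda>j. if j \<in> {1..n} then restrict a {1..n} j else 0)"
      using h by (auto simp: history_def)
    ultimately show "a \<in> (\<lambda>f j. if j \<in> {1..n} then f j else 0) ` ({1..n} \<rightarrow>\<^sub>E {..n})" by blast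
  qed
  show "finite ((\<lambda>f j. if j \<in> {1..n} then f j else 0::nat) ` ({1..n} \<rightarrow>\<^sub>E {..n}))"
    by (intro finite_imageI finite_PiE) auto
qed

lemma finite_set_hist: "finite (set_pmf (hist n))"
  using finite_subset[OF _ finite_history] history_hist by blast

lemma integrable_hist [simp]: "integrable (measure_pmf (hist n)) (f :: _ => real)"
  by (rule integrable_measure_pmf_finite[OF finite_set_hist])

lemma pmf_hist_Suc:
  assumes "history (Suc n) a"
  shows "pmf (hist (Suc n)) a = pmf (hist n) (a(Suc n := 0)) * pmf (attach_pmf (a(Suc n := 0)) n) (a (Suc n))"
proof -
  let ?b = "a(Suc n := 0)"
  have "pmf (hist (Suc n)) a = measure_pmf.expectation (hist n)
      (\<lambda>b. pmf (map_pmf (\<lambda>i. b(Suc n := i)) (attach_pmf b n)) a)"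
    by (simp add: pmf_bind hist.simps(2))
  also have "... = measure_pmf.expectation (hist n) (\<lambda>b. pmf (attach_pmf ?b n) (a (Suc n)) * indicator {?b} b)"
  proof (rule integral_cong_AE)
    show "AE b in measure_pmf (hist n). pmf (map_pmf (\<lambda>i. b(Suc n := i)) (attach_pmf b n)) a
        = pmf (attach_pmf ?b n) (a (Suc n)) * indicator {?b} b"
    proof (rule AE_pmfI)
      fix b assume "b \<in> set_pmf (hist n)"
      then have hb: "history n b" by (rule history_hist)
      show "pmf (map_pmf (\<lambda>i. b(Suc n := i)) (attach_pmf b n)) a
        = pmf (attach_pmf ?b n) (a (Suc n)) * indicator {?b} b"
      proof (cases "b = ?b")
        case True
        have "pmf (map_pmf (\<lambda>i. b(Suc n := i)) (attach_pmf b n)) (b(Suc n := a (Suc n)))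
            = pmf (attach_pmf b n) (a (Suc n))"
          by (rule pmf_map_inj') (auto simp: inj_on_def fun_eq_iff)
        moreover have "b(Suc n := a (Suc n)) = a" using True by (metis fun_upd_triv fun_upd_upd)
        ultimately show ?thesis using True by simp
      next
        case False
        have "a \<notin> (\<lambda>i. b(Suc n := i)) ` set_pmf (attach_pmf b n)"
        proof
          assume "a \<in> (\<lambda>i. b(Suc n := i)) ` set_pmf (attach_pmf b n)"
          then have "?b = b(Suc n := 0)" by auto
          moreover have "b (Suc n) = 0" using hb by (simp add: history_def)
          ultimately show False using False by (metis fun_upd_triv)
        qed
        then have "pmf (map_pmf (\<lambda>i. b(Suc n := i)) (attach_pmf b n)) a = 0"
          by (metis pmf_eq_0_set_pmf set_map_pmf)
        then show ?thesis using False by simp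
      qed
    qed
  qed auto
  also have "... = pmf (hist n) ?b * pmf (attach_pmf ?b n) (a (Suc n))"
    by (simp add: measure_pmf_single)
  finally show ?thesis .
qed

definition restr :: "nat => (nat => nat) => nat => nat" where
  "restr n f = (\<lambda>j. if j \<in> {1..n} then f j else 0)"

lemma restr_eq_iff:
  assumes "history n a"
  shows "restr n f = a \<longleftrightarrow> (\<forall>j\<in>{1..n}. f j = a j)"
proof
  assume "\<forall>j\<in>{1..n}. f j = a j"
  then show "restr n f = a"
    using assms by (intro ext) (auto simp: restr_def history_def)
next
  assume "restr n f = a"
  then have "restr n f j = a j" for j by simp
  then show "\<forall>j\<in>{1..n}. f j = a j" unfolding restr_def by metis
qed

lemma attach_weight_cong:
  assumes "\<And>j. j \<in> {1..max 1 n} ==> a j = b j"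
  shows "attach_weight \<delta> a n i = attach_weight \<delta> b n i"
proof -
  have "tree_edges a m = tree_edges b m" if "m <= n" for m
    unfolding tree_edges_def using that assms by (intro image_cong) auto
  then have "tree_degree a m i = tree_degree b m i" if "m <= n" for m
    unfolding tree_degree_def using that by simp
  then show ?thesis unfolding attach_weight_def by simp
qed

lemma cylinder_sets:
  assumes "reinforced_pa_trees \<delta> M A"
  shows "{\<omega> \<in> space M. \<forall>j\<in>{1..n}. A j \<omega> = a j} \<in> sets M"
proof (rule sets.sets_Collect_finite_All)
  fix j assume "j \<in> {1..n}"
  then have "A j \<in> measurable M (count_space UNIV)"
    using assms unfolding reinforced_pa_trees_def by auto
  from measurable_sets[OF this, of "{a j}"] show "{\<omega> \<in> space M. A j \<omega> = a j} \<in> sets M"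
    by (simp add: vimage_def Int_def conj_commute)
qed auto

lemma restr_measurable:
  assumes "reinforced_pa_trees \<delta> M A"
  shows "(\<lambda>\<omega>. restr n (\<lambda>j. A j \<omega>)) \<in> measurable M (count_space UNIV)"
    and "\<And>\<omega>. \<omega> \<in> space M ==> history n (restr n (\<lambda>j. A j \<omega>))"
proof -
  show hr: "history n (restr n (\<lambda>j. A j \<omega>))" if w: "\<omega> \<in> space M" for \<omega>
  proof -
    have "A j \<omega> < j" if "j >= 1" for j
    proof -
      have "A ((j - 1) + 1) \<omega> <= j - 1"
        using assms w unfolding reinforced_pa_trees_def by blast
      then show ?thesis using that by simp
    qed
    then show ?thesis unfolding history_def restr_def by auto
  qed
  have "(\<lambda>\<omega>. restr n (\<lambda>j. A j \<omega>)) \<in> measurable M (count_space {a. history n a})"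
  proof (subst measurable_count_space_eq2[OF finite_history], intro conjI ballI)
    show "(\<lambda>\<omega>. restr n (\<lambda>j. A j \<omega>)) \<in> space M \<rightarrow> {a. history n a}" using hr by auto
    fix a assume "a \<in> {a. history n a}"
    then have "(\<lambda>\<omega>. restr n (\<lambda>j. A j \<omega>)) -` {a} \<inter> space M
       = {\<omega> \<in> space M. \<forall>j\<in>{1..n}. A j \<omega> = a j}"
      by (simp add: vimage_def Int_def restr_eq_iff conj_commute)
    also have "... \<in> sets M" by (rule cylinder_sets[OF assms])
    finally show "(\<lambda>\<omega>. restr n (\<lambda>j. A j \<omega>)) -` {a} \<inter> space M \<in> sets M" .
  qed
  then show "(\<lambda>\<omega>. restr n (\<lambda>j. A j \<omega>)) \<in> measurable M (count_space UNIV)"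
    using measurable_compose[OF _, of _ M "count_space {a. history n a}" "\<lambda>x. x" "count_space UNIV"] by simp
qed

text \<open>Induction along the conditional probabilities that define the model; histories of probability zero
impose no condition there, but have probability zero in the chain as well.\<close>

lemma cylinder_prob:
  assumes R: "reinforced_pa_trees \<delta> M A" and h: "history n a"
  shows "measure M {\<omega> \<in> space M. \<forall>j\<in>{1..n}. A j \<omega> = a j} = pmf (hist n) a"
  using h
proof (induction n arbitrary: a)
  case 0
  interpret prob_space M using R by (simp add: reinforced_pa_trees_def)
  have "a = (\<lambda>_. 0)" using 0 by (auto simp: history_def)
  then show ?case by (simp add: prob_space)
next
  case (Suc n)
  interpret prob_space M using R by (simp add: reinforced_pa_trees_def)
  let ?b = "a(Suc n := 0)"
  have hb: "history n ?b" using Suc.prems by (auto simp: history_def)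
  have m1: "{\<omega> \<in> space M. \<forall>j\<in>{1..n}. A j \<omega> = a j} \<in> sets M"
    by (rule cylinder_sets[OF R])
  have an: "a (Suc n) <= n" using Suc.prems by (auto simp: history_def less_Suc_eq_le)
  have eqb: "(\<forall>j\<in>{1..n}. A j \<omega> = ?b j) = (\<forall>j\<in>{1..n}. A j \<omega> = a j)" for \<omega> by auto
  have IH: "prob {\<omega> \<in> space M. \<forall>j\<in>{1..n}. A j \<omega> = a j} = pmf (hist n) ?b"
    using Suc.IH[OF hb] unfolding eqb .
  have split: "{\<omega> \<in> space M. \<forall>j\<in>{1..Suc n}. A j \<omega> = a j}
      = {\<omega> \<in> space M. A (n + 1) \<omega> = a (Suc n) & (\<forall>j\<in>{1..n}. A j \<omega> = a j)}"
    by (auto simp: le_Suc_eq)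
  show ?case
  proof (cases "n = 0")
    case True
    have "A (0 + 1) \<omega> <= 0" if "\<omega> \<in> space M" for \<omega>
      using R that unfolding reinforced_pa_trees_def by blast
    then have "{\<omega> \<in> space M. \<forall>j\<in>{1..Suc n}. A j \<omega> = a j} = space M"
      using True an by auto
    then have "prob {\<omega> \<in> space M. \<forall>j\<in>{1..Suc n}. A j \<omega> = a j} = 1" by (simp add: prob_space)
    moreover have "a = (\<lambda>_. 0)"
    proof
      fix j show "a j = 0"
        using Suc.prems True an by (cases "j = Suc 0") (auto simp: history_def)
    qed
    moreover have "set_pmf (attach_pmf (\<lambda>_. 0) 0) \<subseteq> {..0}" by (rule set_attach_pmf) auto
    then have "attach_pmf (\<lambda>_. 0) 0 = return_pmf 0"
      by (metis atMost_0 set_pmf_subset_singleton)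
    moreover have "(\<lambda>_. 0)(Suc 0 := 0) = (\<lambda>_. 0::nat)" by auto
    ultimately show ?thesis using True by (simp add: hist.simps(2) bind_return_pmf)
  next
    case False
    show ?thesis
    proof (cases "pmf (hist n) ?b = 0")
      case True
      have "prob {\<omega> \<in> space M. \<forall>j\<in>{1..Suc n}. A j \<omega> = a j} <= prob {\<omega> \<in> space M. \<forall>j\<in>{1..n}. A j \<omega> = a j}"
        by (intro finite_measure_mono m1) auto
      then show ?thesis using True IH by (simp add: pmf_hist_Suc[OF Suc.prems] measure_le_0_iff)
    next
      case nz: False
      then have pos: "\<P>(\<omega> in M. \<forall>j\<in>{1..n}. A j \<omega> = a j) > 0"
        using IH by (simp add: less_le)
      then have "\<P>(\<omega> in M. A (n + 1) \<omega> = a (Suc n) \<bar> \<forall>j\<in>{1..n}. A j \<omega> = a j) =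
           attach_weight \<delta> a n (a (Suc n)) / (\<Sum>j=0..n. attach_weight \<delta> a n j)"
        using R False an unfolding reinforced_pa_trees_def by auto
      also have "... = attach_weight \<delta> ?b n (a (Suc n)) / (\<Sum>j=0..n. attach_weight \<delta> ?b n j)"
      proof -
        have "attach_weight \<delta> a n i = attach_weight \<delta> ?b n i" for i
          using False by (intro attach_weight_cong) auto
        then show ?thesis by presburger
      qed
      also have "... = pmf (attach_pmf ?b n) (a (Suc n))"
        using hb an by (subst sum_attach_weight, simp add: history_def) (subst pmf_attach, auto simp: history_def)
      finally show ?thesis
        unfolding pmf_hist_Suc[OF Suc.prems] IH[symmetric] split cond_prob_def
        using pos by (simp add: field_simps)
    qed
  qed
qed

text \<open>Everything below is proved for the chain \<open>hist\<close>; this transfers it to an arbitrary realisation.\<close>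

lemma prob_eq_hist:
  assumes R: "reinforced_pa_trees \<delta> M A"
  shows "measure M {\<omega> \<in> space M. \<Phi> (restr n (\<lambda>j. A j \<omega>))} = measure_pmf.prob (hist n) {a. \<Phi> a}"
proof -
  interpret prob_space M using R by (simp add: reinforced_pa_trees_def)
  let ?H = "{a. history n a & \<Phi> a}"
  let ?E = "\<lambda>a. {\<omega> \<in> space M. restr n (\<lambda>j. A j \<omega>) = a}"
  have fin: "finite ?H" using finite_history by (rule finite_subset[rotated]) auto
  have "{\<omega> \<in> space M. \<Phi> (restr n (\<lambda>j. A j \<omega>))} = (\<Union>a\<in>?H. ?E a)"
    using restr_measurable(2)[OF R] by auto
  also have "measure M ... = (\<Sum>a\<in>?H. measure M (?E a))"
    using restr_measurable(1)[OF R, of n]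
    by (intro finite_measure_finite_Union fin) (auto simp: disjoint_family_on_def)
  also have "... = (\<Sum>a\<in>?H. pmf (hist n) a)"
  proof (rule sum.cong)
    fix a assume "a \<in> ?H"
    then have h: "history n a" by simp
    have "?E a = {\<omega> \<in> space M. \<forall>j\<in>{1..n}. A j \<omega> = a j}"
      using h by (simp add: restr_eq_iff)
    then show "measure M (?E a) = pmf (hist n) a" using cylinder_prob[OF R h] by simp
  qed simp
  also have "... = measure_pmf.prob (hist n) ?H"
    using fin by (simp add: measure_measure_pmf_finite)
  also have "... = measure_pmf.prob (hist n) {a. \<Phi> a}"
    by (intro measure_pmf.finite_measure_eq_AE) (auto intro!: AE_pmfI dest: history_hist)
  finally show ?thesis .
qed

end

section \<open>Subtrees of a recursive tree\<close>

datatype 'a dtree = DNode (label: 'a) (subs: "'a dtree list")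

primrec nodes :: "'a dtree => nat" where
  "nodes (DNode v ds) = Suc (sum_list (map nodes ds))"

lemma nodes_map_dtree [simp]: "nodes (map_dtree f d) = nodes d"
proof (induction d)
  case (DNode v ds)
  then have "map (nodes \<circ> map_dtree f) ds = map nodes ds" by auto
  then show ?case by (simp del: map_eq_conv)
qed

text \<open>The subtree of \<open>v\<close> as a plane tree with its labels; children are ordered by age.\<close>

function dec :: "(nat => nat) => nat => nat => nat dtree" where
  "dec a n v = DNode v (map (dec a n) (ch a n v))"
  by pat_completeness auto
termination by (relation "Wellfounded.measure (\<lambda>(a, n, v). n - v)") auto

declare dec.simps [simp del]

lemma label_dec [simp]: "label (dec a n v) = v"
  by (simp add: dec.simps)

abbreviation desc :: "(nat => nat) => nat => nat => nat set" where
  "desc a n v \<equiv> set_dtree (dec a n v)"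

lemma desc_eq: "desc a n v = insert v (\<Union>j\<in>set (ch a n v). desc a n j)"
  by (subst dec.simps) simp

lemma finite_set_dtree: "finite (set_dtree d)"
  by (induction d) auto

lemma funpow_history_le: "history m a ==> (a ^^ k) w <= w"
proof (induction k)
  case (Suc k)
  have "a ((a ^^ k) w) <= (a ^^ k) w"
    using Suc.prems by (cases "(a ^^ k) w = 0") (auto simp: history_def intro: less_imp_le)
  then show ?case using Suc by simp
qed simp

lemma desc_iff:
  assumes a: "history m a" and i: "1 <= i" "i <= n"
  shows "w \<in> desc a n i \<longleftrightarrow> w <= n & (\<exists>k. (a ^^ k) w = i)"
  using i
proof (induction "n - i" arbitrary: i rule: less_induct)
  case less
  have a0: "a 0 = 0" using a by (rule history_zero)
  have IH: "w \<in> desc a n j \<longleftrightarrow> w <= n & (\<exists>k. (a ^^ k) w = j)" if "j \<in> set (ch a n i)" for j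
    using less.hyps[of j] that less.prems by auto
  show ?case
  proof
    assume "w \<in> desc a n i"
    then consider "w = i" | j where "j \<in> set (ch a n i)" "w \<in> desc a n j"
      by (subst (asm) desc_eq) auto
    then show "w <= n & (\<exists>k. (a ^^ k) w = i)"
    proof cases
      case 1
      then have "(a ^^ 0) w = i" by simp
      then have "\<exists>k. (a ^^ k) w = i" by (rule exI[of _ 0])
      then show ?thesis using 1 less.prems by simp
    next
      case 2
      then obtain k where "w <= n" "(a ^^ k) w = j" using IH by auto
      moreover have "a j = i" using 2 by simp
      ultimately have "(a ^^ Suc k) w = i" by simp
      then have "\<exists>k. (a ^^ k) w = i" by (rule exI[of _ "Suc k"])
      then show ?thesis using \<open>w <= n\<close> by simp
    qed
  next
    assume "w <= n & (\<exists>k. (a ^^ k) w = i)"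
    then obtain k where w: "w <= n" and k: "(a ^^ k) w = i" by auto
    show "w \<in> desc a n i"
    proof (cases k)
      case 0
      then show ?thesis using k by (subst desc_eq) simp
    next
      case (Suc k')
      let ?j = "(a ^^ k') w"
      have j: "a ?j = i" using k Suc by simp
      then have "?j ~= 0" using a0 less.prems by (metis not_one_le_zero)
      then have "i < ?j" using historyD[OF a, of ?j] j by simp
      moreover have "?j <= n" using funpow_history_le[OF a, of k' w] w by simp
      ultimately have "?j \<in> set (ch a n i)" using j by simp
      then show ?thesis using IH[of ?j] w by (subst desc_eq) blast
    qed
  qed
qed

lemma desc_subset: "history m a ==> 1 <= i ==> i <= n ==> desc a n i \<subseteq> {i..n}"
  using desc_iff[of m a i n] funpow_history_le[of m a] by auto

lemma finite_desc [simp]: "finite (desc a n i)"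
  by (rule finite_set_dtree)

lemma not_in_desc_child:
  assumes "history m a" "1 <= i" "j \<in> set (ch a n i)"
  shows "i \<notin> desc a n j"
proof -
  have "desc a n j \<subseteq> {j..n}" using assms by (intro desc_subset[of m]) auto
  then show ?thesis using assms(3) by auto
qed

text \<open>The ancestors of a common descendant form a chain.\<close>

lemma desc_nested:
  assumes a: "history m a" and i: "1 <= i" "i <= n" "1 <= j" "j <= n"
    and meet: "desc a n i \<inter> desc a n j ~= {}"
  shows "i \<in> desc a n j \<or> j \<in> desc a n i"
proof -
  obtain w where "w \<in> desc a n i" "w \<in> desc a n j" using meet by blast
  then obtain k l where kl: "(a ^^ k) w = i" "(a ^^ l) w = j"
    unfolding desc_iff[OF a i(1,2)] desc_iff[OF a i(3,4)] by blast
  have "(a ^^ (l - k)) i = j" if "k <= l"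
    using kl funpow_add[of "l - k" k a] that by (metis comp_apply le_add_diff_inverse2)
  moreover have "(a ^^ (k - l)) j = i" if "l <= k"
    using kl funpow_add[of "k - l" l a] that by (metis comp_apply le_add_diff_inverse2)
  ultimately show ?thesis
    using desc_iff[OF a i(1,2)] desc_iff[OF a i(3,4)] i by (meson nat_le_linear)
qed

lemma desc_siblings_disjoint:
  assumes a: "history m a" and i: "1 <= i"
    and j: "j \<in> set (ch a n i)" "j' \<in> set (ch a n i)" "j ~= j'"
  shows "desc a n j \<inter> desc a n j' = {}"
proof (rule ccontr)
  have no: "k \<notin> desc a n l" if kl: "k \<in> set (ch a n i)" "l \<in> set (ch a n i)" "k ~= l" for k l
  proof
    assume "k \<in> desc a n l"
    moreover have "1 <= l" "l <= n" using kl i by auto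
    ultimately have "\<exists>q. (a ^^ q) k = l" using desc_iff[OF a, of l n k] by simp
    then obtain q where q: "(a ^^ q) k = l" by blast
    then obtain q' where "q = Suc q'" using kl(3) by (cases q) auto
    then have "(a ^^ q') i = l" using q kl(1) by (simp add: funpow_swap1)
    then have "l <= i" using funpow_history_le[OF a, of q' i] by simp
    then show False using kl(2) by simp
  qed
  assume "desc a n j \<inter> desc a n j' ~= {}"
  then have "j \<in> desc a n j' \<or> j' \<in> desc a n j"
    using i j by (intro desc_nested[OF a]) auto
  then show False using no j by blast
qed

lemma card_desc:
  assumes a: "history m a" and i: "1 <= i" "i <= n"
  shows "card (desc a n i) = nodes (dec a n i)"
  using i
proof (induction "n - i" arbitrary: i rule: less_induct)
  case less
  let ?C = "set (ch a n i)"
  have IH: "card (desc a n j) = nodes (dec a n j)" if "j \<in> ?C" for j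
    using less.hyps[of j] that less.prems by auto
  have ni: "i \<notin> (\<Union>j\<in>?C. desc a n j)"
    using not_in_desc_child[OF a less.prems(1)] by blast
  have "card (desc a n i) = Suc (card (\<Union>j\<in>?C. desc a n j))"
    by (subst desc_eq, subst card_insert_disjoint) (use ni in auto)
  also have "card (\<Union>j\<in>?C. desc a n j) = (\<Sum>j\<in>?C. card (desc a n j))"
    by (intro card_UN_disjoint ballI impI desc_siblings_disjoint[OF a less.prems(1)]) simp_all
  also have "... = (\<Sum>j\<leftarrow>ch a n i. nodes (dec a n j))"
    using IH by (subst sum_list_distinct_conv_sum_set) auto
  finally show ?case by (subst dec.simps) (simp add: comp_def)
qed

lemma desc_closed:
  assumes a: "history n a" and i: "1 <= i" "i <= n" and w: "w \<in> {1..n}" "a w \<in> desc a n i"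
  shows "w \<in> desc a n i"
proof -
  obtain k where "(a ^^ k) (a w) = i" using w(2) desc_iff[OF a i] by auto
  then have "(a ^^ Suc k) w = i" by (simp add: funpow_swap1)
  then have "\<exists>k. (a ^^ k) w = i" by (rule exI[of _ "Suc k"])
  then show ?thesis using desc_iff[OF a i] w(1) by simp
qed

text \<open>The two histories make the same attachments as far as a parent in \<open>V\<close> is concerned. If \<open>V\<close> is the union of
two subtrees of \<open>a0\<close>, this holds for every \<open>a\<close> with the same two subtrees.\<close>

definition agree :: "nat set => (nat => nat) => nat => (nat => nat) => bool" where
  "agree V a0 m a \<longleftrightarrow> (\<forall>w\<in>{1..m}. a w \<in> V \<or> a0 w \<in> V --> a w = a0 w)"

lemma dec_eq_imp_ch_eq:
  assumes "dec a n i = dec a0 n i" "v \<in> desc a0 n i"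
  shows "ch a n v = ch a0 n v"
  using assms
proof (induction "n - i" arbitrary: i rule: less_induct)
  case less
  have "map (dec a n) (ch a n i) = map (dec a0 n) (ch a0 n i)"
    using less.prems(1) by (simp add: dec.simps[of _ _ i])
  then have m: "map (dec a n) (ch a n i) = map (dec a0 n) (ch a0 n i)" .
  have "map label (map (dec a n) (ch a n i)) = map label (map (dec a0 n) (ch a0 n i))"
    unfolding m ..
  then have c: "ch a n i = ch a0 n i" by (simp add: comp_def)
  then have eq: "ch a n i = ch a0 n i" "\<forall>j\<in>set (ch a0 n i). dec a n j = dec a0 n j"
    using m by (simp_all add: map_eq_conv)
  show ?case
  proof (cases "v = i")
    case False
    then obtain j where "j \<in> set (ch a0 n i)" "v \<in> desc a0 n j"
      using less.prems(2) by (subst (asm) desc_eq) auto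
    then show ?thesis using less.hyps[of j] eq by auto
  qed (use eq in auto)
qed

lemma agreeI:
  assumes "history n a" "history n a0" "\<And>v. v \<in> V ==> ch a n v = ch a0 n v"
  shows "agree V a0 n a"
  unfolding agree_def
proof (intro ballI impI)
  fix w assume w: "w \<in> {1..n}" "a w \<in> V \<or> a0 w \<in> V"
  have in_ch: "w \<in> set (ch a n (a w))" "w \<in> set (ch a0 n (a0 w))"
    using w(1) historyD[OF assms(1), of w] historyD[OF assms(2), of w] by simp_all
  from w(2) show "a w = a0 w"
  proof
    assume "a w \<in> V"
    then have "w \<in> set (ch a0 n (a w))" using in_ch(1) assms(3) by simp
    then show ?thesis by simp
  next
    assume "a0 w \<in> V"
    then have "w \<in> set (ch a n (a0 w))" using in_ch(2) assms(3) by simp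
    then show ?thesis by simp
  qed
qed

section \<open>Joint law of two disjoint subtrees\<close>

context reinforcement begin

text \<open>The probability that \<open>j\<close> attaches to \<open>v\<close>, when the children of \<open>v\<close> are \<open>js\<close>.\<close>

definition rate :: "nat => nat list => nat => real" where
  "rate v js j = th \<delta> v js (j - 1) / total_weight \<delta> (j - 1)"

definition cumul :: "nat => nat => nat list => real" where
  "cumul n v js = (\<Sum>k<n. th \<delta> v js k / total_weight \<delta> k)"

text \<open>The weight of one vertex: probabilities of its attachments times an exponential for the steps at which
nothing attaches to it. It is the discrete counterpart of the density of a point process.\<close>

definition gw :: "nat => nat => nat list => real" where
  "gw n v js = (\<Prod>j\<leftarrow>js. rate v js j) * exp (- cumul n v js)"

primrec wt :: "nat => nat dtree => real" where
  "wt n (DNode v ds) = gw n v (map label ds) * prod_list (map (wt n) ds)"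

lemma rate_nonneg: "rate v js j >= 0"
  unfolding rate_def using th_nonneg total_weight_pos by (simp add: less_imp_le)

lemma gw_nonneg: "gw n v js >= 0"
  unfolding gw_def by (intro mult_nonneg_nonneg prod_list_nonneg) (auto simp: rate_nonneg)

lemma wt_nonneg: "wt n d >= 0"
  by (induction d) (auto intro!: mult_nonneg_nonneg gw_nonneg prod_list_nonneg)

text \<open>Labels determine the vertices, so the recursive product is a product over the descendants.\<close>

lemma wt_dec:
  assumes a: "history m a" and i: "1 <= i" "i <= n"
  shows "wt n (dec a n i) = (\<Prod>v\<in>desc a n i. gw n v (ch a n v))"
  using i
proof (induction "n - i" arbitrary: i rule: less_induct)
  case less
  let ?C = "set (ch a n i)"
  have IH: "wt n (dec a n j) = (\<Prod>v\<in>desc a n j. gw n v (ch a n v))" if "j \<in> ?C" for j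
    using less.hyps[of j] that less.prems by auto
  have ni: "i \<notin> (\<Union>j\<in>?C. desc a n j)"
    using not_in_desc_child[OF a less.prems(1)] by blast
  have "(\<Prod>v\<in>desc a n i. gw n v (ch a n v))
      = gw n i (ch a n i) * (\<Prod>v\<in>(\<Union>j\<in>?C. desc a n j). gw n v (ch a n v))"
    by (subst desc_eq, subst prod.insert) (use ni in auto)
  also have "(\<Prod>v\<in>(\<Union>j\<in>?C. desc a n j). gw n v (ch a n v)) = (\<Prod>j\<in>?C. \<Prod>v\<in>desc a n j. gw n v (ch a n v))"
    by (intro prod.UNION_disjoint ballI impI desc_siblings_disjoint[OF a less.prems(1)]) simp_all
  also have "... = (\<Prod>j\<leftarrow>ch a n i. wt n (dec a n j))"
    using IH by (subst prod.distinct_set_conv_list[symmetric]) auto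
  finally show ?case by (subst dec.simps) (simp add: comp_def)
qed

lemma expectation_hist_Suc:
  "measure_pmf.expectation (hist (Suc n)) (f :: _ => real) = measure_pmf.expectation (hist n)
     (\<lambda>a. \<Sum>i\<le>n. attach_weight \<delta> a n i / total_weight \<delta> n * f (a(Suc n := i)))"
proof -
  have fin: "finite (set_pmf (attach_pmf a n))" if "a \<in> set_pmf (hist n)" for a
    using set_attach_pmf[of a n] history_hist[OF that] finite_subset[of _ "{..n}"] by (auto simp: history_def)
  have "measure_pmf.expectation (hist (Suc n)) f = (\<Sum>a\<in>set_pmf (hist n). pmf (hist n) a *\<^sub>R
      measure_pmf.expectation (map_pmf (\<lambda>i. a(Suc n := i)) (attach_pmf a n)) f)"
    unfolding hist.simps(2) by (rule pmf_expectation_bind) (use fin finite_set_hist in auto)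
  also have "... = (\<Sum>a\<in>set_pmf (hist n). pmf (hist n) a *\<^sub>R
      (\<Sum>i\<le>n. attach_weight \<delta> a n i / total_weight \<delta> n * f (a(Suc n := i))))"
  proof (rule sum.cong)
    fix a assume "a \<in> set_pmf (hist n)"
    then have h: "\<forall>j\<ge>1. a j < j" using history_hist by (auto simp: history_def)
    have "measure_pmf.expectation (map_pmf (\<lambda>i. a(Suc n := i)) (attach_pmf a n)) f
        = measure_pmf.expectation (attach_pmf a n) (\<lambda>i. f (a(Suc n := i)))" by simp
    also have "... = (\<Sum>i\<le>n. pmf (attach_pmf a n) i *\<^sub>R f (a(Suc n := i)))"
      by (rule integral_measure_pmf) (use set_attach_pmf[OF h, of n] in auto)
    also have "... = (\<Sum>i\<le>n. attach_weight \<delta> a n i / total_weight \<delta> n * f (a(Suc n := i)))"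
      by (intro sum.cong) (auto simp: pmf_attach[OF h])
    finally show "pmf (hist n) a *\<^sub>R measure_pmf.expectation (map_pmf (\<lambda>i. a(Suc n := i)) (attach_pmf a n)) f
      = pmf (hist n) a *\<^sub>R (\<Sum>i\<le>n. attach_weight \<delta> a n i / total_weight \<delta> n * f (a(Suc n := i)))" by simp
  qed simp
  also have "... = measure_pmf.expectation (hist n)
     (\<lambda>a. \<Sum>i\<le>n. attach_weight \<delta> a n i / total_weight \<delta> n * f (a(Suc n := i)))"
    by (rule integral_measure_pmf[symmetric]) (use finite_set_hist in auto)
  finally show ?thesis .
qed

lemma expectation_hist_mono:
  assumes "\<And>a. history n a ==> f a <= (g a :: real)"
  shows "measure_pmf.expectation (hist n) f <= measure_pmf.expectation (hist n) g"
  by (rule integral_mono_AE) (auto intro!: AE_pmfI assms history_hist)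

lemma th_zero: "m < v ==> \<forall>j\<in>set js. v < j ==> th \<delta> v js m = 0"
proof -
  assume "m < v" "\<forall>j\<in>set js. v < j"
  then have "map (\<lambda>j. real (m + 1 - j)) js = map (\<lambda>j. 0) js" by (intro map_cong) auto
  then show ?thesis using \<open>m < v\<close> unfolding th_def by (simp del: map_eq_conv)
qed

lemma th_le:
  "th \<delta> v js m <= (1 + \<delta> + real (length js)) * (real m + 1)"
proof -
  have "(1 + \<delta>) * real (m + 1 - v) <= (1 + \<delta>) * (real m + 1)"
    using delta by (intro mult_left_mono) auto
  moreover have "(\<Sum>j\<leftarrow>js. real (m + 1 - j)) <= (\<Sum>j\<leftarrow>js. real m + 1)"
    by (intro sum_list_mono) auto
  moreover have "(\<Sum>j\<leftarrow>js. real m + 1) = real (length js) * (real m + 1)"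
    by (simp add: sum_list_triv)
  ultimately show ?thesis unfolding th_def by (simp add: algebra_simps)
qed

lemma th_over_total_le:
  "th \<delta> v js m / total_weight \<delta> m <= 2 * (1 + \<delta> + real (length js)) / ((1 + \<delta>) * (real m + 1))"
proof -
  have d: "1 + \<delta> > 0" using delta by simp
  have "th \<delta> v js m / total_weight \<delta> m <= ((1 + \<delta> + real (length js)) * (real m + 1)) / ((1 + \<delta>) / 2 * (real m + 1)\<^sup>2)"
    using d by (intro frac_le th_le total_weight_ge mult_nonneg_nonneg) auto
  also have "... = 2 * (1 + \<delta> + real (length js)) / ((1 + \<delta>) * (real m + 1))"
  proof -
    have "c * x / (e / 2 * x\<^sup>2) = 2 * c / (e * x)" if "x > 0" "e > 0" for c x e :: real
      using that by (simp add: divide_simps power2_eq_square)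
    then show ?thesis using d by simp
  qed
  finally show ?thesis .
qed

text \<open>A bound for the probability that step \<open>k + 1\<close> is made as in \<open>a0\<close>: if it attaches to \<open>V\<close>, this is the
exact probability, otherwise \<open>1 - x\<close> is bounded by \<open>exp (- x)\<close>, which makes the bound multiplicative.\<close>

definition step_bound :: "nat set => (nat => nat) => nat => nat => real" where
  "step_bound V a0 n k = (if a0 (Suc k) \<in> V
     then th \<delta> (a0 (Suc k)) (ch a0 n (a0 (Suc k))) k / total_weight \<delta> k
     else exp (- (\<Sum>v\<in>V. th \<delta> v (ch a0 n v) k / total_weight \<delta> k)))"

text \<open>As long as \<open>a\<close> agrees with \<open>a0\<close> on \<open>V\<close>, the weights of the vertices in \<open>V\<close> are the same in both, and the total
weight is deterministic.\<close>

lemma agree_prob_step: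
  assumes h0: "history n a0" and V: "V \<subseteq> {1..n}" and h: "history m a" and m: "m < n"
  shows "(\<Sum>i\<le>m. attach_weight \<delta> a m i / total_weight \<delta> m * indicator {b. agree V a0 (Suc m) b} (a(Suc m := i)))
    <= indicator {b. agree V a0 m b} a * step_bound V a0 n m"
proof -
  have ha: "\<forall>j\<ge>1. a j < j" and h0a: "\<forall>j\<ge>1. a0 j < j" using h h0 by (auto simp: history_def)
  have finV: "finite V" using V finite_subset by blast
  have sb: "step_bound V a0 n m >= 0"
    unfolding step_bound_def using th_nonneg total_weight_pos by (simp add: less_imp_le)
  have imp: "agree V a0 m a & (i \<in> V \<or> a0 (Suc m) \<in> V --> i = a0 (Suc m))"
    if "agree V a0 (Suc m) (a(Suc m := i))" for i
    using that unfolding agree_def by (auto split: if_splits) (metis atLeastAtMost_iff le_Suc_eq not_less_eq_eq order_refl)+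
  show ?thesis
  proof (cases "agree V a0 m a")
    case False
    then have "\<not> agree V a0 (Suc m) (a(Suc m := i))" for i using imp by blast
    then show ?thesis using False by simp
  next
    case True
    have w: "attach_weight \<delta> a m v = th \<delta> v (ch a0 n v) m" if v: "v \<in> V" "v <= m" for v
    proof -
      have v1: "1 <= v" using v V by auto
      have "attach_weight \<delta> a m v = th \<delta> v (ch a m v) m"
        by (rule attach_weight_th[OF ha v1 v(2) order_refl])
      also have "{w \<in> {v<..m}. a w = v} = {w \<in> {v<..m}. a0 w = v}"
      proof -
        have "a w = v \<longleftrightarrow> a0 w = v" if "w \<in> {v<..m}" for w
        proof -
          have "w \<in> {1..m}" using that by simp
          then have "a w \<in> V \<or> a0 w \<in> V --> a w = a0 w" using True unfolding agree_def by blast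
          then show ?thesis using v(1) by metis
        qed
        then show ?thesis by blast
      qed
      then have "ch a m v = ch a0 m v" unfolding ch_def by simp
      also have "th \<delta> v (ch a0 m v) m = attach_weight \<delta> a0 m v"
        by (rule attach_weight_th[OF h0a v1 v(2) order_refl, symmetric])
      also have "... = th \<delta> v (ch a0 n v) m"
        using m by (intro attach_weight_th[OF h0a v1 v(2)]) simp
      finally show ?thesis .
    qed
    let ?p = "\<lambda>i. attach_weight \<delta> a m i / total_weight \<delta> m"
    have p0: "?p i >= 0" for i using attach_weight_nonneg[OF ha] total_weight_pos by (simp add: less_imp_le)
    have p1: "(\<Sum>i\<le>m. ?p i) = 1"
      using sum_attach_weight[OF ha, of \<delta> m] total_weight_pos[of m]
      by (simp flip: sum_divide_distrib add: atLeast0AtMost)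
    have "(\<Sum>i\<le>m. ?p i * indicator {b. agree V a0 (Suc m) b} (a(Suc m := i))) <= step_bound V a0 n m"
    proof (cases "a0 (Suc m) \<in> V")
      case inV: True
      have am: "a0 (Suc m) <= m" using historyD[OF h0, of "Suc m"] by simp
      have "(\<Sum>i\<le>m. ?p i * indicator {b. agree V a0 (Suc m) b} (a(Suc m := i)))
          <= (\<Sum>i\<le>m. if i = a0 (Suc m) then ?p i else 0)"
      proof (rule sum_mono)
        fix i show "?p i * indicator {b. agree V a0 (Suc m) b} (a(Suc m := i)) <= (if i = a0 (Suc m) then ?p i else 0)"
          using imp[of i] inV p0[of i] by (cases "agree V a0 (Suc m) (a(Suc m := i))") (auto simp del: fun_upd_apply)
      qed
      also have "... = ?p (a0 (Suc m))" using am by simp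
      finally show ?thesis using inV w[OF inV am] by (simp add: step_bound_def)
    next
      case nV: False
      have "(\<Sum>i\<le>m. ?p i * indicator {b. agree V a0 (Suc m) b} (a(Suc m := i)))
          <= (\<Sum>i\<le>m. if i \<in> V then 0 else ?p i)"
      proof (rule sum_mono)
        fix i show "?p i * indicator {b. agree V a0 (Suc m) b} (a(Suc m := i)) <= (if i \<in> V then 0 else ?p i)"
          using imp[of i] nV p0[of i] by (cases "agree V a0 (Suc m) (a(Suc m := i))") (auto simp del: fun_upd_apply)
      qed
      also have "... = (\<Sum>i\<le>m. ?p i) - (\<Sum>i\<le>m. if i \<in> V then ?p i else 0)"
        unfolding sum_subtractf[symmetric] by (intro sum.cong) auto
      also have "(\<Sum>i\<le>m. if i \<in> V then ?p i else 0) = (\<Sum>i\<in>V. if i <= m then ?p i else 0)"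
        using sum.inter_restrict[of "{..m}" ?p V] sum.inter_restrict[OF finV, of ?p "{..m}"]
        by (simp add: Int_commute)
      also have "... = (\<Sum>v\<in>V. th \<delta> v (ch a0 n v) m / total_weight \<delta> m)"
        using w by (intro sum.cong) (auto simp: th_zero)
      also have "(\<Sum>i\<le>m. ?p i) - (\<Sum>v\<in>V. th \<delta> v (ch a0 n v) m / total_weight \<delta> m) <= step_bound V a0 n m"
        using nV p1 exp_ge_add_one_self[of "- (\<Sum>v\<in>V. th \<delta> v (ch a0 n v) m / total_weight \<delta> m)"]
        by (simp add: step_bound_def)
      finally show ?thesis .
    qed
    then show ?thesis using True by simp
  qed
qed

lemma agree_prob_prod:
  assumes h0: "history n a0" and V: "V \<subseteq> {1..n}"
  shows "m <= n ==> measure_pmf.prob (hist m) {a. agree V a0 m a} <= (\<Prod>k<m. step_bound V a0 n k)"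
proof (induction m)
  case 0
  then show ?case by simp
next
  case (Suc m)
  have sb: "step_bound V a0 n m >= 0"
    unfolding step_bound_def using th_nonneg total_weight_pos by (simp add: less_imp_le)
  have "measure_pmf.prob (hist (Suc m)) {a. agree V a0 (Suc m) a}
      = measure_pmf.expectation (hist (Suc m)) (indicator {a. agree V a0 (Suc m) a})" by simp
  also have "... <= measure_pmf.expectation (hist m) (\<lambda>a. indicator {b. agree V a0 m b} a * step_bound V a0 n m)"
    unfolding expectation_hist_Suc using Suc.prems
    by (intro expectation_hist_mono agree_prob_step[OF h0 V]) auto
  also have "... = measure_pmf.prob (hist m) {a. agree V a0 m a} * step_bound V a0 n m" by simp
  also have "... <= (\<Prod>k<m. step_bound V a0 n k) * step_bound V a0 n m"
    using Suc sb by (intro mult_right_mono) auto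
  finally show ?case by simp
qed

text \<open>The product over the steps is regrouped by the vertex to which a step attaches. The exponentials are
missing at the at most \<open>K\<close> steps that attach to \<open>V\<close>; supplying them costs a factor close to one,
since at a time after \<open>lo\<close> each exponent is of order \<open>1 / lo\<close>.\<close>

lemma step_bound_regroup:
  assumes h0: "history n a0" and V: "V \<subseteq> {lo..n}" and lo: "1 <= lo"
    and closed: "\<And>w. w \<in> {1..n} ==> a0 w \<in> V ==> w \<in> V" and K: "card V <= K"
  shows "(\<Prod>k<n. step_bound V a0 n k)
    <= exp (2 * real K ^ 2 * (1 + \<delta> + real K) / ((1 + \<delta>) * real lo)) * (\<Prod>v\<in>V. gw n v (ch a0 n v))"
proof -
  have finV: "finite V" using V finite_subset by blast
  let ?K = "{k \<in> {..<n}. a0 (Suc k) \<in> V}"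
  let ?t = "\<lambda>v k. th \<delta> v (ch a0 n v) k / total_weight \<delta> k"
  let ?S = "\<lambda>k. \<Sum>v\<in>V. ?t v k"
  have t0: "?t v k >= 0" for v k using th_nonneg total_weight_pos by (simp add: less_imp_le)
  have "(\<Prod>k<n. step_bound V a0 n k)
      = (\<Prod>k<n. (if a0 (Suc k) \<in> V then ?t (a0 (Suc k)) k else 1) *
          ((if a0 (Suc k) \<in> V then exp (?S k) else 1) * exp (- ?S k)))"
    by (intro prod.cong) (auto simp: step_bound_def exp_minus)
  also have "... = (\<Prod>k\<in>?K. ?t (a0 (Suc k)) k) * ((\<Prod>k\<in>?K. exp (?S k)) * (\<Prod>k<n. exp (- ?S k)))"
    by (simp only: prod.distrib prod.inter_filter finite_lessThan mult.assoc)
  also have "(\<Prod>k\<in>?K. exp (?S k)) = exp (\<Sum>k\<in>?K. ?S k)"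
    by (simp add: exp_sum)
  also have "(\<Prod>k<n. exp (- ?S k)) = (\<Prod>v\<in>V. exp (- cumul n v (ch a0 n v)))"
    unfolding cumul_def using finV
    by (simp flip: exp_sum add: sum_negf) (rule sum.swap)
  also have "(\<Prod>k\<in>?K. ?t (a0 (Suc k)) k) = (\<Prod>v\<in>V. \<Prod>k\<in>{k \<in> ?K. a0 (Suc k) = v}. ?t (a0 (Suc k)) k)"
    using finV by (intro prod.group[symmetric]) auto
  also have "... = (\<Prod>v\<in>V. \<Prod>j\<leftarrow>ch a0 n v. rate v (ch a0 n v) j)"
  proof (rule prod.cong)
    fix v assume v: "v \<in> V"
    have "(\<Prod>j\<leftarrow>ch a0 n v. rate v (ch a0 n v) j) = (\<Prod>j\<in>set (ch a0 n v). rate v (ch a0 n v) j)"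
      by (rule prod.distinct_set_conv_list[symmetric]) simp
    also have "... = (\<Prod>k\<in>{k \<in> ?K. a0 (Suc k) = v}. rate v (ch a0 n v) (Suc k))"
    proof (rule prod.reindex_bij_witness[of _ Suc "\<lambda>j. j - 1"])
      fix j assume j: "j \<in> set (ch a0 n v)"
      then show "Suc (j - 1) = j" by auto
      then show "j - 1 \<in> {k \<in> ?K. a0 (Suc k) = v}" using j v by auto
      show "rate v (ch a0 n v) (Suc (j - 1)) = rate v (ch a0 n v) j" using \<open>Suc (j - 1) = j\<close> by simp
    next
      fix k assume k: "k \<in> {k \<in> ?K. a0 (Suc k) = v}"
      then show "Suc k \<in> set (ch a0 n v)" using historyD[OF h0, of "Suc k"] by auto
    qed auto
    finally show "(\<Prod>k\<in>{k \<in> ?K. a0 (Suc k) = v}. ?t (a0 (Suc k)) k) = (\<Prod>j\<leftarrow>ch a0 n v. rate v (ch a0 n v) j)"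
      by (simp add: rate_def)
  qed simp
  also have "(\<Prod>v\<in>V. \<Prod>j\<leftarrow>ch a0 n v. rate v (ch a0 n v) j) * (exp (\<Sum>k\<in>?K. ?S k) * (\<Prod>v\<in>V. exp (- cumul n v (ch a0 n v))))
     = exp (\<Sum>k\<in>?K. ?S k) * (\<Prod>v\<in>V. gw n v (ch a0 n v))"
    unfolding gw_def prod.distrib by simp
  also have "... <= exp (2 * real K ^ 2 * (1 + \<delta> + real K) / ((1 + \<delta>) * real lo)) * (\<Prod>v\<in>V. gw n v (ch a0 n v))"
  proof (intro mult_right_mono prod_nonneg)
    have d: "1 + \<delta> > 0" using delta by simp
    let ?c = "2 * (1 + \<delta> + real K) / ((1 + \<delta>) * real lo)"
    have c0: "?c >= 0" using d by simp
    have K': "card ?K <= K"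
    proof -
      have "Suc ` ?K \<subseteq> V" using closed by auto
      then have "card (Suc ` ?K) <= card V" by (rule card_mono[OF finV])
      then show ?thesis using K by (simp add: card_image)
    qed
    have S: "?S k <= real K * ?c" if k: "k \<in> ?K" for k
    proof -
      have "Suc k \<in> V" using closed[of "Suc k"] k by auto
      then have lok: "real lo <= real k + 1" using V by force
      have "?t v k <= ?c" if v: "v \<in> V" for v
      proof -
        have "set (ch a0 n v) \<subseteq> V" using closed v V by auto
        then have "card (set (ch a0 n v)) <= card V" by (rule card_mono[OF finV])
        then have "length (ch a0 n v) <= K"
          unfolding distinct_card[OF distinct_ch] using K by simp
        then have "2 * (1 + \<delta> + real (length (ch a0 n v))) / ((1 + \<delta>) * (real k + 1)) <= ?c"
          using d lok lo by (intro frac_le mult_left_mono) auto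
        then show ?thesis using th_over_total_le[of v "ch a0 n v" k] by linarith
      qed
      then have "?S k <= real (card V) * ?c" by (rule sum_bounded_above)
      also have "... <= real K * ?c" using c0 K by (intro mult_right_mono) auto
      finally show ?thesis .
    qed
    then have "(\<Sum>k\<in>?K. ?S k) <= real (card ?K) * (real K * ?c)" by (rule sum_bounded_above)
    also have "... <= real K * (real K * ?c)" using c0 K' by (intro mult_right_mono mult_nonneg_nonneg) auto
    also have "... = 2 * real K ^ 2 * (1 + \<delta> + real K) / ((1 + \<delta>) * real lo)"
      by (simp add: power2_eq_square)
    finally show "exp (\<Sum>k\<in>?K. ?S k) <= exp (2 * real K ^ 2 * (1 + \<delta> + real K) / ((1 + \<delta>) * real lo))" by simp
  qed (rule gw_nonneg)
  finally show ?thesis .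
qed

definition corr :: "nat => nat => real" where
  "corr K lo = exp (2 * real K ^ 2 * (1 + \<delta> + real K) / ((1 + \<delta>) * real lo))"

text \<open>The union of two disjoint subtrees is closed under taking children, and the product of the weights of its
vertices factorises.\<close>

lemma pair_prob_le:
  assumes h0: "history n a0" and lo: "1 <= lo" and i: "i \<in> {lo..n}" "j \<in> {lo..n}"
    and disj: "desc a0 n i \<inter> desc a0 n j = {}"
    and K: "nodes (dec a0 n i) + nodes (dec a0 n j) <= K"
  shows "measure_pmf.prob (hist n) {a. dec a n i = dec a0 n i & dec a n j = dec a0 n j}
    <= corr K lo * (wt n (dec a0 n i) * wt n (dec a0 n j))"
proof -
  let ?V = "desc a0 n i \<union> desc a0 n j"
  have ij: "1 <= i" "i <= n" "1 <= j" "j <= n" using lo i by auto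
  have sub: "?V \<subseteq> {lo..n}" using desc_subset[OF h0 ij(1,2)] desc_subset[OF h0 ij(3,4)] i by fastforce
  have "measure_pmf.prob (hist n) {a. dec a n i = dec a0 n i & dec a n j = dec a0 n j}
     <= measure_pmf.prob (hist n) {a. agree ?V a0 n a}"
  proof (rule measure_pmf.finite_measure_mono_AE)
    show "AE a in measure_pmf (hist n). a \<in> {a. dec a n i = dec a0 n i & dec a n j = dec a0 n j}
        --> a \<in> {a. agree ?V a0 n a}"
    proof (rule AE_pmfI, clarify)
      fix a assume a: "a \<in> set_pmf (hist n)" and eq: "dec a n i = dec a0 n i" "dec a n j = dec a0 n j"
      show "agree ?V a0 n a"
      proof (rule agreeI[OF history_hist[OF a] h0])
        fix v assume "v \<in> ?V"
        then show "ch a n v = ch a0 n v" using dec_eq_imp_ch_eq[OF eq(1)] dec_eq_imp_ch_eq[OF eq(2)] by blast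
      qed
    qed
  qed auto
  also have "... <= (\<Prod>k<n. step_bound ?V a0 n k)"
    using sub lo by (intro agree_prob_prod[OF h0]) auto
  also have "... <= corr K lo * (\<Prod>v\<in>?V. gw n v (ch a0 n v))"
    unfolding corr_def
  proof (rule step_bound_regroup[OF h0 sub lo])
    show "w \<in> ?V" if "w \<in> {1..n}" "a0 w \<in> ?V" for w
      using desc_closed[OF h0 ij(1,2) that(1)] desc_closed[OF h0 ij(3,4) that(1)] that(2) by blast
    show "card ?V <= K"
      using disj K card_desc[OF h0 ij(1,2)] card_desc[OF h0 ij(3,4)] by (simp add: card_Un_disjoint)
  qed
  also have "(\<Prod>v\<in>?V. gw n v (ch a0 n v)) = wt n (dec a0 n i) * wt n (dec a0 n j)"
    unfolding wt_dec[OF h0 ij(1,2)] wt_dec[OF h0 ij(3,4)] by (rule prod.union_disjoint) (use disj in auto)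
  finally show ?thesis .
qed

end

section \<open>Summing over the labellings of a shape\<close>

type_synonym ptree = "unit dtree"

abbreviation shape :: "'a dtree => ptree" where
  "shape \<equiv> map_dtree (\<lambda>_. ())"

primrec Lset :: "nat => (nat => nat dtree set) list => nat => nat dtree list set" where
  "Lset n [] l = {[]}"
| "Lset n (D # Ds) l = (\<lambda>(j, d, ds). d # ds) ` (SIGMA j:{l<..n}. D j \<times> Lset n Ds j)"

text \<open>The labellings of a shape by increasing labels up to \<open>n\<close>, with root label \<open>i\<close>. Working with lists of
increasing siblings avoids symmetry factors of unordered trees.\<close>

primrec Dset :: "nat => ptree => nat => nat dtree set" where
  "Dset n (DNode u ts) = (\<lambda>i. DNode i ` Lset n (map (Dset n) ts) i)"

lemma label_Dset: "d \<in> Dset n t i ==> label d = i"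
  by (cases t) auto

lemma finite_Lset: "(\<And>D j. D \<in> set Ds ==> finite (D j)) ==> finite (Lset n Ds l)"
  by (induction Ds arbitrary: l) auto

lemma finite_Dset: "finite (Dset n t i)"
proof (induction t arbitrary: i)
  case (DNode u ts)
  have "finite (Lset n (map (Dset n) ts) i)"
    using DNode by (intro finite_Lset) auto
  then show ?case by simp
qed

lemma map_in_Lset:
  assumes "sorted_wrt (<) (l # js)" "\<forall>j\<in>set js. j <= n & f j \<in> g j j"
  shows "map f js \<in> Lset n (map g js) l"
  using assms
proof (induction js arbitrary: l)
  case (Cons j js)
  have "map f js \<in> Lset n (map g js) j" using Cons by simp
  moreover have "j \<in> {l<..n}" "f j \<in> g j j" using Cons.prems by auto
  ultimately show ?case by (auto intro!: image_eqI[where x="(j, f j, map f js)"])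
qed simp

lemma sorted_ch: "sorted_wrt (<) (i # ch a n i)"
  by (simp add: ch_def strict_sorted_iff)

lemma dec_in_Dset: "dec a n i \<in> Dset n (shape (dec a n i)) i"
proof (induction "n - i" arbitrary: i rule: less_induct)
  case less
  have "map (dec a n) (ch a n i) \<in> Lset n (map (\<lambda>j. Dset n (shape (dec a n j))) (ch a n i)) i"
    using less by (intro map_in_Lset sorted_ch) auto
  then show ?case
    by (simp add: dec.simps[of a n i] comp_def)
qed

context reinforcement begin

text \<open>The weight of a vertex in accumulator form: siblings are summed over one at a time, and the rate of a child
depends on the older ones only.\<close>

primrec gacc :: "nat => nat => nat list => nat list => real" where
  "gacc n i acc [] = exp (- cumul n i acc)"
| "gacc n i acc (j # js) = rate i acc j * gacc n i (acc @ [j]) js"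

lemma rate_append:
  assumes "\<forall>k\<in>set js. j <= k" "1 <= j"
  shows "rate v (acc @ js) j = rate v acc j"
proof -
  have "map (\<lambda>k. real (j - 1 + 1 - k)) js = map (\<lambda>k. 0) js"
    using assms by (intro map_cong) auto
  then have "(\<Sum>k\<leftarrow>js. real (j - 1 + 1 - k)) = 0" by (simp del: map_eq_conv)
  then show ?thesis unfolding rate_def th_def by simp
qed

lemma gacc_eq:
  assumes "sorted_wrt (<) (v # js)"
  shows "gacc n v acc js = (\<Prod>j\<leftarrow>js. rate v (acc @ js) j) * exp (- cumul n v (acc @ js))"
  using assms
proof (induction js arbitrary: acc)
  case (Cons j js)
  have "rate v acc j = rate v (acc @ j # js) j"
    using Cons.prems by (intro rate_append[symmetric]) (auto simp: less_imp_le)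
  then show ?case using Cons by simp
qed simp

lemma gw_gacc: "sorted_wrt (<) (v # js) ==> gw n v js = gacc n v [] js"
  by (simp add: gw_def gacc_eq)

lemma gacc_nonneg: "gacc n i acc js >= 0"
  by (induction js arbitrary: acc) (auto intro!: mult_nonneg_nonneg rate_nonneg)

primrec Gsum :: "nat => (nat => real) list => nat => nat list => real" where
  "Gsum n [] i acc = exp (- cumul n i acc)"
| "Gsum n (f # fs) i acc =
    (\<Sum>j\<in>{last (i # acc)<..n}. rate i acc j * f j * Gsum n fs i (acc @ [j]))"

text \<open>The sum of the weights of all labellings of a shape, as an iterated sum over the birth times.\<close>

primrec Fsum :: "nat => ptree => nat => real" where
  "Fsum n (DNode u ts) = (\<lambda>i. Gsum n (map (Fsum n) ts) i [])"

lemma Gsum_nonneg: "(\<And>f j. f \<in> set fs ==> 0 <= f j) ==> 0 <= Gsum n fs i acc"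
  by (induction fs arbitrary: acc) (auto intro!: sum_nonneg mult_nonneg_nonneg rate_nonneg)

lemma Fsum_nonneg: "0 <= Fsum n t i"
  by (induction t arbitrary: i) (auto intro!: Gsum_nonneg)

lemma sorted_labels_Lset:
  assumes "ds \<in> Lset n Ds l" "\<And>D d j. D \<in> set Ds ==> d \<in> D j ==> label d = j"
  shows "sorted_wrt (<) (l # map label ds)"
  using assms
proof (induction Ds arbitrary: l ds)
  case (Cons D Ds)
  then obtain j d ds' where d: "j \<in> {l<..n}" "d \<in> D j" "ds' \<in> Lset n Ds j" "ds = d # ds'" by auto
  have "sorted_wrt (<) (j # map label ds')" using Cons.IH[OF d(3)] Cons.prems(2) by auto
  moreover have "label d = j" using Cons.prems(2) d(2) by auto
  ultimately show ?case using d by auto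
qed simp

lemma sum_Lset_le:
  assumes "list_all2 (\<lambda>D f. \<forall>j. finite (D j) & (\<forall>d\<in>D j. label d = j) & (\<Sum>d\<in>D j. wt n d) <= f j) Ds fs"
  shows "(\<Sum>ds\<in>Lset n Ds (last (i # acc)). gacc n i acc (map label ds) * prod_list (map (wt n) ds))
     <= Gsum n fs i acc"
  using assms
proof (induction Ds fs arbitrary: acc rule: list_all2_induct)
  case Nil
  then show ?case by simp
next
  case (Cons D Ds f fs)
  let ?l = "last (i # acc)"
  let ?h = "\<lambda>acc ds. gacc n i acc (map label ds) * prod_list (map (wt n) ds)"
  have h0: "0 <= ?h acc ds" for acc ds
    by (intro mult_nonneg_nonneg gacc_nonneg prod_list_nonneg) (auto simp: wt_nonneg)
  have D: "finite (D j)" "d \<in> D j ==> label d = j" "(\<Sum>d\<in>D j. wt n d) <= f j" for j d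
    using Cons.hyps(1) by auto
  have finL: "finite (Lset n Ds j)" for j
  proof (rule finite_Lset)
    fix D' j assume "D' \<in> set Ds"
    then obtain k where "k < length Ds" "D' = Ds ! k" by (auto simp: in_set_conv_nth)
    then show "finite (D' j)" using list_all2_nthD[OF Cons.hyps(2), of k] by auto
  qed
  let ?S = "SIGMA j:{?l<..n}. D j \<times> Lset n Ds j"
  have finS: "finite ?S" using D finL by (intro finite_SigmaI) auto
  have "(\<Sum>ds\<in>Lset n (D # Ds) ?l. ?h acc ds) <= (\<Sum>x\<in>?S. (?h acc \<circ> (\<lambda>(j, d, ds). d # ds)) x)"
    unfolding Lset.simps using finS h0 by (intro sum_image_le) auto
  also have "... = (\<Sum>j\<in>{?l<..n}. \<Sum>x\<in>D j \<times> Lset n Ds j. (?h acc \<circ> (\<lambda>(j, d, ds). d # ds)) (j, x))"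
    using D finL by (subst sum.Sigma) (auto intro!: sum.cong)
  also have "... = (\<Sum>j\<in>{?l<..n}. rate i acc j * (\<Sum>d\<in>D j. wt n d) * (\<Sum>ds\<in>Lset n Ds j. ?h (acc @ [j]) ds))"
  proof (rule sum.cong)
    fix j
    have "(\<Sum>x\<in>D j \<times> Lset n Ds j. (?h acc \<circ> (\<lambda>(j, d, ds). d # ds)) (j, x))
       = (\<Sum>(d, ds)\<in>D j \<times> Lset n Ds j. (rate i acc j * wt n d) * ?h (acc @ [j]) ds)"
      using D(2) by (intro sum.cong) auto
    also have "... = (\<Sum>d\<in>D j. rate i acc j * wt n d) * (\<Sum>ds\<in>Lset n Ds j. ?h (acc @ [j]) ds)"
      by (simp add: sum_product sum.cartesian_product)
    finally show "(\<Sum>x\<in>D j \<times> Lset n Ds j. (?h acc \<circ> (\<lambda>(j, d, ds). d # ds)) (j, x))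
      = rate i acc j * (\<Sum>d\<in>D j. wt n d) * (\<Sum>ds\<in>Lset n Ds j. ?h (acc @ [j]) ds)"
      by (simp add: sum_distrib_left)
  qed simp
  also have "... <= (\<Sum>j\<in>{?l<..n}. rate i acc j * f j * Gsum n fs i (acc @ [j]))"
  proof (rule sum_mono)
    fix j
    have f0: "0 <= f j" using D(3)[of j] wt_nonneg by (meson order_trans sum_nonneg)
    have "(\<Sum>ds\<in>Lset n Ds j. ?h (acc @ [j]) ds) <= Gsum n fs i (acc @ [j])"
      using Cons.IH[of "acc @ [j]"] by simp
    then show "rate i acc j * (\<Sum>d\<in>D j. wt n d) * (\<Sum>ds\<in>Lset n Ds j. ?h (acc @ [j]) ds)
        <= rate i acc j * f j * Gsum n fs i (acc @ [j])"
      by (intro mult_mono mult_left_mono D(3) rate_nonneg mult_nonneg_nonneg sum_nonneg h0 f0)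
  qed
  finally show ?case by simp
qed

lemma sum_Dset_le: "(\<Sum>d\<in>Dset n t i. wt n d) <= Fsum n t i"
proof (induction t arbitrary: i)
  case (DNode u ts)
  let ?Ds = "map (Dset n) ts"
  have lab: "D \<in> set ?Ds ==> d \<in> D j ==> label d = j" for D d j using label_Dset by auto
  have "(\<Sum>d\<in>Dset n (DNode u ts) i. wt n d) = (\<Sum>ds\<in>Lset n ?Ds i. wt n (DNode i ds))"
    by (simp add: sum.reindex inj_on_def)
  also have "... = (\<Sum>ds\<in>Lset n ?Ds (last (i # [])). gacc n i [] (map label ds) * prod_list (map (wt n) ds))"
  proof (rule sum.cong)
    fix ds assume "ds \<in> Lset n ?Ds (last (i # []))"
    then have "sorted_wrt (<) (i # map label ds)"
      using sorted_labels_Lset[of ds n ?Ds i] lab by simp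
    then show "wt n (DNode i ds) = gacc n i [] (map label ds) * prod_list (map (wt n) ds)"
      by (simp add: gw_gacc del: sorted_wrt.simps)
  qed simp
  also have "... <= Gsum n (map (Fsum n) ts) i []"
    using DNode by (intro sum_Lset_le) (auto simp: list_all2_conv_all_nth finite_Dset label_Dset)
  finally show ?case by simp
qed

text \<open>Summing \<open>pair_prob_le\<close> over the labellings of both subtrees factorises the bound.\<close>

lemma pair_shape_prob_le:
  assumes lo: "1 <= lo" and i: "i \<in> {lo..n}" "j \<in> {lo..n}"
  shows "measure_pmf.prob (hist n) {a. shape (dec a n i) = t & shape (dec a n j) = t & desc a n i \<inter> desc a n j = {}}
    <= corr (2 * nodes t) lo * (Fsum n t i * Fsum n t j)"
proof -
  let ?E = "\<lambda>a. shape (dec a n i) = t & shape (dec a n j) = t & desc a n i \<inter> desc a n j = {}"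
  let ?J = "(\<lambda>a. (dec a n i, dec a n j)) ` {a. history n a & ?E a}"
  have c0: "corr (2 * nodes t) lo >= 0" unfolding corr_def by simp
  have J: "?J \<subseteq> Dset n t i \<times> Dset n t j"
  proof
    fix x assume "x \<in> ?J"
    then obtain a where "?E a" "x = (dec a n i, dec a n j)" by blast
    then show "x \<in> Dset n t i \<times> Dset n t j"
      using dec_in_Dset[of a n i] dec_in_Dset[of a n j] by simp
  qed
  have fin: "finite (Dset n t i \<times> Dset n t j)" using finite_Dset by blast
  have finJ: "finite ?J" using finite_subset[OF J fin] .
  let ?B = "\<lambda>x. {a. (dec a n i, dec a n j) = x}"
  have "measure_pmf.prob (hist n) {a. ?E a} <= measure_pmf.prob (hist n) (\<Union>x\<in>?J. ?B x)"
  proof (rule measure_pmf.finite_measure_mono_AE)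
    show "AE a in measure_pmf (hist n). a \<in> {a. ?E a} --> a \<in> (\<Union>x\<in>?J. ?B x)"
      by (rule AE_pmfI) (use history_hist in blast)
  qed auto
  also have "... <= (\<Sum>x\<in>?J. measure_pmf.prob (hist n) (?B x))"
    using finJ by (intro measure_pmf.finite_measure_subadditive_finite) auto
  also have "... <= (\<Sum>x\<in>?J. corr (2 * nodes t) lo * (wt n (fst x) * wt n (snd x)))"
  proof (rule sum_mono)
    fix x assume "x \<in> ?J"
    then obtain a0 where a0: "history n a0" "?E a0" "x = (dec a0 n i, dec a0 n j)" by blast
    have "nodes (dec a0 n i) = nodes t" "nodes (dec a0 n j) = nodes t"
      using a0(2) nodes_map_dtree by metis+
    then have "nodes (dec a0 n i) + nodes (dec a0 n j) <= 2 * nodes t" by simp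
    then show "measure_pmf.prob (hist n) (?B x) <= corr (2 * nodes t) lo * (wt n (fst x) * wt n (snd x))"
      using pair_prob_le[OF a0(1) lo i] a0(2,3) by simp
  qed
  also have "... <= (\<Sum>x\<in>Dset n t i \<times> Dset n t j. corr (2 * nodes t) lo * (wt n (fst x) * wt n (snd x)))"
    using c0 wt_nonneg by (intro sum_mono2 fin J) auto
  also have "... = corr (2 * nodes t) lo * ((\<Sum>d\<in>Dset n t i. wt n d) * (\<Sum>d\<in>Dset n t j. wt n d))"
  proof -
    have "(\<Sum>x\<in>Dset n t i \<times> Dset n t j. wt n (fst x) * wt n (snd x))
        = (\<Sum>d\<in>Dset n t i. wt n d) * (\<Sum>d\<in>Dset n t j. wt n d)"
      unfolding sum_product sum.cartesian_product by (intro sum.cong) auto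
    then show ?thesis by (simp only: sum_distrib_left[symmetric])
  qed
  also have "... <= corr (2 * nodes t) lo * (Fsum n t i * Fsum n t j)"
    by (intro mult_left_mono mult_mono sum_Dset_le c0 Fsum_nonneg sum_nonneg wt_nonneg)
  finally show ?thesis .
qed

end

section \<open>Limits of sums as integrals\<close>

lemma riemann_sum_integral:
  fixes u :: "nat => real"
  assumes n: "n >= 1"
  shows "has_bochner_integral lborel (\<lambda>z. indicator {0..<1} z * (real n * u (nat \<lfloor>real n * z\<rfloor>))) (\<Sum>m<n. u m)"
proof -
  let ?I = "\<lambda>m. {real m / real n..<real (Suc m) / real n}"
  have n0: "real n > 0" using n by simp
  have eq: "indicator {0..<1} z * (real n * u (nat \<lfloor>real n * z\<rfloor>)) = (\<Sum>m<n. real n * u m * indicator (?I m) z)" for z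
  proof -
    have ind: "indicator (?I m) z = (if 0 <= z & m = nat \<lfloor>real n * z\<rfloor> then 1 else 0::real)" for m
    proof -
      have "z \<in> ?I m \<longleftrightarrow> real m <= real n * z & real n * z < real m + 1"
        using n0 by (simp add: field_simps)
      also have "... \<longleftrightarrow> \<lfloor>real n * z\<rfloor> = int m" by (auto simp: floor_eq_iff)
      also have "... \<longleftrightarrow> 0 <= z & m = nat \<lfloor>real n * z\<rfloor>"
      proof (cases "0 <= z")
        case True
        then have "0 <= \<lfloor>real n * z\<rfloor>" by simp
        then show ?thesis using True by auto
      next
        case False
        then have "real n * z < 0" using n0 by (simp add: mult_pos_neg)
        then have "\<lfloor>real n * z\<rfloor> < 0" by simp
        then have "\<lfloor>real n * z\<rfloor> ~= int m" by linarith
        then show ?thesis using False by blast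
      qed
      finally show ?thesis by (simp add: indicator_def)
    qed
    have "(\<Sum>m<n. real n * u m * indicator (?I m) z)
        = (\<Sum>m<n. if m = nat \<lfloor>real n * z\<rfloor> then (if 0 <= z then real n * u m else 0) else 0)"
      unfolding ind by (intro sum.cong) auto
    also have "... = (if nat \<lfloor>real n * z\<rfloor> < n & 0 <= z then real n * u (nat \<lfloor>real n * z\<rfloor>) else 0)" by simp
    also have "(nat \<lfloor>real n * z\<rfloor> < n & 0 <= z) \<longleftrightarrow> 0 <= z & z < 1"
    proof (cases "0 <= z")
      case True
      have "nat \<lfloor>real n * z\<rfloor> < n \<longleftrightarrow> \<lfloor>real n * z\<rfloor> < int n"
        using True n by (simp add: nat_less_iff)
      also have "... \<longleftrightarrow> real n * z < real n" by (simp add: floor_less_iff)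
      also have "... \<longleftrightarrow> z < 1" using n0 by simp
      finally show ?thesis using True by simp
    qed simp
    finally show ?thesis by (simp add: indicator_def)
  qed
  have "has_bochner_integral lborel (\<lambda>z. \<Sum>m<n. real n * u m * indicator (?I m) z) (\<Sum>m<n. real n * u m * (1 / real n))"
  proof (intro has_bochner_integral_sum has_bochner_integral_mult_right)
    fix m
    have le: "real m / real n <= real (Suc m) / real n" by (intro divide_right_mono) auto
    have m: "measure lborel (?I m) = 1 / real n"
      using n0 le by (simp add: measure_def emeasure_lborel_Ico flip: diff_divide_distrib)
    have "has_bochner_integral lborel (indicator (?I m) :: real => real) (measure lborel (?I m))"
      using le by (intro has_bochner_integral_real_indicator) (auto simp: emeasure_lborel_Ico)
    then show "has_bochner_integral lborel (indicator (?I m) :: real => real) (1 / real n)" using m by simp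
  qed
  then show ?thesis using n0 unfolding eq by simp
qed

lemma floor_ratio_tendsto:
  assumes "0 < z"
  shows "(\<lambda>n. real (nat \<lfloor>real n * z\<rfloor>) / real n) \<longlonglongrightarrow> z"
proof (rule tendsto_sandwich)
  show "\<forall>\<^sub>F n in sequentially. z - 1 / real n <= real (nat \<lfloor>real n * z\<rfloor>) / real n"
    using eventually_gt_at_top[of 0]
  proof eventually_elim
    case (elim n)
    have "real n * z - 1 <= real (nat \<lfloor>real n * z\<rfloor>)" by linarith
    then have "(real n * z - 1) / real n <= real (nat \<lfloor>real n * z\<rfloor>) / real n" by (intro divide_right_mono) auto
    then show ?case using elim by (simp add: diff_divide_distrib)
  qed
  show "\<forall>\<^sub>F n in sequentially. real (nat \<lfloor>real n * z\<rfloor>) / real n <= z"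
    using eventually_gt_at_top[of 0]
  proof eventually_elim
    case (elim n)
    have "0 <= real n * z" using assms by simp
    then have "real (nat \<lfloor>real n * z\<rfloor>) <= real n * z" by linarith
    then have "real (nat \<lfloor>real n * z\<rfloor>) / real n <= real n * z / real n" by (intro divide_right_mono) auto
    then show ?case using elim by simp
  qed
  show "(\<lambda>n. z - 1 / real n) \<longlonglongrightarrow> z"
    using tendsto_diff[OF tendsto_const[of z] lim_1_over_n] by simp
qed simp

lemma Suc_ratio_tendsto:
  assumes "(\<lambda>n. real (m n) / real n) \<longlonglongrightarrow> z"
  shows "(\<lambda>n. real (Suc (m n)) / real n) \<longlonglongrightarrow> z"
proof -
  have "(\<lambda>n. real (m n) / real n + 1 / real n) \<longlonglongrightarrow> z + 0"
    by (intro tendsto_add assms lim_1_over_n)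
  then show ?thesis by (simp add: add_divide_distrib add.commute)
qed

text \<open>Dominated convergence for the step functions. Convergence is required along all sequences with
\<open>m n / n\<close> tending to \<open>z\<close>, a form that is stable under nesting of such sums; at countably many \<open>z\<close>,
such as the end points of the inner intervals, it may fail.\<close>

lemma riemann_limit:
  fixes u :: "nat => nat => real" and U :: "real => real"
  assumes bound: "\<forall>\<^sub>F n in sequentially. \<forall>m<n. \<bar>u n m\<bar> <= C / real n"
    and N: "countable N"
    and conv: "\<And>z m. 0 < z ==> z < 1 ==> z \<notin> N ==> (\<lambda>n. real (m n) / real n) \<longlonglongrightarrow> z ==>
        (\<lambda>n. real n * u n (m n)) \<longlonglongrightarrow> U z"
  shows "(\<lambda>n. \<Sum>m<n. u n m) \<longlonglongrightarrow> (\<integral>z. indicator {0<..<1} z * U z \<partial>lborel)"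
    and "integrable lborel (\<lambda>z. indicator {0<..<1} z * U z)"
proof -
  define s where "s n z = indicator {0..<1} z * (real n * u n (nat \<lfloor>real n * z\<rfloor>))" for n and z :: real
  have s_meas [measurable]: "s n \<in> borel_measurable lborel" for n
    unfolding s_def by measurable
  have s_int: "(\<integral>z. s n z \<partial>lborel) = (\<Sum>m<n. u n m)" if "n >= 1" for n
    using has_bochner_integral_integral_eq[OF riemann_sum_integral[OF that, of "u n"]] unfolding s_def .
  let ?g = "\<lambda>z. indicator {0<..<1} z * U z"
  have s_conv: "(\<lambda>n. s n z) \<longlonglongrightarrow> ?g z" if z: "z \<notin> insert 0 N" for z
  proof (cases "0 < z & z < 1")
    case True
    then show ?thesis
      using conv[OF _ _ _ floor_ratio_tendsto, of z] z unfolding s_def by simp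
  next
    case False
    then have "z < 0 \<or> 1 <= z" using z by auto
    then show ?thesis unfolding s_def by (auto simp: indicator_def)
  qed
  have N': "countable (insert 0 N)" using N by simp
  have AEN: "AE z in lborel. z \<notin> insert 0 N"
    by (intro AE_not_in countable_imp_null_set_lborel N')
  have g_meas: "?g \<in> borel_measurable lborel"
  proof (rule measurable_discrete_difference[where X = "insert 0 N" and f = "\<lambda>z. lim (\<lambda>n. s n z)"])
    show "(\<lambda>z. lim (\<lambda>n. s n z)) \<in> borel_measurable lborel" by measurable
    show "lim (\<lambda>n. s n z) = ?g z" if "z \<notin> insert 0 N" for z
      using s_conv[OF that] by (rule limI)
  qed (use N' in auto)
  obtain n0 where n0: "\<And>n m. n >= n0 ==> m < n ==> \<bar>u n m\<bar> <= C / real n"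
    using bound unfolding eventually_sequentially by blast
  define n1 where "n1 = max 1 n0"
  let ?w = "\<lambda>z::real. indicator {0..<1} z * \<bar>C\<bar>"
  have s_bound: "norm (s (n + n1) z) <= ?w z" for n z
  proof (cases "0 <= z & z < 1")
    case True
    let ?n = "n + n1"
    have pos: "real ?n > 0" unfolding n1_def by simp
    have "real ?n * z < real ?n * 1" using True pos by (intro mult_strict_left_mono) auto
    then have "\<lfloor>real ?n * z\<rfloor> < int ?n" by (simp add: floor_less_iff)
    moreover have "0 <= \<lfloor>real ?n * z\<rfloor>" using True by simp
    ultimately have "nat \<lfloor>real ?n * z\<rfloor> < ?n" by linarith
    then have "\<bar>u ?n (nat \<lfloor>real ?n * z\<rfloor>)\<bar> <= C / real ?n" by (intro n0) (auto simp: n1_def)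
    then have "real ?n * \<bar>u ?n (nat \<lfloor>real ?n * z\<rfloor>)\<bar> <= C"
      using pos by (simp only: pos_le_divide_eq mult.commute)
    then show ?thesis using True unfolding s_def by (simp add: abs_mult)
  next
    case False
    then have "indicator {0..<1} z = (0::real)" by (auto simp: indicator_def)
    then show ?thesis unfolding s_def by simp
  qed
  have w_int: "integrable lborel ?w"
    by (intro integrable_mult_left integrable_real_indicator) (auto simp: emeasure_lborel_Ico)
  have AEconv: "AE z in lborel. (\<lambda>n. s (n + n1) z) \<longlonglongrightarrow> ?g z"
    using AEN
  proof eventually_elim
    case (elim z)
    then show ?case using LIMSEQ_ignore_initial_segment[OF s_conv[of z], of n1] by simp
  qed
  have AEb: "AE z in lborel. norm (s (n + n1) z) <= ?w z" for n
    using s_bound by simp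
  show "integrable lborel ?g"
    by (rule integrable_dominated_convergence[OF g_meas _ w_int AEconv AEb]) measurable
  have "(\<lambda>n. \<integral>z. s (n + n1) z \<partial>lborel) \<longlonglongrightarrow> (\<integral>z. ?g z \<partial>lborel)"
    by (rule integral_dominated_convergence[OF g_meas _ w_int AEconv AEb]) measurable
  then have "(\<lambda>n. \<Sum>m<n + n1. u (n + n1) m) \<longlonglongrightarrow> (\<integral>z. ?g z \<partial>lborel)"
    by (subst (asm) s_int) (auto simp: n1_def)
  then show "(\<lambda>n. \<Sum>m<n. u n m) \<longlonglongrightarrow> (\<integral>z. ?g z \<partial>lborel)"
    by (rule LIMSEQ_offset)
qed

lemma riemann_limit_conj:
  fixes u :: "nat => nat => real" and U :: "real => real"
  assumes "\<forall>\<^sub>F n in sequentially. \<forall>m<n. \<bar>u n m\<bar> <= C / real n" "countable N"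
    "\<And>z m. 0 < z ==> z < 1 ==> z \<notin> N ==> (\<lambda>n. real (m n) / real n) \<longlonglongrightarrow> z ==>
        (\<lambda>n. real n * u n (m n)) \<longlonglongrightarrow> U z"
  shows "(\<lambda>n. \<Sum>m<n. u n m) \<longlonglongrightarrow> (\<integral>z. indicator {0<..<1} z * U z \<partial>lborel) &
    integrable lborel (\<lambda>z. indicator {0<..<1} z * U z)"
proof (rule conjI)
  show "(\<lambda>n. \<Sum>m<n. u n m) \<longlonglongrightarrow> (\<integral>z. indicator {0<..<1} z * U z \<partial>lborel)"
    by (rule riemann_limit(1)[where C = C and N = N]) (fact assms)+
  show "integrable lborel (\<lambda>z. indicator {0<..<1} z * U z)"
    by (rule riemann_limit(2)[where C = C and N = N]) (fact assms)+
qed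

text \<open>Up to a constant, the accumulated rate at which a half-edge present since the rescaled time \<open>y\<close> attracts vertices
until time 1.\<close>

definition Psi :: "real => real" where
  "Psi y = y - 1 - ln y"

lemma integral_Psi:
  assumes y: "0 < y" "y < 1"
  shows "(\<integral>z. indicator {0<..<1} z * (max 0 (z - y) / z\<^sup>2) \<partial>lborel) = Psi y"
proof -
  have "has_bochner_integral lborel (\<lambda>z. indicator {y..1} z *\<^sub>R ((z - y) / z\<^sup>2)) ((ln 1 + y / 1) - (ln y + y / y))"
  proof (rule has_bochner_integral_FTC_Icc)
    fix z assume z: "y <= z" "z <= 1"
    then have "z > 0" using y by simp
    then have "((\<lambda>z. ln z + y / z) has_real_derivative (z - y) / z\<^sup>2) (at z within {y..1})"
      by (auto intro!: derivative_eq_intros simp: field_simps power2_eq_square)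
    then show "((\<lambda>z. ln z + y / z) has_vector_derivative (z - y) / z\<^sup>2) (at z within {y..1})"
      by (simp add: has_real_derivative_iff_has_vector_derivative)
  next
    show "continuous_on {y..1} (\<lambda>z. (z - y) / z\<^sup>2)"
      using y by (intro continuous_intros) auto
  qed (use y in auto)
  then have "(\<integral>z. indicator {y..1} z *\<^sub>R ((z - y) / z\<^sup>2) \<partial>lborel) = Psi y"
    using y by (simp add: has_bochner_integral_integral_eq Psi_def)
  moreover have "(\<integral>z. indicator {0<..<1} z * (max 0 (z - y) / z\<^sup>2) \<partial>lborel)
      = (\<integral>z. indicator {y..1} z *\<^sub>R ((z - y) / z\<^sup>2) \<partial>lborel)"
  proof (rule integral_cong_AE)
    have "AE z in lborel. z ~= (1::real)" by (rule AE_lborel_singleton)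
    then show "AE z in lborel. indicator {0<..<1} z * (max 0 (z - y) / z\<^sup>2) = indicator {y..1} z *\<^sub>R ((z - y) / z\<^sup>2)"
      by eventually_elim (use y in \<open>auto simp: indicator_def max_def\<close>)
  qed (use y in measurable)
  ultimately show ?thesis by simp
qed

lemma real_Suc_diff: "real (m + 1 - j) = max 0 (real m + 1 - real j)"
  by (simp add: max_def of_nat_diff)

lemma excess_tendsto:
  assumes "(\<lambda>n. real (m n) / real n) \<longlonglongrightarrow> z" "(\<lambda>n. real (j n) / real n) \<longlonglongrightarrow> y"
  shows "(\<lambda>n. real (m n + 1 - j n) / real n) \<longlonglongrightarrow> max 0 (z - y)"
proof -
  have "(\<lambda>n. max 0 (real (Suc (m n)) / real n - real (j n) / real n)) \<longlonglongrightarrow> max 0 (z - y)"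
    by (intro tendsto_max tendsto_const tendsto_diff Suc_ratio_tendsto assms)
  moreover have "max 0 (real (Suc (m n)) / real n - real (j n) / real n) = real (m n + 1 - j n) / real n" for n
    unfolding real_Suc_diff by (simp add: max_divide_distrib_right diff_divide_distrib add_divide_distrib add.commute)
  ultimately show ?thesis by simp
qed

subsection \<open>Rescaled weights\<close>

context reinforcement begin

definition total_lim :: "real => real" where
  "total_lim z = (1 + \<delta> / 2) * z\<^sup>2"

lemma half_delta: "1 + \<delta> / 2 > 0"
  using delta by simp

lemma total_weight_tendsto:
  assumes "(\<lambda>n. real (m n) / real n) \<longlonglongrightarrow> z"
  shows "(\<lambda>n. total_weight \<delta> (m n) / (real n)\<^sup>2) \<longlonglongrightarrow> total_lim z"
proof -
  let ?x = "\<lambda>n. real (m n) / real n" and ?e = "\<lambda>n. 1 / real n"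
  have "(\<lambda>n. ?x n * (?x n + ?e n) + \<delta> * (?x n + ?e n) * (?x n + 2 * ?e n) / 2 + ?e n * ?e n)
      \<longlonglongrightarrow> z * (z + 0) + \<delta> * (z + 0) * (z + 2 * 0) / 2 + 0 * 0"
    by (intro tendsto_intros assms lim_1_over_n) auto
  also have "z * (z + 0) + \<delta> * (z + 0) * (z + 2 * 0) / 2 + 0 * 0 = total_lim z"
    by (simp add: total_lim_def power2_eq_square field_simps)
  finally have L: "(\<lambda>n. ?x n * (?x n + ?e n) + \<delta> * (?x n + ?e n) * (?x n + 2 * ?e n) / 2 + ?e n * ?e n)
      \<longlonglongrightarrow> total_lim z" .
  show ?thesis
  proof (rule Lim_transform_eventually[OF L])
    show "\<forall>\<^sub>F n in sequentially. ?x n * (?x n + ?e n) + \<delta> * (?x n + ?e n) * (?x n + 2 * ?e n) / 2 + ?e n * ?e n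
        = total_weight \<delta> (m n) / (real n)\<^sup>2"
      using eventually_gt_at_top[of 0]
    proof eventually_elim
      case (elim n)
      have "x / e * (x / e + 1 / e) + \<delta> * (x / e + 1 / e) * (x / e + 2 * (1 / e)) / 2 + 1 / e * (1 / e)
        = (x * (x + 1) + \<delta> * (x + 1) * (x + 2) / 2 + 1) / e\<^sup>2" if "e > 0" for x e :: real
        using that by (simp add: field_simps power2_eq_square)
      then show ?case using elim unfolding total_weight_def by simp
    qed
  qed
qed

lemma ratio_tendsto:
  assumes "(\<lambda>n. X n / real n) \<longlonglongrightarrow> x" "(\<lambda>n. real (m n) / real n) \<longlonglongrightarrow> z" "z > 0"
  shows "(\<lambda>n. real n * (X n / total_weight \<delta> (m n))) \<longlonglongrightarrow> x / total_lim z"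
proof -
  have "total_lim z ~= 0" using assms(3) half_delta by (simp add: total_lim_def)
  then have L: "(\<lambda>n. (X n / real n) / (total_weight \<delta> (m n) / (real n)\<^sup>2)) \<longlonglongrightarrow> x / total_lim z"
    by (intro tendsto_divide assms total_weight_tendsto)
  show ?thesis
  proof (rule Lim_transform_eventually[OF L])
    show "\<forall>\<^sub>F n in sequentially. (X n / real n) / (total_weight \<delta> (m n) / (real n)\<^sup>2) = real n * (X n / total_weight \<delta> (m n))"
      using eventually_gt_at_top[of 0]
      by eventually_elim (simp add: power2_eq_square)
  qed
qed

definition th_lim :: "real => real list => real => real" where
  "th_lim y ys z = (1 + \<delta>) * max 0 (z - y) + (\<Sum>x\<leftarrow>ys. max 0 (z - x))"

definition rate_lim :: "real => real list => real => real" where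
  "rate_lim y ys z = th_lim y ys z / total_lim z"

definition H_lim :: "real => real list => real" where
  "H_lim y ys = ((1 + \<delta>) * Psi y + (\<Sum>x\<leftarrow>ys. Psi x)) / (1 + \<delta> / 2)"

text \<open>Labels are allowed to vary with \<open>n\<close>, and only their rescaled limits matter.\<close>

abbreviation ratio_to :: "(nat => nat) => real => bool" where
  "ratio_to q y \<equiv> (\<lambda>n. real (q n) / real n) \<longlonglongrightarrow> y"

lemma th_tendsto:
  assumes "ratio_to m z" "ratio_to i y" "list_all2 ratio_to qs ys"
  shows "(\<lambda>n. th \<delta> (i n) (map (\<lambda>q. q n) qs) (m n) / real n) \<longlonglongrightarrow> th_lim y ys z"
proof -
  have "(\<lambda>n. (\<Sum>q\<leftarrow>qs. real (m n + 1 - q n)) / real n) \<longlonglongrightarrow> (\<Sum>x\<leftarrow>ys. max 0 (z - x))"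
    using assms(3)
  proof (induction rule: list_all2_induct)
    case (Cons q qs y ys)
    then show ?case
      using tendsto_add[OF excess_tendsto[OF assms(1) Cons.hyps(1)] Cons.IH] by (simp add: add_divide_distrib)
  qed simp
  from tendsto_add[OF tendsto_mult_left[OF excess_tendsto[OF assms(1,2)], of "1 + \<delta>"] this]
  show ?thesis by (simp add: th_def th_lim_def comp_def add_divide_distrib)
qed

lemma rate_tendsto:
  assumes "ratio_to m z" "ratio_to i y" "list_all2 ratio_to qs ys" "z > 0"
  shows "(\<lambda>n. real n * rate (i n) (map (\<lambda>q. q n) qs) (Suc (m n))) \<longlonglongrightarrow> rate_lim y ys z"
  using ratio_tendsto[OF th_tendsto[OF assms(1-3)] assms(1,4)] by (simp add: rate_def rate_lim_def)

lemma ratio_eventually_gt: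
  assumes "ratio_to j y" "c < y"
  shows "\<forall>\<^sub>F n in sequentially. c * real n < real (j n)"
  using order_tendstoD(1)[OF assms] eventually_gt_at_top[of 0]
  by eventually_elim (simp add: field_simps)

lemma ratio_eventually_lt:
  assumes "ratio_to j y" "y < c"
  shows "\<forall>\<^sub>F n in sequentially. real (j n) < c * real n"
  using order_tendstoD(2)[OF assms] eventually_gt_at_top[of 0]
  by eventually_elim (simp add: field_simps)

text \<open>The nonzero summands have \<open>m >= j n\<close>, which is of order \<open>n\<close>, so they are of order \<open>1 / n\<close>.\<close>

lemma excess_sum_tendsto:
  assumes j: "ratio_to j y" and y: "0 < y" "y < 1"
  shows "(\<lambda>n. \<Sum>m<n. real (m + 1 - j n) / total_weight \<delta> m) \<longlonglongrightarrow> Psi y / (1 + \<delta> / 2)"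
proof -
  define c where "c = 2 / ((1 + \<delta>) * (y / 2))"
  have d: "1 + \<delta> > 0" using delta by simp
  have "y / 2 < y" using y by simp
  have "(\<lambda>n. \<Sum>m<n. real (m + 1 - j n) / total_weight \<delta> m)
      \<longlonglongrightarrow> (\<integral>z. indicator {0<..<1} z * (max 0 (z - y) / total_lim z) \<partial>lborel)"
  proof (rule riemann_limit(1)[where C = c and N = "{}"])
    show "\<forall>\<^sub>F n in sequentially. \<forall>m<n. \<bar>real (m + 1 - j n) / total_weight \<delta> m\<bar> <= c / real n"
      using ratio_eventually_gt[OF j \<open>y / 2 < y\<close>] eventually_gt_at_top[of 0]
    proof eventually_elim
      case (elim n)
      show ?case
      proof (intro allI impI)
        fix m
        show "\<bar>real (m + 1 - j n) / total_weight \<delta> m\<bar> <= c / real n"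
        proof (cases "j n <= m + 1")
          case False
          then show ?thesis using d y by (simp add: c_def)
        next
          case True
          then have jm: "y / 2 * real n <= real m + 1" using elim y by linarith
          have "\<bar>real (m + 1 - j n) / total_weight \<delta> m\<bar> = real (m + 1 - j n) / total_weight \<delta> m"
            using total_weight_pos[of m] by simp
          also have "... <= (real m + 1) / ((1 + \<delta>) / 2 * (real m + 1)\<^sup>2)"
            using d by (intro frac_le total_weight_ge) auto
          also have "... = 2 / ((1 + \<delta>) * (real m + 1))"
          proof -
            have "x / (e / 2 * x\<^sup>2) = 2 / (e * x)" if "x > 0" "e > 0" for x e :: real
              using that by (simp add: divide_simps power2_eq_square)
            from this[of "real m + 1" "1 + \<delta>"] show ?thesis using d by simp
          qed
          also have "... <= 2 / ((1 + \<delta>) * (y / 2 * real n))"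
            using d y elim jm by (intro frac_le mult_left_mono mult_pos_pos) auto
          also have "... = c / real n" unfolding c_def by simp
          finally show ?thesis .
        qed
      qed
    qed
    show "(\<lambda>n. real n * (real (m n + 1 - j n) / total_weight \<delta> (m n))) \<longlonglongrightarrow> max 0 (z - y) / total_lim z"
      if "0 < z" "ratio_to m z" for z m
      by (rule ratio_tendsto[OF excess_tendsto[OF that(2) j] that(2,1)])
  qed simp
  also have "(\<integral>z. indicator {0<..<1} z * (max 0 (z - y) / total_lim z) \<partial>lborel)
      = (\<integral>z. (indicator {0<..<1} z * (max 0 (z - y) / z\<^sup>2)) / (1 + \<delta> / 2) \<partial>lborel)"
    unfolding total_lim_def by (intro Bochner_Integration.integral_cong) auto
  also have "... = Psi y / (1 + \<delta> / 2)"
    by (simp only: Bochner_Integration.integral_divide_zero integral_Psi[OF y])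
  finally show ?thesis .
qed

lemma cumul_tendsto:
  assumes "ratio_to i y" "0 < y" "y < 1" "list_all2 ratio_to qs ys" "\<forall>x\<in>set ys. 0 < x & x < 1"
  shows "(\<lambda>n. cumul n (i n) (map (\<lambda>q. q n) qs)) \<longlonglongrightarrow> H_lim y ys"
proof -
  have S: "(\<lambda>n. \<Sum>q\<leftarrow>qs. \<Sum>m<n. real (m + 1 - q n) / total_weight \<delta> m) \<longlonglongrightarrow> (\<Sum>x\<leftarrow>ys. Psi x / (1 + \<delta> / 2))"
    using assms(4,5)
  proof (induction rule: list_all2_induct)
    case (Cons q qs x ys)
    then show ?case
      using tendsto_add[OF excess_sum_tendsto[of q x]] by simp
  qed simp
  have eq: "cumul n (i n) (map (\<lambda>q. q n) qs) = (1 + \<delta>) * (\<Sum>m<n. real (m + 1 - i n) / total_weight \<delta> m)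
      + (\<Sum>q\<leftarrow>qs. \<Sum>m<n. real (m + 1 - q n) / total_weight \<delta> m)" for n
  proof -
    have "(\<Sum>m<n. (\<Sum>q\<leftarrow>qs. real (m + 1 - q n)) / total_weight \<delta> m)
        = (\<Sum>q\<leftarrow>qs. \<Sum>m<n. real (m + 1 - q n) / total_weight \<delta> m)"
      by (induction qs) (simp_all add: add_divide_distrib sum.distrib)
    then show ?thesis
      unfolding cumul_def th_def by (simp add: add_divide_distrib sum.distrib sum_distrib_left comp_def)
  qed
  have "(\<Sum>x\<leftarrow>ys. Psi x / (1 + \<delta> / 2)) = (\<Sum>x\<leftarrow>ys. Psi x) / (1 + \<delta> / 2)"
    by (induction ys) (simp_all add: add_divide_distrib)
  then have "H_lim y ys = (1 + \<delta>) * (Psi y / (1 + \<delta> / 2)) + (\<Sum>x\<leftarrow>ys. Psi x / (1 + \<delta> / 2))"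
    by (simp add: H_lim_def add_divide_distrib)
  then show ?thesis
    unfolding eq using tendsto_add[OF tendsto_mult_left[OF excess_sum_tendsto[OF assms(1-3)], of "1 + \<delta>"] S] by simp
qed

text \<open>The limit of \<open>Gsum\<close>: the next sibling is born at the rescaled time \<open>z\<close> after the last one.\<close>

primrec Glim :: "(real => real) list => real => real list => real" where
  "Glim [] y ys = exp (- H_lim y ys)"
| "Glim (g # gs) y ys =
    (\<integral>z. indicator {last (y # ys)<..<1} z * (rate_lim y ys z * g z * Glim gs y (ys @ [z])) \<partial>lborel)"

primrec Flim :: "ptree => real => real" where
  "Flim (DNode u ts) = (\<lambda>y. Glim (map Flim ts) y [])"

text \<open>Pointwise convergence along rescaled labels, together with a bound away from the origin: this is
what dominated convergence needs, and it is inherited by the iterated sums.\<close>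

definition fconv :: "(nat => nat => real) => (real => real) => bool" where
  "fconv f g \<longleftrightarrow> (\<forall>j y. 0 < y & y < 1 & ratio_to j y --> (\<lambda>n. f n (j n)) \<longlonglongrightarrow> g y) &
     (\<forall>\<epsilon>>0. \<exists>C. \<forall>n j. \<epsilon> * real n <= real j & j <= n & 1 <= n --> \<bar>f n j\<bar> <= C)"

lemma rate_le:
  assumes "\<epsilon> > 0" "\<epsilon> * real n <= real j" "1 <= n" "length acc <= L"
  shows "rate i acc j <= 2 * (1 + \<delta> + real L) / ((1 + \<delta>) * \<epsilon>) / real n"
proof -
  have d: "1 + \<delta> > 0" using delta by simp
  have "0 < \<epsilon> * real n" using assms by simp
  then have j: "1 <= j" using assms(2) by (cases j) auto
  have "rate i acc j <= 2 * (1 + \<delta> + real (length acc)) / ((1 + \<delta>) * (real (j - 1) + 1))"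
    unfolding rate_def by (rule th_over_total_le)
  also have "... <= 2 * (1 + \<delta> + real L) / ((1 + \<delta>) * (\<epsilon> * real n))"
    using assms d j by (intro frac_le mult_left_mono mult_pos_pos) (auto simp: of_nat_diff)
  finally show ?thesis by (simp add: mult.assoc)
qed

lemma cumul_nonneg: "cumul n i acc >= 0"
  unfolding cumul_def using th_nonneg total_weight_pos by (intro sum_nonneg) (simp add: less_imp_le)

lemma Gsum_bound:
  assumes "list_all2 fconv fs gs" "\<epsilon> > 0"
  shows "\<exists>C. \<forall>n i acc. 1 <= n & \<epsilon> * real n <= real (last (i # acc)) & length acc <= L -->
    \<bar>Gsum n (map (\<lambda>f. f n) fs) i acc\<bar> <= C"
  using assms(1)
proof (induction arbitrary: L rule: list_all2_induct)
  case Nil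
  have "\<bar>exp (- cumul n i acc)\<bar> <= 1" for n i acc using cumul_nonneg by simp
  then show ?case by (intro exI[of _ 1]) simp
next
  case (Cons f fs g gs)
  obtain C where C: "\<And>n i acc. 1 <= n ==> \<epsilon> * real n <= real (last (i # acc)) ==> length acc <= Suc L ==>
    \<bar>Gsum n (map (\<lambda>f. f n) fs) i acc\<bar> <= C"
    using Cons.IH[of "Suc L"] by blast
  obtain D where D: "\<And>n j. \<epsilon> * real n <= real j ==> j <= n ==> 1 <= n ==> \<bar>f n j\<bar> <= D"
    using Cons.hyps(1) assms(2) unfolding fconv_def by meson
  define R where "R = 2 * (1 + \<delta> + real L) / ((1 + \<delta>) * \<epsilon>)"
  have R0: "R >= 0" using delta assms(2) by (simp add: R_def)
  show ?case
  proof (intro exI[of _ "R * \<bar>D\<bar> * \<bar>C\<bar>"] allI impI, elim conjE)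
    fix n i acc assume n: "1 <= n" "\<epsilon> * real n <= real (last (i # acc))" "length acc <= L"
    have "\<bar>Gsum n (map (\<lambda>f. f n) (f # fs)) i acc\<bar>
       <= (\<Sum>j\<in>{last (i # acc)<..n}. \<bar>rate i acc j * f n j * Gsum n (map (\<lambda>f. f n) fs) i (acc @ [j])\<bar>)"
      unfolding list.map Gsum.simps by (rule sum_abs)
    also have "... <= (\<Sum>j\<in>{last (i # acc)<..n}. R / real n * \<bar>D\<bar> * \<bar>C\<bar>)"
    proof (rule sum_mono)
      fix j assume j: "j \<in> {last (i # acc)<..n}"
      then have ej: "\<epsilon> * real n <= real j" using n(2) by auto
      have "\<bar>rate i acc j\<bar> <= R / real n"
        unfolding R_def using rate_le[OF assms(2) ej n(1,3)] rate_nonneg[of i acc j] by simp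
      moreover have "\<bar>f n j\<bar> <= \<bar>D\<bar>" using D[OF ej _ n(1)] j by fastforce
      moreover have "\<bar>Gsum n (map (\<lambda>f. f n) fs) i (acc @ [j])\<bar> <= \<bar>C\<bar>"
        using C[of n i "acc @ [j]"] n ej by fastforce
      ultimately show "\<bar>rate i acc j * f n j * Gsum n (map (\<lambda>f. f n) fs) i (acc @ [j])\<bar> <= R / real n * \<bar>D\<bar> * \<bar>C\<bar>"
        unfolding abs_mult using R0 by (intro mult_mono) auto
    qed
    also have "... = real (n - last (i # acc)) * (R / real n * \<bar>D\<bar> * \<bar>C\<bar>)" by simp
    also have "... <= real n * (R / real n * \<bar>D\<bar> * \<bar>C\<bar>)"
      using R0 by (intro mult_right_mono mult_nonneg_nonneg) auto
    also have "... = R * \<bar>D\<bar> * \<bar>C\<bar>" using n(1) by simp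
    finally show "\<bar>Gsum n (map (\<lambda>f. f n) (f # fs)) i acc\<bar> <= R * \<bar>D\<bar> * \<bar>C\<bar>" .
  qed
qed

text \<open>Each sum over the next sibling is a Riemann sum. Integrability of the limit integrand comes with it.\<close>

lemma Gsum_limit:
  assumes "list_all2 fconv fs gs" "ratio_to i y" "0 < y" "y < 1"
    "list_all2 ratio_to qs ys" "\<forall>x\<in>set ys. 0 < x & x < 1"
  shows "(\<lambda>n. Gsum n (map (\<lambda>f. f n) fs) (i n) (map (\<lambda>q. q n) qs)) \<longlonglongrightarrow> Glim gs y ys &
    (\<forall>g gs'. gs = g # gs' -->
      integrable lborel (\<lambda>z. indicator {last (y # ys)<..<1} z * (rate_lim y ys z * g z * Glim gs' y (ys @ [z]))))"
  using assms(1,5,6)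
proof (induction arbitrary: qs ys rule: list_all2_induct)
  case Nil
  then show ?case
    using cumul_tendsto[OF assms(2-4) Nil] by (auto intro!: tendsto_intros)
next
  case (Cons f fs g gs)
  define l where "l n = last (i n # map (\<lambda>q. q n) qs)" for n
  have last_to: "ratio_to l (last (y # ys))" and yl: "0 < last (y # ys)" "last (y # ys) < 1"
  proof -
    have la: "list_all2 ratio_to (i # qs) (y # ys)" using assms(2) Cons.prems(1) by simp
    have "length qs = length ys" using Cons.prems(1) by (rule list_all2_lengthD)
    then have "last (i # qs) = (i # qs) ! length qs" "last (y # ys) = (y # ys) ! length qs"
      using last_conv_nth[of "i # qs"] last_conv_nth[of "y # ys"] by simp_all
    then have "ratio_to (last (i # qs)) (last (y # ys))"
      using list_all2_nthD[OF la, of "length qs"] by simp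
    moreover have "l = (\<lambda>n. last (i # qs) n)"
      unfolding l_def by (auto simp: last_map)
    ultimately show "ratio_to l (last (y # ys))" by simp
    have "last (y # ys) \<in> set (y # ys)" by (rule last_in_set) simp
    then show "0 < last (y # ys)" "last (y # ys) < 1" using assms(3,4) Cons.prems(2) by auto
  qed
  (* Labels beyond the last sibling eventually exceed ep n, where all bounds are uniform. *)
  define ep where "ep = last (y # ys) / 2"
  have ep: "ep > 0" "ep < last (y # ys)" using yl by (auto simp: ep_def)
  let ?G = "\<lambda>n j. Gsum n (map (\<lambda>f. f n) fs) (i n) (map (\<lambda>q. q n) qs @ [j])"
  let ?r = "\<lambda>n j. rate (i n) (map (\<lambda>q. q n) qs) j"
  define u where "u n m = indicator {l n..} m * (?r n (Suc m) * f n (Suc m) * ?G n (Suc m))" for n m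
  define U where "U z = indicator {last (y # ys)<..} z * (rate_lim y ys z * g z * Glim gs y (ys @ [z]))" for z :: real
  have sum_u: "Gsum n (map (\<lambda>f. f n) (f # fs)) (i n) (map (\<lambda>q. q n) qs) = (\<Sum>m<n. u n m)" for n
  proof -
    have "Gsum n (map (\<lambda>f. f n) (f # fs)) (i n) (map (\<lambda>q. q n) qs) = (\<Sum>j\<in>{l n<..n}. ?r n j * f n j * ?G n j)"
      unfolding l_def by simp
    also have "... = (\<Sum>m\<in>{m \<in> {..<n}. l n <= m}. ?r n (Suc m) * f n (Suc m) * ?G n (Suc m))"
      by (rule sum.reindex_bij_witness[of _ Suc "\<lambda>j. j - 1"]) auto
    also have "... = (\<Sum>m<n. if l n <= m then ?r n (Suc m) * f n (Suc m) * ?G n (Suc m) else 0)"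
      by (rule sum.inter_filter) simp
    also have "... = (\<Sum>m<n. u n m)"
      unfolding u_def by (intro sum.cong) (auto simp: indicator_def)
    finally show ?thesis .
  qed
  obtain C where C: "\<And>n i acc. 1 <= n ==> ep * real n <= real (last (i # acc)) ==> length acc <= Suc (length qs) ==>
    \<bar>Gsum n (map (\<lambda>f. f n) fs) i acc\<bar> <= C"
    using Gsum_bound[OF Cons.hyps(2) ep(1), of "Suc (length qs)"] by blast
  obtain D where D: "\<And>n j. ep * real n <= real j ==> j <= n ==> 1 <= n ==> \<bar>f n j\<bar> <= D"
    using Cons.hyps(1) ep(1) unfolding fconv_def by meson
  define R where "R = 2 * (1 + \<delta> + real (length qs)) / ((1 + \<delta>) * ep)"
  have R0: "R >= 0" using delta ep(1) by (simp add: R_def)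
  have both: "(\<lambda>n. \<Sum>m<n. u n m) \<longlonglongrightarrow> (\<integral>z. indicator {0<..<1} z * U z \<partial>lborel) &
    integrable lborel (\<lambda>z. indicator {0<..<1} z * U z)"
  proof (rule riemann_limit_conj[where C = "R * \<bar>D\<bar> * \<bar>C\<bar>" and N = "{last (y # ys)}"])
    show "\<forall>\<^sub>F n in sequentially. \<forall>m<n. \<bar>u n m\<bar> <= R * \<bar>D\<bar> * \<bar>C\<bar> / real n"
      using ratio_eventually_gt[OF last_to ep(2)] eventually_ge_at_top[of 1]
    proof eventually_elim
      case (elim n)
      show ?case
      proof (intro allI impI)
        fix m assume m: "m < n"
        show "\<bar>u n m\<bar> <= R * \<bar>D\<bar> * \<bar>C\<bar> / real n"
        proof (cases "l n <= m")
          case True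
          then have em: "ep * real n <= real (Suc m)" using elim by simp
          have "\<bar>?r n (Suc m)\<bar> <= R / real n"
            unfolding R_def using rate_le[OF ep(1) em elim(2), of "map (\<lambda>q. q n) qs" "length qs" "i n"] rate_nonneg[of "i n" "map (\<lambda>q. q n) qs" "Suc m"] by simp
          moreover have "\<bar>f n (Suc m)\<bar> <= \<bar>D\<bar>" using D[OF em _ elim(2)] m by fastforce
          moreover have "\<bar>?G n (Suc m)\<bar> <= \<bar>C\<bar>"
            using C[of n "i n" "map (\<lambda>q. q n) qs @ [Suc m]"] em elim(2) by fastforce
          ultimately have "\<bar>?r n (Suc m) * f n (Suc m) * ?G n (Suc m)\<bar> <= R / real n * \<bar>D\<bar> * \<bar>C\<bar>"
            unfolding abs_mult using R0 by (intro mult_mono) auto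
          then show ?thesis using True unfolding u_def by simp
        qed (use R0 in \<open>simp add: u_def\<close>)
      qed
    qed
    fix z m assume z: "0 < z" "z < 1" "z \<notin> {last (y # ys)}" and m: "ratio_to m z"
    have Sm: "ratio_to (\<lambda>n. Suc (m n)) z" by (rule Suc_ratio_tendsto[OF m])
    show "(\<lambda>n. real n * u n (m n)) \<longlonglongrightarrow> U z"
    proof (cases "last (y # ys) < z")
      case True
      have fz: "(\<lambda>n. f n (Suc (m n))) \<longlonglongrightarrow> g z"
        using Cons.hyps(1) z Sm unfolding fconv_def by (elim conjE allE[of _ "\<lambda>n. Suc (m n)"]) auto
      have "(\<lambda>n. Gsum n (map (\<lambda>f. f n) fs) (i n) (map (\<lambda>q. q n) (qs @ [\<lambda>n. Suc (m n)]))) \<longlonglongrightarrow> Glim gs y (ys @ [z])"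
      proof (rule Cons.IH[THEN conjunct1])
        show "list_all2 ratio_to (qs @ [\<lambda>n. Suc (m n)]) (ys @ [z])"
          by (rule list_all2_appendI[OF Cons.prems(1)]) (use Sm in simp)
      qed (use Cons.prems z in auto)
      then have Gz: "(\<lambda>n. ?G n (Suc (m n))) \<longlonglongrightarrow> Glim gs y (ys @ [z])" by simp
      have L: "(\<lambda>n. (real n * ?r n (Suc (m n))) * f n (Suc (m n)) * ?G n (Suc (m n))) \<longlonglongrightarrow> U z"
        using tendsto_mult[OF tendsto_mult[OF rate_tendsto[OF m assms(2) Cons.prems(1) z(1)] fz] Gz] True
        unfolding U_def by simp
      obtain c where c: "last (y # ys) < c" "c < z" using True dense by blast
      show ?thesis
      proof (rule Lim_transform_eventually[OF L])
        show "\<forall>\<^sub>F n in sequentially. (real n * ?r n (Suc (m n))) * f n (Suc (m n)) * ?G n (Suc (m n)) = real n * u n (m n)"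
          using ratio_eventually_lt[OF last_to c(1)] ratio_eventually_gt[OF m c(2)]
          by eventually_elim (simp add: u_def)
      qed
    next
      case False
      then have lt: "z < last (y # ys)" using z by simp
      obtain c where c: "z < c" "c < last (y # ys)" using lt dense by blast
      have "\<forall>\<^sub>F n in sequentially. 0 = real n * u n (m n)"
        using ratio_eventually_gt[OF last_to c(2)] ratio_eventually_lt[OF m c(1)]
        by eventually_elim (simp add: u_def)
      then have "(\<lambda>n. real n * u n (m n)) \<longlonglongrightarrow> 0" by (rule Lim_transform_eventually[OF tendsto_const])
      then show ?thesis using lt by (simp add: U_def)
    qed
  qed simp
  have eqU: "indicator {0<..<1} z * U z
      = indicator {last (y # ys)<..<1} z * (rate_lim y ys z * g z * Glim gs y (ys @ [z]))" for z
    unfolding U_def using yl by (auto simp: indicator_def)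
  show ?case
  proof (intro conjI allI impI)
    show "(\<lambda>n. Gsum n (map (\<lambda>f. f n) (f # fs)) (i n) (map (\<lambda>q. q n) qs)) \<longlonglongrightarrow> Glim (g # gs) y ys"
      using conjunct1[OF both] unfolding sum_u eqU Glim.simps .
    fix g' gs' assume "g # gs = g' # gs'"
    then have "g' = g" "gs' = gs" by auto
    then show "integrable lborel (\<lambda>z. indicator {last (y # ys)<..<1} z * (rate_lim y ys z * g' z * Glim gs' y (ys @ [z])))"
      using conjunct2[OF both] unfolding eqU by simp
  qed
qed

lemma Gsum_tendsto:
  assumes "list_all2 fconv fs gs" "ratio_to i y" "0 < y" "y < 1"
    "list_all2 ratio_to qs ys" "\<forall>x\<in>set ys. 0 < x & x < 1"
  shows "(\<lambda>n. Gsum n (map (\<lambda>f. f n) fs) (i n) (map (\<lambda>q. q n) qs)) \<longlonglongrightarrow> Glim gs y ys"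
  by (rule conjunct1[OF Gsum_limit[OF assms]])

text \<open>Every point of \<open>(0, 1)\<close> is a limit of ratios, so the Riemann sums of \<open>Gsum_limit\<close> are available.\<close>

lemma Glim_integrable:
  assumes fc: "list_all2 fconv fs (g # gs)" and y: "0 < y" "y < 1" and ys: "\<forall>x\<in>set ys. 0 < x & x < 1"
  shows "integrable lborel (\<lambda>z. indicator {last (y # ys)<..<1} z * (rate_lim y ys z * g z * Glim gs y (ys @ [z])))"
proof -
  have "list_all2 ratio_to (map (\<lambda>x n. nat \<lfloor>real n * x\<rfloor>) ys) ys"
    using ys by (auto simp: list_all2_conv_all_nth intro: floor_ratio_tendsto)
  from conjunct2[OF Gsum_limit[OF fc floor_ratio_tendsto[OF y(1)] y this ys]] show ?thesis by simp
qed

lemma Fsum_fconv: "fconv (\<lambda>n. Fsum n t) (Flim t)"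
proof (induction t)
  case (DNode u ts)
  have L: "list_all2 fconv (map (\<lambda>t n. Fsum n t) ts) (map Flim ts)"
    using DNode by (auto simp: list_all2_conv_all_nth)
  have eq: "Fsum n (DNode u ts) i = Gsum n (map (\<lambda>f. f n) (map (\<lambda>t n. Fsum n t) ts)) i []" for n i
    by (simp add: comp_def)
  show ?case
    unfolding fconv_def
  proof (intro conjI allI impI, elim conjE)
    fix j y assume "0 < y" "y < 1" "ratio_to j y"
    then show "(\<lambda>n. Fsum n (DNode u ts) (j n)) \<longlonglongrightarrow> Flim (DNode u ts) y"
      unfolding eq using Gsum_tendsto[OF L, of j y "[]" "[]"] by simp
  next
    fix \<epsilon> :: real assume "\<epsilon> > 0"
    then show "\<exists>C. \<forall>n j. \<epsilon> * real n <= real j & j <= n & 1 <= n --> \<bar>Fsum n (DNode u ts) j\<bar> <= C"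
      unfolding eq using Gsum_bound[OF L, of \<epsilon> 0] by force
  qed
qed

text \<open>The cut-off at \<open>\<epsilon> n\<close> keeps the bounds uniform; it is removed only after the comparison with the
branching process.\<close>

lemma Fsum_average_tendsto:
  assumes e: "\<epsilon> > 0"
  shows "(\<lambda>n. (\<Sum>i | i \<in> {1..n} & \<epsilon> * real n <= real i. Fsum n t i) / real n)
    \<longlonglongrightarrow> (\<integral>z. indicator {0<..<1} z * (indicator {\<epsilon><..} z * Flim t z) \<partial>lborel)" (is ?lim)
    and "integrable lborel (\<lambda>z. indicator {0<..<1} z * (indicator {\<epsilon><..} z * Flim t z))" (is ?int)
proof -
  define u where "u n m = (if \<epsilon> * real n <= real (Suc m) then Fsum n t (Suc m) / real n else 0)" for n m
  obtain C where C: "\<And>n j. \<epsilon> * real n <= real j ==> j <= n ==> 1 <= n ==> \<bar>Fsum n t j\<bar> <= C"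
    using Fsum_fconv[of t] e unfolding fconv_def by meson
  have both: "(\<lambda>n. \<Sum>m<n. u n m) \<longlonglongrightarrow> (\<integral>z. indicator {0<..<1} z * (indicator {\<epsilon><..} z * Flim t z) \<partial>lborel) &
    integrable lborel (\<lambda>z. indicator {0<..<1} z * (indicator {\<epsilon><..} z * Flim t z))"
  proof (rule riemann_limit_conj[where C = "\<bar>C\<bar>" and N = "{\<epsilon>}"])
    show "\<forall>\<^sub>F n in sequentially. \<forall>m<n. \<bar>u n m\<bar> <= \<bar>C\<bar> / real n"
    proof (intro always_eventually allI impI)
      fix n m :: nat assume "m < n"
      then have "\<bar>Fsum n t (Suc m)\<bar> <= \<bar>C\<bar>" if "\<epsilon> * real n <= real (Suc m)"
        using C[OF that] by fastforce
      then show "\<bar>u n m\<bar> <= \<bar>C\<bar> / real n" unfolding u_def by (auto intro!: divide_right_mono)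
    qed
    fix z m assume z: "0 < z" "z < 1" "z \<notin> {\<epsilon>}" and m: "ratio_to m z"
    have Sm: "ratio_to (\<lambda>n. Suc (m n)) z" by (rule Suc_ratio_tendsto[OF m])
    show "(\<lambda>n. real n * u n (m n)) \<longlonglongrightarrow> indicator {\<epsilon><..} z * Flim t z"
    proof (cases "\<epsilon> < z")
      case True
      have "(\<lambda>n. Fsum n t (Suc (m n))) \<longlonglongrightarrow> Flim t z"
        using Fsum_fconv[of t] z Sm unfolding fconv_def by (elim conjE allE[of _ "\<lambda>n. Suc (m n)"]) auto
      then have "(\<lambda>n. Fsum n t (Suc (m n))) \<longlonglongrightarrow> indicator {\<epsilon><..} z * Flim t z" using True by simp
      then show ?thesis
      proof (rule Lim_transform_eventually)
        show "\<forall>\<^sub>F n in sequentially. Fsum n t (Suc (m n)) = real n * u n (m n)"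
          using ratio_eventually_gt[OF Sm True] eventually_gt_at_top[of 0]
          by eventually_elim (simp add: u_def)
      qed
    next
      case False
      then have "z < \<epsilon>" using z by simp
      have "\<forall>\<^sub>F n in sequentially. 0 = real n * u n (m n)"
        using ratio_eventually_lt[OF Sm \<open>z < \<epsilon>\<close>] by eventually_elim (simp add: u_def)
      then have "(\<lambda>n. real n * u n (m n)) \<longlonglongrightarrow> 0" by (rule Lim_transform_eventually[OF tendsto_const])
      then show ?thesis using \<open>z < \<epsilon>\<close> by simp
    qed
  qed simp
  moreover have "(\<Sum>i | i \<in> {1..n} & \<epsilon> * real n <= real i. Fsum n t i) / real n = (\<Sum>m<n. u n m)" for n
  proof -
    have "(\<Sum>i | i \<in> {1..n} & \<epsilon> * real n <= real i. Fsum n t i)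
       = (\<Sum>m\<in>{m \<in> {..<n}. \<epsilon> * real n <= real (Suc m)}. Fsum n t (Suc m))"
      by (rule sum.reindex_bij_witness[of _ Suc "\<lambda>j. j - 1"]) auto
    also have "... / real n = (\<Sum>m\<in>{m \<in> {..<n}. \<epsilon> * real n <= real (Suc m)}. Fsum n t (Suc m) / real n)"
      by (rule sum_divide_distrib)
    also have "... = (\<Sum>m<n. u n m)" unfolding u_def by (rule sum.inter_filter) simp
    finally show ?thesis .
  qed
  ultimately show ?lim ?int using both by simp_all
qed

end

section \<open>Empirical frequencies of subtree shapes\<close>

lemma finite_nodes_le: "finite {t :: ptree. nodes t <= K}"
proof (induction K)
  case 0
  have ne: "nodes t ~= 0" for t :: ptree by (cases t) auto
  have "{t :: ptree. nodes t <= 0} = {}" using ne by (metis (mono_tags, lifting) Collect_empty_eq le_zero_eq)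
  then show ?case by (simp only: finite.emptyI)
next
  case (Suc K)
  have len: "length ts <= sum_list (map nodes ts)" for ts :: "ptree list"
  proof (induction ts)
    case (Cons t ts)
    then show ?case by (cases t) auto
  qed simp
  have mem: "nodes t <= sum_list (map nodes ts)" if "t \<in> set ts" for t and ts :: "ptree list"
    using member_le_sum_list[of "nodes t" "map nodes ts"] that by auto
  have "{t :: ptree. nodes t <= Suc K} \<subseteq> DNode () ` {ts. set ts \<subseteq> {t. nodes t <= K} & length ts <= K}"
  proof
    fix t :: ptree assume t: "t \<in> {t. nodes t <= Suc K}"
    obtain ts where ts: "t = DNode () ts" by (cases t) auto
    then have "sum_list (map nodes ts) <= K" using t by simp
    then have "ts \<in> {ts. set ts \<subseteq> {t. nodes t <= K} & length ts <= K}"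
      using len[of ts] mem[of _ ts] order_trans by blast
    then show "t \<in> DNode () ` {ts. set ts \<subseteq> {t. nodes t <= K} & length ts <= K}" using ts by blast
  qed
  moreover have "finite (DNode () ` {ts. set ts \<subseteq> {t :: ptree. nodes t <= K} & length ts <= K})"
    using Suc by (intro finite_imageI finite_lists_length_le)
  ultimately show ?case by (rule finite_subset)
qed

context reinforcement begin

text \<open>Convergence in probability along the chain of histories.\<close>

definition conv_hist :: "(nat => (nat => nat) => real) => real => bool" where
  "conv_hist X c \<longleftrightarrow> (\<forall>\<epsilon>>0. (\<lambda>n. measure_pmf.prob (hist n) {a. \<bar>X n a - c\<bar> > \<epsilon>}) \<longlonglongrightarrow> 0)"

definition freq :: "((nat => nat) => nat => nat => 'x) => 'x => nat => (nat => nat) => real" where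
  "freq \<phi> x n a = real (card {v \<in> {0..n}. \<phi> a n v = x}) / real (n + 1)"

definition ptree_of :: "(nat => nat) => nat => nat => ptree" where
  "ptree_of a n v = shape (dec a n v)"

abbreviation hexp :: "nat => ((nat => nat) => real) => real" where
  "hexp n f \<equiv> measure_pmf.expectation (hist n) f"

lemma freq_nonneg: "freq \<phi> x n a >= 0"
  by (simp add: freq_def)

subsection \<open>Second moments\<close>

text \<open>Of two intersecting subtrees one contains the other. If both have shape \<open>t\<close>, the root of the inner one is
among the at most \<open>nodes t\<close> vertices of the outer one.\<close>

lemma overlap_count:
  assumes a: "history n a" and I: "I \<subseteq> {1..n}"
  shows "card {(i, j) \<in> I \<times> I. ptree_of a n i = t & ptree_of a n j = t & desc a n i \<inter> desc a n j ~= {}}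
    <= 2 * nodes t * n"
proof -
  let ?I = "{i \<in> I. ptree_of a n i = t}"
  let ?S = "SIGMA i:?I. desc a n i"
  have fin: "finite ?I" using I finite_subset by fastforce
  have finS: "finite ?S" using fin by (intro finite_SigmaI) auto
  have "{(i, j) \<in> I \<times> I. ptree_of a n i = t & ptree_of a n j = t & desc a n i \<inter> desc a n j ~= {}}
      \<subseteq> ?S \<union> prod.swap ` ?S"
  proof (rule subsetI)
    fix x assume "x \<in> {(i, j) \<in> I \<times> I. ptree_of a n i = t & ptree_of a n j = t & desc a n i \<inter> desc a n j ~= {}}"
    then obtain i j where x: "x = (i, j)" and ij: "i \<in> I" "j \<in> I" "ptree_of a n i = t" "ptree_of a n j = t"
      and meet: "desc a n i \<inter> desc a n j ~= {}" by blast
    have "i \<in> desc a n j \<or> j \<in> desc a n i"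
      using ij I by (intro desc_nested[OF a] meet) auto
    then show "x \<in> ?S \<union> prod.swap ` ?S"
    proof
      assume "i \<in> desc a n j"
      then have "(j, i) \<in> ?S" using ij by simp
      then have "prod.swap (j, i) \<in> prod.swap ` ?S" by (rule imageI)
      then show ?thesis using x by simp
    qed (use x ij in simp)
  qed
  then have "card {(i, j) \<in> I \<times> I. ptree_of a n i = t & ptree_of a n j = t & desc a n i \<inter> desc a n j ~= {}}
      <= card (?S \<union> prod.swap ` ?S)" using finS by (intro card_mono) auto
  also have "... <= card ?S + card (prod.swap ` ?S)" by (rule card_Un_le)
  also have "... <= card ?S + card ?S" using finS by (intro add_left_mono card_image_le)
  also have "card ?S = (\<Sum>i\<in>?I. card (desc a n i))" using fin by (subst card_SigmaI) auto
  also have "... = (\<Sum>i\<in>?I. nodes t)"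
  proof (rule sum.cong)
    fix i assume i: "i \<in> ?I"
    then have "card (desc a n i) = nodes (dec a n i)" using I by (intro card_desc[OF a]) auto
    also have "... = nodes (ptree_of a n i)" unfolding ptree_of_def by simp
    finally show "card (desc a n i) = nodes t" using i by simp
  qed simp
  also have "... <= n * nodes t"
    using card_mono[of "{1..n}" ?I] I by auto
  finally show ?thesis by (simp add: algebra_simps)
qed

text \<open>Old vertices are discarded: their rates are unbounded on the scale \<open>1 / n\<close>.\<close>

definition late :: "real => nat => nat set" where
  "late \<epsilon> n = {i \<in> {1..n}. \<epsilon> * real n <= real i}"

lemma finite_late [simp]: "finite (late \<epsilon> n)"
  by (simp add: late_def)

text \<open>The square counts pairs of vertices. Disjoint pairs are bounded by \<open>pair_shape_prob_le\<close>, the others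
by \<open>overlap_count\<close>.\<close>

lemma late_second_moment:
  assumes e: "\<epsilon> > 0" and n: "n >= 1"
  shows "hexp n (\<lambda>a. (real (card {i \<in> late \<epsilon> n. ptree_of a n i = t}))\<^sup>2)
    <= corr (2 * nodes t) (nat \<lceil>\<epsilon> * real n\<rceil>) * (\<Sum>i\<in>late \<epsilon> n. Fsum n t i)\<^sup>2 + 2 * real (nodes t) * real n"
proof -
  let ?I = "late \<epsilon> n"
  let ?lo = "nat \<lceil>\<epsilon> * real n\<rceil>"
  let ?c = "corr (2 * nodes t) ?lo"
  let ?both = "\<lambda>a i j. ptree_of a n i = t & ptree_of a n j = t"
  let ?dis = "\<lambda>a i j. desc a n i \<inter> desc a n j = {}"
  have "0 < \<epsilon> * real n" using e n by simp
  then have "0 < \<lceil>\<epsilon> * real n\<rceil>" by simp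
  then have lo: "1 <= ?lo" by linarith
  have I: "?I \<subseteq> {?lo..n}" unfolding late_def by (auto simp: nat_le_iff ceiling_le_iff)
  have I1: "?I \<subseteq> {1..n}" unfolding late_def by auto
  have sq: "(real (card {i \<in> ?I. ptree_of a n i = t}))\<^sup>2
     <= (\<Sum>x\<in>?I \<times> ?I. indicator {a. ?both a (fst x) (snd x) & ?dis a (fst x) (snd x)} a) + 2 * real (nodes t) * real n"
    if a: "history n a" for a
  proof -
    let ?A = "{x \<in> ?I \<times> ?I. ?both a (fst x) (snd x) & ?dis a (fst x) (snd x)}"
    let ?B = "{(i, j) \<in> ?I \<times> ?I. ?both a i j & \<not> ?dis a i j}"
    have "card {i \<in> ?I. ptree_of a n i = t} * card {i \<in> ?I. ptree_of a n i = t} = card (?A \<union> ?B)"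
      unfolding card_cartesian_product[symmetric] by (rule arg_cong[where f = card]) auto
    also have "... <= card ?A + card ?B" by (rule card_Un_le)
    also have "card ?B <= 2 * nodes t * n" using overlap_count[OF a I1, of t] by (simp add: conj_assoc)
    finally have "real (card {i \<in> ?I. ptree_of a n i = t} * card {i \<in> ?I. ptree_of a n i = t})
       <= real (card ?A + 2 * nodes t * n)" by (simp only: of_nat_le_iff)
    moreover have "real (card ?A) = (\<Sum>x\<in>?I \<times> ?I. indicator {a. ?both a (fst x) (snd x) & ?dis a (fst x) (snd x)} a)"
      by (simp add: indicator_def Int_def sum.inter_filter[symmetric])
    ultimately show ?thesis by (simp add: power2_eq_square)
  qed
  have "hexp n (\<lambda>a. (real (card {i \<in> ?I. ptree_of a n i = t}))\<^sup>2)
      <= hexp n (\<lambda>a. (\<Sum>x\<in>?I \<times> ?I. indicator {a. ?both a (fst x) (snd x) & ?dis a (fst x) (snd x)} a) + 2 * real (nodes t) * real n)"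
    by (intro expectation_hist_mono sq)
  also have "... = (\<Sum>x\<in>?I \<times> ?I. measure_pmf.prob (hist n) {a. ?both a (fst x) (snd x) & ?dis a (fst x) (snd x)}) + 2 * real (nodes t) * real n"
    by simp
  also have "(\<Sum>x\<in>?I \<times> ?I. measure_pmf.prob (hist n) {a. ?both a (fst x) (snd x) & ?dis a (fst x) (snd x)})
      <= (\<Sum>x\<in>?I \<times> ?I. ?c * (Fsum n t (fst x) * Fsum n t (snd x)))"
  proof (rule sum_mono)
    fix x assume "x \<in> ?I \<times> ?I"
    then have "fst x \<in> {?lo..n}" "snd x \<in> {?lo..n}" using I by auto
    from pair_shape_prob_le[OF lo this, of t]
    show "measure_pmf.prob (hist n) {a. ?both a (fst x) (snd x) & ?dis a (fst x) (snd x)}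
        <= ?c * (Fsum n t (fst x) * Fsum n t (snd x))"
      unfolding ptree_of_def by (simp add: conj_assoc)
  qed
  also have "(\<Sum>x\<in>?I \<times> ?I. ?c * (Fsum n t (fst x) * Fsum n t (snd x))) = ?c * (\<Sum>i\<in>?I. Fsum n t i)\<^sup>2"
  proof -
    have "(\<Sum>x\<in>?I \<times> ?I. Fsum n t (fst x) * Fsum n t (snd x)) = (\<Sum>i\<in>?I. Fsum n t i)\<^sup>2"
      unfolding power2_eq_square sum_product sum.cartesian_product by (intro sum.cong) auto
    then show ?thesis by (simp only: sum_distrib_left[symmetric])
  qed
  finally show ?thesis by simp
qed

lemma card_late_le: "card (late \<epsilon> n) <= n"
proof -
  have "late \<epsilon> n \<subseteq> {1..n}" by (auto simp: late_def)
  from card_mono[OF _ this] show ?thesis by simp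
qed

lemma card_early:
  assumes "\<epsilon> > 0"
  shows "real (card {v \<in> {0..n}. v \<notin> late \<epsilon> n}) <= \<epsilon> * real n + 1"
proof -
  have "{v \<in> {0..n}. v \<notin> late \<epsilon> n} \<subseteq> {..<nat \<lceil>\<epsilon> * real n\<rceil>} \<union> {0}"
    unfolding late_def using assms by (auto simp: zless_nat_eq_int_zless less_ceiling_iff)
  then have "card {v \<in> {0..n}. v \<notin> late \<epsilon> n} <= card ({..<nat \<lceil>\<epsilon> * real n\<rceil>} \<union> {0})"
    by (intro card_mono) auto
  moreover have "real (card ({..<nat \<lceil>\<epsilon> * real n\<rceil>} \<union> {0})) <= \<epsilon> * real n + 1"
  proof (cases "n = 0")
    case False
    then have "0 < \<epsilon> * real n" using assms by simp
    then have "0 < \<lceil>\<epsilon> * real n\<rceil>" by simp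
    then have "{..<nat \<lceil>\<epsilon> * real n\<rceil>} \<union> {0} = {..<nat \<lceil>\<epsilon> * real n\<rceil>}" by auto
    then show ?thesis using \<open>0 < \<lceil>\<epsilon> * real n\<rceil>\<close> ceiling_correct[of "\<epsilon> * real n"] by simp
  qed simp
  ultimately show ?thesis by linarith
qed

lemma freq_second_moment:
  assumes e: "0 < \<epsilon>" "\<epsilon> <= 1" and n: "n >= 1"
  shows "hexp n (\<lambda>a. (freq ptree_of t n a)\<^sup>2)
    <= corr (2 * nodes t) (nat \<lceil>\<epsilon> * real n\<rceil>) * ((\<Sum>i\<in>late \<epsilon> n. Fsum n t i) / real n)\<^sup>2
      + 2 * real (nodes t) / real n + 3 * (\<epsilon> + 1 / real n)"
proof -
  let ?L = "\<lambda>a. real (card {i \<in> late \<epsilon> n. ptree_of a n i = t})"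
  let ?d = "\<epsilon> + 1 / real n"
  have n0: "real n > 0" using n by simp
  have pt: "(freq ptree_of t n a)\<^sup>2 <= (?L a)\<^sup>2 / (real n)\<^sup>2 + 3 * ?d" for a
  proof -
    let ?y = "?L a / (real n + 1)" and ?e = "(\<epsilon> * real n + 1) / (real n + 1)"
    have "card {v \<in> {0..n}. ptree_of a n v = t} <= card ({i \<in> late \<epsilon> n. ptree_of a n i = t} \<union> {v \<in> {0..n}. v \<notin> late \<epsilon> n})"
      by (intro card_mono) auto
    also have "... <= card {i \<in> late \<epsilon> n. ptree_of a n i = t} + card {v \<in> {0..n}. v \<notin> late \<epsilon> n}" by (rule card_Un_le)
    finally have "real (card {v \<in> {0..n}. ptree_of a n v = t}) <= ?L a + real (card {v \<in> {0..n}. v \<notin> late \<epsilon> n})" by simp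
    also have "... <= ?L a + (\<epsilon> * real n + 1)" using card_early[OF e(1), of n] by simp
    finally have cn: "real (card {v \<in> {0..n}. ptree_of a n v = t}) <= ?L a + (\<epsilon> * real n + 1)" .
    have n1: "real (n + 1) = real n + 1" by simp
    have "freq ptree_of t n a <= (?L a + (\<epsilon> * real n + 1)) / (real n + 1)"
      unfolding freq_def n1 by (rule divide_right_mono[OF cn]) simp
    also have "... = ?y + ?e" by (simp add: add_divide_distrib)
    finally have le: "freq ptree_of t n a <= ?y + ?e" .
    have "{i \<in> late \<epsilon> n. ptree_of a n i = t} \<subseteq> {1..n}" unfolding late_def by auto
    then have "card {i \<in> late \<epsilon> n. ptree_of a n i = t} <= n" using card_mono[of "{1..n}"] by fastforce
    then have y: "0 <= ?y" "?y <= 1" by (auto simp: divide_simps)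
    have ee: "0 <= ?e" "?e <= 1"
      using e mult_right_mono[of \<epsilon> 1 "real n"] by (auto simp: divide_simps)
    have "(freq ptree_of t n a)\<^sup>2 <= (?y + ?e)\<^sup>2" by (rule power_mono[OF le freq_nonneg])
    also have "... = ?y\<^sup>2 + (2 * ?y * ?e + ?e * ?e)" by (simp add: power2_eq_square algebra_simps)
    also have "... <= ?y\<^sup>2 + (2 * 1 * ?e + 1 * ?e)"
      using y ee by (intro add_left_mono add_mono mult_right_mono mult_left_mono) auto
    also have "... = ?y\<^sup>2 + 3 * ?e"
    proof -
      have "2 * 1 * x + 1 * x = 3 * x" for x :: real by simp
      then show ?thesis by (simp only:)
    qed
    also have "?y\<^sup>2 <= (?L a / real n)\<^sup>2" using n0 by (intro power_mono divide_left_mono) auto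
    also have "?e <= (\<epsilon> * real n + 1) / real n" using n0 e by (intro divide_left_mono) auto
    also have "... = ?d" using n0 by (simp add: add_divide_distrib)
    finally show ?thesis by (simp add: power_divide)
  qed
  have "hexp n (\<lambda>a. (freq ptree_of t n a)\<^sup>2) <= hexp n (\<lambda>a. (?L a)\<^sup>2 / (real n)\<^sup>2 + 3 * ?d)"
    by (intro expectation_hist_mono pt)
  also have "... = hexp n (\<lambda>a. (?L a)\<^sup>2) / (real n)\<^sup>2 + 3 * ?d"
    by (subst Bochner_Integration.integral_add) simp_all
  also have "hexp n (\<lambda>a. (?L a)\<^sup>2) / (real n)\<^sup>2
     <= (corr (2 * nodes t) (nat \<lceil>\<epsilon> * real n\<rceil>) * (\<Sum>i\<in>late \<epsilon> n. Fsum n t i)\<^sup>2 + 2 * real (nodes t) * real n) / (real n)\<^sup>2"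
    by (intro divide_right_mono late_second_moment e n) auto
  also have "... = corr (2 * nodes t) (nat \<lceil>\<epsilon> * real n\<rceil>) * ((\<Sum>i\<in>late \<epsilon> n. Fsum n t i) / real n)\<^sup>2
      + 2 * real (nodes t) / real n"
    using n0 by (simp add: add_divide_distrib power_divide) (simp add: power2_eq_square)
  finally show ?thesis by simp
qed

lemma corr_tendsto:
  assumes "\<epsilon> > 0"
  shows "(\<lambda>n. corr K (nat \<lceil>\<epsilon> * real n\<rceil>)) \<longlonglongrightarrow> 1"
proof -
  let ?C = "2 * real K ^ 2 * (1 + \<delta> + real K) / (1 + \<delta>)"
  have "filterlim (\<lambda>n. \<epsilon> * real n) at_top sequentially"
    by (rule filterlim_tendsto_pos_mult_at_top[OF tendsto_const assms filterlim_real_sequentially])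
  then have "filterlim (\<lambda>n. real (nat \<lceil>\<epsilon> * real n\<rceil>)) at_top sequentially"
    by (rule filterlim_at_top_mono) (auto intro!: always_eventually real_nat_ceiling_ge)
  then have "(\<lambda>n. ?C / real (nat \<lceil>\<epsilon> * real n\<rceil>)) \<longlonglongrightarrow> 0"
    by (rule tendsto_divide_0[OF tendsto_const filterlim_at_top_imp_at_infinity])
  then have "(\<lambda>n. exp (?C / real (nat \<lceil>\<epsilon> * real n\<rceil>))) \<longlonglongrightarrow> exp 0" by (rule tendsto_exp)
  then show ?thesis unfolding corr_def by simp
qed

lemma freq_second_moment_limsup:
  assumes u: "\<And>\<epsilon>. \<epsilon> > 0 ==> (\<integral>z. indicator {0<..<1} z * (indicator {\<epsilon><..} z * Flim t z) \<partial>lborel) <= u"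
    and eta: "\<eta> > 0"
  shows "\<forall>\<^sub>F n in sequentially. hexp n (\<lambda>a. (freq ptree_of t n a)\<^sup>2) <= u\<^sup>2 + \<eta>"
proof -
  define e where "e = min 1 (\<eta> / 6)"
  have e: "0 < e" "e <= 1" "3 * e < \<eta>" using eta unfolding e_def by auto
  let ?J = "\<integral>z. indicator {0<..<1} z * (indicator {e<..} z * Flim t z) \<partial>lborel"
  let ?A = "\<lambda>n. (\<Sum>i\<in>late e n. Fsum n t i) / real n"
  have A: "?A \<longlonglongrightarrow> ?J" using Fsum_average_tendsto(1)[OF e(1), of t] unfolding late_def .
  have J0: "0 <= ?J"
    by (rule LIMSEQ_le_const[OF A]) (auto intro!: divide_nonneg_nonneg sum_nonneg Fsum_nonneg)
  have "(\<lambda>n. corr (2 * nodes t) (nat \<lceil>e * real n\<rceil>) * (?A n)\<^sup>2 + 2 * real (nodes t) / real n + 3 * (e + 1 / real n))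
     \<longlonglongrightarrow> 1 * ?J\<^sup>2 + 0 + 3 * (e + 0)"
    by (intro tendsto_intros corr_tendsto e A lim_const_over_n lim_1_over_n)
  moreover have "1 * ?J\<^sup>2 + 0 + 3 * (e + 0) < u\<^sup>2 + \<eta>"
    using power_mono[OF u[OF e(1)] J0, of 2] e(3) by simp
  ultimately have "\<forall>\<^sub>F n in sequentially. corr (2 * nodes t) (nat \<lceil>e * real n\<rceil>) * (?A n)\<^sup>2 + 2 * real (nodes t) / real n + 3 * (e + 1 / real n) < u\<^sup>2 + \<eta>"
    by (rule order_tendstoD(2))
  then show ?thesis
    using eventually_ge_at_top[of 1]
  proof eventually_elim
    case (elim n)
    show ?case using freq_second_moment[OF e(1,2) elim(2), of t] elim(1) by linarith
  qed
qed

subsection \<open>Tightness\<close>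

lemma card_desc_step:
  assumes a: "history m a" and i: "1 <= i" "i <= m" and k: "k <= m"
  shows "card (desc (a(Suc m := k)) (Suc m) i) <= card (desc a m i) + (if k \<in> desc a m i then 1 else 0)"
proof -
  let ?b = "a(Suc m := k)"
  have b: "history (Suc m) ?b" using a k by (auto simp: history_def)
  have pow: "(?b ^^ q) w = (a ^^ q) w" if "w <= m" for q w
  proof (induction q)
    case (Suc q)
    have "(a ^^ q) w <= m" using funpow_history_le[OF a, of q w] that by simp
    then show ?case using Suc by simp
  qed simp
  have sub: "desc ?b (Suc m) i \<subseteq> desc a m i \<union> (if k \<in> desc a m i then {Suc m} else {})"
  proof
    fix w assume "w \<in> desc ?b (Suc m) i"
    then have "w <= Suc m & (\<exists>q. (?b ^^ q) w = i)"
      using desc_iff[OF b, of i "Suc m" w] i by simp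
    then obtain q where w: "w <= Suc m" "(?b ^^ q) w = i" by blast
    show "w \<in> desc a m i \<union> (if k \<in> desc a m i then {Suc m} else {})"
    proof (cases "w <= m")
      case True
      then have "(a ^^ q) w = i" using w pow by simp
      then have "w <= m & (\<exists>q. (a ^^ q) w = i)" using True by blast
      then show ?thesis using desc_iff[OF a i] by simp
    next
      case False
      then have wm: "w = Suc m" using w by simp
      then obtain q' where "q = Suc q'" using w(2) i by (cases q) auto
      then have "(?b ^^ q') k = i" using w(2) wm by (simp add: funpow_swap1)
      then have "(a ^^ q') k = i" using pow[OF k] by simp
      then have "k <= m & (\<exists>q. (a ^^ q) k = i)" using k by blast
      then show ?thesis using desc_iff[OF a i] wm by simp
    qed
  qed
  have "card (desc ?b (Suc m) i) <= card (desc a m i \<union> (if k \<in> desc a m i then {Suc m} else {}))"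
    by (rule card_mono[OF _ sub]) auto
  also have "... <= card (desc a m i) + card (if k \<in> desc a m i then {Suc m} else {})" by (rule card_Un_le)
  finally show ?thesis by (simp split: if_splits)
qed

text \<open>The weight of \<open>k\<close> is at most \<open>m + 1\<close> times its degree plus \<open>\<delta>\<close>, and the degrees in a subtree sum up to at
most twice its size.\<close>

lemma desc_weight_le:
  assumes a: "history m a" and i: "1 <= i" "i <= m"
  shows "(\<Sum>k\<in>desc a m i. attach_weight \<delta> a m k / total_weight \<delta> m)
    <= 2 * (2 + \<delta>) / (1 + \<delta>) / (real m + 1) * real (card (desc a m i))"
proof -
  let ?V = "desc a m i"
  have d: "1 + \<delta> > 0" using delta by simp
  have V: "?V \<subseteq> {i..m}" by (rule desc_subset[OF a i])
  have "(\<Sum>k\<in>?V. attach_weight \<delta> a m k / total_weight \<delta> m)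
     <= (\<Sum>k\<in>?V. 2 / ((1 + \<delta>) * (real m + 1)) * (1 + \<delta> + real (card (set (ch a m k)))))"
  proof (rule sum_mono)
    fix k assume "k \<in> ?V"
    then have k: "1 <= k" "k <= m" using V i by auto
    have "attach_weight \<delta> a m k / total_weight \<delta> m = th \<delta> k (ch a m k) m / total_weight \<delta> m"
      using attach_weight_th[of a k m m \<delta>] k a by (simp add: history_def)
    also have "... <= 2 * (1 + \<delta> + real (length (ch a m k))) / ((1 + \<delta>) * (real m + 1))"
      by (rule th_over_total_le)
    also have "length (ch a m k) = card (set (ch a m k))" by (simp only: distinct_card distinct_ch)
    finally show "attach_weight \<delta> a m k / total_weight \<delta> m
      <= 2 / ((1 + \<delta>) * (real m + 1)) * (1 + \<delta> + real (card (set (ch a m k))))" by simp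
  qed
  also have "... = 2 / ((1 + \<delta>) * (real m + 1)) * ((1 + \<delta>) * real (card ?V) + real (\<Sum>k\<in>?V. card (set (ch a m k))))"
  proof -
    have "(\<Sum>k\<in>?V. 1 + \<delta> + real (card (set (ch a m k)))) = (1 + \<delta>) * real (card ?V) + real (\<Sum>k\<in>?V. card (set (ch a m k)))"
      by (simp add: sum.distrib algebra_simps)
    then show ?thesis by (simp only: sum_distrib_left[symmetric])
  qed
  also have "... <= 2 / ((1 + \<delta>) * (real m + 1)) * ((1 + \<delta>) * real (card ?V) + real (card ?V))"
  proof -
    have "(\<Sum>k\<in>?V. card (set (ch a m k))) = card (\<Union>k\<in>?V. set (ch a m k))"
      by (rule card_UN_disjoint[symmetric]) auto
    also have "... <= card ?V"
    proof (rule card_mono)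
      show "(\<Union>k\<in>?V. set (ch a m k)) \<subseteq> ?V"
        using desc_closed[OF a i] by auto
    qed simp
    finally have "real (\<Sum>k\<in>?V. card (set (ch a m k))) <= real (card ?V)" by (simp only: of_nat_le_iff)
    then show ?thesis using d by (intro mult_left_mono add_left_mono) auto
  qed
  also have "... = 2 * (2 + \<delta>) / (1 + \<delta>) / (real m + 1) * real (card (desc a m i))"
  proof -
    have "2 / (e * x) * (e * c + c) = 2 * (1 + e) / e / x * c" if "e > 0" "x > 0" for e x c :: real
      using that by (simp add: field_simps)
    from this[OF d, of "real m + 1" "real (card ?V)"] show ?thesis by simp
  qed
  finally show ?thesis .
qed

text \<open>By the two lemmas above the expected size grows at step \<open>m\<close> by a factor at most \<open>1 + c / (m + 1)\<close>; between
\<open>\<epsilon> n\<close> and \<open>n\<close> these factors multiply to at most \<open>exp (c / \<epsilon>)\<close>.\<close>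

lemma expected_card_desc:
  assumes e: "\<epsilon> > 0" and i: "i \<in> late \<epsilon> n"
  shows "hexp n (\<lambda>a. real (card (desc a n i))) <= exp (2 * (2 + \<delta>) / (1 + \<delta>) / \<epsilon>)"
proof -
  let ?q = "2 * (2 + \<delta>) / (1 + \<delta>)"
  have i1: "1 <= i" "i <= n" and en: "\<epsilon> * real n <= real i" using i by (auto simp: late_def)
  have n0: "real n > 0" using i1 by simp
  have q0: "?q >= 0" using delta by simp
  let ?r = "1 + ?q / (\<epsilon> * real n)"
  have "?q / (\<epsilon> * real n) >= 0" using e by (intro divide_nonneg_nonneg[OF q0]) auto
  then have r1: "?r >= 1" by linarith
  have step: "hexp m (\<lambda>a. real (card (desc a m i))) <= ?r ^ (m - i)" if "i <= m" "m <= n" for m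
    using that
  proof (induction m rule: dec_induct)
    case base
    have "card (desc a i i) = 1" for a by (subst desc_eq) (simp add: ch_def)
    then show ?case by simp
  next
    case (step m)
    have "hexp (Suc m) (\<lambda>a. real (card (desc a (Suc m) i)))
       <= hexp m (\<lambda>a. ?r * real (card (desc a m i)))"
      unfolding expectation_hist_Suc
    proof (rule expectation_hist_mono)
      fix a assume a: "history m a"
      have im: "i <= m" using step by simp
      have ha: "\<forall>j\<ge>1. a j < j" using a by (simp add: history_def)
      let ?p = "\<lambda>k. attach_weight \<delta> a m k / total_weight \<delta> m"
      have p0: "?p k >= 0" for k using attach_weight_nonneg[OF ha] total_weight_pos by (simp add: less_imp_le)
      have p1: "(\<Sum>k\<le>m. ?p k) = 1"
        using sum_attach_weight[OF ha, of \<delta> m] total_weight_pos[of m]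
        by (simp flip: sum_divide_distrib add: atLeast0AtMost)
      have V: "desc a m i \<subseteq> {..m}" using desc_subset[OF a i1(1) im] by auto
      have "(\<Sum>k\<le>m. ?p k * real (card (desc (a(Suc m := k)) (Suc m) i)))
          <= (\<Sum>k\<le>m. ?p k * (real (card (desc a m i)) + (if k \<in> desc a m i then 1 else 0)))"
      proof (rule sum_mono)
        fix k assume "k \<in> {..m}"
        then have "card (desc (a(Suc m := k)) (Suc m) i) <= card (desc a m i) + (if k \<in> desc a m i then 1 else 0)"
          by (intro card_desc_step[OF a i1(1) im]) simp
        then have "real (card (desc (a(Suc m := k)) (Suc m) i)) <= real (card (desc a m i)) + (if k \<in> desc a m i then 1 else 0)"
          by (simp split: if_splits)
        then show "?p k * real (card (desc (a(Suc m := k)) (Suc m) i)) <= ?p k * (real (card (desc a m i)) + (if k \<in> desc a m i then 1 else 0))"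
          using p0 by (rule mult_left_mono)
      qed
      also have "... = (\<Sum>k\<le>m. ?p k) * real (card (desc a m i)) + (\<Sum>k\<le>m. if k \<in> desc a m i then ?p k else 0)"
        unfolding sum_distrib_right sum.distrib[symmetric] by (intro sum.cong) (auto simp: distrib_left)
      finally have A: "(\<Sum>k\<le>m. ?p k * real (card (desc (a(Suc m := k)) (Suc m) i)))
          <= (\<Sum>k\<le>m. ?p k) * real (card (desc a m i)) + (\<Sum>k\<le>m. if k \<in> desc a m i then ?p k else 0)" .
      have "(\<Sum>k\<le>m. if k \<in> desc a m i then ?p k else 0) = (\<Sum>k\<in>desc a m i. ?p k)"
        using sum.inter_restrict[of "{..m}" ?p "desc a m i"] V by (simp add: Int_absorb1)
      also have "... <= ?q / (real m + 1) * real (card (desc a m i))" by (rule desc_weight_le[OF a i1(1) im])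
      also have "... <= ?q / (\<epsilon> * real n) * real (card (desc a m i))"
      proof (intro mult_right_mono divide_left_mono)
        show "\<epsilon> * real n <= real m + 1" using en im by linarith
      qed (use q0 e n0 in auto)
      finally have B: "(\<Sum>k\<le>m. if k \<in> desc a m i then ?p k else 0) <= ?q / (\<epsilon> * real n) * real (card (desc a m i))" .
      note A
      also note add_left_mono[OF B, of "(\<Sum>k\<le>m. ?p k) * real (card (desc a m i))"]
      also have "(\<Sum>k\<le>m. ?p k) * real (card (desc a m i)) + ?q / (\<epsilon> * real n) * real (card (desc a m i))
          = ?r * real (card (desc a m i))"
        unfolding p1 by (simp only: distrib_right)
      finally show "(\<Sum>k\<le>m. ?p k * real (card (desc (a(Suc m := k)) (Suc m) i))) <= ?r * real (card (desc a m i))" .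
    qed
    also have "... = ?r * hexp m (\<lambda>a. real (card (desc a m i)))" by simp
    also have "... <= ?r * ?r ^ (m - i)" using step r1 by (intro mult_left_mono) auto
    also have "... = ?r ^ (Suc m - i)" using step by (simp add: Suc_diff_le)
    finally show ?case .
  qed
  have "hexp n (\<lambda>a. real (card (desc a n i))) <= ?r ^ (n - i)" using step i1 by simp
  also have "... <= ?r ^ n" using r1 by (intro power_increasing) auto
  also have "... <= exp (?q / (\<epsilon> * real n)) ^ n" using r1 by (intro power_mono exp_ge_add_one_self) auto
  also have "... = exp (real n * (?q / (\<epsilon> * real n)))" by (rule exp_of_nat_mult[symmetric])
  also have "real n * (?q / (\<epsilon> * real n)) = ?q / \<epsilon>" using n0 by simp
  finally show ?thesis .
qed

text \<open>Vertices with a subtree larger than \<open>K\<close> are either old or counted by Markov's inequality.\<close>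

lemma tight_freq:
  assumes eta: "\<eta> > 0"
  shows "\<exists>K. \<forall>G. finite G --> {t. nodes t <= K} \<subseteq> G -->
    (\<forall>\<^sub>F n in sequentially. (\<Sum>t\<in>G. hexp n (freq ptree_of t n)) >= 1 - \<eta>)"
proof -
  define e where "e = \<eta> / 4"
  have e: "e > 0" using eta by (simp add: e_def)
  let ?C = "exp (2 * (2 + \<delta>) / (1 + \<delta>) / e)"
  (* Markov bounds the expected fraction of large subtrees by ?C / K, at most a quarter of the error allowed. *)
  define K where "K = nat \<lceil>4 * ?C / \<eta>\<rceil>"
  have "0 < 4 * ?C / \<eta>" using eta by simp
  then have K0: "real K >= 4 * ?C / \<eta>" "real K > 0" unfolding K_def by (linarith, simp)
  have CK: "?C / real K <= \<eta> / 4" using K0 eta by (simp add: field_simps)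
  show ?thesis
  proof (intro exI[of _ K] allI impI)
    fix G :: "ptree set" assume G: "finite G" "{t. nodes t <= K} \<subseteq> G"
    have ev: "\<forall>\<^sub>F n in sequentially. 1 / real n < \<eta> / 4"
      using order_tendstoD(2)[OF lim_1_over_n, of "\<eta> / 4"] eta by simp
    show "\<forall>\<^sub>F n in sequentially. (\<Sum>t\<in>G. hexp n (freq ptree_of t n)) >= 1 - \<eta>"
      using ev eventually_ge_at_top[of 1]
    proof eventually_elim
      case (elim n)
      let ?big = "\<lambda>a. \<Sum>i\<in>late e n. real (card (desc a n i)) / real K"
      have n0: "real n > 0" using elim by simp
      have pt: "1 - (e + 1 / real n) - ?big a / real n <= (\<Sum>t\<in>G. freq ptree_of t n a)" if a: "history n a" for a
      proof -
        let ?S = "{v \<in> {0..n}. ptree_of a n v \<in> G}"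
        have "card {0..n} <= card (?S \<union> ({v \<in> {0..n}. v \<notin> late e n} \<union> {v \<in> late e n. ptree_of a n v \<notin> G}))"
          by (intro card_mono) auto
        also have "... <= card ?S + (card {v \<in> {0..n}. v \<notin> late e n} + card {v \<in> late e n. ptree_of a n v \<notin> G})"
          by (meson add_left_mono card_Un_le order_trans)
        finally have "real (n + 1) <= real (card ?S) + real (card {v \<in> {0..n}. v \<notin> late e n}) + real (card {v \<in> late e n. ptree_of a n v \<notin> G})" by simp
        moreover have "real (card {v \<in> {0..n}. v \<notin> late e n}) <= e * real n + 1" by (rule card_early[OF e])
        moreover have "real (card {v \<in> late e n. ptree_of a n v \<notin> G}) <= ?big a"
        proof -
          have "real (card {v \<in> late e n. ptree_of a n v \<notin> G}) = (\<Sum>v\<in>late e n. if ptree_of a n v \<notin> G then 1 else 0)"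
            by (simp add: sum.inter_filter[symmetric])
          also have "... <= ?big a"
          proof (rule sum_mono)
            fix v assume v: "v \<in> late e n"
            have "real K <= real (card (desc a n v))" if "ptree_of a n v \<notin> G"
            proof -
              have "card (desc a n v) = nodes (ptree_of a n v)"
                using card_desc[OF a, of v n] v unfolding ptree_of_def late_def by simp
              moreover have "\<not> nodes (ptree_of a n v) <= K" using that G(2) by blast
              ultimately show ?thesis by simp
            qed
            then show "(if ptree_of a n v \<notin> G then 1 else 0) <= real (card (desc a n v)) / real K"
              using K0(2) by (simp add: field_simps)
          qed
          finally show ?thesis .
        qed
        ultimately have S: "real (n + 1) - (e * real n + 1) - ?big a <= real (card ?S)" by linarith
        have B0: "0 <= ?big a" by (intro sum_nonneg) auto
        have "card ?S = (\<Sum>t\<in>G. card {v \<in> {0..n}. ptree_of a n v = t})"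
        proof -
          have "?S = (\<Union>t\<in>G. {v \<in> {0..n}. ptree_of a n v = t})" by auto
          then show ?thesis using G(1) by (simp only:) (intro card_UN_disjoint, auto)
        qed
        then have "(\<Sum>t\<in>G. freq ptree_of t n a) = real (card ?S) / real (n + 1)"
          unfolding freq_def by (simp add: sum_divide_distrib)
        also have "... >= (real (n + 1) - (e * real n + 1) - ?big a) / real (n + 1)"
          using S by (intro divide_right_mono) auto
        also have "(real (n + 1) - (e * real n + 1) - ?big a) / real (n + 1) = 1 - (e * real n + 1) / real (n + 1) - ?big a / real (n + 1)"
          by (simp only: diff_divide_distrib) simp
        also have "... >= 1 - (e * real n + 1) / real n - ?big a / real n"
          using n0 e B0 by (intro diff_mono divide_left_mono) auto
        also have "(e * real n + 1) / real n = e + 1 / real n" using n0 by (simp add: add_divide_distrib)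
        finally show ?thesis by linarith
      qed
      have big: "hexp n ?big <= real n * (?C / real K)"
      proof -
        have "hexp n ?big = (\<Sum>i\<in>late e n. hexp n (\<lambda>a. real (card (desc a n i))) / real K)" by simp
        also have "... <= (\<Sum>i\<in>late e n. ?C / real K)"
          by (intro sum_mono divide_right_mono expected_card_desc e) auto
        also have "... = real (card (late e n)) * (?C / real K)" by simp
        also have "... <= real n * (?C / real K)"
          using card_late_le[of e n] by (intro mult_right_mono) auto
        finally show ?thesis .
      qed
      have "1 - \<eta> <= 1 - (e + 1 / real n) - ?C / real K"
        using CK elim(1) eta e_def by linarith
      also have "... <= 1 - (e + 1 / real n) - hexp n ?big / real n"
      proof -
        have "hexp n ?big / real n <= real n * (?C / real K) / real n" by (rule divide_right_mono[OF big]) simp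
        then show ?thesis using n0 by simp
      qed
      also have "... = hexp n (\<lambda>a. 1 - (e + 1 / real n) - ?big a / real n)"
        by (subst Bochner_Integration.integral_diff) simp_all
      also have "... <= hexp n (\<lambda>a. \<Sum>t\<in>G. freq ptree_of t n a)"
        by (intro expectation_hist_mono pt)
      also have "... = (\<Sum>t\<in>G. hexp n (freq ptree_of t n))" by simp
      finally show ?case .
    qed
  qed
qed

end

subsection \<open>Convergence of the frequencies\<close>

context reinforcement begin

lemma hexp_square_le: "(hexp n f)\<^sup>2 <= hexp n (\<lambda>a. (f a)\<^sup>2)"
proof -
  have "0 <= hexp n (\<lambda>a. (f a - hexp n f)\<^sup>2)" by (intro Bochner_Integration.integral_nonneg) auto
  also have "... = hexp n (\<lambda>a. (f a)\<^sup>2 - 2 * hexp n f * f a + (hexp n f)\<^sup>2)"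
    by (simp add: power2_eq_square algebra_simps)
  also have "... = hexp n (\<lambda>a. (f a)\<^sup>2) - 2 * hexp n f * hexp n f + (hexp n f)\<^sup>2"
    by (subst Bochner_Integration.integral_add, simp, simp, subst Bochner_Integration.integral_diff) simp_all
  finally show ?thesis by (simp add: power2_eq_square)
qed

text \<open>Chebyshev's inequality.\<close>

lemma conv_hist_L2:
  assumes "\<And>\<eta>. \<eta> > 0 ==> \<forall>\<^sub>F n in sequentially. hexp n (\<lambda>a. (X n a - c)\<^sup>2) <= \<eta>"
  shows "conv_hist X c"
  unfolding conv_hist_def
proof (intro allI impI)
  fix \<epsilon> :: real assume e: "\<epsilon> > 0"
  have le: "measure_pmf.prob (hist n) {a. \<bar>X n a - c\<bar> > \<epsilon>} <= hexp n (\<lambda>a. (X n a - c)\<^sup>2) / \<epsilon>\<^sup>2" for n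
  proof -
    have pt: "indicator {a. \<bar>X n a - c\<bar> > \<epsilon>} a <= (X n a - c)\<^sup>2 / \<epsilon>\<^sup>2" for a
    proof (cases "\<bar>X n a - c\<bar> > \<epsilon>")
      case True
      then have "\<epsilon>\<^sup>2 <= (X n a - c)\<^sup>2" using e by (metis abs_ge_zero less_imp_le power2_abs power_mono)
      then show ?thesis using True e by simp
    qed simp
    have "measure_pmf.prob (hist n) {a. \<bar>X n a - c\<bar> > \<epsilon>} = hexp n (indicator {a. \<bar>X n a - c\<bar> > \<epsilon>})" by simp
    also have "... <= hexp n (\<lambda>a. (X n a - c)\<^sup>2 / \<epsilon>\<^sup>2)" by (intro expectation_hist_mono pt)
    finally show ?thesis by simp
  qed
  show "(\<lambda>n. measure_pmf.prob (hist n) {a. \<bar>X n a - c\<bar> > \<epsilon>}) \<longlonglongrightarrow> 0"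
  proof (rule tendstoI)
    fix r :: real assume r: "r > 0"
    have "\<forall>\<^sub>F n in sequentially. hexp n (\<lambda>a. (X n a - c)\<^sup>2) <= r * \<epsilon>\<^sup>2 / 2"
      using r e by (intro assms) simp
    then show "\<forall>\<^sub>F n in sequentially. dist (measure_pmf.prob (hist n) {a. \<bar>X n a - c\<bar> > \<epsilon>}) 0 < r"
    proof eventually_elim
      case (elim n)
      have "hexp n (\<lambda>a. (X n a - c)\<^sup>2) / \<epsilon>\<^sup>2 <= r / 2" using elim e by (simp add: field_simps)
      with le[of n] have "measure_pmf.prob (hist n) {a. \<bar>X n a - c\<bar> > \<epsilon>} <= r / 2" by (rule order_trans)
      then show ?case using r by simp
    qed
  qed
qed

text \<open>The first moments are at most \<open>u t + o(1)\<close> by the bound on the second moments, their sum over a large finite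
set of shapes is at least \<open>1 - \<eta>\<close> by tightness, and the sum of the \<open>u t\<close> is at most one. Hence
the first moments converge to \<open>u t\<close>, and then so do the frequencies in mean square.\<close>

theorem freq_conv:
  assumes u0: "\<And>t. u t >= 0"
    and u: "\<And>t \<epsilon>. \<epsilon> > 0 ==> (\<integral>z. indicator {0<..<1} z * (indicator {\<epsilon><..} z * Flim t z) \<partial>lborel) <= u t"
    and u1: "\<And>G. finite G ==> (\<Sum>t\<in>G. u t) <= 1"
  shows "conv_hist (freq ptree_of t) (u t)"
    and "\<eta> > 0 ==> \<exists>G. finite G & (\<Sum>t\<in>G. u t) >= 1 - \<eta>"
proof -
  let ?e = "\<lambda>t n. hexp n (freq ptree_of t n)"
  have upper: "\<forall>\<^sub>F n in sequentially. ?e t n <= u t + \<eta>" if eta: "\<eta> > 0" for t \<eta>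
  proof -
    have "\<forall>\<^sub>F n in sequentially. hexp n (\<lambda>a. (freq ptree_of t n a)\<^sup>2) <= (u t)\<^sup>2 + \<eta>\<^sup>2"
      using eta by (intro freq_second_moment_limsup u) auto
    then show ?thesis
    proof eventually_elim
      case (elim n)
      have "(?e t n)\<^sup>2 <= (u t)\<^sup>2 + \<eta>\<^sup>2" using hexp_square_le elim by (rule order_trans)
      also have "... <= (u t + \<eta>)\<^sup>2" using u0[of t] eta by (simp add: power2_sum)
      finally have sq: "(?e t n)\<^sup>2 <= (u t + \<eta>)\<^sup>2" .
      show ?case by (rule power2_le_imp_le[OF sq]) (use u0[of t] eta in simp)
    qed
  qed
  have uppers: "\<forall>\<^sub>F n in sequentially. (\<Sum>t\<in>G. ?e t n) <= (\<Sum>t\<in>G. u t) + \<eta>" if eta: "\<eta> > 0" and G: "finite G" for G \<eta>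
  proof -
    let ?h = "\<eta> / (real (card G) + 1)"
    have h: "?h > 0" using eta by simp
    have "\<forall>\<^sub>F n in sequentially. \<forall>t\<in>G. ?e t n <= u t + ?h"
      using G upper[OF h] by (intro eventually_ball_finite) auto
    then show ?thesis
    proof eventually_elim
      case (elim n)
      have "(\<Sum>t\<in>G. ?e t n) <= (\<Sum>t\<in>G. u t + ?h)" using elim by (intro sum_mono) auto
      also have "... = (\<Sum>t\<in>G. u t) + real (card G) * ?h" by (simp add: sum.distrib)
      also have "real (card G) * ?h <= \<eta>" using eta by (simp add: field_simps)
      finally show ?case by simp
    qed
  qed
  show "\<exists>G. finite G & (\<Sum>t\<in>G. u t) >= 1 - \<eta>" if eta: "\<eta> > 0" for \<eta>
  proof -
    have h: "\<eta> / 2 > 0" using eta by simp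
    obtain K where K: "\<And>G. finite G ==> {t. nodes t <= K} \<subseteq> G ==>
       \<forall>\<^sub>F n in sequentially. (\<Sum>t\<in>G. ?e t n) >= 1 - \<eta> / 2"
      using tight_freq[OF h] by blast
    let ?G = "{t. nodes t <= K} :: ptree set"
    have "\<forall>\<^sub>F n in sequentially. 1 - \<eta> <= (\<Sum>t\<in>?G. u t)"
      using K[OF finite_nodes_le order_refl] uppers[OF h finite_nodes_le[of K]] by eventually_elim linarith
    then show ?thesis using finite_nodes_le[of K] by (auto simp: eventually_const)
  qed
  have lower: "\<forall>\<^sub>F n in sequentially. ?e t n >= u t - \<eta>" if eta: "\<eta> > 0" for t \<eta>
  proof -
    have h: "\<eta> / 2 > 0" using eta by simp
    obtain K where K: "\<And>G. finite G ==> {t. nodes t <= K} \<subseteq> G ==>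
       \<forall>\<^sub>F n in sequentially. (\<Sum>t\<in>G. ?e t n) >= 1 - \<eta> / 2"
      using tight_freq[OF h] by blast
    (* A lower bound for one shape: total mass minus the upper bounds for all others. *)
    let ?H = "{t. nodes t <= K} - {t}" and ?G = "insert t {t. nodes t <= K}"
    have fin: "finite ?H" "finite ?G" using finite_nodes_le by auto
    have split: "(\<Sum>t\<in>?G. f t) = f t + (\<Sum>t\<in>?H. f t)" for f :: "ptree => real"
      using finite_nodes_le[of K] by (rule sum.insert_remove)
    have uH: "(\<Sum>t\<in>?H. u t) <= 1 - u t" using u1[OF fin(2)] unfolding split by simp
    show ?thesis
      using K[OF fin(2) subset_insertI] uppers[OF h fin(1)]
    proof eventually_elim
      case (elim n)
      show ?case using elim uH unfolding split by linarith
    qed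
  qed
  show "conv_hist (freq ptree_of t) (u t)"
  proof (rule conv_hist_L2)
    fix \<eta> :: real assume eta: "\<eta> > 0"
    have h: "\<eta> / 3 > 0" using eta by simp
    have ut: "u t <= 1" using u1[of "{t}"] by simp
    have "\<forall>\<^sub>F n in sequentially. hexp n (\<lambda>a. (freq ptree_of t n a)\<^sup>2) <= (u t)\<^sup>2 + \<eta> / 3"
      by (intro freq_second_moment_limsup u h)
    then show "\<forall>\<^sub>F n in sequentially. hexp n (\<lambda>a. (freq ptree_of t n a - u t)\<^sup>2) <= \<eta>"
      using lower[OF h, of t]
    proof eventually_elim
      case (elim n)
      have "hexp n (\<lambda>a. (freq ptree_of t n a - u t)\<^sup>2) = hexp n (\<lambda>a. (freq ptree_of t n a)\<^sup>2 - 2 * u t * freq ptree_of t n a + (u t)\<^sup>2)"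
        by (simp add: power2_eq_square algebra_simps)
      also have "... = hexp n (\<lambda>a. (freq ptree_of t n a)\<^sup>2) - 2 * u t * ?e t n + (u t)\<^sup>2"
        by (subst Bochner_Integration.integral_add, simp, simp, subst Bochner_Integration.integral_diff) simp_all
      also have "... <= (u t)\<^sup>2 + \<eta> / 3 - 2 * u t * (u t - \<eta> / 3) + (u t)\<^sup>2"
        using elim u0[of t] by (intro add_mono diff_mono mult_left_mono) auto
      also have "... = \<eta> / 3 + u t * (2 * \<eta> / 3)" by (simp add: power2_eq_square algebra_simps)
      also have "... <= \<eta> / 3 + 1 * (2 * \<eta> / 3)" using ut eta by (intro add_left_mono mult_right_mono) auto
      finally show ?case by simp
    qed
  qed
qed

text \<open>Scheffe's lemma for empirical measures: if the frequencies of the atoms converge and the limit is a probability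
measure, then little mass lies outside of a large finite set, uniformly in \<open>n\<close>.\<close>

lemma conv_hist_expectation:
  fixes \<phi> :: "(nat => nat) => nat => nat => 'x" and f :: "'x => real"
  assumes L: "prob_space L" "sets L = UNIV" and B: "\<And>x. \<bar>f x\<bar> <= B"
    and tight: "\<And>\<eta>. \<eta> > 0 ==> \<exists>G. finite G & measure L G >= 1 - \<eta> & (\<forall>x\<in>G. conv_hist (freq \<phi> x) (measure L {x}))"
  shows "conv_hist (\<lambda>n a. (\<Sum>v\<in>{0..n}. f (\<phi> a n v)) / real (n + 1)) (\<integral>x. f x \<partial>L)"
  unfolding conv_hist_def
proof (intro allI impI)
  interpret L: prob_space L by (rule L)
  have B0: "B >= 0" using B[of undefined] by linarith
  have spL: "space L = UNIV" using L(2) sets.top[of L] sets.sets_into_space[of UNIV L] by auto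
  have fm: "f \<in> borel_measurable L" unfolding measurable_def using L(2) by auto
  have fint: "integrable L f" by (rule L.integrable_const_bound[where B = B]) (use fm B in auto)
  fix \<epsilon> :: real assume e: "\<epsilon> > 0"
  (* Three error terms: B \<eta> for the limit outside G, B \<eta> on G and 2 B \<eta> for the frequencies outside G. *)
  define \<eta> where "\<eta> = \<epsilon> / (4 * B + 1)"
  have eta: "\<eta> > 0" "4 * B * \<eta> < \<epsilon>"
    using e B0 unfolding \<eta>_def by (simp, simp add: field_simps)
  obtain G where G: "finite G" "measure L G >= 1 - \<eta>" "\<And>x. x \<in> G ==> conv_hist (freq \<phi> x) (measure L {x})"
    using tight[OF eta(1)] by blast
  define h where "h = \<eta> / (real (card G) + 1)"
  have h: "h > 0" "real (card G) * h <= \<eta>" using eta unfolding h_def by (simp, simp add: field_simps)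
  let ?X = "\<lambda>n a. (\<Sum>v\<in>{0..n}. f (\<phi> a n v)) / real (n + 1)"
  let ?c = "\<lambda>x. measure L {x}"
  have LG: "measure L G = (\<Sum>x\<in>G. ?c x)"
    using G(1) by (intro L.finite_measure_eq_sum_singleton) (auto simp: L(2))
  have Lf: "\<bar>(\<integral>x. f x \<partial>L) - (\<Sum>x\<in>G. ?c x * f x)\<bar> <= B * \<eta>"
  proof -
    have "(\<integral>x. f x * indicator G x \<partial>L) = (\<Sum>x\<in>G. ?c x * f x)"
    proof -
      have "(\<integral>x. f x * indicator G x \<partial>L) = (\<integral>x. (\<Sum>y\<in>G. f y * indicator {y} x) \<partial>L)"
      proof (rule Bochner_Integration.integral_cong)
        fix x show "f x * indicator G x = (\<Sum>y\<in>G. f y * indicator {y} x)"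
          using G(1) by (auto simp: indicator_def if_distrib cong: if_cong)
      qed simp
      also have "... = (\<Sum>y\<in>G. f y * ?c y)"
        using spL L(2) by (subst Bochner_Integration.integral_sum) (auto intro!: integrable_real_mult_indicator integrable_mult_right integrable_real_indicator simp: L.emeasure_eq_measure)
      finally show ?thesis by (simp add: mult.commute)
    qed
    then have "(\<integral>x. f x \<partial>L) - (\<Sum>x\<in>G. ?c x * f x) = (\<integral>x. f x - f x * indicator G x \<partial>L)"
      using fint L(2) by (subst Bochner_Integration.integral_diff) (auto intro: integrable_real_mult_indicator)
    also have "... = (\<integral>x. f x * indicator (- G) x \<partial>L)"
      by (intro Bochner_Integration.integral_cong) (auto simp: indicator_def)
    also have "\<bar>...\<bar> <= (\<integral>x. \<bar>f x * indicator (- G) x\<bar> \<partial>L)" by (rule integral_abs_bound)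
    also have "... <= (\<integral>x. B * indicator (- G) x \<partial>L)"
    proof (rule integral_mono)
      have "integrable L (\<lambda>x. f x * indicator (- G) x)"
        by (rule integrable_real_mult_indicator[OF _ fint]) (simp add: L(2))
      then show "integrable L (\<lambda>x. \<bar>f x * indicator (- G) x\<bar>)" by (rule integrable_abs)
      show "integrable L (\<lambda>x. B * indicator (- G) x)"
        by (intro integrable_mult_right integrable_real_indicator) (auto simp: L(2) L.emeasure_eq_measure)
      show "\<bar>f x * indicator (- G) x\<bar> <= B * indicator (- G) x" for x
        using B[of x] by (cases "x \<in> G") auto
    qed
    also have "... = B * measure L (- G)" using spL by simp
    also have "measure L (- G) = 1 - measure L G"
      using L.prob_compl[of G] L(2) spL by (simp add: Compl_eq_Diff_UNIV)
    finally show ?thesis using G(2) B0 mult_left_mono[of "1 - measure L G" \<eta> B] by linarith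
  qed
  have good: "\<bar>?X n a - (\<integral>x. f x \<partial>L)\<bar> <= \<epsilon>" if close: "\<forall>x\<in>G. \<bar>freq \<phi> x n a - ?c x\<bar> <= h" for n a
  proof -
    let ?S = "{v \<in> {0..n}. \<phi> a n v \<in> G}" and ?R = "{v \<in> {0..n}. \<phi> a n v \<notin> G}"
    have "(\<Sum>v\<in>{0..n}. f (\<phi> a n v)) = (\<Sum>v\<in>?S. f (\<phi> a n v)) + (\<Sum>v\<in>?R. f (\<phi> a n v))"
      by (subst sum.union_disjoint[symmetric]) (auto intro!: sum.cong)
    moreover have "(\<Sum>v\<in>?S. f (\<phi> a n v)) = (\<Sum>x\<in>G. \<Sum>v\<in>{v \<in> ?S. \<phi> a n v = x}. f (\<phi> a n v))"
      using G(1) by (intro sum.group[symmetric]) auto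
    moreover have "(\<Sum>x\<in>G. \<Sum>v\<in>{v \<in> ?S. \<phi> a n v = x}. f (\<phi> a n v)) = (\<Sum>x\<in>G. real (card {v \<in> {0..n}. \<phi> a n v = x}) * f x)"
    proof (rule sum.cong)
      fix x assume "x \<in> G"
      then have "{v \<in> ?S. \<phi> a n v = x} = {v \<in> {0..n}. \<phi> a n v = x}" by auto
      then show "(\<Sum>v\<in>{v \<in> ?S. \<phi> a n v = x}. f (\<phi> a n v)) = real (card {v \<in> {0..n}. \<phi> a n v = x}) * f x" by simp
    qed simp
    ultimately have X: "?X n a = (\<Sum>x\<in>G. freq \<phi> x n a * f x) + (\<Sum>v\<in>?R. f (\<phi> a n v)) / real (n + 1)"
      unfolding freq_def by (simp add: add_divide_distrib sum_divide_distrib)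
    have cardR: "real (card ?R) / real (n + 1) = 1 - (\<Sum>x\<in>G. freq \<phi> x n a)"
    proof -
      have "card (?S \<union> ?R) = card ?S + card ?R" by (rule card_Un_disjoint) auto
      moreover have "?S \<union> ?R = {0..n}" by auto
      ultimately have "card {0..n} = card ?S + card ?R" by simp
      moreover have "card ?S = (\<Sum>x\<in>G. card {v \<in> {0..n}. \<phi> a n v = x})"
      proof -
        have "?S = (\<Union>x\<in>G. {v \<in> {0..n}. \<phi> a n v = x})" by auto
        then show ?thesis using G(1) by (simp only:) (intro card_UN_disjoint, auto)
      qed
      ultimately have "real (card ?R) = real (n + 1) - (\<Sum>x\<in>G. real (card {v \<in> {0..n}. \<phi> a n v = x}))" by simp
      then show ?thesis unfolding freq_def by (simp add: diff_divide_distrib sum_divide_distrib)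
    qed
    have dG: "(\<Sum>x\<in>G. \<bar>freq \<phi> x n a - ?c x\<bar>) <= \<eta>"
    proof -
      have "(\<Sum>x\<in>G. \<bar>freq \<phi> x n a - ?c x\<bar>) <= (\<Sum>x\<in>G. h)" using close by (intro sum_mono) auto
      then show ?thesis using h(2) by simp
    qed
    have "\<bar>(\<Sum>v\<in>?R. f (\<phi> a n v)) / real (n + 1)\<bar> <= B * (1 - (\<Sum>x\<in>G. freq \<phi> x n a))"
    proof -
      have "\<bar>\<Sum>v\<in>?R. f (\<phi> a n v)\<bar> <= (\<Sum>v\<in>?R. \<bar>f (\<phi> a n v)\<bar>)" by (rule sum_abs)
      also have "... <= (\<Sum>v\<in>?R. B)" by (intro sum_mono B)
      also have "... = real (card ?R) * B" by simp
      finally have "\<bar>\<Sum>v\<in>?R. f (\<phi> a n v)\<bar> / real (n + 1) <= real (card ?R) * B / real (n + 1)"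
        by (intro divide_right_mono) auto
      also have "... = B * (real (card ?R) / real (n + 1))" by simp
      finally show ?thesis unfolding cardR by simp
    qed
    also have "... <= B * (2 * \<eta>)"
    proof (rule mult_left_mono[OF _ B0])
      have "(\<Sum>x\<in>G. ?c x) - (\<Sum>x\<in>G. freq \<phi> x n a) = (\<Sum>x\<in>G. ?c x - freq \<phi> x n a)" by (simp add: sum_subtractf)
      also have "... <= (\<Sum>x\<in>G. \<bar>freq \<phi> x n a - ?c x\<bar>)" by (intro sum_mono) auto
      finally show "1 - (\<Sum>x\<in>G. freq \<phi> x n a) <= 2 * \<eta>" using dG G(2) LG by linarith
    qed
    finally have R: "\<bar>(\<Sum>v\<in>?R. f (\<phi> a n v)) / real (n + 1)\<bar> <= 2 * B * \<eta>" by simp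
    have "\<bar>(\<Sum>x\<in>G. freq \<phi> x n a * f x) - (\<Sum>x\<in>G. ?c x * f x)\<bar> = \<bar>\<Sum>x\<in>G. (freq \<phi> x n a - ?c x) * f x\<bar>"
      by (simp add: sum_subtractf left_diff_distrib)
    also have "... <= (\<Sum>x\<in>G. \<bar>(freq \<phi> x n a - ?c x) * f x\<bar>)" by (rule sum_abs)
    also have "... <= (\<Sum>x\<in>G. \<bar>freq \<phi> x n a - ?c x\<bar> * B)"
      unfolding abs_mult by (intro sum_mono mult_left_mono B) auto
    also have "... = (\<Sum>x\<in>G. \<bar>freq \<phi> x n a - ?c x\<bar>) * B" by (simp add: sum_distrib_right)
    also have "... <= \<eta> * B" by (rule mult_right_mono[OF dG B0])
    finally have M: "\<bar>(\<Sum>x\<in>G. freq \<phi> x n a * f x) - (\<Sum>x\<in>G. ?c x * f x)\<bar> <= B * \<eta>" by (simp add: mult.commute)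
    show ?thesis using X R M Lf eta(2) by linarith
  qed
  have "(\<lambda>n. \<Sum>x\<in>G. measure_pmf.prob (hist n) {a. \<bar>freq \<phi> x n a - ?c x\<bar> > h}) \<longlonglongrightarrow> (\<Sum>x\<in>G. 0)"
    using G(3) h(1) unfolding conv_hist_def by (intro tendsto_sum) auto
  then have lim: "(\<lambda>n. \<Sum>x\<in>G. measure_pmf.prob (hist n) {a. \<bar>freq \<phi> x n a - ?c x\<bar> > h}) \<longlonglongrightarrow> 0" by simp
  show "(\<lambda>n. measure_pmf.prob (hist n) {a. \<bar>?X n a - (\<integral>x. f x \<partial>L)\<bar> > \<epsilon>}) \<longlonglongrightarrow> 0"
  proof (rule tendsto_sandwich[OF _ _ tendsto_const lim]; intro always_eventually allI)
    fix n
    have "measure_pmf.prob (hist n) {a. \<bar>?X n a - (\<integral>x. f x \<partial>L)\<bar> > \<epsilon>}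
       <= measure_pmf.prob (hist n) (\<Union>x\<in>G. {a. \<bar>freq \<phi> x n a - ?c x\<bar> > h})"
    proof (rule measure_pmf.finite_measure_mono)
      show "{a. \<bar>?X n a - (\<integral>x. f x \<partial>L)\<bar> > \<epsilon>} \<subseteq> (\<Union>x\<in>G. {a. \<bar>freq \<phi> x n a - ?c x\<bar> > h})"
      proof
        fix a assume a: "a \<in> {a. \<bar>?X n a - (\<integral>x. f x \<partial>L)\<bar> > \<epsilon>}"
        then have "\<not> (\<forall>x\<in>G. \<bar>freq \<phi> x n a - ?c x\<bar> <= h)" using good[of n a] by (metis (mono_tags, lifting) mem_Collect_eq not_le)
        then obtain x where "x \<in> G" "\<bar>freq \<phi> x n a - ?c x\<bar> > h" by (meson not_le)
        then show "a \<in> (\<Union>x\<in>G. {a. \<bar>freq \<phi> x n a - ?c x\<bar> > h})" by blast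
      qed
    qed auto
    also have "... <= (\<Sum>x\<in>G. measure_pmf.prob (hist n) {a. \<bar>freq \<phi> x n a - ?c x\<bar> > h})"
      by (intro measure_pmf.finite_measure_subadditive_finite G) auto
    finally show "measure_pmf.prob (hist n) {a. \<bar>?X n a - (\<integral>x. f x \<partial>L)\<bar> > \<epsilon>}
      <= (\<Sum>x\<in>G. measure_pmf.prob (hist n) {a. \<bar>freq \<phi> x n a - ?c x\<bar> > h})" .
  qed simp
qed

end

section \<open>Joint densities of the point process\<close>

text \<open>The primitive of \<open>1 - exp (- x)\<close> that vanishes at 0.\<close>

definition psi :: "real => real" where
  "psi x = x + exp (- x) - 1"

lemma psi_nonneg: "psi x >= 0"
  using exp_ge_add_one_self[of "- x"] by (simp add: psi_def)

lemma psi_ge: "psi x >= x - 1"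
  by (simp add: psi_def)

lemma psi_0 [simp]: "psi 0 = 0"
  by (simp add: psi_def)

lemma psi_measurable [measurable]: "psi \<in> borel_measurable borel"
  unfolding psi_def by measurable

lemma psi_deriv: "(psi has_real_derivative 1 - exp (- x)) (at x within S)"
  unfolding psi_def by (auto intro!: derivative_eq_intros)

abbreviation points :: "nat => (nat => real) measure" where
  "points k \<equiv> \<Pi>\<^sub>M j\<in>{1..<k}. borel"

text \<open>The birth time 0 acts as the point before the first one.\<close>

definition lst :: "(nat => real) => nat => real" where
  "lst \<sigma> k = (if k <= 1 then 0 else \<sigma> (k - 1))"

lemma lst_Suc [simp]: "k >= 1 ==> lst \<sigma> (Suc k) = \<sigma> k"
  by (simp add: lst_def)

lemma lst_measurable [measurable]: "(\<lambda>\<sigma>. lst \<sigma> k) \<in> borel_measurable (points k)"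
  unfolding lst_def by (cases "k <= 1") (auto intro!: measurable_component_singleton)

lemma upd_measurable:
  assumes "k >= 1"
  shows "(\<lambda>(\<sigma>, z). \<sigma>(k := z)) \<in> measurable (points k \<Otimes>\<^sub>M borel) (points (Suc k))"
proof -
  have "insert k {1..<k} = {1..<Suc k}" using assms by auto
  then show ?thesis using measurable_add_dim[of k "{1..<k}" "\<lambda>_. borel"] by simp
qed

context reinforcement begin

abbreviation "ca \<equiv> (1 + \<delta>) / (1 + \<delta> / 2)"
abbreviation "cb \<equiv> 1 / (1 + \<delta> / 2)"

lemma ca_pos: "ca > 0" and cb_pos: "cb > 0"
  using delta half_delta by auto

text \<open>The hazard rate as a function of the absolute time \<open>z\<close> instead of the time since the last point. The next
constant \<open>Lam\<close> is its primitive.\<close>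

definition lam :: "(nat => real) => nat => real => real" where
  "lam \<sigma> k z = ca * (1 - exp (- z)) + cb * (\<Sum>j\<in>{1..<k}. 1 - exp (- (z - \<sigma> j)))"

definition Lam :: "(nat => real) => nat => real => real" where
  "Lam \<sigma> k z = ca * psi z + cb * (\<Sum>j\<in>{1..<k}. psi (z - \<sigma> j))"

lemma Lam_deriv: "((\<lambda>x. Lam \<sigma> k (x + c)) has_real_derivative lam \<sigma> k (x + c)) (at x within S)"
proof -
  have "((\<lambda>x. psi (x + d)) has_real_derivative (1 - exp (- (x + d))) * 1) (at x within S)" for d
    by (rule DERIV_chain2[OF psi_deriv]) (auto intro!: derivative_eq_intros)
  then have *: "((\<lambda>x. psi (x + d)) has_real_derivative (1 - exp (- (x + d)))) (at x within S)" for d by simp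
  have "((\<lambda>x. psi (x + c - \<sigma> j)) has_real_derivative (1 - exp (- (x + c - \<sigma> j)))) (at x within S)" for j
    using *[of "c - \<sigma> j"] by (simp add: add_diff_eq)
  then show ?thesis
    unfolding Lam_def lam_def by (intro DERIV_add DERIV_cmult DERIV_sum *)
qed

text \<open>A new point has not contributed yet at the time of its birth, so accumulated hazards of successive points
telescope.\<close>

lemma Lam_upd: "k >= 1 ==> Lam (\<sigma>(k := z)) (Suc k) z = Lam \<sigma> k z"
  unfolding Lam_def by (simp add: atLeastLessThanSuc)

lemma lam_cong: "(\<And>j. j \<in> {1..<k} ==> \<sigma> j = \<tau> j) ==> lam \<sigma> k z = lam \<tau> k z"
  unfolding lam_def by simp

lemma Lam_cong: "(\<And>j. j \<in> {1..<k} ==> \<sigma> j = \<tau> j) ==> Lam \<sigma> k z = Lam \<tau> k z"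
  unfolding Lam_def by simp

lemma lst_cong: "k >= 1 ==> (\<And>j. j \<in> {1..<k} ==> \<sigma> j = \<tau> j) ==> lst \<sigma> k = lst \<tau> k"
  unfolding lst_def by auto

lemma lam_measurable [measurable]:
  "(\<lambda>(\<sigma>, z). lam \<sigma> k z) \<in> borel_measurable (points k \<Otimes>\<^sub>M borel)"
  unfolding lam_def by measurable

lemma Lam_measurable [measurable]:
  "(\<lambda>(\<sigma>, z). Lam \<sigma> k z) \<in> borel_measurable (points k \<Otimes>\<^sub>M borel)"
  unfolding Lam_def by measurable

definition increasing :: "(nat => real) => nat => bool" where
  "increasing \<sigma> k \<longleftrightarrow> 0 <= lst \<sigma> k & (\<forall>j\<in>{1..<k}. \<sigma> j <= lst \<sigma> k)"

lemma lam_nonneg: "increasing \<sigma> k ==> lst \<sigma> k <= z ==> 0 <= lam \<sigma> k z"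
  unfolding lam_def increasing_def using ca_pos cb_pos
  by (intro add_nonneg_nonneg mult_nonneg_nonneg sum_nonneg) (auto simp: less_imp_le dest!: bspec)

lemma hazard_eq:
  assumes "k >= 1" "\<sigma> 0 = 0"
  shows "hazard \<delta> \<sigma> k x = lam \<sigma> k (x + lst \<sigma> k)"
proof -
  have "{1..k - 1} = {1..<k}" using assms by auto
  moreover have "\<sigma> (k - 1) = lst \<sigma> k" using assms by (auto simp: lst_def)
  ultimately show ?thesis unfolding hazard_def lam_def by (simp add: algebra_simps)
qed

lemma integral_hazard:
  assumes "k >= 1" "\<sigma> 0 = 0" "s >= 0"
  shows "integral {0..s} (hazard \<delta> \<sigma> k) = Lam \<sigma> k (s + lst \<sigma> k) - Lam \<sigma> k (lst \<sigma> k)"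
proof -
  have hz: "hazard \<delta> \<sigma> k = (\<lambda>x. lam \<sigma> k (x + lst \<sigma> k))"
    by (rule ext) (rule hazard_eq[where \<sigma> = \<sigma>, OF assms(1,2)])
  have "(hazard \<delta> \<sigma> k has_integral (Lam \<sigma> k (s + lst \<sigma> k) - Lam \<sigma> k (0 + lst \<sigma> k))) {0..s}"
    unfolding hz
    by (rule fundamental_theorem_of_calculus[OF assms(3)])
       (use Lam_deriv in \<open>auto simp: has_real_derivative_iff_has_vector_derivative[symmetric]\<close>)
  then show ?thesis by (simp add: integral_unique)
qed

text \<open>The conditional survival function of the \<open>k\<close>-th inter-arrival time, given the points before it.\<close>

definition surv :: "(nat => real) => nat => real => real" where
  "surv \<sigma> k x = exp (- (Lam \<sigma> k (x + lst \<sigma> k) - Lam \<sigma> k (lst \<sigma> k)))"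

definition dens :: "(nat => real) => nat => real => ennreal" where
  "dens \<sigma> k x = ennreal (lam \<sigma> k (x + lst \<sigma> k)) * ennreal (surv \<sigma> k x) * indicator {0<..} x"

lemma surv_measurable [measurable]:
  assumes [measurable]: "k >= 1"
  shows "(\<lambda>(\<sigma>, x). surv \<sigma> k x) \<in> borel_measurable (points k \<Otimes>\<^sub>M borel)"
proof -
  have [measurable]: "(\<lambda>p. lst (fst p) k) \<in> borel_measurable (points k \<Otimes>\<^sub>M borel)"
    using measurable_compose[OF measurable_fst lst_measurable] .
  have m: "(\<lambda>p. (fst p, snd p + lst (fst p) k)) \<in> measurable (points k \<Otimes>\<^sub>M borel) (points k \<Otimes>\<^sub>M borel)"
    "(\<lambda>p. (fst p, lst (fst p) k)) \<in> measurable (points k \<Otimes>\<^sub>M borel) (points k \<Otimes>\<^sub>M borel)"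
    by measurable
  have "(\<lambda>p. Lam (fst p) k (snd p + lst (fst p) k)) \<in> borel_measurable (points k \<Otimes>\<^sub>M borel)"
    "(\<lambda>p. Lam (fst p) k (lst (fst p) k)) \<in> borel_measurable (points k \<Otimes>\<^sub>M borel)"
    using measurable_compose[OF m(1) Lam_measurable[of k]] measurable_compose[OF m(2) Lam_measurable[of k]] by simp_all
  then show ?thesis unfolding surv_def case_prod_beta by measurable
qed

lemma dens_measurable [measurable]:
  assumes [measurable]: "k >= 1"
  shows "(\<lambda>(\<sigma>, x). dens \<sigma> k x) \<in> borel_measurable (points k \<Otimes>\<^sub>M borel)"
proof -
  have [measurable]: "(\<lambda>p. lst (fst p) k) \<in> borel_measurable (points k \<Otimes>\<^sub>M borel)"
    using measurable_compose[OF measurable_fst lst_measurable] .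
  have m: "(\<lambda>p. (fst p, snd p + lst (fst p) k)) \<in> measurable (points k \<Otimes>\<^sub>M borel) (points k \<Otimes>\<^sub>M borel)"
    by measurable
  have "(\<lambda>p. lam (fst p) k (snd p + lst (fst p) k)) \<in> borel_measurable (points k \<Otimes>\<^sub>M borel)"
    using measurable_compose[OF m lam_measurable[of k]] by simp
  moreover have "(\<lambda>p. surv (fst p) k (snd p)) \<in> borel_measurable (points k \<Otimes>\<^sub>M borel)"
    using surv_measurable[OF assms] by (simp add: case_prod_beta)
  ultimately show ?thesis unfolding dens_def case_prod_beta by measurable
qed

text \<open>The constant term of the hazard rate tends to \<open>ca > 0\<close>, so the accumulated hazard diverges. Thus \<open>dens\<close>, the
conditional density, has total mass one.\<close>

lemma surv_tendsto: "(surv \<sigma> k \<longlongrightarrow> 0) at_top"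
proof -
  have lim: "filterlim (\<lambda>x. - Lam \<sigma> k (lst \<sigma> k) + ca * ((lst \<sigma> k - 1) + x)) at_top at_top"
    by (intro filterlim_tendsto_add_at_top[OF tendsto_const] filterlim_tendsto_pos_mult_at_top[OF tendsto_const ca_pos] filterlim_ident)
  have le: "ca * (x + (lst \<sigma> k - 1)) <= Lam \<sigma> k (x + lst \<sigma> k)" for x
  proof -
    have "ca * (x + (lst \<sigma> k - 1)) <= ca * psi (x + lst \<sigma> k)"
      using ca_pos psi_ge[of "x + lst \<sigma> k"] by (intro mult_left_mono) auto
    moreover have "0 <= cb * (\<Sum>j\<in>{1..<k}. psi (x + lst \<sigma> k - \<sigma> j))"
      using cb_pos by (intro mult_nonneg_nonneg sum_nonneg psi_nonneg) auto
    ultimately show ?thesis unfolding Lam_def by linarith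
  qed
  have "filterlim (\<lambda>x. Lam \<sigma> k (x + lst \<sigma> k) - Lam \<sigma> k (lst \<sigma> k)) at_top at_top"
  proof (rule filterlim_at_top_mono[OF lim], intro always_eventually allI)
    fix x
    show "- Lam \<sigma> k (lst \<sigma> k) + ca * ((lst \<sigma> k - 1) + x) <= Lam \<sigma> k (x + lst \<sigma> k) - Lam \<sigma> k (lst \<sigma> k)"
      using le[of x] by (simp add: add.commute)
  qed
  then show ?thesis
    unfolding surv_def by (intro filterlim_compose[OF exp_at_bot]) (simp add: filterlim_uminus_at_bot)
qed

lemma surv_deriv: "(surv \<sigma> k has_real_derivative - (lam \<sigma> k (x + lst \<sigma> k) * surv \<sigma> k x)) (at x within S)"
  unfolding surv_def by (auto intro!: derivative_eq_intros Lam_deriv)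

lemma surv_0 [simp]: "surv \<sigma> k 0 = 1"
  by (simp add: surv_def)

lemma lam_shift_measurable [measurable]: "(\<lambda>x. lam \<sigma> k (x + c)) \<in> borel_measurable borel"
  unfolding lam_def by measurable

lemma Lam_shift_measurable [measurable]: "(\<lambda>x. Lam \<sigma> k (x + c)) \<in> borel_measurable borel"
  unfolding Lam_def by measurable

lemma surv_meas1 [measurable]: "surv \<sigma> k \<in> borel_measurable borel"
  unfolding surv_def by measurable

lemma dens_tail:
  assumes inc: "increasing \<sigma> k" and s: "s >= 0"
  shows "(\<integral>\<^sup>+x. dens \<sigma> k x * indicator {s<..} x \<partial>lborel) = ennreal (surv \<sigma> k s)"
proof -
  have "(\<integral>\<^sup>+x. dens \<sigma> k x * indicator {s<..} x \<partial>lborel)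
      = (\<integral>\<^sup>+x. ennreal (lam \<sigma> k (x + lst \<sigma> k) * surv \<sigma> k x) * indicator {s..} x \<partial>lborel)"
  proof (rule nn_integral_cong_AE)
    have "AE x in lborel. x ~= s" by (rule AE_lborel_singleton)
    then show "AE x in lborel. dens \<sigma> k x * indicator {s<..} x = ennreal (lam \<sigma> k (x + lst \<sigma> k) * surv \<sigma> k x) * indicator {s..} x"
    proof eventually_elim
      case (elim x)
      show ?case
      proof (cases "s < x")
        case True
        then show ?thesis using s unfolding dens_def by (simp add: ennreal_mult'' surv_def)
      qed (use elim in \<open>auto simp: indicator_def\<close>)
    qed
  qed
  also have "... = ennreal (0 - (- surv \<sigma> k s))"
  proof (rule nn_integral_FTC_atLeast)
    fix x assume x: "s <= x"
    show "((\<lambda>x. - surv \<sigma> k x) has_real_derivative lam \<sigma> k (x + lst \<sigma> k) * surv \<sigma> k x) (at x)"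
      using DERIV_minus[OF surv_deriv] by simp
    show "0 <= lam \<sigma> k (x + lst \<sigma> k) * surv \<sigma> k x"
      using s x by (intro mult_nonneg_nonneg lam_nonneg inc) (auto simp: surv_def)
  next
    show "((\<lambda>x. - surv \<sigma> k x) \<longlongrightarrow> 0) at_top"
      using tendsto_minus[OF surv_tendsto, of \<sigma> k] by simp
  qed measurable
  finally show ?thesis by simp
qed

end

locale point_process = reinforcement \<delta> + prob_space M for \<delta> :: real and M :: "'m measure" +
  fixes E :: "nat => 'm => real"
  assumes inter: "interarrivals \<delta> M E"
begin

abbreviation arr :: "'m => nat => real" where
  "arr \<omega> \<equiv> arrival (\<lambda>i. E i \<omega>)"

abbreviation past :: "nat => 'm => nat => real" where
  "past k \<omega> \<equiv> restrict (arr \<omega>) {1..<k}"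

lemma E_meas: "k >= 1 ==> E k \<in> borel_measurable M"
  using inter unfolding interarrivals_def by blast

lemma E_pos: "AE \<omega> in M. \<forall>k\<ge>1. E k \<omega> > 0"
proof -
  have "AE \<omega> in M. k >= 1 --> E k \<omega> > 0" for k
    using inter unfolding interarrivals_def by (cases "k >= 1") auto
  then show ?thesis by (simp add: AE_all_countable)
qed

lemma arr_0 [simp]: "arr \<omega> 0 = 0"
  by (simp add: arrival_def)

lemma arr_Suc: "arr \<omega> (Suc k) = arr \<omega> k + E (Suc k) \<omega>"
  by (simp add: arrival_def)

lemma arr_meas [measurable]: "(\<lambda>\<omega>. arr \<omega> k) \<in> borel_measurable M"
  unfolding arrival_def by (intro borel_measurable_sum E_meas) auto

lemma past_meas [measurable]: "past k \<in> measurable M (points k)"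
  by (intro measurable_restrict) simp

lemma lst_past: "k >= 1 ==> lst (past k \<omega>) k = arr \<omega> (k - 1)"
  by (auto simp: lst_def)

lemma arr_mono:
  assumes "\<forall>k\<ge>1. E k \<omega> > 0" "i < j"
  shows "arr \<omega> i < arr \<omega> j"
  using assms(2)
proof (induction j)
  case (Suc j)
  have "arr \<omega> j < arr \<omega> (Suc j)" using assms(1) by (simp add: arr_Suc)
  then show ?case using Suc by (cases "i = j") auto
qed simp

lemma increasing_past: "k >= 1 ==> AE \<omega> in M. increasing (past k \<omega>) k"
  using E_pos
proof eventually_elim
  case (elim \<omega>)
  have le: "arr \<omega> i <= arr \<omega> j" if "i <= j" for i j
    using arr_mono[OF elim(2), of i j] that by (cases "i = j") auto
  show ?case
    unfolding increasing_def lst_past[OF elim(1)] using le[of 0 "k - 1"] le[of _ "k - 1"] by auto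
qed

text \<open>The defining property of the inter-arrival times, integrated over a set of pasts; this removes the
conditional expectation.\<close>

lemma survival:
  assumes k: "k >= 1" and B: "B \<in> sets (points k)" and s: "s >= 0"
  shows "emeasure M {\<omega> \<in> space M. past k \<omega> \<in> B & E k \<omega> > s}
    = (\<integral>\<^sup>+\<omega>. indicator B (past k \<omega>) * ennreal (surv (past k \<omega>) k s) \<partial>M)"
proof -
  let ?F = "past_points M E k"
  let ?f = "indicator {\<omega> \<in> space M. E k \<omega> > s} :: 'm => real"
  let ?A = "past k -` B \<inter> space M"
  have F: "?F = vimage_algebra (space M) (past k) (points k)"
    unfolding past_points_def ..
  have sub: "subalgebra M ?F"
    unfolding F subalgebra_def
    by (auto simp: sets_vimage_algebra2 measurable_space[OF past_meas]) (use past_meas in \<open>auto simp: sets_vimage_algebra2 space_PiM measurable_def\<close>)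
  interpret F: finite_measure_subalgebra M ?F by unfold_locales (rule sub)
  have A: "?A \<in> sets ?F" unfolding F by (rule in_vimage_algebra[OF B])
  have AM: "?A \<in> sets M" using A sub unfolding subalgebra_def by auto
  have Es: "{\<omega> \<in> space M. E k \<omega> > s} \<in> sets M" using E_meas[OF k] by measurable
  have int_f: "integrable M ?f" using Es by (intro integrable_real_indicator) (auto simp: emeasure_eq_measure)
  have eq: "{\<omega> \<in> space M. past k \<omega> \<in> B & E k \<omega> > s} = ?A \<inter> {\<omega> \<in> space M. E k \<omega> > s}" by auto
  have g_meas: "(\<lambda>\<omega>. indicator B (past k \<omega>) * surv (past k \<omega>) k s) \<in> borel_measurable M"
  proof -
    have "(\<lambda>\<omega>. (past k \<omega>, s)) \<in> measurable M (points k \<Otimes>\<^sub>M borel)" by measurable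
    from measurable_compose[OF this surv_measurable[OF k]]
    have "(\<lambda>\<omega>. surv (past k \<omega>) k s) \<in> borel_measurable M" by simp
    moreover have "(\<lambda>\<omega>. indicator B (past k \<omega>) :: real) \<in> borel_measurable M"
      by (rule measurable_compose[OF past_meas]) (use B in simp)
    ultimately show ?thesis by measurable
  qed
  have "measure M {\<omega> \<in> space M. past k \<omega> \<in> B & E k \<omega> > s} = (\<integral>\<omega>. indicator ?A \<omega> * ?f \<omega> \<partial>M)"
    unfolding eq using AM Es by (subst indicator_inter_arith[symmetric]) simp
  also have "... = (\<integral>\<omega>. indicator ?A \<omega> * real_cond_exp M ?F ?f \<omega> \<partial>M)"
    using F.real_cond_exp_intA[OF int_f A] unfolding set_lebesgue_integral_def by simp
  also have "... = (\<integral>\<omega>. indicator B (past k \<omega>) * surv (past k \<omega>) k s \<partial>M)"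
  proof (rule integral_cong_AE)
    have "AE \<omega> in M. real_cond_exp M ?F ?f \<omega> = exp (- integral {0..s} (hazard \<delta> (arr \<omega>) k))"
      using inter k s unfolding interarrivals_def by blast
    then show "AE \<omega> in M. indicator ?A \<omega> * real_cond_exp M ?F ?f \<omega> = indicator B (past k \<omega>) * surv (past k \<omega>) k s"
    proof (rule AE_mp, intro AE_I2 impI)
      fix \<omega> assume w: "\<omega> \<in> space M" and c: "real_cond_exp M ?F ?f \<omega> = exp (- integral {0..s} (hazard \<delta> (arr \<omega>) k))"
      have "Lam (arr \<omega>) k z = Lam (past k \<omega>) k z" for z by (rule Lam_cong) simp
      moreover have "lst (arr \<omega>) k = lst (past k \<omega>) k" by (rule lst_cong[OF k]) simp
      ultimately have "real_cond_exp M ?F ?f \<omega> = surv (past k \<omega>) k s"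
        unfolding c integral_hazard[where \<sigma> = "arr \<omega>", OF k arr_0 s] surv_def by simp
      then show "indicator ?A \<omega> * real_cond_exp M ?F ?f \<omega> = indicator B (past k \<omega>) * surv (past k \<omega>) k s"
        using w by (simp add: indicator_def)
    qed
  qed (use AM g_meas in auto)
  finally have m: "measure M {\<omega> \<in> space M. past k \<omega> \<in> B & E k \<omega> > s}
     = (\<integral>\<omega>. indicator B (past k \<omega>) * surv (past k \<omega>) k s \<partial>M)" .
  have "AE \<omega> in M. norm (indicator B (past k \<omega>) * surv (past k \<omega>) k s) <= 1"
    using increasing_past[OF k]
  proof eventually_elim
    case (elim \<omega>)
    have "surv (past k \<omega>) k s <= surv (past k \<omega>) k 0"
    proof (rule DERIV_nonpos_imp_nonincreasing[OF s])
      fix x assume "0 <= x" "x <= s"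
      then show "\<exists>y. DERIV (surv (past k \<omega>) k) x :> y & y <= 0"
      proof (intro exI conjI)
        show "DERIV (surv (past k \<omega>) k) x :> - (lam (past k \<omega>) k (x + lst (past k \<omega>) k) * surv (past k \<omega>) k x)"
          by (rule surv_deriv)
        have "0 <= lam (past k \<omega>) k (x + lst (past k \<omega>) k)"
          using \<open>0 <= x\<close> by (intro lam_nonneg[OF elim]) simp
        then show "- (lam (past k \<omega>) k (x + lst (past k \<omega>) k) * surv (past k \<omega>) k x) <= 0"
          by (simp add: surv_def)
      qed
    qed
    then show ?case by (auto simp: indicator_def surv_def)
  qed
  then have int: "integrable M (\<lambda>\<omega>. indicator B (past k \<omega>) * surv (past k \<omega>) k s)"
    using g_meas by (intro integrable_const_bound[where B = 1]) auto
  have "emeasure M {\<omega> \<in> space M. past k \<omega> \<in> B & E k \<omega> > s} = (\<integral>\<^sup>+\<omega>. ennreal (indicator B (past k \<omega>) * surv (past k \<omega>) k s) \<partial>M)"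
    unfolding emeasure_eq_measure m by (rule nn_integral_eq_integral[OF int, symmetric]) (auto simp: surv_def)
  also have "... = (\<integral>\<^sup>+\<omega>. indicator B (past k \<omega>) * ennreal (surv (past k \<omega>) k s) \<partial>M)"
    by (intro nn_integral_cong) (auto simp: indicator_def)
  finally show ?thesis .
qed

text \<open>Both measures agree on products with a half-line, and half-lines determine a finite measure on the reals.\<close>

lemma joint_law:
  assumes k: "k >= 1"
  shows "distr M (points k \<Otimes>\<^sub>M borel) (\<lambda>\<omega>. (past k \<omega>, E k \<omega>))
    = density (distr M (points k) (past k) \<Otimes>\<^sub>M lborel) (\<lambda>(\<sigma>, x). dens \<sigma> k x)"
    (is "?P = ?Q")
proof -
  let ?Y = "distr M (points k) (past k)"
  interpret Y: prob_space ?Y by (rule prob_space_distr) measurable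
  interpret YL: pair_sigma_finite ?Y lborel ..
  note [measurable] = E_meas[OF k] dens_measurable[OF k]
  have sets_YL: "sets (?Y \<Otimes>\<^sub>M lborel) = sets (points k \<Otimes>\<^sub>M borel)"
    by (intro sets_pair_measure_cong) auto
  have d_meas: "(\<lambda>(\<sigma>, x). dens \<sigma> k x) \<in> borel_measurable (?Y \<Otimes>\<^sub>M lborel)"
    using dens_measurable[OF k] by (simp add: measurable_cong_sets[OF sets_YL refl])
  have mP: "(\<lambda>\<omega>. (past k \<omega>, E k \<omega>)) \<in> measurable M (points k \<Otimes>\<^sub>M borel)" by measurable
  interpret P: prob_space ?P by (rule prob_space_distr[OF mP])
  have rect_P: "emeasure ?P (B \<times> C) = emeasure M {\<omega> \<in> space M. past k \<omega> \<in> B & E k \<omega> \<in> C}"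
    if "B \<in> sets (points k)" "C \<in> sets borel" for B C
    using that by (subst emeasure_distr[OF mP]) (auto intro!: arg_cong[where f = "emeasure M"])
  have rect_Q: "emeasure ?Q (B \<times> C) = (\<integral>\<^sup>+\<omega>. indicator B (past k \<omega>) * (\<integral>\<^sup>+x. dens (past k \<omega>) k x * indicator C x \<partial>lborel) \<partial>M)"
    if [measurable]: "B \<in> sets (points k)" "C \<in> sets borel" for B C
  proof -
    have BC: "B \<times> C \<in> sets (?Y \<Otimes>\<^sub>M lborel)" unfolding sets_YL using that by simp
    have "emeasure ?Q (B \<times> C) = (\<integral>\<^sup>+p. (case p of (\<sigma>, x) => dens \<sigma> k x) * indicator (B \<times> C) p \<partial>(?Y \<Otimes>\<^sub>M lborel))"
      by (rule emeasure_density[OF d_meas BC])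
    also have "... = (\<integral>\<^sup>+\<sigma>. \<integral>\<^sup>+x. (case (\<sigma>, x) of (\<sigma>, x) => dens \<sigma> k x) * indicator (B \<times> C) (\<sigma>, x) \<partial>lborel \<partial>?Y)"
      using d_meas BC by (intro lborel.nn_integral_fst[symmetric]) measurable
    also have "... = (\<integral>\<^sup>+\<sigma>. indicator B \<sigma> * (\<integral>\<^sup>+x. dens \<sigma> k x * indicator C x \<partial>lborel) \<partial>?Y)"
      by (intro nn_integral_cong) (auto simp: indicator_def)
    also have "... = (\<integral>\<^sup>+\<omega>. indicator B (past k \<omega>) * (\<integral>\<^sup>+x. dens (past k \<omega>) k x * indicator C x \<partial>lborel) \<partial>M)"
      by (rule nn_integral_distr) (measurable)
    finally show ?thesis .
  qed
  have tails: "emeasure ?P (B \<times> {s<..}) = emeasure ?Q (B \<times> {s<..})" if B: "B \<in> sets (points k)" for B s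
  proof -
    let ?s = "max 0 s"
    have "emeasure ?P (B \<times> {s<..}) = emeasure M {\<omega> \<in> space M. past k \<omega> \<in> B & E k \<omega> > s}"
      using rect_P[OF B, of "{s<..}"] by simp
    also have "... = emeasure M {\<omega> \<in> space M. past k \<omega> \<in> B & E k \<omega> > ?s}"
    proof (rule emeasure_eq_AE)
      show "AE \<omega> in M. (\<omega> \<in> {\<omega> \<in> space M. past k \<omega> \<in> B & E k \<omega> > s}) = (\<omega> \<in> {\<omega> \<in> space M. past k \<omega> \<in> B & E k \<omega> > ?s})"
        using E_pos by eventually_elim (use k in auto)
    qed (use B in measurable)
    also have "... = (\<integral>\<^sup>+\<omega>. indicator B (past k \<omega>) * ennreal (surv (past k \<omega>) k ?s) \<partial>M)"
      by (rule survival[OF k B]) simp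
    also have "... = (\<integral>\<^sup>+\<omega>. indicator B (past k \<omega>) * (\<integral>\<^sup>+x. dens (past k \<omega>) k x * indicator {s<..} x \<partial>lborel) \<partial>M)"
    proof (rule nn_integral_cong_AE, use increasing_past[OF k] in eventually_elim)
      case (elim \<omega>)
      have "(\<integral>\<^sup>+x. dens (past k \<omega>) k x * indicator {s<..} x \<partial>lborel) = (\<integral>\<^sup>+x. dens (past k \<omega>) k x * indicator {?s<..} x \<partial>lborel)"
        by (intro nn_integral_cong) (auto simp: dens_def indicator_def)
      then show ?case using dens_tail[OF elim, of ?s] by simp
    qed
    also have "... = emeasure ?Q (B \<times> {s<..})" using rect_Q[OF B, of "{s<..}"] by simp
    finally show ?thesis .
  qed
  have rects: "emeasure ?P (B \<times> C) = emeasure ?Q (B \<times> C)" if B: "B \<in> sets (points k)" and C: "C \<in> sets borel" for B C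
  proof -
    (* The marginals of the second coordinate on B are finite measures on the reals with equal tails. *)
    define m1 where "m1 = distr (density ?P (indicator (B \<times> UNIV))) borel snd"
    define m2 where "m2 = distr (density ?Q (indicator (B \<times> UNIV))) borel snd"
    have BU: "B \<times> UNIV \<in> sets (points k \<Otimes>\<^sub>M borel)" using B by simp
    have sQ: "sets ?Q = sets (points k \<Otimes>\<^sub>M borel)" using sets_YL by simp
    have dens_rect: "emeasure (distr (density R (indicator (B \<times> UNIV))) borel snd) D = emeasure R (B \<times> D)"
      if sR: "sets R = sets (points k \<Otimes>\<^sub>M borel)" and D: "D \<in> sets borel"
      for R :: "((nat => real) \<times> real) measure" and D
    proof -
      let ?R = "density R (indicator (B \<times> UNIV))"
      have sR': "sets ?R = sets (points k \<Otimes>\<^sub>M borel)" using sR by simp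
      have ms: "snd \<in> measurable ?R borel"
        unfolding measurable_cong_sets[OF sR' refl] by (rule measurable_snd)
      have s: "snd -` D \<inter> space ?R \<in> sets R"
        using measurable_sets[OF ms D] by simp
      have BU': "B \<times> UNIV \<in> sets R" using BU sR by simp
      have "emeasure (distr ?R borel snd) D = emeasure ?R (snd -` D \<inter> space ?R)"
        by (rule emeasure_distr[OF ms D])
      also have "... = (\<integral>\<^sup>+p. indicator (B \<times> UNIV) p * indicator (snd -` D \<inter> space ?R) p \<partial>R)"
        by (rule emeasure_density[OF borel_measurable_indicator[OF BU'] s])
      also have "... = (\<integral>\<^sup>+p. indicator (B \<times> D) p \<partial>R)"
        by (intro nn_integral_cong) (auto simp: indicator_def)
      also have "... = emeasure R (B \<times> D)" using B D sR by (intro nn_integral_indicator) simp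
      finally show ?thesis .
    qed
    have e1: "emeasure m1 D = emeasure ?P (B \<times> D)" if D: "D \<in> sets borel" for D
      unfolding m1_def by (rule dens_rect[OF _ D]) simp
    have e2: "emeasure m2 D = emeasure ?Q (B \<times> D)" if D: "D \<in> sets borel" for D
      unfolding m2_def by (rule dens_rect[OF sQ D])
    have "m1 = m2"
    proof (rule measure_eqI_lessThan)
      show "sets m1 = sets borel" "sets m2 = sets borel" unfolding m1_def m2_def by auto
      have gt: "{x<..} \<in> sets borel" for x :: real by simp
      show "emeasure m1 {x<..} < \<infinity>" for x
        unfolding e1[OF gt] infinity_ennreal_def less_top[symmetric] by (rule P.emeasure_finite)
      show "emeasure m1 {x<..} = emeasure m2 {x<..}" for x
        unfolding e1[OF gt] e2[OF gt] by (rule tails[OF B])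
    qed
    then show ?thesis using e1[OF C] e2[OF C] by simp
  qed
  show ?thesis
  proof (rule measure_eqI_generator_eq[where E = "{a \<times> b |a b. a \<in> sets (points k) & b \<in> sets borel}"
        and \<Omega> = "space (points k) \<times> space borel" and A = "\<lambda>_. space (points k) \<times> UNIV"])
    show "Int_stable {a \<times> b |a b. a \<in> sets (points k) & b \<in> sets (borel :: real measure)}"
      by (rule Int_stable_pair_measure_generator)
    show "{a \<times> b |a b. a \<in> sets (points k) & b \<in> sets (borel :: real measure)} \<subseteq> Pow (space (points k) \<times> space borel)"
      by (rule pair_measure_closed)
    show "sets ?P = sigma_sets (space (points k) \<times> space borel) {a \<times> b |a b. a \<in> sets (points k) & b \<in> sets borel}"
      by (simp add: sets_pair_measure)
    show "sets ?Q = sigma_sets (space (points k) \<times> space borel) {a \<times> b |a b. a \<in> sets (points k) & b \<in> sets borel}"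
      using sets_YL by (simp add: sets_pair_measure)
    show "emeasure ?P X = emeasure ?Q X" if "X \<in> {a \<times> b |a b. a \<in> sets (points k) & b \<in> sets borel}" for X
      using that rects by auto
    show "range (\<lambda>_::nat. space (points k) \<times> UNIV) \<subseteq> {a \<times> b |a b. a \<in> sets (points k) & b \<in> sets (borel :: real measure)}"
      by auto (metis sets.top sets_eq_imp_space_eq UNIV_I space_borel)
    show "emeasure ?P (space (points k) \<times> UNIV) ~= \<infinity>"
      unfolding infinity_ennreal_def by (rule P.emeasure_finite)
  qed auto
qed

lemma joint_nn_integral:
  assumes k: "k >= 1" and [measurable]: "(\<lambda>(\<sigma>, x). \<Phi> \<sigma> x) \<in> borel_measurable (points k \<Otimes>\<^sub>M borel)"
  shows "(\<integral>\<^sup>+\<omega>. \<Phi> (past k \<omega>) (E k \<omega>) \<partial>M)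
    = (\<integral>\<^sup>+\<omega>. (\<integral>\<^sup>+x. dens (past k \<omega>) k x * \<Phi> (past k \<omega>) x \<partial>lborel) \<partial>M)"
proof -
  let ?Y = "distr M (points k) (past k)"
  note [measurable] = E_meas[OF k] dens_measurable[OF k]
  have sets_YL: "sets (?Y \<Otimes>\<^sub>M lborel) = sets (points k \<Otimes>\<^sub>M borel)"
    by (intro sets_pair_measure_cong) auto
  have d_meas: "(\<lambda>(\<sigma>, x). dens \<sigma> k x) \<in> borel_measurable (?Y \<Otimes>\<^sub>M lborel)"
    "(\<lambda>(\<sigma>, x). \<Phi> \<sigma> x) \<in> borel_measurable (?Y \<Otimes>\<^sub>M lborel)"
    using dens_measurable[OF k] assms(2) by (simp_all add: measurable_cong_sets[OF sets_YL refl])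
  have mP: "(\<lambda>\<omega>. (past k \<omega>, E k \<omega>)) \<in> measurable M (points k \<Otimes>\<^sub>M borel)" by measurable
  have "(\<integral>\<^sup>+\<omega>. \<Phi> (past k \<omega>) (E k \<omega>) \<partial>M)
      = (\<integral>\<^sup>+p. (case p of (\<sigma>, x) => \<Phi> \<sigma> x) \<partial>distr M (points k \<Otimes>\<^sub>M borel) (\<lambda>\<omega>. (past k \<omega>, E k \<omega>)))"
    by (subst nn_integral_distr[OF mP]) (use assms(2) in simp_all)
  also have "... = (\<integral>\<^sup>+p. (case p of (\<sigma>, x) => dens \<sigma> k x) * (case p of (\<sigma>, x) => \<Phi> \<sigma> x) \<partial>(?Y \<Otimes>\<^sub>M lborel))"
    unfolding joint_law[OF k] by (rule nn_integral_density[OF d_meas])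
  also have "... = (\<integral>\<^sup>+\<sigma>. \<integral>\<^sup>+x. (case (\<sigma>, x) of (\<sigma>, x) => dens \<sigma> k x) * (case (\<sigma>, x) of (\<sigma>, x) => \<Phi> \<sigma> x) \<partial>lborel \<partial>?Y)"
    by (rule lborel.nn_integral_fst[symmetric, OF borel_measurable_times_ennreal[OF d_meas]])
  also have "... = (\<integral>\<^sup>+\<omega>. (\<integral>\<^sup>+x. (case (past k \<omega>, x) of (\<sigma>, x) => dens \<sigma> k x) * (case (past k \<omega>, x) of (\<sigma>, x) => \<Phi> \<sigma> x) \<partial>lborel) \<partial>M)"
    by (rule nn_integral_distr[OF past_meas lborel.borel_measurable_nn_integral_fst[OF borel_measurable_times_ennreal[OF d_meas]]])
  finally show ?thesis by simp
qed

end

lemma lst_raw [measurable (raw)]: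
  "g \<in> measurable N (points k) ==> (\<lambda>p. lst (g p) k) \<in> borel_measurable N"
  by (rule measurable_compose[OF _ lst_measurable])

lemma upd_raw:
  assumes "1 <= k" "g \<in> measurable N (points k)" "h \<in> borel_measurable N"
  shows "(\<lambda>p. (g p)(k := h p)) \<in> measurable N (points (Suc k))"
  using measurable_compose[OF measurable_Pair[OF assms(2,3)] upd_measurable[OF assms(1)]] by simp

context reinforcement begin

lemma lam_raw [measurable (raw)]:
  assumes "g \<in> measurable N (points k)" "h \<in> borel_measurable N"
  shows "(\<lambda>p. lam (g p) k (h p)) \<in> borel_measurable N"
  using measurable_compose[OF measurable_Pair[OF assms] lam_measurable] by simp

lemma Lam_raw [measurable (raw)]:
  assumes "g \<in> measurable N (points k)" "h \<in> borel_measurable N"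
  shows "(\<lambda>p. Lam (g p) k (h p)) \<in> borel_measurable N"
  using measurable_compose[OF measurable_Pair[OF assms] Lam_measurable] by simp

text \<open>The density of having exactly \<open>length fs\<close> further points up to \<open>s\<close>, weighted by \<open>f s z\<close> for each of these points
\<open>z\<close>, up to a factor \<open>exp (Lam \<sigma> k (lst \<sigma> k))\<close>. \<open>RR\<close> is the weight of one realisation.\<close>

primrec KK :: "(real => real => ennreal) list => real => (nat => real) => nat => ennreal" where
  "KK [] s \<sigma> k = ennreal (exp (- Lam \<sigma> k s))"
| "KK (f # fs) s \<sigma> k =
    (\<integral>\<^sup>+z. (if lst \<sigma> k < z & z <= s then ennreal (lam \<sigma> k z) * f s z * KK fs s (\<sigma>(k := z)) (Suc k) else 0) \<partial>lborel)"

primrec RR :: "(real => real => ennreal) list => real => (nat => real) => nat => ennreal" where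
  "RR [] s \<sigma> k = (if s < \<sigma> k then 1 else 0)"
| "RR (f # fs) s \<sigma> k = (if \<sigma> k <= s then f s (\<sigma> k) * RR fs s \<sigma> (Suc k) else 0)"

definition jmeas :: "(real => real => ennreal) => bool" where
  "jmeas f \<longleftrightarrow> (\<lambda>(s, z). f s z) \<in> borel_measurable (borel \<Otimes>\<^sub>M borel)"

lemma jmeas_raw:
  assumes "jmeas f" "g \<in> borel_measurable N" "h \<in> borel_measurable N"
  shows "(\<lambda>p. f (g p) (h p)) \<in> borel_measurable N"
  using measurable_compose[OF measurable_Pair[OF assms(2,3)] assms(1)[unfolded jmeas_def]] by simp

lemma KK_measurable:
  assumes "1 <= k" "\<forall>f\<in>set fs. jmeas f"
  shows "(\<lambda>(s, \<sigma>). KK fs s \<sigma> k) \<in> borel_measurable (borel \<Otimes>\<^sub>M points k)"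
  using assms
proof (induction fs arbitrary: k)
  case Nil
  show ?case unfolding KK.simps case_prod_beta by measurable
next
  case (Cons f fs)
  let ?N = "(borel \<Otimes>\<^sub>M points k) \<Otimes>\<^sub>M (lborel :: real measure)"
  have g: "(\<lambda>q. snd (fst q)) \<in> measurable ?N (points k)" by measurable
  have h: "(\<lambda>q. fst (fst q)) \<in> borel_measurable ?N" by measurable
  have z: "(\<lambda>q. snd q) \<in> borel_measurable ?N" by measurable
  note [measurable] = g h
  have [measurable]: "(\<lambda>q. f (fst (fst q)) (snd q)) \<in> borel_measurable ?N"
    using Cons.prems(2) by (intro jmeas_raw[OF _ h z]) simp
  have IH: "(\<lambda>(s, \<sigma>). KK fs s \<sigma> (Suc k)) \<in> borel_measurable (borel \<Otimes>\<^sub>M points (Suc k))"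
    using Cons.prems by (intro Cons.IH) auto
  have [measurable]: "(\<lambda>q. KK fs (fst (fst q)) ((snd (fst q))(k := snd q)) (Suc k)) \<in> borel_measurable ?N"
    using measurable_compose[OF measurable_Pair[OF h upd_raw[OF Cons.prems(1) g z]] IH] by simp
  have "(\<lambda>q. if lst (snd (fst q)) k < snd q & snd q <= fst (fst q) then ennreal (lam (snd (fst q)) k (snd q)) * f (fst (fst q)) (snd q) * KK fs (fst (fst q)) ((snd (fst q))(k := snd q)) (Suc k) else 0) \<in> borel_measurable ?N"
    by measurable
  then show ?case
    unfolding KK.simps case_prod_beta by (intro lborel.borel_measurable_nn_integral) (simp add: case_prod_beta)
qed

lemma KK_raw:
  assumes "1 <= k" "\<forall>f\<in>set fs. jmeas f" "h \<in> borel_measurable N" "g \<in> measurable N (points k)"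
  shows "(\<lambda>p. KK fs (h p) (g p) k) \<in> borel_measurable N"
  using measurable_compose[OF measurable_Pair[OF assms(3,4)] KK_measurable[OF assms(1,2)]] by simp

lemma KK_cong: "(\<And>j. j \<in> {1..<k} ==> \<sigma> j = \<tau> j) ==> KK fs s \<sigma> k = KK fs s \<tau> k"
proof (induction fs arbitrary: k \<sigma> \<tau>)
  case Nil
  then show ?case using Lam_cong[of k \<sigma> \<tau> s] by simp
next
  case (Cons f fs)
  have "lst \<sigma> k = lst \<tau> k" using Cons.prems by (auto simp: lst_def)
  moreover have "lam \<sigma> k z = lam \<tau> k z" for z using Cons.prems by (intro lam_cong) auto
  moreover have "KK fs s (\<sigma>(k := z)) (Suc k) = KK fs s (\<tau>(k := z)) (Suc k)" for z
    using Cons.prems by (intro Cons.IH) auto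
  ultimately show ?case by (simp only: KK.simps)
qed

end

context point_process begin

lemma past_Suc: "k >= 1 ==> past (Suc k) \<omega> = (past k \<omega>)(k := arr \<omega> k)"
  by (auto simp: fun_eq_iff)

lemma arr_lst: "k >= 1 ==> arr \<omega> k = lst (past k \<omega>) k + E k \<omega>"
  by (cases k) (auto simp: lst_def arr_Suc arrival_def)

text \<open>The survival factors \<open>exp (- Lam)\<close> of successive points telescope by \<open>Lam_upd\<close>, so only the hazard rates at the
points and the survival factor at \<open>s\<close> are left.\<close>

lemma KK_formula_aux:
  assumes "k >= 1" "\<Phi> \<in> borel_measurable (points k)" "\<forall>f\<in>set fs. jmeas f"
  shows "(\<integral>\<^sup>+\<omega>. \<Phi> (past k \<omega>) * (if lst (past k \<omega>) k <= s then 1 else 0) * RR fs s (arr \<omega>) k \<partial>M)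
    = (\<integral>\<^sup>+\<omega>. \<Phi> (past k \<omega>) * (if lst (past k \<omega>) k <= s then 1 else 0)
        * ennreal (exp (Lam (past k \<omega>) k (lst (past k \<omega>) k))) * KK fs s (past k \<omega>) k \<partial>M)"
  using assms
proof (induction fs arbitrary: k \<Phi>)
  case Nil
  note k = Nil(1)
  note [measurable] = Nil(2)
  let ?\<Psi> = "\<lambda>\<sigma> x. \<Phi> \<sigma> * (if lst \<sigma> k <= s then 1 else 0) * (if s < lst \<sigma> k + x then 1 else 0) :: ennreal"
  have "(\<integral>\<^sup>+\<omega>. \<Phi> (past k \<omega>) * (if lst (past k \<omega>) k <= s then 1 else 0) * RR [] s (arr \<omega>) k \<partial>M)
     = (\<integral>\<^sup>+\<omega>. ?\<Psi> (past k \<omega>) (E k \<omega>) \<partial>M)"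
    using arr_lst[OF k] by simp
  also have "... = (\<integral>\<^sup>+\<omega>. (\<integral>\<^sup>+x. dens (past k \<omega>) k x * ?\<Psi> (past k \<omega>) x \<partial>lborel) \<partial>M)"
    by (rule joint_nn_integral[OF k]) measurable
  also have "... = (\<integral>\<^sup>+\<omega>. \<Phi> (past k \<omega>) * (if lst (past k \<omega>) k <= s then 1 else 0)
        * ennreal (exp (Lam (past k \<omega>) k (lst (past k \<omega>) k))) * KK [] s (past k \<omega>) k \<partial>M)"
  proof (rule nn_integral_cong_AE, use increasing_past[OF k] in eventually_elim)
    case (elim \<omega>)
    define \<sigma> where "\<sigma> = past k \<omega>"
    have inc: "increasing \<sigma> k" using elim unfolding \<sigma>_def .
    show ?case
    proof (cases "lst \<sigma> k <= s")
      case True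
      have "(\<integral>\<^sup>+x. dens \<sigma> k x * ?\<Psi> \<sigma> x \<partial>lborel) = (\<integral>\<^sup>+x. \<Phi> \<sigma> * (dens \<sigma> k x * indicator {s - lst \<sigma> k<..} x) \<partial>lborel)"
        using True by (intro nn_integral_cong) (auto simp: indicator_def mult.commute)
      also have "... = \<Phi> \<sigma> * (\<integral>\<^sup>+x. dens \<sigma> k x * indicator {s - lst \<sigma> k<..} x \<partial>lborel)"
        by (rule nn_integral_cmult) (simp add: dens_def)
      also have "(\<integral>\<^sup>+x. dens \<sigma> k x * indicator {s - lst \<sigma> k<..} x \<partial>lborel) = ennreal (surv \<sigma> k (s - lst \<sigma> k))"
        using True by (intro dens_tail[OF inc]) simp
      also have "surv \<sigma> k (s - lst \<sigma> k) = exp (Lam \<sigma> k (lst \<sigma> k)) * exp (- Lam \<sigma> k s)"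
        unfolding surv_def by (simp add: mult_exp_exp)
      finally show ?thesis using True unfolding \<sigma>_def[symmetric] by (simp add: ennreal_mult'' mult.assoc)
    qed (simp add: \<sigma>_def)
  qed
  finally show ?case .
next
  case (Cons f fs)
  note k = Cons.prems(1)
  note [measurable] = Cons.prems(2)
  have f: "jmeas f" and fs: "\<forall>f\<in>set fs. jmeas f" using Cons.prems(3) by auto
  have Sk: "1 <= Suc k" by simp
  have sub: "(\<lambda>\<sigma>. restrict \<sigma> {1..<k}) \<in> measurable (points (Suc k)) (points k)"
    by (rule measurable_restrict_subset) auto
  note [measurable] = sub
  let ?I = "\<lambda>\<sigma> k. (if lst \<sigma> k <= s then 1 else 0) :: ennreal"
  define \<Phi>' where "\<Phi>' \<sigma> = \<Phi> (restrict \<sigma> {1..<k}) * ?I (restrict \<sigma> {1..<k}) k * f s (\<sigma> k)" for \<sigma>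
  have fk: "(\<lambda>\<sigma>. f s (\<sigma> k)) \<in> borel_measurable (points (Suc k))"
    using k by (intro jmeas_raw[OF f] measurable_component_singleton) auto
  have \<Phi>'_meas: "\<Phi>' \<in> borel_measurable (points (Suc k))"
    unfolding \<Phi>'_def using fk by measurable
  have restr: "restrict (past (Suc k) \<omega>) {1..<k} = past k \<omega>" for \<omega> by (auto simp: fun_eq_iff)
  have pk: "past (Suc k) \<omega> k = arr \<omega> k" for \<omega> using k by simp
  let ?\<Psi> = "\<lambda>\<sigma> x. \<Phi> \<sigma> * ?I \<sigma> k * (f s (lst \<sigma> k + x) * ((if lst \<sigma> k + x <= s then 1 else 0)
      * (ennreal (exp (Lam \<sigma> k (lst \<sigma> k + x))) * KK fs s (\<sigma>(k := lst \<sigma> k + x)) (Suc k))))"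
  have "(\<integral>\<^sup>+\<omega>. \<Phi> (past k \<omega>) * ?I (past k \<omega>) k * RR (f # fs) s (arr \<omega>) k \<partial>M)
      = (\<integral>\<^sup>+\<omega>. \<Phi>' (past (Suc k) \<omega>) * ?I (past (Suc k) \<omega>) (Suc k) * RR fs s (arr \<omega>) (Suc k) \<partial>M)"
    unfolding \<Phi>'_def restr pk lst_Suc[OF k] by (intro nn_integral_cong) (auto simp: mult.assoc)
  also have "... = (\<integral>\<^sup>+\<omega>. \<Phi>' (past (Suc k) \<omega>) * ?I (past (Suc k) \<omega>) (Suc k)
        * ennreal (exp (Lam (past (Suc k) \<omega>) (Suc k) (lst (past (Suc k) \<omega>) (Suc k)))) * KK fs s (past (Suc k) \<omega>) (Suc k) \<partial>M)"
    by (rule Cons.IH[OF Sk \<Phi>'_meas fs])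
  also have "... = (\<integral>\<^sup>+\<omega>. ?\<Psi> (past k \<omega>) (E k \<omega>) \<partial>M)"
  proof (intro nn_integral_cong)
    fix \<omega>
    have "Lam (past (Suc k) \<omega>) (Suc k) (arr \<omega> k) = Lam (past k \<omega>) k (arr \<omega> k)"
      unfolding past_Suc[OF k] by (rule Lam_upd[OF k])
    then show "\<Phi>' (past (Suc k) \<omega>) * ?I (past (Suc k) \<omega>) (Suc k)
        * ennreal (exp (Lam (past (Suc k) \<omega>) (Suc k) (lst (past (Suc k) \<omega>) (Suc k)))) * KK fs s (past (Suc k) \<omega>) (Suc k)
      = ?\<Psi> (past k \<omega>) (E k \<omega>)"
      unfolding \<Phi>'_def restr pk lst_Suc[OF k] arr_lst[OF k, symmetric]
      unfolding past_Suc[OF k] by (simp add: mult.assoc)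
  qed
  also have "... = (\<integral>\<^sup>+\<omega>. (\<integral>\<^sup>+x. dens (past k \<omega>) k x * ?\<Psi> (past k \<omega>) x \<partial>lborel) \<partial>M)"
  proof (rule joint_nn_integral[OF k])
    let ?N = "points k \<Otimes>\<^sub>M (borel :: real measure)"
    have m: "fst \<in> measurable ?N (points k)" "(\<lambda>q. lst (fst q) k + snd q) \<in> borel_measurable ?N" by measurable
    have [measurable]: "(\<lambda>q. f s (lst (fst q) k + snd q)) \<in> borel_measurable ?N"
      by (rule jmeas_raw[OF f _ m(2)]) simp
    have [measurable]: "(\<lambda>q. KK fs s ((fst q)(k := lst (fst q) k + snd q)) (Suc k)) \<in> borel_measurable ?N"
      by (rule KK_raw[OF Sk fs _ upd_raw[OF k m]]) simp
    show "(\<lambda>(\<sigma>, x). ?\<Psi> \<sigma> x) \<in> borel_measurable ?N"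
      unfolding case_prod_beta by measurable
  qed
  also have "... = (\<integral>\<^sup>+\<omega>. \<Phi> (past k \<omega>) * ?I (past k \<omega>) k
        * ennreal (exp (Lam (past k \<omega>) k (lst (past k \<omega>) k))) * KK (f # fs) s (past k \<omega>) k \<partial>M)"
  proof (intro nn_integral_cong)
    fix \<omega> assume w: "\<omega> \<in> space M"
    define \<sigma> where "\<sigma> = past k \<omega>"
    let ?l = "lst \<sigma> k"
    let ?g = "\<lambda>z. if ?l < z & z <= s then ennreal (lam \<sigma> k z) * f s z * KK fs s (\<sigma>(k := z)) (Suc k) else 0"
    let ?c = "\<Phi> \<sigma> * ?I \<sigma> k * ennreal (exp (Lam \<sigma> k ?l))"
    have sp: "\<sigma> \<in> space (points k)" unfolding \<sigma>_def using measurable_space[OF past_meas w] .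
    have "(\<lambda>z. \<sigma>) \<in> measurable borel (points k)" using sp by simp
    then have u: "(\<lambda>z. \<sigma>(k := z)) \<in> measurable borel (points (Suc k))"
      by (rule upd_raw[OF k]) simp
    have [measurable]: "(\<lambda>z. KK fs s (\<sigma>(k := z)) (Suc k)) \<in> borel_measurable borel"
      by (rule KK_raw[OF Sk fs _ u]) simp
    have [measurable]: "(\<lambda>z. f s z) \<in> borel_measurable borel" by (rule jmeas_raw[OF f]) auto
    have [measurable]: "(\<lambda>z. lam \<sigma> k z) \<in> borel_measurable borel" unfolding lam_def by measurable
    have g_meas: "?g \<in> borel_measurable borel" by measurable
    have "(\<integral>\<^sup>+x. dens \<sigma> k x * ?\<Psi> \<sigma> x \<partial>lborel) = (\<integral>\<^sup>+x. ?c * ?g (?l + 1 * x) \<partial>lborel)"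
    proof (intro nn_integral_cong)
      fix x
      have e: "surv \<sigma> k x * exp (Lam \<sigma> k (?l + x)) = exp (Lam \<sigma> k ?l)"
        unfolding surv_def by (simp add: mult_exp_exp add.commute)
      have e': "ennreal (surv \<sigma> k x) * ennreal (exp (Lam \<sigma> k (?l + x))) = ennreal (exp (Lam \<sigma> k ?l))"
        unfolding e[symmetric] by (rule ennreal_mult''[symmetric]) simp
      show "dens \<sigma> k x * ?\<Psi> \<sigma> x = ?c * ?g (?l + 1 * x)"
      proof (cases "0 < x & ?l + x <= s")
        case True
        then have "dens \<sigma> k x * ?\<Psi> \<sigma> x = ennreal (lam \<sigma> k (x + ?l)) * ennreal (surv \<sigma> k x) * (\<Phi> \<sigma> * ?I \<sigma> k * (f s (?l + x)
          * (ennreal (exp (Lam \<sigma> k (?l + x))) * KK fs s (\<sigma>(k := ?l + x)) (Suc k))))"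
          unfolding dens_def by simp
        also have "... = \<Phi> \<sigma> * ?I \<sigma> k * (ennreal (surv \<sigma> k x) * ennreal (exp (Lam \<sigma> k (?l + x))))
            * (ennreal (lam \<sigma> k (?l + x)) * f s (?l + x) * KK fs s (\<sigma>(k := ?l + x)) (Suc k))"
          by (simp only: mult_ac add.commute[of x])
        finally show ?thesis unfolding e' using True by simp
      qed (auto simp: dens_def)
    qed
    also have "... = ?c * (\<integral>\<^sup>+x. ?g (?l + 1 * x) \<partial>lborel)"
      using g_meas by (intro nn_integral_cmult) measurable
    also have "(\<integral>\<^sup>+x. ?g (?l + 1 * x) \<partial>lborel) = (\<integral>\<^sup>+z. ?g z \<partial>lborel)"
      using nn_integral_real_affine[of ?g 1 ?l] g_meas by simp
    finally show "(\<integral>\<^sup>+x. dens (past k \<omega>) k x * ?\<Psi> (past k \<omega>) x \<partial>lborel)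
      = \<Phi> (past k \<omega>) * ?I (past k \<omega>) k
        * ennreal (exp (Lam (past k \<omega>) k (lst (past k \<omega>) k))) * KK (f # fs) s (past k \<omega>) k"
      unfolding \<sigma>_def[symmetric] KK.simps .
  qed
  finally show ?case .
qed

lemma KK_formula:
  assumes "s >= 0" "\<forall>f\<in>set fs. jmeas f"
  shows "(\<integral>\<^sup>+\<omega>. RR fs s (arr \<omega>) 1 \<partial>M) = KK fs s (\<lambda>_. 0) 1"
proof -
  have "(\<integral>\<^sup>+\<omega>. RR fs s (arr \<omega>) 1 \<partial>M) = (\<integral>\<^sup>+\<omega>. KK fs s (past 1 \<omega>) 1 \<partial>M)"
    using KK_formula_aux[of 1 "\<lambda>_. 1" fs s] assms by (simp add: lst_def Lam_def)
  also have "... = (\<integral>\<^sup>+\<omega>. KK fs s (\<lambda>_. 0) 1 \<partial>M)"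
    by (intro nn_integral_cong KK_cong) auto
  finally show ?thesis by (simp add: emeasure_space_1)
qed

end

section \<open>Limit weights and the point process\<close>

lemma ennreal_integral_le:
  fixes f :: "'a => real"
  shows "ennreal (\<integral>x. f x \<partial>M) <= (\<integral>\<^sup>+x. ennreal (f x) \<partial>M)"
proof (cases "integrable M f")
  case True
  have fin: "(\<integral>\<^sup>+x. ennreal (f x) \<partial>M) < top"
  proof -
    have "(\<integral>\<^sup>+x. ennreal (f x) \<partial>M) <= (\<integral>\<^sup>+x. ennreal (norm (f x)) \<partial>M)"
      by (intro nn_integral_mono ennreal_leI) simp
    also have "... < top" using True by (simp add: integrable_iff_bounded)
    finally show ?thesis .
  qed
  have "(\<integral>x. f x \<partial>M) <= enn2real (\<integral>\<^sup>+x. ennreal (f x) \<partial>M)"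
    unfolding real_lebesgue_integral_def[OF True] by simp
  then have "ennreal (\<integral>x. f x \<partial>M) <= ennreal (enn2real (\<integral>\<^sup>+x. ennreal (f x) \<partial>M))" by (rule ennreal_leI)
  then show ?thesis using fin by simp
next
  case False
  then show ?thesis by (simp add: not_integrable_integral_eq)
qed

lemma Psi_exp: "Psi (exp (- x)) = psi x"
  by (simp add: Psi_def psi_def)

text \<open>The change of variables between the two pictures: a birth at time \<open>x\<close> in the life of an individual that has
age \<open>s\<close> at the end is a vertex with rescaled label \<open>exp (x - s)\<close>.\<close>

definition scaled :: "real => (nat => real) => nat => real list" where
  "scaled s \<sigma> k = map (\<lambda>j. exp (- (s - \<sigma> j))) [1..<k]"

lemma sum_list_scaled: "(\<Sum>y\<leftarrow>scaled s \<sigma> k. f y) = (\<Sum>j\<in>{1..<k}. f (exp (- (s - \<sigma> j))))"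
  unfolding scaled_def by (simp add: interv_sum_list_conv_sum_set_nat comp_def)

lemma scaled_upd: "k >= 1 ==> scaled s (\<sigma>(k := x)) (Suc k) = scaled s \<sigma> k @ [exp (- (s - x))]"
  unfolding scaled_def by simp

lemma last_scaled:
  assumes "k >= 1"
  shows "last (exp (- s) # scaled s \<sigma> k) = exp (- (s - lst \<sigma> k))"
proof (cases "k = 1")
  case True
  then show ?thesis by (simp add: scaled_def lst_def)
next
  case False
  then obtain m where "k = Suc m" "m >= 1" using assms by (cases k) auto
  then show ?thesis by (simp add: scaled_def lst_def)
qed

context reinforcement begin

lemma th_lim_nonneg: "th_lim y ys z >= 0"
proof -
  have "0 <= (1 + \<delta>) * max 0 (z - y)" using delta by simp
  moreover have "0 <= (\<Sum>x\<leftarrow>ys. max 0 (z - x))" by (intro sum_list_nonneg) auto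
  ultimately show ?thesis unfolding th_lim_def by simp
qed

lemma rate_lim_nonneg: "rate_lim y ys z >= 0"
  unfolding rate_lim_def total_lim_def using half_delta th_lim_nonneg
  by (intro divide_nonneg_nonneg mult_nonneg_nonneg) auto

lemma Glim_nonneg: "(\<And>g z. g \<in> set gs ==> 0 <= g z) ==> 0 <= Glim gs y ys"
proof (induction gs arbitrary: ys)
  case (Cons g gs)
  show ?case unfolding Glim.simps
  proof (rule Bochner_Integration.integral_nonneg)
    fix z
    have "0 <= g z" "0 <= Glim gs y (ys @ [z])" using Cons by auto
    then show "0 <= indicator {last (y # ys)<..<1} z * (rate_lim y ys z * g z * Glim gs y (ys @ [z]))"
      using rate_lim_nonneg by simp
  qed
qed simp

lemma Flim_nonneg: "0 <= Flim t z"
  by (induction t arbitrary: z) (auto intro!: Glim_nonneg)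

lemma H_lim_Lam: "H_lim (exp (- s)) (scaled s \<sigma> k) = Lam \<sigma> k s"
proof -
  have "(A * p + T) / d = A / d * p + 1 / d * T" for A p T d :: real by (simp add: add_divide_distrib)
  then show ?thesis unfolding H_lim_def Lam_def sum_list_scaled Psi_exp .
qed

text \<open>The factor \<open>exp (x - s)\<close> is the Jacobian of the change of variables. This identity is what links
the trees with the point process.\<close>

lemma rate_lim_lam:
  assumes inc: "increasing \<sigma> k" and x: "lst \<sigma> k <= x"
  shows "rate_lim (exp (- s)) (scaled s \<sigma> k) (exp (x - s)) * exp (x - s) = lam \<sigma> k x"
proof -
  let ?z = "exp (x - s)"
  have x0: "0 <= x" using inc x by (auto simp: increasing_def)
  have m: "max 0 (?z - exp (- (s - c))) = ?z * (1 - exp (- (x - c)))" if "c <= x" for c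
  proof -
    have "exp (- (s - c)) = ?z * exp (- (x - c))" by (simp add: mult_exp_exp)
    moreover have "?z * exp (- (x - c)) <= ?z * 1" using that by (intro mult_left_mono) auto
    ultimately show ?thesis by (simp add: max_def algebra_simps)
  qed
  have "th_lim (exp (- s)) (scaled s \<sigma> k) ?z = (1 + \<delta>) * (?z * (1 - exp (- x))) + (\<Sum>j\<in>{1..<k}. ?z * (1 - exp (- (x - \<sigma> j))))"
  proof -
    have s1: "max 0 (?z - exp (- s)) = ?z * (1 - exp (- x))" using m[OF x0] by simp
    have s2: "(\<Sum>j\<in>{1..<k}. max 0 (?z - exp (- (s - \<sigma> j)))) = (\<Sum>j\<in>{1..<k}. ?z * (1 - exp (- (x - \<sigma> j))))"
    proof (rule sum.cong[OF refl m])
      fix j assume "j \<in> {1..<k}"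
      then have "\<sigma> j <= lst \<sigma> k" using inc unfolding increasing_def by blast
      then show "\<sigma> j <= x" using x by simp
    qed
    show ?thesis unfolding th_lim_def sum_list_scaled s1 s2 ..
  qed
  also have "... = ?z * ((1 + \<delta>) * (1 - exp (- x)) + (\<Sum>j\<in>{1..<k}. 1 - exp (- (x - \<sigma> j))))"
    by (simp add: sum_distrib_left distrib_left mult.left_commute)
  finally have th: "th_lim (exp (- s)) (scaled s \<sigma> k) ?z = ?z * ((1 + \<delta>) * (1 - exp (- x)) + (\<Sum>j\<in>{1..<k}. 1 - exp (- (x - \<sigma> j))))" .
  have "z * A / (d * z\<^sup>2) * z = A / d" if "z > 0" "d > 0" for z A d :: real
    using that by (simp add: power2_eq_square)
  from this[OF _ half_delta, of ?z]
  have A: "?z * A / ((1 + \<delta> / 2) * ?z\<^sup>2) * ?z = A / (1 + \<delta> / 2)" for A by simp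
  have "(A * p + T) / d = A / d * p + 1 / d * T" for A p T d :: real by (simp add: add_divide_distrib)
  then show ?thesis
    unfolding rate_lim_def th total_lim_def lam_def A .
qed

text \<open>The probability that an individual of age \<open>s\<close> has a progeny of the given plane shape: its children are born at
points \<open>z\<close> of the point process and have age \<open>s - z\<close>.\<close>

primrec qq :: "ptree => real => ennreal" where
  "qq (DNode u ts) = (\<lambda>s. if s < 0 then 0 else KK (map (\<lambda>Q s z. Q (s - z)) (map qq ts)) s (\<lambda>_. 0) 1)"

abbreviation qshift :: "ptree => real => real => ennreal" where
  "qshift t \<equiv> (\<lambda>s z. qq t (s - z))"

lemma qq_eq: "s >= 0 ==> qq (DNode u ts) s = KK (map qshift ts) s (\<lambda>_. 0) 1"
  by (simp add: comp_def)

lemma jmeas_shift: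
  assumes [measurable]: "Q \<in> borel_measurable borel"
  shows "jmeas (\<lambda>s z. Q (s - z))"
  unfolding jmeas_def by measurable

lemma qq_measurable [measurable]: "qq t \<in> borel_measurable borel"
proof (induction t)
  case (DNode u ts)
  let ?fs = "map qshift ts"
  have fs: "\<forall>f\<in>set ?fs. jmeas f" using DNode jmeas_shift by auto
  have g: "(\<lambda>_. \<lambda>_. undefined) \<in> measurable borel (points 1)"
    by (rule measurable_const) (simp add: space_PiM)
  have "(\<lambda>s. KK ?fs s (\<lambda>_. undefined) 1) \<in> borel_measurable borel"
    by (rule KK_raw[OF _ fs _ g]) auto
  moreover have "KK ?fs s (\<lambda>_. undefined) 1 = KK ?fs s (\<lambda>_. 0) 1" for s by (rule KK_cong) auto
  ultimately have [measurable]: "(\<lambda>s. KK ?fs s (\<lambda>_. 0) 1) \<in> borel_measurable borel" by simp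
  have "(\<lambda>s. if s < 0 then 0 else KK ?fs s (\<lambda>_. 0) 1) \<in> borel_measurable borel" by measurable
  moreover have eq: "map (\<lambda>Q s z. Q (s - z)) (map qq ts) = ?fs" by simp
  ultimately show ?case unfolding qq.simps eq by blast
qed

lemma jmeas_qshift: "jmeas (qshift t)"
  by (rule jmeas_shift) measurable

text \<open>The integrals agree after the change of variables \<open>z = exp (x - s)\<close>. An inequality suffices later on, and
it spares the discussion of finiteness on the side of the point process.\<close>

lemma Glim_le_KK:
  assumes "\<forall>t\<in>set ts. \<forall>s>0. ennreal (Flim t (exp (- s))) <= qq t s"
    and "s > 0" "k >= 1" "increasing \<sigma> k" "lst \<sigma> k < s"
  shows "ennreal (Glim (map Flim ts) (exp (- s)) (scaled s \<sigma> k)) <= KK (map qshift ts) s \<sigma> k"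
  using assms(1,3-5)
proof (induction ts arbitrary: k \<sigma>)
  case Nil
  then show ?case by (simp add: H_lim_Lam)
next
  case (Cons t ts)
  let ?y = "exp (- s)" and ?ys = "scaled s \<sigma> k"
  let ?l = "lst \<sigma> k" and ?L = "last (exp (- s) # scaled s \<sigma> k)"
  let ?G = "\<lambda>z. Glim (map Flim ts) ?y (?ys @ [z])"
  let ?\<Phi> = "\<lambda>z. indicator {?L<..<1} z * (rate_lim ?y ?ys z * Flim t z * ?G z)"
  have L: "?L = exp (?l - s)" unfolding last_scaled[OF Cons.prems(2)] by simp
  have fc: "list_all2 fconv (map (\<lambda>t n. Fsum n t) (t # ts)) (Flim t # map Flim ts)"
    by (simp add: Fsum_fconv list_all2_map1 list_all2_map2 list_all2_same)
  have "\<forall>x\<in>set ?ys. 0 < x & x < 1"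
    unfolding scaled_def using Cons.prems(3,4) by (auto simp: increasing_def)
  then have int: "integrable lborel ?\<Phi>"
    using assms(2) by (intro Glim_integrable[OF fc]) auto
  have "ennreal (Glim (map Flim (t # ts)) ?y ?ys) <= (\<integral>\<^sup>+z. ennreal (?\<Phi> z) \<partial>lborel)"
    unfolding list.map Glim.simps by (rule ennreal_integral_le)
  also have "... = (\<integral>\<^sup>+z. ennreal (?\<Phi> z * indicator {exp (?l - s)..exp (s - s)} z) \<partial>lborel)"
    unfolding L by (intro nn_integral_cong) (auto simp: indicator_def)
  also have "... = (\<integral>\<^sup>+x. ennreal (?\<Phi> (exp (x - s)) * exp (x - s) * indicator {?l..s} x) \<partial>lborel)"
  proof (rule nn_integral_substitution)
    have "?\<Phi> \<in> borel_measurable borel" using int by (simp add: borel_measurable_integrable)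
    then show "set_borel_measurable borel {exp (?l - s)..exp (s - s)} ?\<Phi>"
      unfolding set_borel_measurable_def by measurable
    show "((\<lambda>x. exp (x - s)) has_real_derivative exp (x - s)) (at x)" for x
      by (auto intro!: derivative_eq_intros)
    show "continuous_on {?l..s} (\<lambda>x. exp (x - s))" by (intro continuous_intros)
  qed (use Cons.prems in auto)
  also have "... <= KK (map qshift (t # ts)) s \<sigma> k"
    unfolding list.map KK.simps
  proof (intro nn_integral_mono)
    fix x
    show "ennreal (?\<Phi> (exp (x - s)) * exp (x - s) * indicator {?l..s} x)
      <= (if ?l < x & x <= s then ennreal (lam \<sigma> k x) * qq t (s - x) * KK (map qshift ts) s (\<sigma>(k := x)) (Suc k) else 0)"
    proof (cases "?l < x & x < s")
      case True
      have G: "?G (exp (x - s)) = Glim (map Flim ts) ?y (scaled s (\<sigma>(k := x)) (Suc k))"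
        unfolding scaled_upd[OF Cons.prems(2)] by simp
      have inc: "increasing (\<sigma>(k := x)) (Suc k)"
      proof -
        have x0: "0 <= x" using Cons.prems(3) True by (simp add: increasing_def)
        have le: "\<sigma> j <= x" if "j \<in> {1..<k}" for j
          using Cons.prems(3) True that unfolding increasing_def by force
        show ?thesis
          unfolding increasing_def lst_Suc[OF Cons.prems(2)] using x0 le by (auto simp: less_Suc_eq)
      qed
      have IH: "ennreal (?G (exp (x - s))) <= KK (map qshift ts) s (\<sigma>(k := x)) (Suc k)"
        unfolding G by (rule Cons.IH[OF _ _ inc]) (use Cons.prems True in auto)
      have F: "ennreal (Flim t (exp (x - s))) <= qq t (s - x)"
        using Cons.prems(1)[rule_format, of t "s - x"] True by simp
      have "?\<Phi> (exp (x - s)) * exp (x - s) * indicator {?l..s} x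
          = (rate_lim ?y ?ys (exp (x - s)) * exp (x - s)) * Flim t (exp (x - s)) * ?G (exp (x - s))"
        unfolding L using True by simp
      also have "rate_lim ?y ?ys (exp (x - s)) * exp (x - s) = lam \<sigma> k x"
        using True Cons.prems by (intro rate_lim_lam) auto
      also have "ennreal (lam \<sigma> k x * Flim t (exp (x - s)) * ?G (exp (x - s)))
          = ennreal (lam \<sigma> k x) * ennreal (Flim t (exp (x - s))) * ennreal (?G (exp (x - s)))"
        by (subst ennreal_mult'', rule Glim_nonneg) (auto simp: Flim_nonneg ennreal_mult'')
      also have "... <= ennreal (lam \<sigma> k x) * qq t (s - x) * KK (map qshift ts) s (\<sigma>(k := x)) (Suc k)"
        by (intro mult_mono F IH) auto
      finally show ?thesis using True by simp
    next
      case False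
      then have "?\<Phi> (exp (x - s)) = 0 \<or> indicator {?l..s} x = (0::real)"
        unfolding L by (auto simp: indicator_def)
      then show ?thesis by auto
    qed
  qed
  finally show ?case .
qed

lemma Flim_le_qq: "s > 0 ==> ennreal (Flim t (exp (- s))) <= qq t s"
proof (induction t arbitrary: s)
  case (DNode u ts)
  have "ennreal (Glim (map Flim ts) (exp (- s)) (scaled s (\<lambda>_. 0) 1)) <= KK (map qshift ts) s (\<lambda>_. 0) 1"
    using DNode by (intro Glim_le_KK) (auto simp: increasing_def lst_def)
  then show ?case using DNode.prems by (simp add: scaled_def comp_def)
qed

text \<open>If \<open>z\<close> is uniform on \<open>(0, 1)\<close>, then \<open>- ln z\<close> is a standard exponential variable.\<close>

lemma Flim_integral_le:
  assumes e: "\<epsilon> > 0"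
  shows "ennreal (\<integral>z. indicator {0<..<1} z * (indicator {\<epsilon><..} z * Flim t z) \<partial>lborel)
    <= (\<integral>\<^sup>+s. ennreal (exponential_density 1 s) * qq t s \<partial>lborel)"
proof (cases "\<epsilon> < 1")
  case False
  have z: "indicator {0<..<1} z * (indicator {\<epsilon><..} z * Flim t z) = 0" for z
    using False by (auto simp: indicator_def)
  show ?thesis unfolding z by simp
next
  case True
  let ?\<Phi> = "\<lambda>z. indicator {0<..<1} z * (indicator {\<epsilon><..} z * Flim t z)"
  have int: "integrable lborel ?\<Phi>" by (rule Fsum_average_tendsto(2)[OF e])
  have "ennreal (\<integral>z. ?\<Phi> z \<partial>lborel) <= (\<integral>\<^sup>+z. ennreal (?\<Phi> z) \<partial>lborel)" by (rule ennreal_integral_le)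
  also have "... = (\<integral>\<^sup>+z. ennreal (?\<Phi> z * indicator {exp (ln \<epsilon>)..exp 0} z) \<partial>lborel)"
    using e by (intro nn_integral_cong) (auto simp: indicator_def)
  also have "... = (\<integral>\<^sup>+x. ennreal (?\<Phi> (exp x) * exp x * indicator {ln \<epsilon>..0} x) \<partial>lborel)"
  proof (rule nn_integral_substitution)
    have "?\<Phi> \<in> borel_measurable borel" using int by (simp add: borel_measurable_integrable)
    then show "set_borel_measurable borel {exp (ln \<epsilon>)..exp 0} ?\<Phi>"
      unfolding set_borel_measurable_def by measurable
    show "continuous_on {ln \<epsilon>..0} (exp :: real => real)" by (intro continuous_intros)
  qed (use True e in auto)
  also have "... <= (\<integral>\<^sup>+x. ennreal (exponential_density 1 (0 + (-1) * x)) * qq t (0 + (-1) * x) \<partial>lborel)"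
  proof (intro nn_integral_mono)
    fix x :: real
    show "ennreal (?\<Phi> (exp x) * exp x * indicator {ln \<epsilon>..0} x)
      <= ennreal (exponential_density 1 (0 + (-1) * x)) * qq t (0 + (-1) * x)"
    proof (cases "x < 0")
      case True
      have "ennreal (?\<Phi> (exp x) * exp x * indicator {ln \<epsilon>..0} x) <= ennreal (exp x * Flim t (exp x))"
        using Flim_nonneg[of t "exp x"] by (intro ennreal_leI) (auto simp: indicator_def mult.commute)
      also have "... = ennreal (exp x) * ennreal (Flim t (exp x))" by (rule ennreal_mult') simp
      also have "... <= ennreal (exp x) * qq t (- x)"
        using Flim_le_qq[of "- x" t] True by (intro mult_left_mono) auto
      finally show ?thesis using True by (simp add: exponential_density_def)
    next
      case False
      then have z: "?\<Phi> (exp x) = 0" by (auto simp: indicator_def)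
      show ?thesis unfolding z by simp
    qed
  qed
  also have "... = (\<integral>\<^sup>+s. ennreal (exponential_density 1 s) * qq t s \<partial>lborel)"
    using nn_integral_real_affine[of "\<lambda>s. ennreal (exponential_density 1 s) * qq t s" "-1" 0] by simp
  finally show ?thesis .
qed

end

section \<open>The branching process\<close>

abbreviation times :: "(nat => real) measure" where
  "times \<equiv> \<Pi>\<^sub>M k\<in>{1..}. borel"

lemma arrival_raw [measurable (raw)]:
  assumes "g \<in> measurable N times"
  shows "(\<lambda>p. arrival (g p) k) \<in> borel_measurable N"
proof -
  have "(\<lambda>p. g p i) \<in> borel_measurable N" if "i \<in> {1..k}" for i
    using measurable_compose[OF assms measurable_component_singleton[of i "{1..}"]] that by simp
  then show ?thesis unfolding arrival_def by (intro borel_measurable_sum)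
qed

lemma arrival_cong: "(\<And>i. i >= 1 ==> e i = e' i) ==> arrival e k = arrival e' k"
  unfolding arrival_def by (intro sum.cong) auto

text \<open>\<open>pv t x w r\<close>: the descendants of \<open>w\<close> born within time \<open>r\<close> of its birth form the plane tree \<open>t\<close>, siblings being
ordered by birth.\<close>

primrec pv :: "ptree => (nat list => nat => real) => nat list => real => bool" where
  "pv (DNode u ts) = (\<lambda>x w r. arrival (x w) (length ts) <= r & r < arrival (x w) (Suc (length ts)) &
     (\<forall>k<length ts. (map pv ts ! k) x (w @ [Suc k]) (r - arrival (x w) (Suc k))))"

text \<open>The labels on which \<open>pv t x w r\<close> depends.\<close>

definition below :: "nat list => nat list set" where
  "below w = {w @ v |v. v \<in> labels}"

lemma below_self: "w \<in> below w"
  unfolding below_def labels_def by (rule CollectI, rule exI[of _ "[]"]) simp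

lemma below_child: "below (w @ [Suc k]) \<subseteq> below w"
proof
  fix u assume "u \<in> below (w @ [Suc k])"
  then obtain v where "u = w @ (Suc k # v)" "v \<in> labels" unfolding below_def by auto
  moreover from this have "Suc k # v \<in> labels" unfolding labels_def by simp
  ultimately show "u \<in> below w" unfolding below_def by blast
qed

lemma below_labels: "w \<in> labels ==> below w \<subseteq> labels"
  unfolding below_def labels_def by auto

lemma below_disjoint: "j ~= k ==> below (w @ [j]) \<inter> below (w @ [k]) = {}"
  unfolding below_def by auto

lemma not_below_child: "w \<notin> below (w @ [k])"
  unfolding below_def by auto

lemma pv_simp: "pv (DNode u ts) x w r \<longleftrightarrow> arrival (x w) (length ts) <= r & r < arrival (x w) (Suc (length ts)) &
     (\<forall>k<length ts. pv (ts ! k) x (w @ [Suc k]) (r - arrival (x w) (Suc k)))"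
  by simp

declare pv.simps [simp del]

lemma pv_cong:
  "(\<And>u k. u \<in> below w ==> k >= 1 ==> x u k = x' u k) ==> pv t x w r = pv t x' w r"
proof (induction t arbitrary: w r)
  case (DNode u ts)
  have a: "arrival (x w) k = arrival (x' w) k" for k
    using DNode.prems below_self by (intro arrival_cong) auto
  have "pv (ts ! k) x (w @ [Suc k]) r = pv (ts ! k) x' (w @ [Suc k]) r" if "k < length ts" for k r
  proof (rule DNode.IH)
    show "ts ! k \<in> set ts" using that by simp
    fix v :: "nat list" and j :: nat assume "v \<in> below (w @ [Suc k])" "1 <= j"
    then show "x v j = x' v j" using below_child[of w k] by (intro DNode.prems) auto
  qed
  then show ?case unfolding pv_simp a by simp
qed

lemma pv_raw:
  assumes "below w \<subseteq> A" "g \<in> measurable N (\<Pi>\<^sub>M u\<in>A. times)" "h \<in> borel_measurable N"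
  shows "Measurable.pred N (\<lambda>p. pv t (g p) w (h p))"
  using assms
proof (induction t arbitrary: w h)
  case (DNode u ts)
  have w: "w \<in> A" using DNode.prems(1) below_self by blast
  have gw: "(\<lambda>p. g p w) \<in> measurable N times"
    using measurable_compose[OF DNode.prems(2) measurable_component_singleton[OF w]] .
  have a: "(\<lambda>p. arrival (g p w) k) \<in> borel_measurable N" for k by (rule arrival_raw[OF gw])
  note h = DNode.prems(3)
  have "Measurable.pred N (\<lambda>p. pv (ts ! k) (g p) (w @ [Suc k]) (h p - arrival (g p w) (Suc k)))" if "k < length ts" for k
  proof (rule DNode.IH)
    show "ts ! k \<in> set ts" using that by simp
    show "below (w @ [Suc k]) \<subseteq> A" using below_child DNode.prems(1) by (rule order_trans)
    show "(\<lambda>p. h p - arrival (g p w) (Suc k)) \<in> borel_measurable N"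
      by (rule borel_measurable_diff[OF h a])
  qed (rule DNode.prems(2))
  then have all: "{p \<in> space N. \<forall>k\<in>{..<length ts}. pv (ts ! k) (g p) (w @ [Suc k]) (h p - arrival (g p w) (Suc k))} \<in> sets N"
    unfolding pred_def by (intro sets.sets_Collect_finite_All) (simp_all only: lessThan_iff finite_lessThan)
  have "{p \<in> space N. arrival (g p w) (length ts) <= h p & h p < arrival (g p w) (Suc (length ts)) &
     (\<forall>k\<in>{..<length ts}. pv (ts ! k) (g p) (w @ [Suc k]) (h p - arrival (g p w) (Suc k)))} \<in> sets N"
    by (intro sets.sets_Collect_conj borel_measurable_le borel_measurable_less a h all)
  then show ?case unfolding pv_simp pred_def by (simp only: Ball_def lessThan_iff)
qed

context reinforcement begin

lemma RR_eq: "RR fs s \<sigma> k = (if (\<forall>i<length fs. \<sigma> (k + i) <= s) & s < \<sigma> (k + length fs)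
    then (\<Prod>i<length fs. (fs ! i) s (\<sigma> (k + i))) else 0)"
proof (induction fs arbitrary: k)
  case (Cons f fs)
  have "(\<forall>i<Suc (length fs). \<sigma> (k + i) <= s) \<longleftrightarrow> \<sigma> k <= s & (\<forall>i<length fs. \<sigma> (Suc k + i) <= s)"
    by (simp add: All_less_Suc2)
  moreover have "(\<Prod>i<Suc (length fs). ((f # fs) ! i) s (\<sigma> (k + i))) = f s (\<sigma> k) * (\<Prod>i<length fs. (fs ! i) s (\<sigma> (Suc k + i)))"
    by (simp add: prod.lessThan_Suc_shift del: prod.lessThan_Suc)
  ultimately show ?case using Cons[of "Suc k"] by auto
qed simp

end

locale branching = reinforcement \<delta> + prob_space B for \<delta> :: real and B :: "'b measure" +
  fixes X :: "nat list => nat => 'b => real" and S :: "'b => real"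
  assumes bp: "BP_realisation \<delta> B X S"
begin

lemma pp: "u \<in> labels ==> point_process \<delta> B (X u)"
  using bp unfolding BP_realisation_def by unfold_locales auto

text \<open>The point processes attached to the labels in \<open>A\<close>, as an element of a product space.\<close>

definition Xr :: "nat list set => 'b => nat list => nat => real" where
  "Xr A \<omega> = (\<lambda>u\<in>A. \<lambda>k\<in>{1..}. X u k \<omega>)"

abbreviation Xf :: "'b => nat list => nat => real" where
  "Xf \<omega> \<equiv> (\<lambda>u k. X u k \<omega>)"

lemma X_times: "u \<in> labels ==> (\<lambda>\<omega>. \<lambda>k\<in>{1..}. X u k \<omega>) \<in> measurable B times"
  using point_process.E_meas[OF pp] by (intro measurable_restrict) auto

lemma Xr_meas: "A \<subseteq> labels ==> Xr A \<in> measurable B (\<Pi>\<^sub>M u\<in>A. times)"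
  unfolding Xr_def by (rule measurable_restrict) (rule X_times, blast)

lemma pv_Xr: "below w \<subseteq> A ==> pv t (Xr A \<omega>) w r = pv t (Xf \<omega>) w r"
  by (rule pv_cong) (auto simp: Xr_def)

lemma arrival_Xr: "w \<in> A ==> arrival (Xr A \<omega> w) k = arrival (Xf \<omega> w) k"
  by (rule arrival_cong) (simp add: Xr_def)

text \<open>Disjoint sets of labels carry independent families; integrating out one of them is Fubini's theorem.\<close>

lemma independent_groups:
  assumes AC: "A \<inter> C = {}" "A \<subseteq> labels" "C \<subseteq> labels"
    and F: "(\<lambda>(a, c). F a c) \<in> borel_measurable ((\<Pi>\<^sub>M u\<in>A. times) \<Otimes>\<^sub>M (\<Pi>\<^sub>M u\<in>C. times))"
  shows "(\<integral>\<^sup>+\<omega>. F (Xr A \<omega>) (Xr C \<omega>) \<partial>B) = (\<integral>\<^sup>+\<omega>. (\<integral>\<^sup>+\<omega>'. F (Xr A \<omega>) (Xr C \<omega>') \<partial>B) \<partial>B)"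
proof -
  let ?A = "\<Pi>\<^sub>M u\<in>A. times" and ?C = "\<Pi>\<^sub>M u\<in>C. times"
  have iv: "indep_vars (\<lambda>u. times) (\<lambda>u \<omega>. \<lambda>k\<in>{1..}. X u k \<omega>) labels"
    using bp unfolding BP_realisation_def by blast
  have "indep_var ?A (Xr A) ?C (Xr C)"
    using indep_var_restrict[OF iv AC] unfolding Xr_def .
  then have D: "distr B ?A (Xr A) \<Otimes>\<^sub>M distr B ?C (Xr C) = distr B (?A \<Otimes>\<^sub>M ?C) (\<lambda>\<omega>. (Xr A \<omega>, Xr C \<omega>))"
    unfolding indep_var_distribution_eq by blast
  note mA = Xr_meas[OF AC(2)] and mC = Xr_meas[OF AC(3)]
  interpret C: prob_space "distr B ?C (Xr C)" by (rule prob_space_distr[OF mC])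
  have F': "(\<lambda>(a, c). F a c) \<in> borel_measurable (distr B ?A (Xr A) \<Otimes>\<^sub>M distr B ?C (Xr C))"
    using F by (simp add: D)
  have "(\<integral>\<^sup>+\<omega>. F (Xr A \<omega>) (Xr C \<omega>) \<partial>B) = (\<integral>\<^sup>+p. (case p of (a, c) => F a c) \<partial>distr B (?A \<Otimes>\<^sub>M ?C) (\<lambda>\<omega>. (Xr A \<omega>, Xr C \<omega>)))"
    by (subst nn_integral_distr[OF measurable_Pair[OF mA mC]]) (use F in simp_all)
  also have "... = (\<integral>\<^sup>+a. (\<integral>\<^sup>+c. F a c \<partial>distr B ?C (Xr C)) \<partial>distr B ?A (Xr A))"
    unfolding D[symmetric] using C.nn_integral_fst[OF F'] by simp
  also have "... = (\<integral>\<^sup>+\<omega>. (\<integral>\<^sup>+c. F (Xr A \<omega>) c \<partial>distr B ?C (Xr C)) \<partial>B)"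
    using C.borel_measurable_nn_integral_fst[OF F'] by (subst nn_integral_distr[OF mA]) simp_all
  also have "... = (\<integral>\<^sup>+\<omega>. (\<integral>\<^sup>+\<omega>'. F (Xr A \<omega>) (Xr C \<omega>') \<partial>B) \<partial>B)"
  proof (intro nn_integral_cong)
    fix \<omega> assume w: "\<omega> \<in> space B"
    have "Xr A \<omega> \<in> space ?A" using measurable_space[OF mA w] .
    then have "F (Xr A \<omega>) \<in> borel_measurable ?C"
      using measurable_compose[OF measurable_Pair1' F] by simp
    then show "(\<integral>\<^sup>+c. F (Xr A \<omega>) c \<partial>distr B ?C (Xr C)) = (\<integral>\<^sup>+\<omega>'. F (Xr A \<omega>) (Xr C \<omega>') \<partial>B)"
      by (intro nn_integral_distr[OF mC]) simp
  qed
  finally show ?thesis .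
qed

abbreviation pvi :: "ptree => (nat list => nat => real) => nat list => real => ennreal" where
  "pvi t x w r \<equiv> (if pv t x w r then 1 else 0)"

text \<open>The subtrees of the children live on disjoint sets of labels, away from the label \<open>w\<close> that carries their birth
times.\<close>

lemma children_independent:
  assumes w: "w \<in> labels"
    and IH: "\<And>t w r. t \<in> set ts ==> w \<in> labels ==> (\<integral>\<^sup>+\<omega>. pvi t (Xf \<omega>) w r \<partial>B) = qq t r"
  shows "m <= length ts ==> \<Phi> \<in> borel_measurable times ==>
    (\<integral>\<^sup>+\<omega>. \<Phi> (Xr {w} \<omega> w) * (\<Prod>i<m. pvi (ts ! i) (Xf \<omega>) (w @ [Suc i]) (r - arrival (Xf \<omega> w) (Suc i))) \<partial>B)
    = (\<integral>\<^sup>+\<omega>. \<Phi> (Xr {w} \<omega> w) * (\<Prod>i<m. qq (ts ! i) (r - arrival (Xf \<omega> w) (Suc i))) \<partial>B)"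
proof (induction m arbitrary: \<Phi>)
  case (Suc m)
  note [measurable] = Suc.prems(2)
  let ?A = "{w} \<union> (\<Union>i<m. below (w @ [Suc i]))" and ?C = "below (w @ [Suc m])"
  have wc: "w @ [Suc i] \<in> labels" for i using w by (auto simp: labels_def)
  have AC: "?A \<inter> ?C = {}" "?A \<subseteq> labels" "?C \<subseteq> labels"
  proof -
    have "below (w @ [Suc i]) \<inter> ?C = {}" if "i < m" for i using that by (intro below_disjoint) simp
    then show "?A \<inter> ?C = {}" using not_below_child[of w "Suc m"] by blast
    show "?C \<subseteq> labels" by (rule below_labels[OF wc])
    have "below (w @ [Suc i]) \<subseteq> labels" for i by (rule below_labels[OF wc])
    then show "?A \<subseteq> labels" using w by blast
  qed
  let ?N = "(\<Pi>\<^sub>M u\<in>?A. times) \<Otimes>\<^sub>M (\<Pi>\<^sub>M u\<in>?C. times)"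
  define F where "F a c = \<Phi> (a w) * (\<Prod>i<m. pvi (ts ! i) a (w @ [Suc i]) (r - arrival (a w) (Suc i)))
      * pvi (ts ! m) c (w @ [Suc m]) (r - arrival (a w) (Suc m))" for a c :: "nat list => nat => real"
  have wA: "w \<in> ?A" by simp
  have aw: "(\<lambda>p. fst p w) \<in> measurable ?N times"
    by (rule measurable_compose[OF measurable_fst measurable_component_singleton[OF wA]])
  have Fm: "(\<lambda>(a, c). F a c) \<in> borel_measurable ?N"
  proof -
    have ar: "(\<lambda>p. r - arrival (fst p w) k) \<in> borel_measurable ?N" for k
      by (rule borel_measurable_diff[OF borel_measurable_const arrival_raw[OF aw]])
    have pi: "Measurable.pred ?N (\<lambda>p. pv (ts ! i) (fst p) (w @ [Suc i]) (r - arrival (fst p w) (Suc i)))" if "i < m" for i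

      by (rule pv_raw[OF _ measurable_fst ar]) (use that in blast)
    have [measurable]: "Measurable.pred ?N (\<lambda>p. pv (ts ! m) (snd p) (w @ [Suc m]) (r - arrival (fst p w) (Suc m)))"
      by (rule pv_raw[OF order_refl measurable_snd ar])
    have [measurable]: "(\<lambda>p. \<Prod>i<m. pvi (ts ! i) (fst p) (w @ [Suc i]) (r - arrival (fst p w) (Suc i))) \<in> borel_measurable ?N"
      by (intro borel_measurable_prod_ennreal measurable_If measurable_const pi[unfolded pred_def] pi) auto
    have [measurable]: "(\<lambda>p. \<Phi> (fst p w)) \<in> borel_measurable ?N"
      by (rule measurable_compose[OF aw Suc.prems(2)])
    show ?thesis unfolding F_def case_prod_beta by measurable
  qed
  have Xw: "Xr ?A \<omega> w = Xr {w} \<omega> w" for \<omega> by (simp add: Xr_def)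
  have arw: "arrival (Xr {w} \<omega> w) k = arrival (Xf \<omega> w) k" for \<omega> k by (rule arrival_Xr) simp
  have FX: "F (Xr ?A \<omega>) (Xr ?C \<omega>') = \<Phi> (Xr {w} \<omega> w) * (\<Prod>i<m. pvi (ts ! i) (Xf \<omega>) (w @ [Suc i]) (r - arrival (Xf \<omega> w) (Suc i)))
      * pvi (ts ! m) (Xf \<omega>') (w @ [Suc m]) (r - arrival (Xf \<omega> w) (Suc m))" for \<omega> \<omega>'
  proof -
    have "pv (ts ! i) (Xr ?A \<omega>) (w @ [Suc i]) q = pv (ts ! i) (Xf \<omega>) (w @ [Suc i]) q" if "i < m" for i q
      using that by (intro pv_Xr) auto
    moreover have "pv (ts ! m) (Xr ?C \<omega>') (w @ [Suc m]) q = pv (ts ! m) (Xf \<omega>') (w @ [Suc m]) q" for q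
      by (intro pv_Xr) auto
    ultimately show ?thesis
      unfolding F_def Xw arw by (auto intro!: arg_cong2[where f = "(*)"] prod.cong)
  qed
  let ?\<Phi>' = "\<lambda>y. \<Phi> y * qq (ts ! m) (r - arrival y (Suc m))"
  have [measurable]: "(\<lambda>y. qq (ts ! m) (r - arrival y (Suc m))) \<in> borel_measurable times"
    by (rule measurable_compose[OF _ qq_measurable]) (intro borel_measurable_diff arrival_raw, auto)
  have \<Phi>': "?\<Phi>' \<in> borel_measurable times" by measurable
  have "(\<integral>\<^sup>+\<omega>. \<Phi> (Xr {w} \<omega> w) * (\<Prod>i<Suc m. pvi (ts ! i) (Xf \<omega>) (w @ [Suc i]) (r - arrival (Xf \<omega> w) (Suc i))) \<partial>B)
      = (\<integral>\<^sup>+\<omega>. F (Xr ?A \<omega>) (Xr ?C \<omega>) \<partial>B)"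
    unfolding FX by (simp add: mult.assoc)
  also have "... = (\<integral>\<^sup>+\<omega>. (\<integral>\<^sup>+\<omega>'. F (Xr ?A \<omega>) (Xr ?C \<omega>') \<partial>B) \<partial>B)"
    by (rule independent_groups[OF AC Fm])
  also have "... = (\<integral>\<^sup>+\<omega>. ?\<Phi>' (Xr {w} \<omega> w) * (\<Prod>i<m. pvi (ts ! i) (Xf \<omega>) (w @ [Suc i]) (r - arrival (Xf \<omega> w) (Suc i))) \<partial>B)"
  proof (intro nn_integral_cong)
    fix \<omega>
    have pm: "Measurable.pred B (\<lambda>\<omega>'. pv (ts ! m) (Xf \<omega>') (w @ [Suc m]) q)" for q
      using pv_raw[OF order_refl Xr_meas[OF AC(3)], of "\<lambda>_. q" "ts ! m"] by (simp add: pv_Xr)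
    have "(\<integral>\<^sup>+\<omega>'. F (Xr ?A \<omega>) (Xr ?C \<omega>') \<partial>B)
       = \<Phi> (Xr {w} \<omega> w) * (\<Prod>i<m. pvi (ts ! i) (Xf \<omega>) (w @ [Suc i]) (r - arrival (Xf \<omega> w) (Suc i)))
        * (\<integral>\<^sup>+\<omega>'. pvi (ts ! m) (Xf \<omega>') (w @ [Suc m]) (r - arrival (Xf \<omega> w) (Suc m)) \<partial>B)"
      unfolding FX by (rule nn_integral_cmult) (use pm in measurable)
    also have "(\<integral>\<^sup>+\<omega>'. pvi (ts ! m) (Xf \<omega>') (w @ [Suc m]) (r - arrival (Xf \<omega> w) (Suc m)) \<partial>B)
       = qq (ts ! m) (r - arrival (Xr {w} \<omega> w) (Suc m))"
      using Suc.prems(1) wc by (subst IH) (auto simp: arrival_Xr)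
    finally show "(\<integral>\<^sup>+\<omega>'. F (Xr ?A \<omega>) (Xr ?C \<omega>') \<partial>B)
       = ?\<Phi>' (Xr {w} \<omega> w) * (\<Prod>i<m. pvi (ts ! i) (Xf \<omega>) (w @ [Suc i]) (r - arrival (Xf \<omega> w) (Suc i)))"
      by (simp add: mult_ac)
  qed
  also have "... = (\<integral>\<^sup>+\<omega>. ?\<Phi>' (Xr {w} \<omega> w) * (\<Prod>i<m. qq (ts ! i) (r - arrival (Xf \<omega> w) (Suc i))) \<partial>B)"
    by (rule Suc.IH[OF _ \<Phi>']) (use Suc.prems in simp)
  also have "... = (\<integral>\<^sup>+\<omega>. \<Phi> (Xr {w} \<omega> w) * (\<Prod>i<Suc m. qq (ts ! i) (r - arrival (Xf \<omega> w) (Suc i))) \<partial>B)"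
    by (intro nn_integral_cong) (simp add: arrival_Xr mult_ac)
  finally show ?case .
qed simp

text \<open>Conditionally on the birth times of the children their progenies are independent, which leaves
the functional of one point process computed by \<open>KK_formula\<close>.\<close>

lemma pv_prob:
  assumes "w \<in> labels"
  shows "(\<integral>\<^sup>+\<omega>. pvi t (Xf \<omega>) w r \<partial>B) = qq t r"
  using assms
proof (induction t arbitrary: w r)
  case (DNode u ts)
  interpret P: point_process \<delta> B "X w" by (rule pp[OF DNode.prems])
  let ?c = "length ts"
  let ?\<Phi> = "\<lambda>y. if arrival y ?c <= r & r < arrival y (Suc ?c) then 1 else 0 :: ennreal"
  have arr: "arrival (Xr {w} \<omega> w) k = P.arr \<omega> k" for \<omega> k by (simp add: arrival_Xr)
  have "(\<integral>\<^sup>+\<omega>. pvi (DNode u ts) (Xf \<omega>) w r \<partial>B)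
      = (\<integral>\<^sup>+\<omega>. ?\<Phi> (Xr {w} \<omega> w) * (\<Prod>i<?c. pvi (ts ! i) (Xf \<omega>) (w @ [Suc i]) (r - arrival (Xf \<omega> w) (Suc i))) \<partial>B)"
  proof (intro nn_integral_cong)
    fix \<omega>
    have "(\<Prod>i<n. if Q i then 1 else 0) = (if \<forall>i<n. Q i then 1 else 0 :: ennreal)" for n and Q :: "nat => bool"
      by (induction n) (auto simp: less_Suc_eq)
    then show "pvi (DNode u ts) (Xf \<omega>) w r = ?\<Phi> (Xr {w} \<omega> w) * (\<Prod>i<?c. pvi (ts ! i) (Xf \<omega>) (w @ [Suc i]) (r - arrival (Xf \<omega> w) (Suc i)))"
      unfolding pv_simp arr by simp
  qed
  also have "... = (\<integral>\<^sup>+\<omega>. ?\<Phi> (Xr {w} \<omega> w) * (\<Prod>i<?c. qq (ts ! i) (r - arrival (Xf \<omega> w) (Suc i))) \<partial>B)"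
  proof (rule children_independent[OF DNode.prems DNode.IH])
    show "?\<Phi> \<in> borel_measurable times" by measurable
  qed auto
  also have "... = qq (DNode u ts) r"
  proof (cases "r < 0")
    case True
    have "(\<integral>\<^sup>+\<omega>. ?\<Phi> (Xr {w} \<omega> w) * (\<Prod>i<?c. qq (ts ! i) (r - arrival (Xf \<omega> w) (Suc i))) \<partial>B) = (\<integral>\<^sup>+\<omega>. 0 \<partial>B)"
    proof (rule nn_integral_cong_AE, use P.E_pos in eventually_elim)
      case (elim \<omega>)
      have "0 <= P.arr \<omega> ?c" using P.arr_mono[OF elim, of 0 ?c] by (cases "?c = 0") (auto simp: arrival_def)
      then show ?case using True unfolding arr by simp
    qed
    then show ?thesis using True by simp
  next
    case False
    have "(\<integral>\<^sup>+\<omega>. ?\<Phi> (Xr {w} \<omega> w) * (\<Prod>i<?c. qq (ts ! i) (r - arrival (Xf \<omega> w) (Suc i))) \<partial>B)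
       = (\<integral>\<^sup>+\<omega>. RR (map qshift ts) r (P.arr \<omega>) 1 \<partial>B)"
    proof (rule nn_integral_cong_AE, use P.E_pos in eventually_elim)
      case (elim \<omega>)
      have le: "P.arr \<omega> i <= P.arr \<omega> j" if "i <= j" for i j
        using P.arr_mono[OF elim, of i j] that by (cases "i = j") auto
      have eq: "(\<forall>i<?c. P.arr \<omega> (1 + i) <= r) \<longleftrightarrow> P.arr \<omega> ?c <= r"
      proof
        assume a: "\<forall>i<?c. P.arr \<omega> (1 + i) <= r"
        show "P.arr \<omega> ?c <= r"
        proof (cases ?c)
          case 0
          then show ?thesis using False by (simp add: arrival_def)
        next
          case (Suc n)
          then show ?thesis using a[rule_format, of n] by simp
        qed
      next
        assume a: "P.arr \<omega> ?c <= r"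
        show "\<forall>i<?c. P.arr \<omega> (1 + i) <= r"
          using le[of _ ?c] a by (metis Suc_eq_plus1_left Suc_leI order_trans)
      qed
      have "RR (map qshift ts) r (P.arr \<omega>) 1 = ?\<Phi> (Xr {w} \<omega> w) * (\<Prod>i<?c. qq (ts ! i) (r - P.arr \<omega> (Suc i)))"
        unfolding RR_eq arr length_map eq by (auto intro!: prod.cong)
      then show ?case by simp
    qed
    also have "... = KK (map qshift ts) r (\<lambda>_. 0) 1"
      using False jmeas_qshift by (intro P.KK_formula) auto
    finally show ?thesis using False by (simp add: qq_eq del: qq.simps)
  qed
  finally show ?case .
qed

end

section \<open>Forgetting the planar order\<close>

instance dtree :: (countable) countable
  by countable_datatype

primrec cls :: "ptree => rtree" where
  "cls (DNode u ts) = Node (mset (map cls ts))"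

text \<open>Countability of the set of classes follows from the one of plane trees.\<close>

lemma cls_surj: "\<exists>p. cls p = t"
proof (induction t)
  case (Node M)
  obtain xs where xs: "mset xs = M" using ex_mset by blast
  have "\<forall>x\<in>set xs. \<exists>p. cls p = x" using Node xs by auto
  then obtain h where h: "\<And>x. x \<in> set xs ==> cls (h x) = x" by metis
  have "map cls (map h xs) = xs" using h by (simp add: map_idI)
  then have "cls (DNode () (map h xs)) = Node M" using xs by simp
  then show ?case by blast
qed

lemma countable_rtree: "countable (UNIV :: rtree set)"
proof -
  have "(UNIV :: rtree set) = range cls" using cls_surj by (metis surj_def)
  then show ?thesis by (metis countable_image countableI_type)
qed

lemma countable_rtree_option: "countable (UNIV :: rtree option set)"
  using countable_rtree by (simp add: UNIV_option_conv)

subsection \<open>Measurability of the shape of a random tree\<close>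

text \<open>Enumerating the children turns \<open>has_shape\<close> into a countable union, as measurability requires.\<close>

lemma has_shape_list:
  "has_shape C v (Node M) \<longleftrightarrow> (\<exists>ps. mset (map snd ps) = M & distinct (map fst ps) & C v = fst ` set ps &
     (\<forall>p\<in>set ps. has_shape C (fst p) (snd p)))"
proof
  assume "has_shape C v (Node M)"
  then obtain g where g: "finite (C v)" "\<forall>u\<in>C v. has_shape C u (g u)" "M = image_mset g (mset_set (C v))"
    by (cases rule: has_shape.cases) auto
  obtain us where us: "set us = C v" "distinct us" using finite_distinct_list[OF g(1)] by blast
  let ?ps = "map (\<lambda>u. (u, g u)) us"
  have "mset (map snd ?ps) = M" using us g(3) mset_set_set[OF us(2)] by (simp add: comp_def)
  moreover have "distinct (map fst ?ps)" "C v = fst ` set ?ps" using us by (simp_all add: comp_def image_image)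
  moreover have "\<forall>p\<in>set ?ps. has_shape C (fst p) (snd p)" using us g(2) by auto
  ultimately show "\<exists>ps. mset (map snd ps) = M & distinct (map fst ps) & C v = fst ` set ps &
     (\<forall>p\<in>set ps. has_shape C (fst p) (snd p))" by blast
next
  assume "\<exists>ps. mset (map snd ps) = M & distinct (map fst ps) & C v = fst ` set ps &
     (\<forall>p\<in>set ps. has_shape C (fst p) (snd p))"
  then obtain ps where ps: "mset (map snd ps) = M" "distinct (map fst ps)" "C v = fst ` set ps"
    "\<And>p. p \<in> set ps ==> has_shape C (fst p) (snd p)" by blast
  define g where "g u = the (map_of ps u)" for u
  have g: "g (fst p) = snd p" if "p \<in> set ps" for p
    using ps(2) that unfolding g_def by (cases p) simp
  have "has_shape C v (Node (image_mset g (mset_set (C v))))"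
    by (rule has_shape.intros) (use ps(3,4) g in auto)
  moreover have "image_mset g (mset_set (C v)) = M"
  proof -
    have "mset_set (C v) = mset (map fst ps)"
      using mset_set_set[OF ps(2)] ps(3) by simp
    then have "image_mset g (mset_set (C v)) = mset (map g (map fst ps))" by (simp only: mset_map)
    also have "map g (map fst ps) = map snd ps" using g by simp
    finally show ?thesis using ps(1) by simp
  qed
  ultimately show "has_shape C v (Node M)" by simp
qed

lemma has_shape_sets:
  fixes C :: "'a => 'v::countable => 'v set"
  assumes C: "\<And>u v. {\<omega> \<in> space M. u \<in> C \<omega> v} \<in> sets M"
  shows "{\<omega> \<in> space M. has_shape (C \<omega>) v t} \<in> sets M"
proof (induction t arbitrary: v)
  case (Node N)
  have eqF: "{\<omega> \<in> space M. C \<omega> v = F} \<in> sets M" for F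
  proof -
    have "{\<omega> \<in> space M. \<forall>u. u \<in> C \<omega> v \<longleftrightarrow> u \<in> F} \<in> sets M"
    proof (rule sets.sets_Collect_countable_All)
      fix u
      show "{\<omega> \<in> space M. u \<in> C \<omega> v \<longleftrightarrow> u \<in> F} \<in> sets M"
        using C[of u v] sets.sets_Collect_neg[OF C[of u v]] by (cases "u \<in> F") simp_all
    qed
    then show ?thesis by (simp add: set_eq_iff)
  qed
  let ?P = "{ps :: ('v \<times> rtree) list. mset (map snd ps) = N & distinct (map fst ps)}"
  have cP: "countable ?P"
  proof (rule countable_subset)
    show "?P \<subseteq> lists (UNIV \<times> set_mset N)" by (force simp: in_lists_conv_set)
    show "countable (lists ((UNIV :: 'v set) \<times> set_mset N))"
      by (intro countable_lists countable_SIGMA countable_finite[OF finite_set_mset]) auto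
  qed
  have "{\<omega> \<in> space M. has_shape (C \<omega>) v (Node N)}
     = (\<Union>ps\<in>?P. {\<omega> \<in> space M. C \<omega> v = fst ` set ps & (\<forall>p\<in>set ps. has_shape (C \<omega>) (fst p) (snd p))})"
    unfolding has_shape_list by blast
  also have "... \<in> sets M"
  proof (rule sets.countable_UN'[OF cP], rule image_subsetI)
    fix ps assume ps: "ps \<in> ?P"
    have "{\<omega> \<in> space M. \<forall>p\<in>set ps. has_shape (C \<omega>) (fst p) (snd p)} \<in> sets M"
    proof (rule sets.sets_Collect_finite_All)
      fix p assume "p \<in> set ps"
      then have "snd p \<in># N" using ps by (metis (mono_tags, lifting) image_eqI list.set_map mem_Collect_eq set_mset_mset)
      then show "{\<omega> \<in> space M. has_shape (C \<omega>) (fst p) (snd p)} \<in> sets M" using Node by blast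
    qed simp
    then show "{\<omega> \<in> space M. C \<omega> v = fst ` set ps & (\<forall>p\<in>set ps. has_shape (C \<omega>) (fst p) (snd p))} \<in> sets M"
      by (intro sets.sets_Collect_conj eqF)
  qed
  finally show ?case .
qed

lemma tree_class_Some: "tree_class C v = Some t \<longleftrightarrow> has_shape C v t"
proof (cases "\<exists>t. has_shape C v t")
  case True
  then obtain t0 where t0: "has_shape C v t0" by blast
  have "(THE t. has_shape C v t) = t0"
    using t0 has_shape_unique[OF _ t0] by (rule the_equality)
  then have "tree_class C v = Some t0" unfolding tree_class_def using True by simp
  then show ?thesis using has_shape_unique[OF t0, of t] t0 by auto
qed (auto simp: tree_class_def)

lemma tree_class_measurable:
  fixes C :: "'a => 'v::countable => 'v set"
  assumes C: "\<And>u v. {\<omega> \<in> space M. u \<in> C \<omega> v} \<in> sets M"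
  shows "(\<lambda>\<omega>. tree_class (C \<omega>) v) \<in> measurable M (count_space UNIV)"
proof -
  have S: "(\<lambda>\<omega>. tree_class (C \<omega>) v) -` {Some t} \<inter> space M \<in> sets M" for t
    using has_shape_sets[of M C v t] C by (simp add: vimage_def Int_def tree_class_Some conj_commute)
  have "(\<lambda>\<omega>. tree_class (C \<omega>) v) -` {None} \<inter> space M
      = space M - (\<Union>t. (\<lambda>\<omega>. tree_class (C \<omega>) v) -` {Some t} \<inter> space M)"
    by auto
  also have "... \<in> sets M"
    using S countable_rtree by (intro sets.Diff sets.top sets.countable_UN') auto
  finally have N: "(\<lambda>\<omega>. tree_class (C \<omega>) v) -` {None} \<inter> space M \<in> sets M" .
  have "(\<lambda>\<omega>. tree_class (C \<omega>) v) -` {x} \<inter> space M \<in> sets M" for x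
    using S N by (cases x) auto
  then show ?thesis
    by (subst measurable_count_space_eq_countable[OF countable_rtree_option]) auto
qed

subsection \<open>The branching process at an exponential time\<close>

text \<open>Independence makes the joint law a product, and the second factor has the exponential density.\<close>

lemma indep_elements_nn_integral:
  assumes "prob_space M" and ind: "indep_elements M N Y borel T"
    and T: "distributed M lborel T (exponential_density 1)"
    and F: "F \<in> borel_measurable (N \<Otimes>\<^sub>M borel)"
  shows "(\<integral>\<^sup>+\<omega>. F (Y \<omega>, T \<omega>) \<partial>M)
    = (\<integral>\<^sup>+s. ennreal (exponential_density 1 s) * (\<integral>\<^sup>+\<omega>. F (Y \<omega>, s) \<partial>M) \<partial>lborel)"
proof -
  interpret prob_space M by fact
  have Y: "Y \<in> measurable M N" and Tm: "T \<in> measurable M borel"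
    and iset: "indep_set (sets (vimage_algebra (space M) Y N)) (sets (vimage_algebra (space M) T borel))"
    using ind unfolding indep_elements_def by auto
  let ?Y = "distr M N Y" and ?T = "distr M borel T"
  interpret Y: prob_space ?Y by (rule prob_space_distr[OF Y])
  interpret T: prob_space ?T by (rule prob_space_distr[OF Tm])
  interpret YT: pair_sigma_finite ?Y ?T ..
  have D: "?Y \<Otimes>\<^sub>M ?T = distr M (N \<Otimes>\<^sub>M borel) (\<lambda>\<omega>. (Y \<omega>, T \<omega>))"
  proof (rule pair_measure_eqI)
    show "sigma_finite_measure ?Y" "sigma_finite_measure ?T" by unfold_locales
    show "sets (?Y \<Otimes>\<^sub>M ?T) = sets (distr M (N \<Otimes>\<^sub>M borel) (\<lambda>\<omega>. (Y \<omega>, T \<omega>)))" by simp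
    fix A C assume A: "A \<in> sets ?Y" and C: "C \<in> sets ?T"
    have "prob ((Y -` A \<inter> space M) \<inter> (T -` C \<inter> space M)) = prob (Y -` A \<inter> space M) * prob (T -` C \<inter> space M)"
      using A C by (intro indep_setD[OF iset] in_vimage_algebra) auto
    moreover have "(\<lambda>\<omega>. (Y \<omega>, T \<omega>)) -` (A \<times> C) \<inter> space M = (Y -` A \<inter> space M) \<inter> (T -` C \<inter> space M)" by auto
    ultimately show "emeasure ?Y A * emeasure ?T C = emeasure (distr M (N \<Otimes>\<^sub>M borel) (\<lambda>\<omega>. (Y \<omega>, T \<omega>))) (A \<times> C)"
      using A C Y Tm by (subst emeasure_distr) (auto simp: emeasure_distr emeasure_eq_measure ennreal_mult'' measurable_Pair)
  qed
  have F': "F \<in> borel_measurable (?Y \<Otimes>\<^sub>M ?T)" using F by (simp add: D)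
  have dT: "?T = density lborel (exponential_density 1)"
  proof -
    have "?T = distr M lborel T" by (rule distr_cong) auto
    then show ?thesis using distributed_distr_eq_density[OF T] by simp
  qed
  have inner: "(\<lambda>s. \<integral>\<^sup>+y. F (y, s) \<partial>?Y) \<in> borel_measurable ?T"
    using Y.borel_measurable_nn_integral[of "\<lambda>s y. F (y, s)" ?T] measurable_compose[OF measurable_pair_swap' F'] by (simp add: case_prod_beta)
  have "(\<integral>\<^sup>+\<omega>. F (Y \<omega>, T \<omega>) \<partial>M) = (\<integral>\<^sup>+p. F p \<partial>(?Y \<Otimes>\<^sub>M ?T))"
    unfolding D by (subst nn_integral_distr[OF measurable_Pair[OF Y Tm]]) (use F in simp_all)
  also have "... = (\<integral>\<^sup>+s. (\<integral>\<^sup>+y. F (y, s) \<partial>?Y) \<partial>?T)"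
    by (rule YT.nn_integral_snd[symmetric]) (use F' in simp)
  also have "... = (\<integral>\<^sup>+s. (\<integral>\<^sup>+\<omega>. F (Y \<omega>, s) \<partial>M) \<partial>?T)"
  proof (intro nn_integral_cong)
    fix s
    have "(\<lambda>y. F (y, s)) \<in> borel_measurable N"
      using measurable_compose[OF measurable_Pair2' F, of s] by simp
    then show "(\<integral>\<^sup>+y. F (y, s) \<partial>?Y) = (\<integral>\<^sup>+\<omega>. F (Y \<omega>, s) \<partial>M)"
      by (intro nn_integral_distr[OF Y]) simp
  qed
  also have "... = (\<integral>\<^sup>+s. ennreal (exponential_density 1 s) * (\<integral>\<^sup>+\<omega>. F (Y \<omega>, s) \<partial>M) \<partial>lborel)"
  proof -
    have eq: "(\<lambda>s. \<integral>\<^sup>+y. F (y, s) \<partial>?Y) = (\<lambda>s. \<integral>\<^sup>+\<omega>. F (Y \<omega>, s) \<partial>M)"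
    proof
      fix s
      have "(\<lambda>y. F (y, s)) \<in> borel_measurable N"
        using measurable_compose[OF measurable_Pair2' F, of s] by simp
      then show "(\<integral>\<^sup>+y. F (y, s) \<partial>?Y) = (\<integral>\<^sup>+\<omega>. F (Y \<omega>, s) \<partial>M)"
        by (intro nn_integral_distr[OF Y]) simp
    qed
    have m: "(\<lambda>s. \<integral>\<^sup>+\<omega>. F (Y \<omega>, s) \<partial>M) \<in> borel_measurable borel"
      using inner unfolding eq by simp
    show ?thesis unfolding dT by (rule nn_integral_density) (use m in auto)
  qed
  finally show ?thesis .
qed

lemma birth_time_snoc: "birth_time x (u @ [k]) = birth_time x u + arrival (x u) k"
  unfolding birth_time_def by (simp add: nth_append)

lemma arrival_strict:
  assumes "\<forall>k\<ge>1. e k > 0" "i < j"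
  shows "arrival e i < arrival e j"
  using assms(2)
proof (induction j)
  case (Suc j)
  have "arrival e j < arrival e (Suc j)" using assms(1) by (simp add: arrival_def)
  then show ?case using Suc by (cases "i = j") auto
qed simp

lemma arrival_mono: "\<forall>k\<ge>1. e k > 0 ==> i <= j ==> arrival e i <= arrival e j"
  using arrival_strict[of e i j] by (cases "i = j") auto

lemma arrival_count_unique:
  assumes e: "\<forall>k\<ge>1. e k > 0" and "arrival e c <= r" "r < arrival e (Suc c)" "arrival e d <= r" "r < arrival e (Suc d)"
  shows "c = d"
  using arrival_mono[OF e, of "Suc c" d] arrival_mono[OF e, of "Suc d" c] assms by (cases c d rule: linorder_cases) auto

lemma snoc_label: "u \<in> labels ==> u @ [Suc k] \<in> labels"
  by (auto simp: labels_def)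

text \<open>The children born in time are exactly the first \<open>length ts\<close> ones because all inter-arrival times are positive.\<close>

lemma pv_has_shape:
  assumes pos: "\<forall>u\<in>labels. \<forall>k\<ge>1. x u k > 0"
    and "u \<in> labels" "birth_time x u <= T" "pv t x u (T - birth_time x u)"
  shows "has_shape (children (born_by x T) [] butlast) u (cls t)"
  using assms(2-)
proof (induction t arbitrary: u)
  case (DNode z ts)
  let ?C = "children (born_by x T) [] butlast" and ?c = "length ts" and ?r = "T - birth_time x u"
  note e = pos[rule_format, OF DNode.prems(1)]
  then have e: "\<forall>k\<ge>1. x u k > 0" by blast
  have pv: "arrival (x u) ?c <= ?r" "?r < arrival (x u) (Suc ?c)"
    "\<And>k. k < ?c ==> pv (ts ! k) x (u @ [Suc k]) (?r - arrival (x u) (Suc k))"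
    using DNode.prems(3) unfolding pv_simp by auto
  have born: "arrival (x u) (Suc k) <= ?r \<longleftrightarrow> k < ?c" for k
  proof
    assume "arrival (x u) (Suc k) <= ?r"
    then show "k < ?c" using arrival_mono[OF e, of "Suc ?c" "Suc k"] pv(2) by (cases "k < ?c") auto
  next
    assume "k < ?c"
    then show "arrival (x u) (Suc k) <= ?r" using arrival_mono[OF e, of "Suc k" ?c] pv(1) by simp
  qed
  have C: "?C u = (\<lambda>k. u @ [Suc k]) ` {..<?c}"
  proof (intro equalityI subsetI)
    fix w assume "w \<in> ?C u"
    then have w: "w \<in> labels" "birth_time x w <= T" "w ~= []" "butlast w = u"
      by (auto simp: children_def born_by_def)
    have "w = u @ [last w]" using w(3,4) append_butlast_last_id by metis
    moreover have "last w >= 1" using w(1,3) by (auto simp: labels_def in_lists_conv_set)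
    ultimately obtain k where k: "w = u @ [Suc k]" by (cases "last w") auto
    have "arrival (x u) (Suc k) <= ?r" using w(2) unfolding k birth_time_snoc by simp
    then show "w \<in> (\<lambda>k. u @ [Suc k]) ` {..<?c}" using born k by auto
  next
    fix w assume "w \<in> (\<lambda>k. u @ [Suc k]) ` {..<?c}"
    then obtain k where k: "k < ?c" "w = u @ [Suc k]" by auto
    have "birth_time x w <= T" using born[of k] k unfolding k(2) birth_time_snoc by simp
    then show "w \<in> ?C u" using k snoc_label[OF DNode.prems(1)] by (auto simp: children_def born_by_def)
  qed
  define g where "g w = cls (ts ! (last w - 1))" for w :: "nat list"
  have "has_shape ?C u (Node (image_mset g (mset_set (?C u))))"
  proof (rule has_shape.intros)
    show "finite (?C u)" unfolding C by simp
    show "\<forall>w\<in>?C u. has_shape ?C w (g w)"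
    proof
      fix w assume "w \<in> ?C u"
      then obtain k where k: "k < ?c" "w = u @ [Suc k]" unfolding C by auto
      have "has_shape ?C (u @ [Suc k]) (cls (ts ! k))"
      proof (rule DNode.IH)
        show "ts ! k \<in> set ts" using k by simp
        show "u @ [Suc k] \<in> labels" by (rule snoc_label[OF DNode.prems(1)])
        show "birth_time x (u @ [Suc k]) <= T" using born[of k] k unfolding birth_time_snoc by simp
        show "pv (ts ! k) x (u @ [Suc k]) (T - birth_time x (u @ [Suc k]))"
          using pv(3)[OF k(1)] unfolding birth_time_snoc by (simp add: algebra_simps)
      qed
      then show "has_shape ?C w (g w)" using k by (simp add: g_def)
    qed
  qed
  moreover have "image_mset g (mset_set (?C u)) = mset (map cls ts)"
  proof -
    have "mset_set (?C u) = image_mset (\<lambda>k. u @ [Suc k]) (mset_set {..<?c})"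
      unfolding C by (rule image_mset_mset_set[symmetric]) (auto simp: inj_on_def)
    moreover have "mset_set {..<?c} = mset [0..<?c]"
      using mset_set_set[of "[0..<?c]"] by (simp add: atLeast0LessThan)
    ultimately have "image_mset g (mset_set (?C u)) = mset (map (\<lambda>k. cls (ts ! k)) [0..<?c])"
      by (simp add: multiset.map_comp comp_def g_def)
    also have "map (\<lambda>k. cls (ts ! k)) [0..<?c] = map cls ts"
      by (rule nth_equalityI) auto
    finally show ?thesis .
  qed
  ultimately show ?case by simp
qed

lemma pv_unique:
  assumes pos: "\<forall>u\<in>labels. \<forall>k\<ge>1. x u k > 0"
  shows "u \<in> labels ==> pv t x u r ==> pv t' x u r ==> t = t'"
proof (induction t arbitrary: t' u r)
  case (DNode z ts)
  obtain z' ts' where t': "t' = DNode z' ts'" by (cases t') auto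
  have e: "\<forall>k\<ge>1. x u k > 0" using pos DNode.prems(1) by blast
  have len: "length ts = length ts'"
    using DNode.prems(2,3) unfolding t' pv_simp by (intro arrival_count_unique[OF e]) auto
  have "ts = ts'"
  proof (rule nth_equalityI[OF len])
    fix k assume k: "k < length ts"
    show "ts ! k = ts' ! k"
    proof (rule DNode.IH)
      show "ts ! k \<in> set ts" using k by simp
      show "u @ [Suc k] \<in> labels" by (rule snoc_label[OF DNode.prems(1)])
      show "pv (ts ! k) x (u @ [Suc k]) (r - arrival (x u) (Suc k))" using DNode.prems(2) k unfolding pv_simp by blast
      show "pv (ts' ! k) x (u @ [Suc k]) (r - arrival (x u) (Suc k))" using DNode.prems(3) k len unfolding t' pv_simp by simp
    qed
  qed
  then show ?case by (simp add: t')
qed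

context branching begin

lemma all_pos: "AE \<omega> in B. \<forall>u\<in>labels. \<forall>k\<ge>1. Xf \<omega> u k > 0"
proof -
  have "AE \<omega> in B. u \<in> labels --> (\<forall>k\<ge>1. X u k \<omega> > 0)" for u
    using point_process.E_pos[OF pp, of u] by (cases "u \<in> labels") auto
  then have "AE \<omega> in B. \<forall>u. u \<in> labels --> (\<forall>k\<ge>1. X u k \<omega> > 0)" by (simp add: AE_all_countable)
  then show ?thesis by eventually_elim auto
qed

lemma S_dist: "distributed B lborel S (exponential_density 1)"
  and XS_ind: "indep_elements B (\<Pi>\<^sub>M u\<in>labels. times) (Xr labels) borel S"
  using bp unfolding BP_realisation_def Xr_def by auto

lemma S_meas: "S \<in> borel_measurable B"
  using XS_ind unfolding indep_elements_def by blast

lemma S_nonneg: "AE \<omega> in B. S \<omega> >= 0"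
proof -
  have "(AE \<omega> in B. S \<omega> >= 0) \<longleftrightarrow> (AE s in distr B lborel S. s >= 0)"
    using S_meas by (subst AE_distr_iff) auto
  also have "..." unfolding distributed_distr_eq_density[OF S_dist]
    by (subst AE_density) (auto simp: exponential_density_def intro!: AE_I2 split: if_splits)
  finally show ?thesis .
qed

lemma nil_label: "[] \<in> labels"
  by (simp add: labels_def)

lemma below_nil: "below [] \<subseteq> labels"
  by (rule below_labels[OF nil_label])

lemma pvi_meas: "(\<lambda>\<omega>. pvi t (Xf \<omega>) [] (S \<omega>)) \<in> borel_measurable B"
proof -
  have "Measurable.pred B (\<lambda>\<omega>. pv t (Xr labels \<omega>) [] (S \<omega>))"
    by (rule pv_raw[OF below_nil Xr_meas S_meas]) simp
  then have [measurable]: "Measurable.pred B (\<lambda>\<omega>. pv t (Xf \<omega>) [] (S \<omega>))" using pv_Xr[OF below_nil] by simp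
  show ?thesis by measurable
qed

definition uu :: "ptree => real" where
  "uu t = enn2real (\<integral>\<^sup>+\<omega>. pvi t (Xf \<omega>) [] (S \<omega>) \<partial>B)"

lemma uu_eq: "ennreal (uu t) = (\<integral>\<^sup>+\<omega>. pvi t (Xf \<omega>) [] (S \<omega>) \<partial>B)"
proof -
  have "(\<integral>\<^sup>+\<omega>. pvi t (Xf \<omega>) [] (S \<omega>) \<partial>B) <= (\<integral>\<^sup>+\<omega>. 1 \<partial>B)" by (intro nn_integral_mono) simp
  also have "... = 1" by (simp add: emeasure_space_1)
  finally have "(\<integral>\<^sup>+\<omega>. pvi t (Xf \<omega>) [] (S \<omega>) \<partial>B) < top" by (rule order_le_less_trans) simp
  then show ?thesis unfolding uu_def by simp
qed

lemma uu_density: "ennreal (uu t) = (\<integral>\<^sup>+s. ennreal (exponential_density 1 s) * qq t s \<partial>lborel)"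
proof -
  let ?F = "\<lambda>p. pvi t (fst p) [] (snd p)"
  have [measurable]: "Measurable.pred ((\<Pi>\<^sub>M u\<in>labels. times) \<Otimes>\<^sub>M borel) (\<lambda>p. pv t (fst p) [] (snd p))"
    by (rule pv_raw[OF below_nil]) auto
  have F: "?F \<in> borel_measurable ((\<Pi>\<^sub>M u\<in>labels. times) \<Otimes>\<^sub>M borel)" by measurable
  have "(\<integral>\<^sup>+\<omega>. pvi t (Xf \<omega>) [] (S \<omega>) \<partial>B) = (\<integral>\<^sup>+\<omega>. ?F (Xr labels \<omega>, S \<omega>) \<partial>B)"
    by (simp add: pv_Xr[OF below_nil])
  also have "... = (\<integral>\<^sup>+s. ennreal (exponential_density 1 s) * (\<integral>\<^sup>+\<omega>. ?F (Xr labels \<omega>, s) \<partial>B) \<partial>lborel)"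
    by (rule indep_elements_nn_integral[OF prob_space_axioms XS_ind S_dist F])
  also have "... = (\<integral>\<^sup>+s. ennreal (exponential_density 1 s) * qq t s \<partial>lborel)"
    using pv_prob[OF nil_label] by (simp add: pv_Xr[OF below_nil])
  finally show ?thesis unfolding uu_eq .
qed

text \<open>This is the hypothesis on upper bounds in \<open>freq_conv\<close>.\<close>

lemma uu_ge:
  assumes "\<epsilon> > 0"
  shows "(\<integral>z. indicator {0<..<1} z * (indicator {\<epsilon><..} z * Flim t z) \<partial>lborel) <= uu t"
proof -
  have "ennreal (\<integral>z. indicator {0<..<1} z * (indicator {\<epsilon><..} z * Flim t z) \<partial>lborel) <= ennreal (uu t)"
    unfolding uu_density by (rule Flim_integral_le[OF assms])
  then show ?thesis by (subst (asm) ennreal_le_iff) (simp_all add: uu_def)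
qed

lemma pvi_fubini:
  fixes w :: "ptree => ennreal"
  shows "(\<integral>\<^sup>+t. ennreal (uu t) * w t \<partial>count_space UNIV)
    = (\<integral>\<^sup>+\<omega>. (\<integral>\<^sup>+t. pvi t (Xf \<omega>) [] (S \<omega>) * w t \<partial>count_space UNIV) \<partial>B)"
proof -
  define f where "f t \<omega> = pvi t (Xf \<omega>) [] (S \<omega>) * w t" for t \<omega>
  have f: "f t \<in> borel_measurable B" for t
    unfolding f_def by (rule borel_measurable_times_ennreal[OF pvi_meas borel_measurable_const])
  have "(\<integral>\<^sup>+\<omega>. (\<integral>\<^sup>+t. f t \<omega> \<partial>count_space UNIV) \<partial>B) = (\<integral>\<^sup>+t. (\<integral>\<^sup>+\<omega>. f t \<omega> \<partial>B) \<partial>count_space UNIV)"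
    using f by (rule nn_integral_count_space_nn_integral[OF countableI_type])
  then have "(\<integral>\<^sup>+\<omega>. (\<integral>\<^sup>+t. pvi t (Xf \<omega>) [] (S \<omega>) * w t \<partial>count_space UNIV) \<partial>B)
     = (\<integral>\<^sup>+t. (\<integral>\<^sup>+\<omega>. pvi t (Xf \<omega>) [] (S \<omega>) * w t \<partial>B) \<partial>count_space UNIV)"
    unfolding f_def .
  also have "... = (\<integral>\<^sup>+t. ennreal (uu t) * w t \<partial>count_space UNIV)"
    unfolding uu_eq by (rule nn_integral_cong) (rule nn_integral_multc[OF pvi_meas])
  finally show ?thesis by (rule sym)
qed

lemma pvi_single:
  assumes "\<forall>u\<in>labels. \<forall>k\<ge>1. Xf \<omega> u k > 0" "pv t (Xf \<omega>) [] (S \<omega>)"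
  shows "(\<integral>\<^sup>+t. pvi t (Xf \<omega>) [] (S \<omega>) * w t \<partial>count_space UNIV) = w t"
proof -
  have "(\<integral>\<^sup>+t. pvi t (Xf \<omega>) [] (S \<omega>) * w t \<partial>count_space UNIV) = (\<integral>\<^sup>+t'. w t * indicator {t} t' \<partial>count_space UNIV)"
  proof (rule nn_integral_cong)
    fix t'
    show "pvi t' (Xf \<omega>) [] (S \<omega>) * w t' = w t * indicator {t} t'"
    proof (cases "t' = t")
      case True
      then show ?thesis using assms(2) by simp
    next
      case False
      then have "\<not> pv t' (Xf \<omega>) [] (S \<omega>)" using pv_unique[OF assms(1) nil_label assms(2)] by metis
      then show ?thesis using False by simp
    qed
  qed
  also have "... = w t" by (simp add: nn_integral_cmult_indicator)
  finally show ?thesis .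
qed

text \<open>Almost surely at most one plane shape is realised.\<close>

lemma uu_total_le: "(\<integral>\<^sup>+t. ennreal (uu t) \<partial>count_space UNIV) <= 1"
proof -
  have "(\<integral>\<^sup>+t. ennreal (uu t) \<partial>count_space UNIV) = (\<integral>\<^sup>+\<omega>. (\<integral>\<^sup>+t. pvi t (Xf \<omega>) [] (S \<omega>) * 1 \<partial>count_space UNIV) \<partial>B)"
    using pvi_fubini[of "\<lambda>_. 1"] by simp
  also have "... <= (\<integral>\<^sup>+\<omega>. 1 \<partial>B)"
  proof (rule nn_integral_mono_AE, use all_pos in eventually_elim)
    case (elim \<omega>)
    show ?case
    proof (cases "\<exists>t. pv t (Xf \<omega>) [] (S \<omega>)")
      case True
      then obtain t where "pv t (Xf \<omega>) [] (S \<omega>)" by blast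
      from pvi_single[OF elim this, of "\<lambda>_. 1"] show ?thesis by (simp only: order_refl)
    next
      case False
      then show ?thesis by simp
    qed
  qed
  finally show ?thesis by (simp add: emeasure_space_1)
qed

lemma uu_sum_le:
  assumes "finite G"
  shows "(\<Sum>t\<in>G. uu t) <= 1"
proof -
  have "ennreal (\<Sum>t\<in>G. uu t) = (\<Sum>t\<in>G. ennreal (uu t))" by (rule sum_ennreal[symmetric]) (simp add: uu_def)
  also have "... = (\<integral>\<^sup>+t. ennreal (uu t) * indicator G t \<partial>count_space UNIV)"
    using assms by (subst nn_integral_count_space_indicator[symmetric]) (auto simp: nn_integral_count_space_finite)
  also have "... <= (\<integral>\<^sup>+t. ennreal (uu t) \<partial>count_space UNIV)"
    by (intro nn_integral_mono) (auto simp: indicator_def)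
  also have "... <= ennreal 1" using uu_total_le by simp
  finally show ?thesis by (subst (asm) ennreal_le_iff) simp_all
qed

text \<open>All hypotheses of \<open>freq_conv\<close> hold for the probabilities of the branching process.\<close>

theorem ptree_conv: "conv_hist (freq ptree_of t) (uu t)"
  by (rule freq_conv(1)[OF _ uu_ge uu_sum_le]) (simp_all add: uu_def)

lemma uu_tight: "\<eta> > 0 ==> \<exists>G. finite G & (\<Sum>t\<in>G. uu t) >= 1 - \<eta>"
  by (rule freq_conv(2)[OF _ uu_ge uu_sum_le]) (simp_all add: uu_def)

text \<open>Tightness of the trees shows that the branching process is almost surely finite at the exponential time.\<close>

lemma uu_total: "(\<integral>\<^sup>+t. ennreal (uu t) \<partial>count_space UNIV) = 1"
proof (rule antisym[OF uu_total_le])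
  show "1 <= (\<integral>\<^sup>+t. ennreal (uu t) \<partial>count_space UNIV)"
  proof (rule ennreal_le_epsilon)
    fix e :: real assume e: "0 < e"
    obtain G where G: "finite G" "(\<Sum>t\<in>G. uu t) >= 1 - e" using uu_tight[OF e] by blast
    have "1 <= ennreal ((\<Sum>t\<in>G. uu t) + e)" using G(2) by (simp add: ennreal_ge_1)
    also have "... = (\<Sum>t\<in>G. ennreal (uu t)) + ennreal e"
      using e by (subst ennreal_plus) (auto intro!: sum_nonneg simp: uu_def sum_ennreal)
    also have "(\<Sum>t\<in>G. ennreal (uu t)) = (\<integral>\<^sup>+t. ennreal (uu t) * indicator G t \<partial>count_space UNIV)"
      using G(1) by (subst nn_integral_count_space_indicator[symmetric]) (auto simp: nn_integral_count_space_finite)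
    also have "... <= (\<integral>\<^sup>+t. ennreal (uu t) \<partial>count_space UNIV)"
      by (intro nn_integral_mono) (auto simp: indicator_def)
    finally show "1 <= (\<integral>\<^sup>+t. ennreal (uu t) \<partial>count_space UNIV) + ennreal e" by (simp add: add_right_mono)
  qed
qed

definition U :: "ptree pmf" where
  "U = embed_pmf uu"

lemma pmf_U: "pmf U t = uu t"
  unfolding U_def by (rule pmf_embed_pmf) (simp_all add: uu_total, simp add: uu_def)

lemma BP_tree_measurable: "(\<lambda>\<omega>. BP_tree (Xf \<omega>) (S \<omega>)) \<in> measurable B (count_space UNIV)"
  unfolding BP_tree_def
proof (rule tree_class_measurable)
  fix u v :: "nat list"
  have bt: "(\<lambda>\<omega>. birth_time (Xf \<omega>) u) \<in> borel_measurable B" if "u \<in> labels"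
    unfolding birth_time_def
  proof (intro borel_measurable_sum)
    fix i assume "i \<in> {..<length u}"
    have "take i u \<in> labels" using that by (auto simp: labels_def in_lists_conv_set dest: in_set_takeD)
    then show "(\<lambda>\<omega>. arrival (Xf \<omega> (take i u)) (u ! i)) \<in> borel_measurable B"
      using point_process.arr_meas[OF pp] by blast
  qed
  show "{\<omega> \<in> space B. u \<in> children (born_by (Xf \<omega>) (S \<omega>)) [] butlast v} \<in> sets B"
  proof (cases "u \<in> labels & u ~= [] & butlast u = v")
    case True
    then have "{\<omega> \<in> space B. u \<in> children (born_by (Xf \<omega>) (S \<omega>)) [] butlast v} = {\<omega> \<in> space B. birth_time (Xf \<omega>) u <= S \<omega>}"
      by (auto simp: children_def born_by_def)
    then show ?thesis using True bt S_meas by (simp add: borel_measurable_le)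
  next
    case False
    then have e: "{\<omega> \<in> space B. u \<in> children (born_by (Xf \<omega>) (S \<omega>)) [] butlast v} = {}"
      by (auto simp: children_def born_by_def)
    show ?thesis unfolding e by (rule sets.empty_sets)
  qed
qed

lemma BP_law_sets: "sets (BP_law B X S) = UNIV"
  by (simp add: BP_law_def)

lemma BP_law_prob: "prob_space (BP_law B X S)"
  unfolding BP_law_def by (rule prob_space_distr[OF BP_tree_measurable])

text \<open>On the event that a plane shape is realised, it determines the class. This gives one inequality
between the two probability measures, and hence equality.\<close>

lemma BP_law_eq: "BP_law B X S = measure_pmf (map_pmf (Some \<circ> cls) U)"
proof -
  let ?L = "BP_law B X S" and ?V = "measure_pmf (map_pmf (Some \<circ> cls) U)"
  interpret L: prob_space ?L by (rule BP_law_prob)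
  have le: "emeasure ?V A <= emeasure ?L A" for A
  proof -
    have "emeasure ?V A = (\<integral>\<^sup>+t. indicator A (Some (cls t)) \<partial>measure_pmf U)"
    proof -
      have "emeasure ?V A = (\<integral>\<^sup>+x. indicator A x \<partial>?V)" by (rule nn_integral_indicator[symmetric]) simp
      also have "... = (\<integral>\<^sup>+t. indicator A (Some (cls t)) \<partial>measure_pmf U)"
        by (simp only: nn_integral_map_pmf comp_def)
      finally show ?thesis .
    qed
    also have "... = (\<integral>\<^sup>+t. ennreal (uu t) * indicator A (Some (cls t)) \<partial>count_space UNIV)"
      by (simp add: nn_integral_measure_pmf pmf_U)
    also have "... = (\<integral>\<^sup>+\<omega>. (\<integral>\<^sup>+t. pvi t (Xf \<omega>) [] (S \<omega>) * indicator A (Some (cls t)) \<partial>count_space UNIV) \<partial>B)"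
      by (rule pvi_fubini)
    also have "... <= (\<integral>\<^sup>+\<omega>. indicator A (BP_tree (Xf \<omega>) (S \<omega>)) \<partial>B)"
    proof (rule nn_integral_mono_AE, use all_pos S_nonneg in eventually_elim)
      case (elim \<omega>)
      show ?case
      proof (cases "\<exists>t. pv t (Xf \<omega>) [] (S \<omega>)")
        case True
        then obtain t where t: "pv t (Xf \<omega>) [] (S \<omega>)" by blast
        have "has_shape (children (born_by (Xf \<omega>) (S \<omega>)) [] butlast) [] (cls t)"
          using t elim(2) by (intro pv_has_shape[OF elim(1) nil_label]) (simp_all add: birth_time_def)
        then have "BP_tree (Xf \<omega>) (S \<omega>) = Some (cls t)" unfolding BP_tree_def tree_class_Some .
        then show ?thesis using pvi_single[OF elim(1) t, of "\<lambda>t. indicator A (Some (cls t))"] by simp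
      next
        case False
        then show ?thesis by simp
      qed
    qed
    also have "... = (\<integral>\<^sup>+x. indicator A x \<partial>?L)"
      unfolding BP_law_def by (rule nn_integral_distr[OF BP_tree_measurable, symmetric]) simp
    also have "... = emeasure ?L A" by (rule nn_integral_indicator) (simp add: BP_law_sets)
    finally show ?thesis .
  qed
  show ?thesis
  proof (rule measure_eqI)
    fix A assume "A \<in> sets ?L"
    have sp: "space ?L = UNIV" by (simp add: BP_law_def)
    have l: "measure ?V A <= measure ?L A" for A
      using le[of A] by (simp add: L.emeasure_eq_measure measure_pmf.emeasure_eq_measure)
    have "measure ?L A = 1 - measure ?L (- A)"
      using L.prob_compl[of "- A"] sp by (simp add: BP_law_sets Compl_eq_Diff_UNIV Diff_Diff_Int)
    also have "... <= 1 - measure ?V (- A)" using l[of "- A"] by simp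
    also have "... = measure ?V A"
      using measure_pmf.prob_compl[of A "map_pmf (Some \<circ> cls) U"] by (simp add: Compl_eq_Diff_UNIV)
    finally have "measure ?L A = measure ?V A" using l[of A] by simp
    then show "emeasure ?L A = emeasure ?V A" by (simp add: L.emeasure_eq_measure measure_pmf.emeasure_eq_measure)
  qed (simp add: BP_law_sets)
qed

end

section \<open>The number of children at an exponential time\<close>

context reinforcement begin

text \<open>The probability that exactly \<open>c\<close> points precede an independent exponential time. The formula does not mention
the underlying space, so it compares different realisations.\<close>

definition degree_prob :: "nat => ennreal" where
  "degree_prob c = (\<integral>\<^sup>+s. ennreal (exponential_density 1 s) * KK (replicate c (\<lambda>_ _. 1)) s (\<lambda>_. 0) 1 \<partial>lborel)"

end

context point_process begin

lemma count_at_time: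
  assumes "s >= 0"
  shows "(\<integral>\<^sup>+\<omega>. (if arr \<omega> c <= s & s < arr \<omega> (Suc c) then 1 else 0) \<partial>M) = KK (replicate c (\<lambda>_ _. 1)) s (\<lambda>_. 0) 1"
proof -
  have "(\<integral>\<^sup>+\<omega>. (if arr \<omega> c <= s & s < arr \<omega> (Suc c) then 1 else 0) \<partial>M)
      = (\<integral>\<^sup>+\<omega>. RR (replicate c (\<lambda>_ _. 1)) s (arr \<omega>) 1 \<partial>M)"
  proof (rule nn_integral_cong_AE, use E_pos in eventually_elim)
    case (elim \<omega>)
    have eq: "(\<forall>i<c. arr \<omega> (1 + i) <= s) \<longleftrightarrow> arr \<omega> c <= s"
    proof
      assume a: "\<forall>i<c. arr \<omega> (1 + i) <= s"
      show "arr \<omega> c <= s"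
      proof (cases c)
        case 0
        then show ?thesis using assms by simp
      next
        case (Suc n)
        then show ?thesis using a[rule_format, of n] by simp
      qed
    next
      assume a: "arr \<omega> c <= s"
      show "\<forall>i<c. arr \<omega> (1 + i) <= s"
      proof (intro allI impI)
        fix i assume "i < c"
        then have "arr \<omega> (1 + i) <= arr \<omega> c" by (intro arrival_mono[OF elim]) simp
        then show "arr \<omega> (1 + i) <= s" using a by simp
      qed
    qed
    show ?case unfolding RR_eq length_replicate eq by simp
  qed
  also have "... = KK (replicate c (\<lambda>_ _. 1)) s (\<lambda>_. 0) 1"
    using assms by (intro KK_formula) (auto simp: jmeas_def)
  finally show ?thesis .
qed

lemma count_at_exponential_time:
  assumes "indep_elements M N Y borel T" "distributed M lborel T (exponential_density 1)"
    and g: "\<And>k. (\<lambda>y. arrival (g y) k) \<in> borel_measurable N"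
    and gY: "\<And>\<omega> k. arrival (g (Y \<omega>)) k = arr \<omega> k"
  shows "(\<integral>\<^sup>+\<omega>. (if arr \<omega> c <= T \<omega> & T \<omega> < arr \<omega> (Suc c) then 1 else 0) \<partial>M) = degree_prob c"
proof -
  let ?F = "\<lambda>p. if arrival (g (fst p)) c <= snd p & snd p < arrival (g (fst p)) (Suc c) then 1 else 0 :: ennreal"
  have [measurable]: "(\<lambda>p. arrival (g (fst p)) k) \<in> borel_measurable (N \<Otimes>\<^sub>M (borel :: real measure))" for k
    by (rule measurable_compose[OF measurable_fst g])
  have F: "?F \<in> borel_measurable (N \<Otimes>\<^sub>M borel)" by measurable
  have "(\<integral>\<^sup>+\<omega>. (if arr \<omega> c <= T \<omega> & T \<omega> < arr \<omega> (Suc c) then 1 else 0) \<partial>M) = (\<integral>\<^sup>+\<omega>. ?F (Y \<omega>, T \<omega>) \<partial>M)"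
    by (simp add: gY)
  also have "... = (\<integral>\<^sup>+s. ennreal (exponential_density 1 s) * (\<integral>\<^sup>+\<omega>. ?F (Y \<omega>, s) \<partial>M) \<partial>lborel)"
    by (rule indep_elements_nn_integral[OF prob_space_axioms assms(1,2) F])
  also have "... = degree_prob c"
    unfolding degree_prob_def
  proof (intro nn_integral_cong)
    fix s :: real
    show "ennreal (exponential_density 1 s) * (\<integral>\<^sup>+\<omega>. ?F (Y \<omega>, s) \<partial>M)
      = ennreal (exponential_density 1 s) * KK (replicate c (\<lambda>_ _. 1)) s (\<lambda>_. 0) 1"
    proof (cases "s < 0")
      case True
      then show ?thesis by (simp add: exponential_density_def)
    next
      case False
      then show ?thesis using count_at_time[of s c] by (simp add: gY)
    qed
  qed
  finally show ?thesis .
qed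

subsection \<open>The mean number of points is at least one\<close>

text \<open>A primitive of \<open>exp (- z) * lam \<sigma> k z\<close>.\<close>

definition prim :: "(nat => real) => nat => real => real" where
  "prim \<sigma> k z = - (ca + cb * (real k - 1)) * exp (- z) + exp (- 2 * z) / 2 * (ca + cb * (\<Sum>j\<in>{1..<k}. exp (\<sigma> j)))"

lemma prim_deriv:
  assumes "k >= 1"
  shows "((\<lambda>x. prim \<sigma> k (x + c)) has_real_derivative exp (- (x + c)) * lam \<sigma> k (x + c)) (at x within S)"
proof -
  let ?A = "ca + cb * (real k - 1)" and ?B = "ca + cb * (\<Sum>j\<in>{1..<k}. exp (\<sigma> j))"
  have "((\<lambda>x. prim \<sigma> k (x + c)) has_real_derivative ?A * exp (- (x + c)) - exp (- 2 * (x + c)) * ?B) (at x within S)"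
    unfolding prim_def
  proof -
    define A B where "A = ?A" and "B = ?B"
    have "((\<lambda>x. - A * exp (- (x + c)) + exp (- 2 * (x + c)) / 2 * B) has_real_derivative A * exp (- (x + c)) - exp (- 2 * (x + c)) * B) (at x within S)"
      by (auto intro!: derivative_eq_intros)
    then show "((\<lambda>x. - ?A * exp (- (x + c)) + exp (- 2 * (x + c)) / 2 * ?B) has_real_derivative ?A * exp (- (x + c)) - exp (- 2 * (x + c)) * ?B) (at x within S)"
      unfolding A_def B_def .
  qed
  moreover have "exp (- (x + c)) * lam \<sigma> k (x + c) = ?A * exp (- (x + c)) - exp (- 2 * (x + c)) * ?B"
  proof -
    let ?z = "x + c"
    have e2: "exp (- 2 * ?z) = exp (- ?z) * exp (- ?z)" by (simp add: mult_exp_exp)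
    have s: "(\<Sum>j\<in>{1..<k}. 1 - exp (- (?z - \<sigma> j))) = (real k - 1) - exp (- ?z) * (\<Sum>j\<in>{1..<k}. exp (\<sigma> j))"
    proof -
      have "(\<Sum>j\<in>{1..<k}. 1 - exp (- (?z - \<sigma> j))) = (\<Sum>j\<in>{1..<k}. 1 - exp (- ?z) * exp (\<sigma> j))"
        by (intro sum.cong) (simp_all add: mult_exp_exp)
      also have "... = real (card {1..<k}) - exp (- ?z) * (\<Sum>j\<in>{1..<k}. exp (\<sigma> j))"
        by (simp add: sum_subtractf sum_distrib_left)
      finally show ?thesis using assms by (simp add: of_nat_diff)
    qed
    have "e * (a * (1 - e) + b * (n - e * S)) = (a + b * n) * e - e * e * (a + b * S)" for e a b n S :: real
      by (simp add: algebra_simps)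
    then show ?thesis unfolding lam_def s e2 .
  qed
  ultimately show ?thesis by simp
qed

lemma prim_measurable:
  assumes "g \<in> measurable N (points k)" "h \<in> borel_measurable N"
  shows "(\<lambda>p. prim (g p) k (h p)) \<in> borel_measurable N"
proof -
  note [measurable] = assms
  show ?thesis unfolding prim_def by measurable
qed

definition gain :: "nat => 'm => real" where
  "gain k \<omega> = prim (past k \<omega>) k (arr \<omega> k) - prim (past k \<omega>) k (arr \<omega> (k - 1))"

text \<open>The density of the next point is its hazard rate times its survival function, and by Fubini's theorem the
survival function is the probability that the point has not come yet.\<close>

lemma compensator:
  assumes k: "k >= 1"
  shows "(\<integral>\<^sup>+\<omega>. ennreal (exp (- arr \<omega> k)) \<partial>M) = (\<integral>\<^sup>+\<omega>. ennreal (gain k \<omega>) \<partial>M)"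
    and "AE \<omega> in M. gain k \<omega> >= 0"
proof -
  let ?\<phi> = "\<lambda>\<sigma> x. ennreal (exp (- (x + lst \<sigma> k)) * lam \<sigma> k (x + lst \<sigma> k))"
  let ?G = "\<lambda>\<sigma> y. (\<integral>\<^sup>+x. ?\<phi> \<sigma> x * (if 0 < x & x < y then 1 else 0) \<partial>lborel)"
  have gain_nn: "AE \<omega> in M. ennreal (gain k \<omega>) = ?G (past k \<omega>) (E k \<omega>) & gain k \<omega> >= 0"
    using increasing_past[OF k] E_pos
  proof eventually_elim
    case (elim \<omega>)
    define \<sigma> where "\<sigma> = past k \<omega>"
    have inc: "increasing \<sigma> k" using elim(1) unfolding \<sigma>_def .
    have E0: "0 < E k \<omega>" using elim(2) k by blast
    have g: "gain k \<omega> = prim \<sigma> k (E k \<omega> + lst \<sigma> k) - prim \<sigma> k (0 + lst \<sigma> k)"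
      unfolding gain_def \<sigma>_def lst_past[OF k] arr_lst[OF k] by (simp add: add.commute)
    have nn: "0 <= exp (- (x + lst \<sigma> k)) * lam \<sigma> k (x + lst \<sigma> k)" if "0 <= x" for x
      using that by (intro mult_nonneg_nonneg lam_nonneg[OF inc]) auto
    have "?G \<sigma> (E k \<omega>) = (\<integral>\<^sup>+x. ennreal (exp (- (x + lst \<sigma> k)) * lam \<sigma> k (x + lst \<sigma> k)) * indicator {0..E k \<omega>} x \<partial>lborel)"
    proof (rule nn_integral_cong_AE)
      have "AE x in lborel. x ~= (0::real)" "AE x in lborel. x ~= E k \<omega>" by (rule AE_lborel_singleton)+
      then show "AE x in lborel. ?\<phi> \<sigma> x * (if 0 < x & x < E k \<omega> then 1 else 0)
        = ennreal (exp (- (x + lst \<sigma> k)) * lam \<sigma> k (x + lst \<sigma> k)) * indicator {0..E k \<omega>} x"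
        by eventually_elim (auto simp: indicator_def)
    qed
    also have "... = ennreal (gain k \<omega>)"
      unfolding g
    proof (rule nn_integral_FTC_Icc)
      show "((\<lambda>x. prim \<sigma> k (x + lst \<sigma> k)) has_real_derivative exp (- (x + lst \<sigma> k)) * lam \<sigma> k (x + lst \<sigma> k)) (at x)" for x
        by (rule prim_deriv[OF k])
      show "(\<lambda>x. exp (- (x + lst \<sigma> k)) * lam \<sigma> k (x + lst \<sigma> k)) \<in> borel_measurable borel" by measurable
    qed (use nn E0 in auto)
    finally have 1: "ennreal (gain k \<omega>) = ?G \<sigma> (E k \<omega>)" by simp
    have "prim \<sigma> k (0 + lst \<sigma> k) <= prim \<sigma> k (E k \<omega> + lst \<sigma> k)"
    proof (rule DERIV_nonneg_imp_nondecreasing[OF less_imp_le[OF E0]])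
      fix x assume "0 <= x" "x <= E k \<omega>"
      then show "\<exists>y. DERIV (\<lambda>x. prim \<sigma> k (x + lst \<sigma> k)) x :> y & 0 <= y"
        using prim_deriv[OF k, of \<sigma> "lst \<sigma> k" x UNIV] nn[of x] by blast
    qed
    then have "gain k \<omega> >= 0" unfolding g by simp
    with 1 show ?case unfolding \<sigma>_def by blast
  qed
  then show "AE \<omega> in M. gain k \<omega> >= 0" by eventually_elim blast
  have \<phi>m: "(\<lambda>q. ?\<phi> (f q) (h q)) \<in> borel_measurable N"
    if [measurable]: "f \<in> measurable N (points k)" "h \<in> borel_measurable N" for f h and N :: "'n measure"
    by measurable
  have Gm: "(\<lambda>(\<sigma>, y). ?G \<sigma> y) \<in> borel_measurable (points k \<Otimes>\<^sub>M borel)"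
  proof -
    let ?N = "(points k \<Otimes>\<^sub>M (borel :: real measure)) \<Otimes>\<^sub>M (lborel :: real measure)"
    have m: "(\<lambda>q. fst (fst q)) \<in> measurable ?N (points k)" "(\<lambda>q. snd (fst q)) \<in> borel_measurable ?N" "(\<lambda>q. snd q) \<in> borel_measurable ?N" by measurable
    note [measurable] = m
    have "(\<lambda>q. ?\<phi> (fst (fst q)) (snd q) * (if 0 < snd q & snd q < snd (fst q) then 1 else 0)) \<in> borel_measurable ?N"
      by measurable
    then show ?thesis
      unfolding case_prod_beta by (intro lborel.borel_measurable_nn_integral) (simp add: case_prod_beta)
  qed
  have "(\<integral>\<^sup>+\<omega>. ennreal (gain k \<omega>) \<partial>M) = (\<integral>\<^sup>+\<omega>. ?G (past k \<omega>) (E k \<omega>) \<partial>M)"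
    by (rule nn_integral_cong_AE) (use gain_nn in \<open>eventually_elim, blast\<close>)
  also have "... = (\<integral>\<^sup>+\<omega>. (\<integral>\<^sup>+y. dens (past k \<omega>) k y * ?G (past k \<omega>) y \<partial>lborel) \<partial>M)"
    by (rule joint_nn_integral[OF k Gm])
  also have "... = (\<integral>\<^sup>+\<omega>. (\<integral>\<^sup>+x. dens (past k \<omega>) k x * ennreal (exp (- (x + lst (past k \<omega>) k))) \<partial>lborel) \<partial>M)"
  proof (rule nn_integral_cong_AE, use increasing_past[OF k] in eventually_elim)
    case (elim \<omega>)
    define \<sigma> where "\<sigma> = past k \<omega>"
    have inc: "increasing \<sigma> k" using elim unfolding \<sigma>_def .
    have [measurable]: "(\<lambda>x. ?\<phi> \<sigma> x) \<in> borel_measurable borel" by measurable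
    have [measurable]: "(\<lambda>y. dens \<sigma> k y) \<in> borel_measurable borel" unfolding dens_def by measurable
    have "(\<integral>\<^sup>+y. dens \<sigma> k y * ?G \<sigma> y \<partial>lborel)
       = (\<integral>\<^sup>+y. (\<integral>\<^sup>+x. dens \<sigma> k y * (?\<phi> \<sigma> x * (if 0 < x & x < y then 1 else 0)) \<partial>lborel) \<partial>lborel)"
      by (intro nn_integral_cong nn_integral_cmult[symmetric]) measurable
    also have "... = (\<integral>\<^sup>+x. (\<integral>\<^sup>+y. dens \<sigma> k y * (?\<phi> \<sigma> x * (if 0 < x & x < y then 1 else 0)) \<partial>lborel) \<partial>lborel)"
      by (rule lborel_pair.Fubini') measurable
    also have "... = (\<integral>\<^sup>+x. dens \<sigma> k x * ennreal (exp (- (x + lst \<sigma> k))) \<partial>lborel)"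
    proof (intro nn_integral_cong)
      fix x
      show "(\<integral>\<^sup>+y. dens \<sigma> k y * (?\<phi> \<sigma> x * (if 0 < x & x < y then 1 else 0)) \<partial>lborel) = dens \<sigma> k x * ennreal (exp (- (x + lst \<sigma> k)))"
      proof (cases "0 < x")
        case True
        have "(\<integral>\<^sup>+y. dens \<sigma> k y * (?\<phi> \<sigma> x * (if 0 < x & x < y then 1 else 0)) \<partial>lborel)
            = (\<integral>\<^sup>+y. ?\<phi> \<sigma> x * (dens \<sigma> k y * indicator {x<..} y) \<partial>lborel)"
          using True by (intro nn_integral_cong) (auto simp: indicator_def mult.commute)
        also have "... = ?\<phi> \<sigma> x * ennreal (surv \<sigma> k x)"
          using True by (subst nn_integral_cmult) (auto simp: dens_tail[OF inc])
        also have "... = dens \<sigma> k x * ennreal (exp (- (x + lst \<sigma> k)))"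
          using True unfolding dens_def by (simp add: ennreal_mult' mult_ac)
        finally show ?thesis .
      qed (simp add: dens_def)
    qed
    finally show ?case unfolding \<sigma>_def .
  qed
  also have "... = (\<integral>\<^sup>+\<omega>. ennreal (exp (- (E k \<omega> + lst (past k \<omega>) k))) \<partial>M)"
    by (rule joint_nn_integral[OF k, symmetric]) (unfold case_prod_beta, measurable)
  also have "... = (\<integral>\<^sup>+\<omega>. ennreal (exp (- arr \<omega> k)) \<partial>M)"
    by (simp only: arr_lst[OF k] add.commute)
  finally show "(\<integral>\<^sup>+\<omega>. ennreal (exp (- arr \<omega> k)) \<partial>M) = (\<integral>\<^sup>+\<omega>. ennreal (gain k \<omega>) \<partial>M)" by simp
qed

text \<open>The probability that the \<open>k\<close>-th point precedes an independent exponential time, see \<open>point_before_exponential\<close>.\<close>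

definition mpt :: "nat => real" where
  "mpt k = expectation (\<lambda>\<omega>. exp (- arr \<omega> k))"

lemma arr_nonneg: "AE \<omega> in M. \<forall>k. 0 <= arr \<omega> k"
  using E_pos by eventually_elim (metis arrival_mono arr_0 le0)

lemma exp_arr_integrable: "integrable M (\<lambda>\<omega>. exp (- arr \<omega> k))"
proof (rule integrable_const_bound[where B = 1])
  show "AE \<omega> in M. norm (exp (- arr \<omega> k)) <= 1" using arr_nonneg by eventually_elim simp
qed measurable

lemma mpt_nn: "ennreal (mpt k) = (\<integral>\<^sup>+\<omega>. ennreal (exp (- arr \<omega> k)) \<partial>M)"
  unfolding mpt_def by (rule nn_integral_eq_integral[OF exp_arr_integrable, symmetric]) simp

lemma mpt_nonneg: "mpt k >= 0"
  unfolding mpt_def by (rule Bochner_Integration.integral_nonneg) simp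

lemma gain_measurable [measurable]: "gain k \<in> borel_measurable M"
  unfolding gain_def by (intro borel_measurable_diff prim_measurable past_meas arr_meas)

lemma gain_integral:
  assumes k: "k >= 1"
  shows "integrable M (gain k)" "expectation (gain k) = mpt k"
proof -
  have fin: "(\<integral>\<^sup>+\<omega>. ennreal (gain k \<omega>) \<partial>M) = ennreal (mpt k)"
    using compensator(1)[OF k] mpt_nn by simp
  show "integrable M (gain k)"
    by (rule integrableI_nonneg[OF gain_measurable compensator(2)[OF k]]) (simp add: fin)
  show "expectation (gain k) = mpt k"
    using integral_eq_nn_integral[OF gain_measurable compensator(2)[OF k]] fin mpt_nonneg by simp
qed

text \<open>After a new point the hazard has one more term.\<close>

lemma prim_step:
  assumes k: "k >= 1"
  shows "prim (past (Suc k) \<omega>) (Suc k) (arr \<omega> k) = prim (past k \<omega>) k (arr \<omega> k) - cb / 2 * exp (- arr \<omega> k)"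
proof -
  let ?z = "arr \<omega> k" and ?S = "\<Sum>j\<in>{1..<k}. exp (arr \<omega> j)"
  have e: "exp (- 2 * ?z) * exp ?z = exp (- ?z)" by (simp add: mult_exp_exp)
  have s1: "(\<Sum>j\<in>{1..<Suc k}. exp (past (Suc k) \<omega> j)) = ?S + exp ?z"
    using k by (simp add: atLeastLessThanSuc)
  have s2: "(\<Sum>j\<in>{1..<k}. exp (past k \<omega> j)) = ?S" by (intro sum.cong) auto
  have alg: "- (a + b * (n + 1 - 1)) * x + y / 2 * (a + b * (S + w)) = - (a + b * (n - 1)) * x + y / 2 * (a + b * S) - b / 2 * x"
    if "y * w = x" for a b n x y S w :: real
    using that by (simp add: algebra_simps flip: that)
  show ?thesis unfolding prim_def s1 s2 using alg[OF e, of ca cb "real k" ?S] by (simp only: of_nat_Suc add.commute[of 1])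
qed

text \<open>The terms of the sum telescope, up to the corrections of \<open>prim_step\<close>.\<close>

lemma gain_sum: "(\<Sum>k=1..Suc n. gain k \<omega>)
    = prim (past (Suc n) \<omega>) (Suc n) (arr \<omega> (Suc n)) + ca / 2 + cb / 2 * (\<Sum>k=1..n. exp (- arr \<omega> k))"
proof (induction n)
  case 0
  have p: "prim (past 1 \<omega>) 1 (arr \<omega> (1 - 1)) = - ca / 2"
  proof -
    have "- (a + b * (1 - 1)) * exp (- 0) + exp (- 2 * 0) / 2 * (a + b * 0) = - a / 2" for a b :: real by simp
    moreover have "(\<Sum>j\<in>{1..<1}. exp (past 1 \<omega> j)) = 0" "arr \<omega> (1 - 1) = 0" by simp_all
    ultimately show ?thesis unfolding prim_def of_nat_1 by (simp only:)
  qed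
  have "(\<Sum>k=1..Suc 0. gain k \<omega>) = gain 1 \<omega>" by simp
  also have "... = prim (past 1 \<omega>) 1 (arr \<omega> 1) + ca / 2" unfolding gain_def p by simp
  finally show ?case by (simp only: One_nat_def atLeastatMost_empty[OF zero_less_Suc] sum.empty mult_zero_right add_0_right)
next
  case (Suc n)
  have st: "prim (past (Suc (Suc n)) \<omega>) (Suc (Suc n)) (arr \<omega> (Suc n)) = prim (past (Suc n) \<omega>) (Suc n) (arr \<omega> (Suc n)) - cb / 2 * exp (- arr \<omega> (Suc n))"
    by (rule prim_step) simp
  have "(\<Sum>k=1..Suc (Suc n). gain k \<omega>) = (\<Sum>k=1..Suc n. gain k \<omega>) + gain (Suc (Suc n)) \<omega>"
    by simp
  also have "gain (Suc (Suc n)) \<omega> = prim (past (Suc (Suc n)) \<omega>) (Suc (Suc n)) (arr \<omega> (Suc (Suc n)))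
      - (prim (past (Suc n) \<omega>) (Suc n) (arr \<omega> (Suc n)) - cb / 2 * exp (- arr \<omega> (Suc n)))"
    unfolding gain_def st[symmetric] by simp
  finally have A: "(\<Sum>k=1..Suc (Suc n). gain k \<omega>) = (\<Sum>k=1..Suc n. gain k \<omega>) + (prim (past (Suc (Suc n)) \<omega>) (Suc (Suc n)) (arr \<omega> (Suc (Suc n)))
      - (prim (past (Suc n) \<omega>) (Suc n) (arr \<omega> (Suc n)) - cb / 2 * exp (- arr \<omega> (Suc n))))" .
  have B: "(\<Sum>k=1..Suc n. exp (- arr \<omega> k)) = (\<Sum>k=1..n. exp (- arr \<omega> k)) + exp (- arr \<omega> (Suc n))" by simp
  show ?case unfolding A B Suc.IH distrib_left by linarith
qed

lemma mpt_sum_ge: "(\<Sum>k=1..Suc n. mpt k) >= ca / 2 + cb / 2 * (\<Sum>k=1..n. mpt k) - (ca + cb * real n) * mpt (Suc n)"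
proof -
  have "(\<Sum>k=1..Suc n. mpt k) = (\<Sum>k=1..Suc n. expectation (gain k))"
    by (intro sum.cong) (auto simp: gain_integral(2))
  also have "... = expectation (\<lambda>\<omega>. \<Sum>k=1..Suc n. gain k \<omega>)"
    by (rule Bochner_Integration.integral_sum[symmetric]) (auto intro: gain_integral(1))
  also have "... >= expectation (\<lambda>\<omega>. ca / 2 + cb / 2 * (\<Sum>k=1..n. exp (- arr \<omega> k)) - (ca + cb * real n) * exp (- arr \<omega> (Suc n)))"
  proof (rule integral_mono)
    show "integrable M (\<lambda>\<omega>. ca / 2 + cb / 2 * (\<Sum>k=1..n. exp (- arr \<omega> k)) - (ca + cb * real n) * exp (- arr \<omega> (Suc n)))"
      by (intro Bochner_Integration.integrable_diff Bochner_Integration.integrable_add integrable_const integrable_mult_right Bochner_Integration.integrable_sum exp_arr_integrable)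
    show "integrable M (\<lambda>\<omega>. \<Sum>k=1..Suc n. gain k \<omega>)"
      by (rule Bochner_Integration.integrable_sum) (auto intro: gain_integral(1))
    fix \<omega>
    have "prim (past (Suc n) \<omega>) (Suc n) z >= - (ca + cb * real n) * exp (- z)" for z
    proof -
      have "0 <= exp (- 2 * z) / 2 * (ca + cb * (\<Sum>j\<in>{1..<Suc n}. exp (past (Suc n) \<omega> j)))"
        using ca_pos cb_pos by (intro mult_nonneg_nonneg add_nonneg_nonneg sum_nonneg) auto
      moreover have "real (Suc n) - 1 = real n" by simp
      ultimately show ?thesis unfolding prim_def by (simp only: le_add_same_cancel1)
    qed
    from this[of "arr \<omega> (Suc n)"]
    show "ca / 2 + cb / 2 * (\<Sum>k=1..n. exp (- arr \<omega> k)) - (ca + cb * real n) * exp (- arr \<omega> (Suc n)) <= (\<Sum>k=1..Suc n. gain k \<omega>)"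
      unfolding gain_sum by (simp only: mult_minus_left)
  qed
  also have "expectation (\<lambda>\<omega>. ca / 2 + cb / 2 * (\<Sum>k=1..n. exp (- arr \<omega> k)) - (ca + cb * real n) * exp (- arr \<omega> (Suc n)))
     = ca / 2 + cb / 2 * (\<Sum>k=1..n. mpt k) - (ca + cb * real n) * mpt (Suc n)"
  proof -
    have i: "integrable M (\<lambda>\<omega>. cb / 2 * (\<Sum>k=1..n. exp (- arr \<omega> k)))" "integrable M (\<lambda>\<omega>. (ca + cb * real n) * exp (- arr \<omega> (Suc n)))"
      by (intro integrable_mult_right Bochner_Integration.integrable_sum exp_arr_integrable)+
    have "expectation (\<lambda>\<omega>. \<Sum>k=1..n. exp (- arr \<omega> k)) = (\<Sum>k=1..n. mpt k)"
      unfolding mpt_def by (rule Bochner_Integration.integral_sum) (rule exp_arr_integrable)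
    then show ?thesis
      using i by (subst Bochner_Integration.integral_diff, simp, simp, subst Bochner_Integration.integral_add, simp, simp) (simp add: prob_space mpt_def)
  qed
  finally show ?thesis .
qed

text \<open>If the mean number \<open>m\<close> of points is finite, letting \<open>n\<close> tend to infinity in \<open>mpt_sum_ge\<close> along a suitable
subsequence gives \<open>m >= ca / 2 + (cb / 2) m\<close>, and \<open>ca / 2 + cb / 2 = 1\<close> with \<open>cb < 2\<close>.\<close>

lemma mean_points_ge_1: "(\<Sum>k. ennreal (mpt (Suc k))) >= 1"
proof (cases "(\<Sum>k. ennreal (mpt (Suc k))) = top")
  case False
  then have sm: "summable (\<lambda>k. mpt (Suc k))"
    using mpt_nonneg by (intro summable_suminf_not_top) auto
  let ?m = "\<Sum>k. mpt (Suc k)"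
  have part: "(\<Sum>k=1..n. mpt k) <= ?m" for n
  proof -
    have "(\<Sum>k=1..n. mpt k) = (\<Sum>k<n. mpt (Suc k))"
      by (simp add: sum.atLeast1_atMost_eq)
    also have "... <= ?m" using mpt_nonneg by (intro sum_le_suminf[OF sm]) auto
    finally show ?thesis .
  qed
  have lim: "(\<lambda>n. \<Sum>k=1..n. mpt k) \<longlonglongrightarrow> ?m"
    using summable_LIMSEQ[OF sm] by (simp add: sum.atLeast1_atMost_eq)
  have half: "ca / 2 = 1 - cb / 2" "cb / 2 < 1"
    using delta half_delta by (simp_all add: field_simps)
  have key: "(1 - cb / 2) * 1 <= (1 - cb / 2) * ?m + \<eta>" if eta: "\<eta> > 0" for \<eta>
  proof -
    (* The error terms are (ca + cb) e and mpt (Suc n) <= e. *)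
    define e where "e = \<eta> / (ca + cb + 1)"
    have e: "e > 0" unfolding e_def by (rule divide_pos_pos[OF eta]) (use ca_pos cb_pos in linarith)
    obtain n where n: "real (Suc n) * mpt (Suc n) < e"
    proof -
      (* Otherwise the convergent series dominates a harmonic one. *)
      have "\<exists>n. real (Suc n) * mpt (Suc n) < e"
      proof (rule ccontr)
      assume "\<nexists>n. real (Suc n) * mpt (Suc n) < e"
      then have ge: "e <= real (Suc n) * mpt (Suc n)" for n by (meson not_le)
      have "summable (\<lambda>n. e * (1 / real (Suc n)))"
      proof (rule summable_comparison_test'[OF sm])
        fix n
        have "e * (1 / real (Suc n)) <= mpt (Suc n)" using ge[of n] by (simp add: field_simps)
        then show "norm (e * (1 / real (Suc n))) <= mpt (Suc n)" using e by simp
      qed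
      then have "summable (\<lambda>n. 1 / real (Suc n))" using e by (subst (asm) summable_cmult_iff) auto
      then have "summable (\<lambda>n. inverse (real (Suc n)))" by (simp only: inverse_eq_divide)
      then have "summable (\<lambda>n. inverse (real n))" by (subst (asm) summable_Suc_iff)
      then show False using not_summable_harmonic[where 'a = real] by simp
      qed
      then show ?thesis using that by blast
    qed
    have "(ca + cb * real n) * mpt (Suc n) <= ((ca + cb) * real (Suc n)) * mpt (Suc n)"
    proof (rule mult_right_mono[OF _ mpt_nonneg])
      have "c + d * real n <= (c + d) * real (Suc n)" if "0 < c" "0 < d" for c d :: real
        using that by (simp add: algebra_simps)
      then show "ca + cb * real n <= (ca + cb) * real (Suc n)" using ca_pos cb_pos by blast
    qed
    also have "... = (ca + cb) * (real (Suc n) * mpt (Suc n))" by (simp only: mult.assoc)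
    also have "... <= (ca + cb) * e" using n ca_pos cb_pos by (intro mult_left_mono) auto
    finally have err: "(ca + cb * real n) * mpt (Suc n) <= (ca + cb) * e" .
    have small: "mpt (Suc n) <= e"
      using n mpt_nonneg[of "Suc n"] mult_right_mono[of 1 "real (Suc n)" "mpt (Suc n)"] by simp
    have tot: "(ca + cb) * e + e = \<eta>"
    proof -
      have "(ca + cb) * e + e = (ca + cb + 1) * e" by (simp only: distrib_right mult_1)
      moreover have "ca + cb + 1 ~= 0" using ca_pos cb_pos by linarith
      ultimately show ?thesis by (simp add: e_def)
    qed
    have "ca / 2 <= (\<Sum>k=1..Suc n. mpt k) - cb / 2 * (\<Sum>k=1..n. mpt k) + (ca + cb) * e"
      using mpt_sum_ge[of n] err by linarith
    also have "(\<Sum>k=1..Suc n. mpt k) = (\<Sum>k=1..n. mpt k) + mpt (Suc n)" by simp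
    also have "(\<Sum>k=1..n. mpt k) + mpt (Suc n) - cb / 2 * (\<Sum>k=1..n. mpt k) + (ca + cb) * e
        = (1 - cb / 2) * (\<Sum>k=1..n. mpt k) + (mpt (Suc n) + (ca + cb) * e)" by (simp add: left_diff_distrib)
    finally have a: "ca / 2 <= (1 - cb / 2) * (\<Sum>k=1..n. mpt k) + (mpt (Suc n) + (ca + cb) * e)" .
    have b: "(1 - cb / 2) * (\<Sum>k=1..n. mpt k) <= (1 - cb / 2) * ?m"
      using part half by (intro mult_left_mono) auto
    have fin: "h * 1 <= h * m + \<eta>" if "c <= h * s + (p + d)" "h * s <= h * m" "p <= e" "d + e = \<eta>" "c = h" for h s p d m c :: real
      using that by linarith
    show ?thesis by (rule fin[OF a b small tot half(1)])
  qed
  then have "(1 - cb / 2) * 1 <= (1 - cb / 2) * ?m" by (rule field_le_epsilon)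
  then have "1 <= ?m" using half(2) by simp
  moreover have "(\<Sum>k. ennreal (mpt (Suc k))) = ennreal ?m"
    using sm mpt_nonneg by (intro suminf_ennreal2) auto
  ultimately show ?thesis by simp
qed simp

lemma point_before_exponential:
  assumes "indep_elements M N Y borel T" "distributed M lborel T (exponential_density 1)"
    and g: "(\<lambda>y. arrival (g y) k) \<in> borel_measurable N"
    and gY: "\<And>\<omega>. arrival (g (Y \<omega>)) k = arr \<omega> k"
  shows "(\<integral>\<^sup>+\<omega>. (if arr \<omega> k <= T \<omega> then 1 else 0) \<partial>M) = ennreal (mpt k)"
proof -
  let ?F = "\<lambda>p. if arrival (g (fst p)) k <= snd p then 1 else 0 :: ennreal"
  have [measurable]: "(\<lambda>p. arrival (g (fst p)) k) \<in> borel_measurable (N \<Otimes>\<^sub>M (borel :: real measure))"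
    by (rule measurable_compose[OF measurable_fst g])
  have F: "?F \<in> borel_measurable (N \<Otimes>\<^sub>M borel)" by measurable
  interpret pair_sigma_finite M "lborel :: real measure" ..
  have "(\<integral>\<^sup>+\<omega>. (if arr \<omega> k <= T \<omega> then 1 else 0) \<partial>M) = (\<integral>\<^sup>+\<omega>. ?F (Y \<omega>, T \<omega>) \<partial>M)"
    by (simp add: gY)
  also have "... = (\<integral>\<^sup>+s. ennreal (exponential_density 1 s) * (\<integral>\<^sup>+\<omega>. ?F (Y \<omega>, s) \<partial>M) \<partial>lborel)"
    by (rule indep_elements_nn_integral[OF prob_space_axioms assms(1,2) F])
  also have "... = (\<integral>\<^sup>+s. (\<integral>\<^sup>+\<omega>. ennreal (exponential_density 1 s) * (if arr \<omega> k <= s then 1 else 0) \<partial>M) \<partial>lborel)"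
    by (intro nn_integral_cong) (simp add: gY nn_integral_cmult)
  also have "... = (\<integral>\<^sup>+\<omega>. (\<integral>\<^sup>+s. ennreal (exponential_density 1 s) * (if arr \<omega> k <= s then 1 else 0) \<partial>lborel) \<partial>M)"
    by (rule Fubini') (unfold case_prod_beta, measurable)
  also have "... = (\<integral>\<^sup>+\<omega>. ennreal (exp (- arr \<omega> k)) \<partial>M)"
  proof (rule nn_integral_cong_AE, use arr_nonneg in eventually_elim)
    case (elim \<omega>)
    have a: "0 <= arr \<omega> k" using elim by blast
    have "(\<integral>\<^sup>+s. ennreal (exponential_density 1 s) * (if arr \<omega> k <= s then 1 else 0) \<partial>lborel)
       = (\<integral>\<^sup>+s. ennreal (exp (- s)) * indicator {arr \<omega> k..} s \<partial>lborel)"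
      using a by (intro nn_integral_cong) (auto simp: exponential_density_def indicator_def)
    also have "... = ennreal (0 - (- exp (- arr \<omega> k)))"
    proof (rule nn_integral_FTC_atLeast)
      show "((\<lambda>s. - exp (- s)) has_real_derivative exp (- s)) (at s)" for s :: real
        by (auto intro!: derivative_eq_intros)
      show "((\<lambda>s::real. - exp (- s)) \<longlongrightarrow> 0) at_top"
        using tendsto_minus[OF filterlim_compose[OF exp_at_bot filterlim_uminus_at_bot_at_top]] by simp
    qed auto
    finally show ?case by simp
  qed
  finally show ?thesis unfolding mpt_nn .
qed

end

context branching begin

abbreviation clen :: "ptree => nat" where
  "clen t \<equiv> length (subs t)"

lemma pv_ex: "AE \<omega> in B. \<exists>t. pv t (Xf \<omega>) [] (S \<omega>)"
proof -
  let ?Z = "\<lambda>\<omega>. (\<integral>\<^sup>+t. pvi t (Xf \<omega>) [] (S \<omega>) * 1 \<partial>count_space UNIV)"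
  let ?D = "\<lambda>\<omega>. if \<exists>t. pv t (Xf \<omega>) [] (S \<omega>) then 1 else 0 :: ennreal"
  have pr: "Measurable.pred B (\<lambda>\<omega>. pv t (Xf \<omega>) [] (S \<omega>))" for t
  proof -
    have "Measurable.pred B (\<lambda>\<omega>. pv t (Xr labels \<omega>) [] (S \<omega>))"
      by (rule pv_raw[OF below_nil Xr_meas S_meas]) simp
    then show ?thesis using pv_Xr[OF below_nil] by simp
  qed
  have ex: "{\<omega> \<in> space B. \<exists>t. pv t (Xf \<omega>) [] (S \<omega>)} \<in> sets B"
    by (rule sets.sets_Collect_countable_Ex) (use pr[unfolded pred_def] in blast)
  have "1 = (\<integral>\<^sup>+\<omega>. ?Z \<omega> \<partial>B)" using pvi_fubini[of "\<lambda>_. 1"] uu_total by simp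
  also have "... = (\<integral>\<^sup>+\<omega>. ?D \<omega> \<partial>B)"
  proof (rule nn_integral_cong_AE, use all_pos in eventually_elim)
    case (elim \<omega>)
    show ?case
    proof (cases "\<exists>t. pv t (Xf \<omega>) [] (S \<omega>)")
      case True
      then obtain t where "pv t (Xf \<omega>) [] (S \<omega>)" by blast
      from pvi_single[OF elim this, of "\<lambda>_. 1"] show ?thesis using True by simp
    qed simp
  qed
  also have "... = (\<integral>\<^sup>+\<omega>. indicator {\<omega> \<in> space B. \<exists>t. pv t (Xf \<omega>) [] (S \<omega>)} \<omega> \<partial>B)"
    by (intro nn_integral_cong) (auto simp: indicator_def)
  also have "... = emeasure B {\<omega> \<in> space B. \<exists>t. pv t (Xf \<omega>) [] (S \<omega>)}" by (rule nn_integral_indicator[OF ex])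
  finally have "prob {\<omega> \<in> space B. \<exists>t. pv t (Xf \<omega>) [] (S \<omega>)} = 1" by (simp add: emeasure_eq_measure)
  then show ?thesis using prob_eq_1[OF ex] by auto
qed

lemma emeasure_U:
  "emeasure (measure_pmf U) A = (\<integral>\<^sup>+\<omega>. (\<integral>\<^sup>+t. pvi t (Xf \<omega>) [] (S \<omega>) * indicator A t \<partial>count_space UNIV) \<partial>B)"
proof -
  have "emeasure (measure_pmf U) A = (\<integral>\<^sup>+t. indicator A t \<partial>measure_pmf U)"
    by (rule nn_integral_indicator[symmetric]) simp
  also have "... = (\<integral>\<^sup>+t. ennreal (uu t) * indicator A t \<partial>count_space UNIV)"
    by (simp only: nn_integral_measure_pmf pmf_U)
  also have "... = (\<integral>\<^sup>+\<omega>. (\<integral>\<^sup>+t. pvi t (Xf \<omega>) [] (S \<omega>) * indicator A t \<partial>count_space UNIV) \<partial>B)"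
    by (rule pvi_fubini)
  finally show ?thesis .
qed

lemma pv_clen: "pv t (Xf \<omega>) [] (S \<omega>) ==>
  arrival (Xf \<omega> []) (clen t) <= S \<omega> & S \<omega> < arrival (Xf \<omega> []) (Suc (clen t))"
  by (cases t) (simp add: pv_simp)

text \<open>The number of children of the root is the number of points before the exponential time.\<close>

lemma emeasure_U_clen:
  assumes f: "\<And>\<omega> c. (\<forall>k\<ge>1. X [] k \<omega> > 0) ==> arrival (Xf \<omega> []) c <= S \<omega> ==> S \<omega> < arrival (Xf \<omega> []) (Suc c) ==> R \<omega> \<longleftrightarrow> Q c"
  shows "emeasure (measure_pmf U) {t. Q (clen t)} = (\<integral>\<^sup>+\<omega>. (if R \<omega> then 1 else 0) \<partial>B)"
  unfolding emeasure_U
proof (rule nn_integral_cong_AE, use all_pos pv_ex in eventually_elim)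
  case (elim \<omega>)
  then obtain t where t: "pv t (Xf \<omega>) [] (S \<omega>)" by blast
  have "R \<omega> \<longleftrightarrow> Q (clen t)"
    using elim(1) nil_label pv_clen[OF t] by (intro f) auto
  then show ?case
    using pvi_single[OF elim(1) t, of "indicator {t. Q (clen t)}"] by simp
qed

lemma root_process: "point_process \<delta> B (X [])"
  by (rule pp[OF nil_label])

lemma root_arrival_meas: "(\<lambda>y. arrival (y []) k) \<in> borel_measurable (\<Pi>\<^sub>M u\<in>labels. times)"
  by (rule arrival_raw[OF measurable_component_singleton[OF nil_label]])

lemma clen_law: "emeasure (measure_pmf U) {t. clen t = c} = degree_prob c"
proof -
  have "emeasure (measure_pmf U) {t. clen t = c}
     = (\<integral>\<^sup>+\<omega>. (if arrival (Xf \<omega> []) c <= S \<omega> & S \<omega> < arrival (Xf \<omega> []) (Suc c) then 1 else 0) \<partial>B)"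
  proof (rule emeasure_U_clen)
    fix \<omega> c' assume e: "\<forall>k\<ge>1. X [] k \<omega> > 0" and c: "arrival (Xf \<omega> []) c' <= S \<omega>" "S \<omega> < arrival (Xf \<omega> []) (Suc c')"
    have "c = c'" if "arrival (Xf \<omega> []) c <= S \<omega>" "S \<omega> < arrival (Xf \<omega> []) (Suc c)"
      by (rule arrival_count_unique[OF e that c])
    then show "(arrival (Xf \<omega> []) c <= S \<omega> & S \<omega> < arrival (Xf \<omega> []) (Suc c)) \<longleftrightarrow> c' = c"
      using c by auto
  qed
  also have "... = degree_prob c"
    by (rule point_process.count_at_exponential_time[OF root_process XS_ind S_dist root_arrival_meas])
       (rule arrival_Xr[OF nil_label])
  finally show ?thesis .
qed

lemma mean_clen_ge_1: "(\<integral>\<^sup>+t. ennreal (of_nat (clen t)) \<partial>measure_pmf U) >= 1"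
proof -
  have "(\<integral>\<^sup>+t. ennreal (of_nat (clen t)) \<partial>measure_pmf U) = (\<Sum>k. emeasure (measure_pmf U) {t \<in> space (measure_pmf U). k < clen t})"
    using nn_integral_nat_function[of clen "measure_pmf U"] by (simp add: ennreal_of_nat_eq_real_of_nat)
  also have "... = (\<Sum>k. ennreal (point_process.mpt B (X []) (Suc k)))"
  proof (rule suminf_cong)
    fix k
    have "emeasure (measure_pmf U) {t. k < clen t} = (\<integral>\<^sup>+\<omega>. (if arrival (Xf \<omega> []) (Suc k) <= S \<omega> then 1 else 0) \<partial>B)"
    proof (rule emeasure_U_clen)
      fix \<omega> c assume e: "\<forall>k\<ge>1. X [] k \<omega> > 0" and c: "arrival (Xf \<omega> []) c <= S \<omega>" "S \<omega> < arrival (Xf \<omega> []) (Suc c)"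
      show "arrival (Xf \<omega> []) (Suc k) <= S \<omega> \<longleftrightarrow> k < c"
        using arrival_mono[of "Xf \<omega> []" "Suc k" c] arrival_mono[of "Xf \<omega> []" "Suc c" "Suc k"] e c
        by (cases "k < c") auto
    qed
    also have "... = ennreal (point_process.mpt B (X []) (Suc k))"
      by (rule point_process.point_before_exponential[OF root_process XS_ind S_dist root_arrival_meas])
         (rule arrival_Xr[OF nil_label])
    finally show "emeasure (measure_pmf U) {t \<in> space (measure_pmf U). k < clen t} = ennreal (point_process.mpt B (X []) (Suc k))"
      by simp
  qed
  also have "... >= 1" by (rule point_process.mean_points_ge_1[OF root_process])
  finally show ?thesis .
qed

end

lemma (in reinforcement) limit_degree_prob_eq:
  assumes "interarrivals_with_exp \<delta> P E T" "k >= 1"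
  shows "limit_degree_prob P E T k = enn2real (degree_prob (k - 1))"
proof -
  have E: "interarrivals \<delta> P E" and T: "distributed P lborel T (exponential_density 1)"
    and ind: "indep_elements P times (\<lambda>\<omega>. \<lambda>k\<in>{1..}. E k \<omega>) borel T"
    using assms(1) unfolding interarrivals_with_exp_def by auto
  interpret P: prob_space P using E unfolding interarrivals_def by blast
  interpret pp: point_process \<delta> P E by unfold_locales (rule E)
  obtain c where k: "k = Suc c" using assms(2) by (cases k) auto
  have Tm: "T \<in> borel_measurable P" using ind unfolding indep_elements_def by blast
  let ?A = "{\<omega> \<in> space P. pp.arr \<omega> c <= T \<omega> & T \<omega> < pp.arr \<omega> (Suc c)}"
  have A: "?A \<in> sets P"
    by (intro sets.sets_Collect_conj borel_measurable_le borel_measurable_less pp.arr_meas Tm)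
  have "emeasure P ?A = (\<integral>\<^sup>+\<omega>. indicator ?A \<omega> \<partial>P)" by (rule nn_integral_indicator[OF A, symmetric])
  also have "... = (\<integral>\<^sup>+\<omega>. (if pp.arr \<omega> c <= T \<omega> & T \<omega> < pp.arr \<omega> (Suc c) then 1 else 0) \<partial>P)"
    by (intro nn_integral_cong) (auto simp: indicator_def)
  also have "... = degree_prob c"
  proof (rule pp.count_at_exponential_time[OF ind T, where g = "\<lambda>y. y"])
    show "(\<lambda>y. arrival y k) \<in> borel_measurable times" for k by (rule arrival_raw) simp
    show "arrival (\<lambda>k\<in>{1..}. E k \<omega>) k = pp.arr \<omega> k" for \<omega> k by (rule arrival_cong) simp
  qed
  finally have "emeasure P ?A = degree_prob c" .
  then have "measure P ?A = enn2real (degree_prob c)" by (simp add: measure_def)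
  then show ?thesis unfolding limit_degree_prob_def k arrival_def by simp
qed

section \<open>Fringes of recursive trees\<close>

context reinforcement begin

lemma pos_in_range: "(w :: nat) ~= 0 ==> w <= n ==> w \<in> {1..n}"
  by (cases w) simp_all

definition clsv :: "(nat => nat) => nat => nat => rtree" where
  "clsv a n v = cls (ptree_of a n v)"

definition kids :: "(nat => nat) => nat => nat => nat set" where
  "kids a n v = {w \<in> {v<..n}. a w = v}"

lemma finite_kids [simp]: "finite (kids a n v)"
  by (simp add: kids_def)

lemma ptree_of_subs: "subs (ptree_of a n v) = map (ptree_of a n) (ch a n v)"
  unfolding ptree_of_def by (subst dec.simps) (simp add: comp_def)

lemma clsv_rec: "clsv a n v = Node (image_mset (clsv a n) (mset_set (kids a n v)))"
proof -
  have "cls t = Node (mset (map cls (subs t)))" for t by (cases t) simp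
  then have "clsv a n v = Node (mset (map cls (map (ptree_of a n) (ch a n v))))"
    unfolding clsv_def ptree_of_subs[symmetric] .
  also have "map cls (map (ptree_of a n) (ch a n v)) = map (clsv a n) (ch a n v)"
    by (simp add: clsv_def)
  finally have "clsv a n v = Node (image_mset (clsv a n) (mset (ch a n v)))" by simp
  moreover have "mset (ch a n v) = mset_set (kids a n v)"
    using mset_set_set[OF distinct_ch, of a n v] by (simp add: kids_def)
  ultimately show ?thesis by simp
qed

lemma children_kids:
  assumes "history n a"
  shows "children {0..n} 0 a v = kids a n v"
  using historyD[OF assms] by (fastforce simp: children_def kids_def)

text \<open>Asking for the children of vertices from \<open>v\<close> on only allows to cut off a branch elsewhere.\<close>

lemma has_shape_clsv:
  assumes "\<And>u. v <= u ==> D u = kids a n u"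
  shows "has_shape D v (clsv a n v)"
  using assms
proof (induction "n - v" arbitrary: v rule: less_induct)
  case less
  have eq: "D v = kids a n v" using less.prems by simp
  have "has_shape D v (Node (image_mset (clsv a n) (mset_set (D v))))"
  proof (rule has_shape.intros)
    show "finite (D v)" unfolding eq by simp
    show "\<forall>u\<in>D v. has_shape D u (clsv a n u)"
    proof
      fix u assume "u \<in> D v"
      then have "v < u" "u <= n" unfolding eq kids_def by auto
      then show "has_shape D u (clsv a n u)" using less.prems by (intro less.hyps) auto
    qed
  qed
  then show ?case unfolding eq clsv_rec[symmetric] .
qed

lemma fringe_tree_0:
  assumes "history n a"
  shows "fringe_tree {0..n} 0 a v 0 = Some (clsv a n v)"
  unfolding fringe_tree_def
  using has_shape_clsv[of v "children {0..n} 0 a" a n] by (simp add: tree_class_Some children_kids[OF assms])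

lemma iterate_le:
  fixes a :: "nat => nat"
  assumes "\<forall>j\<in>{1..n}. a j < j" "v <= n" "\<forall>j<i. (a ^^ j) v ~= 0"
  shows "(a ^^ i) v <= n"
  using assms(3)
proof (induction i)
  case (Suc i)
  then have "(a ^^ i) v ~= 0" "(a ^^ i) v <= n" by auto
  then have "(a ^^ i) v \<in> {1..n}" by (rule pos_in_range)
  then have "a ((a ^^ i) v) < (a ^^ i) v" "(a ^^ i) v <= n" using assms(1) by auto
  then have "a ((a ^^ i) v) <= n" by linarith
  then show ?case by simp
qed (simp add: assms)

text \<open>Cutting off the branch of \<open>v\<close> removes one child of the ancestor, and its class from the multiset of subtrees.\<close>

lemma fringe_tree_Suc:
  assumes a: "history n a" and v: "v <= n"
  shows "fringe_tree {0..n} 0 a v (Suc i) = Some s \<longleftrightarrow> (\<forall>j\<le>i. (a ^^ j) v ~= 0) &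
    clsv a n ((a ^^ Suc i) v) = Node (add_mset (clsv a n ((a ^^ i) v)) (subtrees s))"
proof (cases "\<forall>j\<le>i. (a ^^ j) v ~= 0")
  case True
  let ?c = "(a ^^ i) v"
  let ?w = "a ?c"
  let ?D = "\<lambda>u. children {0..n} 0 a u - {?c}"
  have c: "?c ~= 0" "?c <= n"
    using True iterate_le[of n a v i] historyD[OF a] v by auto
  have wc: "?w < ?c" using historyD[OF a, of ?c] c by simp
  have cw: "?c \<in> kids a n ?w" using c wc by (simp add: kids_def)
  have eq: "?D u = kids a n u" if "u ~= ?w" for u
    unfolding children_kids[OF a] using that by (auto simp: kids_def)
  have "has_shape ?D ?w (Node (image_mset (clsv a n) (mset_set (?D ?w))))"
  proof (rule has_shape.intros)
    show "finite (?D ?w)" unfolding children_kids[OF a] by simp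
    show "\<forall>u\<in>?D ?w. has_shape ?D u (clsv a n u)"
    proof
      fix u assume "u \<in> ?D ?w"
      then have "?w < u" unfolding children_kids[OF a] kids_def by auto
      then show "has_shape ?D u (clsv a n u)" by (intro has_shape_clsv eq) auto
    qed
  qed
  then have "tree_class ?D ?w = Some (Node (image_mset (clsv a n) (mset_set (kids a n ?w - {?c}))))"
    unfolding tree_class_Some children_kids[OF a] .
  then have f: "fringe_tree {0..n} 0 a v (Suc i) = Some (Node (image_mset (clsv a n) (mset_set (kids a n ?w - {?c}))))"
    using True unfolding fringe_tree_def by (auto simp: less_Suc_eq_le)
  have "mset_set (kids a n ?w) = add_mset ?c (mset_set (kids a n ?w - {?c}))"
    by (rule mset_set.remove) (use cw in auto)
  then have "clsv a n ?w = Node (add_mset (clsv a n ?c) (image_mset (clsv a n) (mset_set (kids a n ?w - {?c}))))"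
    unfolding clsv_rec[of a n ?w] by simp
  then show ?thesis using True f by (cases s) auto
next
  case False
  then have "fringe_tree {0..n} 0 a v (Suc i) = None"
    unfolding fringe_tree_def by (auto simp: less_Suc_eq_le)
  then show ?thesis using False by auto
qed

text \<open>Adding the removed branches again, one after the other, turns the trees \<open>f_i\<close> into the subtrees of the
ancestors.\<close>

lemma fringe_upto_iff:
  assumes a: "history n a" and v: "v <= n"
  shows "fringe_upto {0..n} 0 a v k = map (\<lambda>i. Some (\<tau> i)) [0..<Suc k] \<longleftrightarrow>
    (\<forall>j<k. (a ^^ j) v ~= 0) & (\<forall>j\<le>k. clsv a n ((a ^^ j) v) = monotone_rep \<tau> j)"
proof (induction k)
  case 0
  show ?case by (simp add: fringe_upto_def fringe_tree_0[OF a])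
next
  case (Suc k)
  have "fringe_upto {0..n} 0 a v (Suc k) = map (\<lambda>i. Some (\<tau> i)) [0..<Suc (Suc k)] \<longleftrightarrow>
    fringe_upto {0..n} 0 a v k = map (\<lambda>i. Some (\<tau> i)) [0..<Suc k] & fringe_tree {0..n} 0 a v (Suc k) = Some (\<tau> (Suc k))"
    unfolding fringe_upto_def by simp
  also have "... \<longleftrightarrow> ((\<forall>j<k. (a ^^ j) v ~= 0) & (\<forall>j\<le>k. clsv a n ((a ^^ j) v) = monotone_rep \<tau> j)) &
     (\<forall>j\<le>k. (a ^^ j) v ~= 0) & clsv a n ((a ^^ Suc k) v) = Node (add_mset (clsv a n ((a ^^ k) v)) (subtrees (\<tau> (Suc k))))"
    unfolding Suc.IH fringe_tree_Suc[OF a v] ..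
  also have "... \<longleftrightarrow> (\<forall>j<Suc k. (a ^^ j) v ~= 0) & (\<forall>j\<le>Suc k. clsv a n ((a ^^ j) v) = monotone_rep \<tau> j)"
    unfolding le_Suc_eq[of _ k] less_Suc_eq_le by (auto simp del: funpow.simps)
  finally show ?case .
qed

lemma count_clsv: "count (subtrees (clsv a n u)) t = card {v \<in> kids a n u. clsv a n v = t}"
proof -
  have "count (image_mset f (mset_set K)) t = card {v \<in> K. f v = t}" if "finite K" for f :: "nat => rtree" and K
    using that
  proof (induction K)
    case (insert x K)
    have "{v \<in> insert x K. f v = t} = (if f x = t then insert x {v \<in> K. f v = t} else {v \<in> K. f v = t})" by auto
    then show ?case using insert by simp
  qed simp
  then show ?thesis unfolding clsv_rec[of a n u] by simp
qed

lemma kids_disjoint: "u ~= u' ==> kids a n u \<inter> kids a n u' = {}"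
  by (auto simp: kids_def)

lemma card_UN_kids:
  assumes "finite U"
  shows "card (\<Union>u\<in>U. {v \<in> kids a n u. P v}) = (\<Sum>u\<in>U. card {v \<in> kids a n u. P v})"
proof (rule card_UN_disjoint[OF assms])
  show "\<forall>u\<in>U. finite {v \<in> kids a n u. P v}" by simp
  show "\<forall>u\<in>U. \<forall>u'\<in>U. u ~= u' --> {v \<in> kids a n u. P v} \<inter> {v \<in> kids a n u'. P v} = {}"
  proof (intro ballI impI)
    fix u u' :: nat assume "u ~= u'"
    from kids_disjoint[OF this, of a n]
    show "{v \<in> kids a n u. P v} \<inter> {v \<in> kids a n u'. P v} = {}" by blast
  qed
qed

text \<open>Each vertex with the right chain of ancestors above it has the same number of children with the required
subtree, which is the last factor of the product.\<close>

lemma card_fringe_upto: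
  assumes a: "history n a"
  shows "card {v \<in> {0..n}. (\<forall>j<k. (a ^^ j) v ~= 0) & (\<forall>j\<le>k. clsv a n ((a ^^ j) v) = m j)}
    = card {v \<in> {0..n}. clsv a n v = m k} * (\<Prod>j=1..k. count (subtrees (m j)) (m (j - 1)))"
proof (induction k arbitrary: m)
  case 0
  then show ?case by simp
next
  case (Suc k)
  let ?S = "\<lambda>k m. {v \<in> {0..n}. (\<forall>j<k. (a ^^ j) v ~= 0) & (\<forall>j\<le>k. clsv a n ((a ^^ j) v) = m j)}"
  let ?m = "\<lambda>j. m (Suc j)"
  let ?T = "\<lambda>u. {v \<in> kids a n u. clsv a n v = m 0}"
  have all: "(\<forall>j<Suc k. P j) \<longleftrightarrow> P 0 & (\<forall>j<k. P (Suc j))" "(\<forall>j\<le>Suc k. P j) \<longleftrightarrow> P 0 & (\<forall>j\<le>k. P (Suc j))" for P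
    by (metis less_Suc_eq_0_disj, metis Suc_le_mono le_0_eq not0_implies_Suc zero_le)
  have lt: "a v < v" if "v ~= 0" for v using historyD[OF a, of v] that by simp
  have S: "?S (Suc k) m = {v \<in> {0..n}. v ~= 0 & clsv a n v = m 0 & a v \<in> ?S k ?m}"
  proof -
    have "v \<in> ?S (Suc k) m \<longleftrightarrow> v \<in> {0..n} & v ~= 0 & clsv a n v = m 0 & a v \<in> ?S k ?m" for v
      unfolding mem_Collect_eq all funpow_Suc_right o_apply funpow_0 using lt[of v] by auto
    then show ?thesis by blast
  qed
  have U: "{v \<in> {0..n}. v ~= 0 & clsv a n v = m 0 & a v \<in> ?S k ?m} = (\<Union>u\<in>?S k ?m. ?T u)"
  proof -
    have "v \<in> {v \<in> {0..n}. v ~= 0 & clsv a n v = m 0 & a v \<in> ?S k ?m} \<longleftrightarrow> a v \<in> ?S k ?m & v \<in> ?T (a v)" for v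
      unfolding kids_def mem_Collect_eq using lt[of v] by auto
    moreover have "v \<in> (\<Union>u\<in>?S k ?m. ?T u) \<longleftrightarrow> a v \<in> ?S k ?m & v \<in> ?T (a v)" for v
      by (simp only: UN_iff mem_Collect_eq kids_def) blast
    ultimately show ?thesis by (intro set_eqI) (simp only:)
  qed
  have "card (\<Union>u\<in>?S k ?m. ?T u) = (\<Sum>u\<in>?S k ?m. card (?T u))"
    by (rule card_UN_kids, rule finite_subset[OF Collect_restrict finite_atLeastAtMost])
  also have "... = (\<Sum>u\<in>?S k ?m. count (subtrees (m 1)) (m 0))"
  proof (intro sum.cong refl)
    fix u assume "u \<in> ?S k ?m"
    then have "\<forall>j\<le>k. clsv a n ((a ^^ j) u) = m (Suc j)" by blast
    from this[rule_format, of 0] have "clsv a n u = m 1" by simp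
    then show "card (?T u) = count (subtrees (m 1)) (m 0)" using count_clsv[of a n u "m 0"] by simp
  qed
  also have "... = card (?S k ?m) * count (subtrees (m 1)) (m 0)" by simp
  also have "card (?S k ?m) = card {v \<in> {0..n}. clsv a n v = m (Suc k)} * (\<Prod>j=1..k. count (subtrees (m (Suc j))) (m (Suc (j - 1))))"
    by (rule Suc.IH)
  also have "... * count (subtrees (m 1)) (m 0) = card {v \<in> {0..n}. clsv a n v = m (Suc k)} * (\<Prod>j=1..Suc k. count (subtrees (m j)) (m (j - 1)))"
  proof -
    let ?q = "\<lambda>j. count (subtrees (m j)) (m (j - 1))"
    have "(\<Prod>j=1..Suc k. ?q j) = ?q 1 * (\<Prod>j=Suc 1..Suc k. ?q j)"
      by (rule prod.atLeast_Suc_atMost) simp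
    also have "(\<Prod>j=Suc 1..Suc k. ?q j) = (\<Prod>j=1..k. ?q (Suc j))"
      by (rule prod.shift_bounds_cl_Suc_ivl)
    also have "... = (\<Prod>j=1..k. count (subtrees (m (Suc j))) (m (Suc (j - 1))))"
      by (intro prod.cong) auto
    finally show ?thesis by (simp add: mult_ac)
  qed
  finally show ?case unfolding S U .
qed

definition fringe_of :: "nat => (nat => nat) => nat => nat => rtree option list" where
  "fringe_of k a n v = fringe_upto {0..n} 0 a v k"

lemma freq_fringe:
  assumes a: "history n a"
  shows "freq (fringe_of k) (map (\<lambda>i. Some (\<tau> i)) [0..<Suc k]) n a
    = freq clsv (monotone_rep \<tau> k) n a * (\<Prod>j=1..k. real (count (subtrees (monotone_rep \<tau> j)) (monotone_rep \<tau> (j - 1))))"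
proof -
  have "{v \<in> {0..n}. fringe_of k a n v = map (\<lambda>i. Some (\<tau> i)) [0..<Suc k]}
    = {v \<in> {0..n}. (\<forall>j<k. (a ^^ j) v ~= 0) & (\<forall>j\<le>k. clsv a n ((a ^^ j) v) = monotone_rep \<tau> j)}"
    unfolding fringe_of_def using fringe_upto_iff[OF a, of _ k \<tau>] by (intro Collect_cong conj_cong) auto
  then have "card {v \<in> {0..n}. fringe_of k a n v = map (\<lambda>i. Some (\<tau> i)) [0..<Suc k]}
     = card {v \<in> {0..n}. clsv a n v = monotone_rep \<tau> k} * (\<Prod>j=1..k. count (subtrees (monotone_rep \<tau> j)) (monotone_rep \<tau> (j - 1)))"
    using card_fringe_upto[OF a, of k "monotone_rep \<tau>"] by (simp only:)
  then show ?thesis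
    unfolding freq_def by (simp only: of_nat_mult of_nat_prod times_divide_eq_left)
qed

lemma sum_count_clsv:
  assumes a: "history n a"
  shows "(\<Sum>u\<in>{0..n}. count (subtrees (clsv a n u)) t) <= card {v \<in> {0..n}. clsv a n v = t}"
proof -
  have "(\<Sum>u\<in>{0..n}. count (subtrees (clsv a n u)) t) = card (\<Union>u\<in>{0..n}. {v \<in> kids a n u. clsv a n v = t})"
    unfolding count_clsv by (rule card_UN_kids[symmetric]) simp
  also have "... <= card {v \<in> {0..n}. clsv a n v = t}"
    by (rule card_mono) (auto simp: kids_def)
  finally show ?thesis .
qed

lemma iterate_restr:
  fixes a :: "nat => nat"
  assumes ab: "\<forall>j\<in>{1..n}. a j = b j & a j < j" and v: "v <= n" and nz: "\<forall>j<i. (a ^^ j) v ~= 0"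
  shows "(a ^^ i) v = (b ^^ i) v"
  using nz
proof (induction i)
  case (Suc i)
  have "(a ^^ i) v \<in> {1..n}"
  proof -
    have "(a ^^ i) v <= n" using Suc.prems ab v by (intro iterate_le) auto
    moreover have "(a ^^ i) v ~= 0" using Suc.prems by blast
    ultimately show ?thesis by (intro pos_in_range)
  qed
  then have "a ((a ^^ i) v) = b ((a ^^ i) v)" using ab by blast
  then show ?case using Suc by simp
qed simp

text \<open>The fringe depends on the attachments of the vertices present only.\<close>

lemma fringe_tree_cong:
  fixes a :: "nat => nat"
  assumes ab: "\<forall>j\<in>{1..n}. a j = b j & a j < j" and v: "v <= n"
  shows "fringe_tree {0..n} 0 a v i = fringe_tree {0..n} 0 b v i"
proof -
  have ba: "\<forall>j\<in>{1..n}. b j = a j & b j < j" using ab by auto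
  have C: "children {0..n} 0 a = children {0..n} 0 b"
    unfolding children_def
  proof (intro ext Collect_cong conj_cong refl)
    fix u w assume "w \<in> {0..n}" "w ~= 0"
    then have "w \<in> {1..n}" by (intro pos_in_range) simp_all
    then show "a w = u \<longleftrightarrow> b w = u" using ab by auto
  qed
  have it: "(a ^^ j) v = (b ^^ j) v" if "(\<forall>j<i. (a ^^ j) v ~= 0) \<or> (\<forall>j<i. (b ^^ j) v ~= 0)" "j <= i" for j
    using that iterate_restr[OF ab v, of j] iterate_restr[OF ba v, of j] by auto
  show ?thesis
  proof (cases "\<exists>j<i. (a ^^ j) v = 0")
    case True
    then have "\<exists>j<i. (b ^^ j) v = 0" using it by (metis less_imp_le)
    then show ?thesis using True unfolding fringe_tree_def C by auto
  next
    case False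
    then have nb: "\<not> (\<exists>j<i. (b ^^ j) v = 0)" using it by (metis less_imp_le)
    have "(a ^^ (i - 1)) v = (b ^^ (i - 1)) v" "(a ^^ i) v = (b ^^ i) v" using False by (auto intro!: it)
    then show ?thesis unfolding fringe_tree_def C if_not_P[OF False] if_not_P[OF nb] by (simp only:)
  qed
qed

lemma fringe_upto_restr:
  fixes a :: "nat => nat"
  assumes "\<forall>j\<ge>1. a j < j" "v <= n"
  shows "fringe_upto {0..n} 0 a v k = fringe_of k (restr n a) n v"
  unfolding fringe_of_def fringe_upto_def
  using assms by (intro map_cong refl fringe_tree_cong) (auto simp: restr_def)

end

section \<open>The limit law is a fringe distribution\<close>

lemma (in reinforcement) conv_hist_nonpos:
  assumes X: "conv_hist X c" and le: "\<And>n a. history n a ==> X n a <= 0"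
  shows "c <= 0"
proof (rule ccontr)
  assume "\<not> c <= 0"
  then have c: "c / 2 > 0" by simp
  have "measure_pmf.prob (hist n) {a. \<bar>X n a - c\<bar> > c / 2} = 1" for n
  proof -
    have "measure_pmf.prob (hist n) UNIV = measure_pmf.prob (hist n) {a. \<bar>X n a - c\<bar> > c / 2}"
    proof (rule measure_pmf.finite_measure_eq_AE)
      show "AE a in measure_pmf (hist n). a \<in> UNIV \<longleftrightarrow> a \<in> {a. \<bar>X n a - c\<bar> > c / 2}"
        unfolding AE_measure_pmf_iff
      proof
        fix a assume "a \<in> set_pmf (hist n)"
        from le[OF history_hist[OF this]] c show "a \<in> UNIV \<longleftrightarrow> a \<in> {a. \<bar>X n a - c\<bar> > c / 2}" by simp
      qed
    qed simp_all
    then show ?thesis by simp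
  qed
  then have "(\<lambda>n. 1 :: real) \<longlonglongrightarrow> 0" using X[unfolded conv_hist_def, rule_format, OF c] by (simp only:)
  then show False by (simp add: LIMSEQ_const_iff)
qed

lemma (in reinforcement) conv_hist_cong:
  assumes X: "conv_hist X c" and eq: "\<And>n a. history n a ==> X n a = Y n a"
  shows "conv_hist Y c"
proof -
  have "measure_pmf.prob (hist n) {a. \<bar>X n a - c\<bar> > e} = measure_pmf.prob (hist n) {a. \<bar>Y n a - c\<bar> > e}" for n e
  proof (rule measure_pmf.finite_measure_eq_AE)
    show "AE a in measure_pmf (hist n). a \<in> {a. \<bar>X n a - c\<bar> > e} \<longleftrightarrow> a \<in> {a. \<bar>Y n a - c\<bar> > e}"
      unfolding AE_measure_pmf_iff using eq[OF history_hist] by simp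
  qed simp_all
  then show ?thesis using X unfolding conv_hist_def by simp
qed

lemma (in reinforcement) conv_hist_scale:
  assumes X: "conv_hist X c"
  shows "conv_hist (\<lambda>n a. X n a * q) (c * q)"
proof (cases "q = 0")
  case False
  have "\<bar>X n a * q - c * q\<bar> > e \<longleftrightarrow> \<bar>X n a - c\<bar> > e / \<bar>q\<bar>" for n a e
  proof -
    have "\<bar>X n a * q - c * q\<bar> = \<bar>X n a - c\<bar> * \<bar>q\<bar>" by (simp only: left_diff_distrib[symmetric] abs_mult)
    then show ?thesis using False by (simp add: pos_divide_less_eq)
  qed
  then show ?thesis using X False unfolding conv_hist_def by simp
qed (simp add: conv_hist_def)

context branching begin

definition cl :: "rtree pmf" where
  "cl = map_pmf cls U"

lemma BP_law_cl: "BP_law B X S = measure_pmf (map_pmf Some cl)"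
  unfolding BP_law_eq cl_def by (simp add: map_pmf_comp comp_def)

lemma average_conv:
  assumes "\<And>x. \<bar>f x\<bar> <= b"
  shows "conv_hist (\<lambda>n a. (\<Sum>v\<in>{0..n}. f (ptree_of a n v)) / real (n + 1)) (measure_pmf.expectation U f)"
proof (rule conv_hist_expectation[OF prob_space_measure_pmf _ assms])
  fix \<eta> :: real assume "\<eta> > 0"
  then obtain G where G: "finite G" "(\<Sum>t\<in>G. uu t) >= 1 - \<eta>" using uu_tight by blast
  have "measure (measure_pmf U) G >= 1 - \<eta>" using G by (simp add: measure_measure_pmf_finite pmf_U)
  moreover have "conv_hist (freq ptree_of x) (measure (measure_pmf U) {x})" for x
    using ptree_conv[of x] by (simp add: measure_pmf_single pmf_U)
  ultimately show "\<exists>G. finite G & measure (measure_pmf U) G >= 1 - \<eta> & (\<forall>x\<in>G. conv_hist (freq ptree_of x) (measure (measure_pmf U) {x}))"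
    using G(1) by blast
qed simp

lemma expectation_cl: "measure_pmf.expectation cl f = measure_pmf.expectation U (\<lambda>x. f (cls x))"
  for f :: "rtree => real"
  unfolding cl_def by simp

lemma average_cl_conv:
  assumes "\<And>x. \<bar>f x\<bar> <= b"
  shows "conv_hist (\<lambda>n a. (\<Sum>v\<in>{0..n}. f (clsv a n v)) / real (n + 1)) (measure_pmf.expectation cl f)"
  using average_conv[of "\<lambda>x. f (cls x)" b] assms unfolding expectation_cl clsv_def by simp

lemma clsv_conv: "conv_hist (freq clsv t) (pmf cl t)"
proof -
  have "conv_hist (\<lambda>n a. (\<Sum>v\<in>{0..n}. indicator {t} (clsv a n v)) / real (n + 1)) (measure_pmf.expectation cl (indicator {t}))"
    by (rule average_cl_conv[of _ 1]) simp
  moreover have "(\<Sum>v\<in>{0..n}. indicator {t} (clsv a n v)) = real (card {v \<in> {0..n}. clsv a n v = t})" for a n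
    by (simp add: indicator_def sum.If_cases Int_def)
  ultimately show ?thesis unfolding freq_def by (simp add: measure_pmf_single)
qed

text \<open>The inequality of \<open>sum_count_clsv\<close> passes to the limit for the bounded truncations of the number of
children.\<close>

lemma child_count_le:
  "(\<integral>\<^sup>+s. ennreal (real (count (subtrees s) t)) \<partial>measure_pmf cl) <= ennreal (pmf cl t)"
proof -
  let ?g = "\<lambda>K s. real (min (count (subtrees s) t) K)"
  have trunc: "(\<integral>\<^sup>+s. ennreal (?g K s) \<partial>measure_pmf cl) <= ennreal (pmf cl t)" for K
  proof -
    let ?f = "\<lambda>s. ?g K s - indicator {t} s"
    have ig: "integrable (measure_pmf cl) (?g K)"
      by (rule measure_pmf.integrable_const_bound[where B = "real K"]) auto
    have ii: "integrable (measure_pmf cl) (indicator {t} :: _ => real)"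
      by (rule measure_pmf.integrable_const_bound[where B = 1]) auto
    have "conv_hist (\<lambda>n a. (\<Sum>v\<in>{0..n}. ?f (clsv a n v)) / real (n + 1)) (measure_pmf.expectation cl ?f)"
    proof (rule average_cl_conv[of _ "real K + 1"])
      fix s show "\<bar>?f s\<bar> <= real K + 1"
        by (cases "s = t") auto
    qed
    then have "measure_pmf.expectation cl ?f <= 0"
    proof (rule conv_hist_nonpos)
      fix n a assume h: "history n a"
      have "(\<Sum>v\<in>{0..n}. ?g K (clsv a n v)) <= real (\<Sum>v\<in>{0..n}. count (subtrees (clsv a n v)) t)"
        unfolding of_nat_sum by (intro sum_mono) simp
      also have "... <= real (card {v \<in> {0..n}. clsv a n v = t})"
        using sum_count_clsv[OF h, of t] by (simp only: of_nat_le_iff)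
      also have "... = (\<Sum>v\<in>{0..n}. indicator {t} (clsv a n v))"
        by (simp add: indicator_def sum.If_cases Int_def)
      finally have "(\<Sum>v\<in>{0..n}. ?f (clsv a n v)) <= 0" by (simp only: sum_subtractf)
      then show "(\<Sum>v\<in>{0..n}. ?f (clsv a n v)) / real (n + 1) <= 0" by (rule divide_nonpos_nonneg) simp
    qed
    then have "measure_pmf.expectation cl (?g K) <= pmf cl t"
      using Bochner_Integration.integral_diff[OF ig ii] by (simp add: measure_pmf_single)
    moreover have "(\<integral>\<^sup>+s. ennreal (?g K s) \<partial>measure_pmf cl) = ennreal (measure_pmf.expectation cl (?g K))"
      by (rule nn_integral_eq_integral[OF ig]) simp
    ultimately show ?thesis by (simp add: ennreal_leI)
  qed
  have sup: "ennreal (real (count (subtrees s) t)) = (SUP K. ennreal (?g K s))" for s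
  proof (rule antisym)
    show "ennreal (real (count (subtrees s) t)) <= (SUP K. ennreal (?g K s))"
      by (rule SUP_upper2[of "count (subtrees s) t"]) simp_all
    show "(SUP K. ennreal (?g K s)) <= ennreal (real (count (subtrees s) t))"
      by (rule SUP_least) (simp add: ennreal_leI)
  qed
  have "(\<integral>\<^sup>+s. ennreal (real (count (subtrees s) t)) \<partial>measure_pmf cl) = (\<integral>\<^sup>+s. (SUP K. ennreal (?g K s)) \<partial>measure_pmf cl)"
    by (intro nn_integral_cong sup)
  also have "... = (SUP K. \<integral>\<^sup>+s. ennreal (?g K s) \<partial>measure_pmf cl)"
    by (rule nn_integral_monotone_convergence_SUP) (auto simp: incseq_def le_fun_def intro!: ennreal_leI)
  also have "... <= ennreal (pmf cl t)" by (rule SUP_least) (rule trunc)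
  finally show ?thesis .
qed

lemma size_count: "(\<integral>\<^sup>+t. ennreal (real (count N t)) \<partial>count_space UNIV) = ennreal (real (size N))"
  for N :: "rtree multiset"
proof -
  have "(\<integral>\<^sup>+t. ennreal (real (count N t)) \<partial>count_space UNIV) = (\<integral>\<^sup>+t. ennreal (real (count N t)) * indicator (set_mset N) t \<partial>count_space UNIV)"
    by (intro nn_integral_cong) (auto simp: indicator_def not_in_iff)
  also have "... = (\<integral>\<^sup>+t. ennreal (real (count N t)) \<partial>count_space (set_mset N))"
    by (simp add: nn_integral_count_space_indicator)
  also have "... = (\<Sum>t\<in>set_mset N. ennreal (real (count N t)))" by (rule nn_integral_count_space_finite) simp
  also have "... = ennreal (real (size N))" by (simp add: size_multiset_overloaded_eq)
  finally show ?thesis .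
qed

text \<open>Both sides of \<open>child_count_le\<close> have the same sum over \<open>t\<close>: on the left it is the mean number of children, which
is at least one, on the right it is one.\<close>

lemma child_count_eq:
  "(\<integral>\<^sup>+s. ennreal (real (count (subtrees s) t)) \<partial>measure_pmf cl) = ennreal (pmf cl t)"
proof -
  let ?J = "\<lambda>t. \<integral>\<^sup>+s. ennreal (real (count (subtrees s) t)) \<partial>measure_pmf cl"
  interpret p: pair_sigma_finite "measure_pmf cl" "count_space (UNIV :: rtree set)"
    by (intro pair_sigma_finite.intro measure_pmf.sigma_finite_measure_axioms sigma_finite_measure_count_space_countable countable_rtree)
  have "1 <= (\<integral>\<^sup>+t. ennreal (of_nat (clen t)) \<partial>measure_pmf U)" by (rule mean_clen_ge_1)
  also have "... = (\<integral>\<^sup>+s. ennreal (real (size (subtrees s))) \<partial>measure_pmf cl)"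
  proof -
    have "size (subtrees (cls t)) = clen t" for t by (cases t) simp
    then show ?thesis unfolding cl_def by simp
  qed
  also have "... = (\<integral>\<^sup>+s. (\<integral>\<^sup>+t. ennreal (real (count (subtrees s) t)) \<partial>count_space UNIV) \<partial>measure_pmf cl)"
    by (simp only: size_count)
  also have "... = (\<integral>\<^sup>+t. ?J t \<partial>count_space UNIV)"
  proof (rule p.Fubini'[symmetric])
    show "case_prod (\<lambda>s t. ennreal (real (count (subtrees s) t))) \<in> borel_measurable (measure_pmf cl \<Otimes>\<^sub>M count_space UNIV)"
      unfolding case_prod_beta
    proof (rule measurable_compose_countable'[where f = "\<lambda>t p. ennreal (real (count (subtrees (fst p)) t))" and g = snd and I = UNIV])
      show "(\<lambda>p. ennreal (real (count (subtrees (fst p)) t))) \<in> borel_measurable (measure_pmf cl \<Otimes>\<^sub>M count_space UNIV)" for t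
        by (rule measurable_compose[OF measurable_fst]) simp
    qed (use countable_rtree in simp_all)
  qed
  finally have ge: "1 <= (\<integral>\<^sup>+t. ?J t \<partial>count_space UNIV)" .
  have tot: "(\<integral>\<^sup>+t. ennreal (pmf cl t) \<partial>count_space UNIV) = 1" by (rule nn_integral_pmf_eq_1)
  have "(\<integral>\<^sup>+t. ?J t \<partial>count_space UNIV) <= (\<integral>\<^sup>+t. ennreal (pmf cl t) \<partial>count_space UNIV)"
    by (intro nn_integral_mono child_count_le)
  then have J1: "(\<integral>\<^sup>+t. ?J t \<partial>count_space UNIV) = 1" using ge tot by simp
  have "(\<integral>\<^sup>+t. (ennreal (pmf cl t) - ?J t) \<partial>count_space UNIV)
     = (\<integral>\<^sup>+t. ennreal (pmf cl t) \<partial>count_space UNIV) - (\<integral>\<^sup>+t. ?J t \<partial>count_space UNIV)"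
    by (rule nn_integral_diff) (use J1 child_count_le in auto)
  also have "... = 0" using J1 tot by simp
  finally have "ennreal (pmf cl t) - ?J t = 0"
    by (subst (asm) nn_integral_0_iff_AE) (auto simp: AE_count_space)
  then have "ennreal (pmf cl t) <= ?J t" by (simp add: diff_eq_0_iff_ennreal ennreal_minus_eq_0)
  then show ?thesis using child_count_le[of t] by (rule antisym[rotated])
qed

lemma fringe_distribution_BP: "fringe_distribution (BP_law B X S)"
  unfolding fringe_distribution_def
proof (intro conjI allI)
  show "prob_space (BP_law B X S)" by (rule BP_law_prob)
  show "sets (BP_law B X S) = sets (count_space UNIV)" using BP_law_sets by simp
  fix t
  let ?V = "map_pmf Some cl"
  let ?h = "\<lambda>s. measure (BP_law B X S) {s} * real (Q_count s t)"
  have m: "measure (BP_law B X S) {s} = pmf ?V s" for s unfolding BP_law_cl by (rule measure_pmf_single)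
  have nn: "(\<integral>\<^sup>+s. ennreal (?h s) \<partial>count_space UNIV) = ennreal (measure (BP_law B X S) {t})"
  proof -
    have "(\<integral>\<^sup>+s. ennreal (?h s) \<partial>count_space UNIV) = (\<integral>\<^sup>+s. ennreal (real (Q_count s t)) \<partial>measure_pmf ?V)"
      unfolding nn_integral_measure_pmf m by (intro nn_integral_cong) (simp add: ennreal_mult')
    also have "... = (\<integral>\<^sup>+s. ennreal (real (Q_count (Some s) t)) \<partial>measure_pmf cl)" by simp
    also have "... = ennreal (pmf ?V t)"
    proof (cases t)
      case None
      then show ?thesis by (simp add: pmf_eq_0_set_pmf)
    next
      case (Some u)
      have "pmf ?V (Some u) = pmf cl u" by (rule pmf_map_inj') simp
      then show ?thesis using child_count_eq[of u] Some by simp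
    qed
    finally show ?thesis unfolding m .
  qed
  have i: "integrable (count_space UNIV) ?h"
    by (rule integrableI_nonneg) (simp_all add: nn)
  then have a: "Infinite_Set_Sum.abs_summable_on ?h UNIV" by (simp add: abs_summable_on_def)
  then have s: "?h summable_on UNIV"
    using abs_summable_equivalent abs_summable_summable by blast
  have "infsum ?h UNIV = infsetsum ?h UNIV" by (rule infsetsum_infsum[OF a, symmetric])
  also have "... = integral\<^sup>L (count_space UNIV) ?h" by (simp add: infsetsum_def)
  also have "... = measure (BP_law B X S) {t}"
    by (subst integral_eq_nn_integral) (simp_all add: nn)
  finally show "(?h has_sum measure (BP_law B X S) {t}) UNIV" using has_sum_infsum[OF s] by simp
qed

end

section \<open>The sin-tree of a fringe distribution\<close>

lemma monotone_rep_cong: "(\<And>j. j <= i ==> \<sigma> j = \<tau> j) ==> monotone_rep \<sigma> i = monotone_rep \<tau> i"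
  by (induction i) auto

text \<open>The subtree grafted at stage \<open>k\<close> is known from stage \<open>k - 1\<close>, so it can be removed again.\<close>

lemma monotone_rep_inj: "(\<forall>j\<le>i. monotone_rep \<sigma> j = monotone_rep \<tau> j) \<longleftrightarrow> (\<forall>j\<le>i. \<sigma> j = \<tau> j)"
proof
  assume "\<forall>j\<le>i. \<sigma> j = \<tau> j"
  then show "\<forall>j\<le>i. monotone_rep \<sigma> j = monotone_rep \<tau> j" by (auto intro!: monotone_rep_cong)
next
  assume e: "\<forall>j\<le>i. monotone_rep \<sigma> j = monotone_rep \<tau> j"
  show "\<forall>j\<le>i. \<sigma> j = \<tau> j"
  proof (intro allI impI)
    fix j assume j: "j <= i"
    show "\<sigma> j = \<tau> j"
    proof (cases j)
      case 0
      then show ?thesis using e[rule_format, of 0] by simp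
    next
      case (Suc k)
      have "subtrees (\<sigma> j) = subtrees (\<tau> j)"
        using e[rule_format, of k] e[rule_format, of "Suc k"] j Suc by simp
      then show ?thesis by (rule rtree.expand)
    qed
  qed
qed

abbreviation path_weight :: "sin_tree => nat => real" where
  "path_weight m i \<equiv> (\<Prod>j=1..i. real (count (subtrees (m j)) (m (j - 1))))"

text \<open>A sequence of trees, each one a subtree of a child of the root of the next, is a monotone representation.\<close>

lemma monotone_rep_surj:
  assumes "\<forall>j<i. m j \<in># subtrees (m (Suc j))"
  obtains \<tau> where "\<And>j. j <= i ==> monotone_rep \<tau> j = m j"
proof
  let ?\<tau> = "\<lambda>j. case j of 0 => m 0 | Suc k => Node (subtrees (m (Suc k)) - {#m k#})"
  show "monotone_rep ?\<tau> j = m j" if "j <= i" for j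
    using that
  proof (induction j)
    case (Suc j)
    then have "m j \<in># subtrees (m (Suc j))" using assms by simp
    then show ?case using Suc by (cases "m (Suc j)") simp
  qed simp
qed

text \<open>Sequences of trees that are not a monotone representation have probability zero on both sides: some factor
\<open>Q\<close> vanishes.\<close>

lemma sin_tree_law_iff:
  "sin_tree_law (measure_pmf (map_pmf Some w)) \<mu> \<longleftrightarrow> prob_space \<mu> & sets \<mu> = sets sin_tree_space &
    (\<forall>i s. measure \<mu> {\<tau> \<in> space \<mu>. \<forall>j\<le>i. \<tau> j = s j} = pmf w (monotone_rep s i) * path_weight (monotone_rep s) i)"
proof -
  let ?D = "measure_pmf (map_pmf Some w)"
  have Some: "measure ?D {Some u} = pmf w u" for u
    unfolding measure_pmf_single by (rule pmf_map_inj') simp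
  have None: "measure ?D {None} = 0"
    unfolding measure_pmf_single by (simp add: pmf_eq_0_set_pmf)
  have eq: "{\<tau> \<in> space \<mu>. \<forall>j\<le>i. Some (monotone_rep \<tau> j) = Some (monotone_rep s j)} = {\<tau> \<in> space \<mu>. \<forall>j\<le>i. \<tau> j = s j}" for i s
    using monotone_rep_inj[of i _ s] by simp
  have "(\<forall>i t. measure \<mu> {\<tau> \<in> space \<mu>. \<forall>j\<le>i. Some (monotone_rep \<tau> j) = t j} =
        measure ?D {t i} * (\<Prod>j=1..i. real (Q_count (t j) (t (j - 1))))) \<longleftrightarrow>
    (\<forall>i s. measure \<mu> {\<tau> \<in> space \<mu>. \<forall>j\<le>i. \<tau> j = s j} = pmf w (monotone_rep s i) * path_weight (monotone_rep s) i)" (is "?L \<longleftrightarrow> ?R")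
  proof
    assume L: ?L
    show ?R
    proof (intro allI)
      fix i s
      show "measure \<mu> {\<tau> \<in> space \<mu>. \<forall>j\<le>i. \<tau> j = s j} = pmf w (monotone_rep s i) * path_weight (monotone_rep s) i"
        using L[rule_format, of i "\<lambda>j. Some (monotone_rep s j)"] unfolding eq Some Q_count.simps .
    qed
  next
    assume R: ?R
    show ?L
    proof (intro allI)
      fix i and t :: "nat => rtree option"
      let ?A = "{\<tau> \<in> space \<mu>. \<forall>j\<le>i. Some (monotone_rep \<tau> j) = t j}"
      let ?p = "\<Prod>j=1..i. real (Q_count (t j) (t (j - 1)))"
      show "measure \<mu> ?A = measure ?D {t i} * ?p"
      proof (cases "\<exists>s. \<forall>j\<le>i. t j = Some (monotone_rep s j)")
        case True
        then obtain s where s: "\<forall>j\<le>i. t j = Some (monotone_rep s j)" by blast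
        have A: "?A = {\<tau> \<in> space \<mu>. \<forall>j\<le>i. Some (monotone_rep \<tau> j) = Some (monotone_rep s j)}"
          using s by (intro Collect_cong conj_cong refl) auto
        have p: "?p = path_weight (monotone_rep s) i"
        proof (intro prod.cong refl)
          fix j assume "j \<in> {1..i}"
          then have "t j = Some (monotone_rep s j)" "t (j - 1) = Some (monotone_rep s (j - 1))" using s by auto
          then show "real (Q_count (t j) (t (j - 1))) = real (count (subtrees (monotone_rep s j)) (monotone_rep s (j - 1)))" by simp
        qed
        have ti: "t i = Some (monotone_rep s i)" using s by blast
        show ?thesis unfolding A eq p ti Some using R by blast
      next
        case False
        have A: "?A = {}"
        proof (rule ccontr)
          assume "?A ~= {}"
          then obtain \<tau> where "\<forall>j\<le>i. Some (monotone_rep \<tau> j) = t j" by blast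
          then have "\<forall>j\<le>i. t j = Some (monotone_rep \<tau> j)" by simp
          then show False using False by blast
        qed
        have "measure ?D {t i} * ?p = 0"
        proof (rule ccontr)
          assume nz: "measure ?D {t i} * ?p ~= 0"
          have ti: "t i ~= None"
          proof
            assume "t i = None"
            then show False using nz None by (simp only: mult_zero_left)
          qed
          have q: "Q_count (t (Suc j)) (t j) ~= 0" if "j < i" for j
          proof -
            have "\<forall>j\<in>{1..i}. real (Q_count (t j) (t (j - 1))) ~= 0" using nz by simp
            from this[rule_format, of "Suc j"] show ?thesis using that by simp
          qed
          have "t j ~= None" if "j <= i" for j
          proof (cases "j = i")
            case False
            then have "Q_count (t (Suc j)) (t j) ~= 0" using that q by simp
            then show ?thesis by (cases "t (Suc j)"; cases "t j") auto
          qed (use ti in simp)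
          then have tS: "t j = Some (the (t j))" if "j <= i" for j using that by simp
          have "the (t j) \<in># subtrees (the (t (Suc j)))" if "j < i" for j
          proof -
            have "Q_count (Some (the (t (Suc j)))) (Some (the (t j))) ~= 0"
              using q[OF that] tS[of j] tS[of "Suc j"] that by simp
            then show ?thesis unfolding Q_count.simps by (simp add: not_in_iff[symmetric])
          qed
          then obtain s where "\<And>j. j <= i ==> monotone_rep s j = the (t j)"
            using monotone_rep_surj[of i "\<lambda>j. the (t j)"] by blast
          then have "\<forall>j\<le>i. t j = Some (monotone_rep s j)" using tS by simp
          then show False using False by blast
        qed
        then show ?thesis unfolding A by simp
      qed
    qed
  qed
  then show ?thesis unfolding sin_tree_law_def by (simp only:)
qed

lemma measurable_prefix:
  assumes "sets \<mu> = sets sin_tree_space"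
  shows "(\<lambda>\<tau>. map (\<lambda>i. Some (\<tau> i)) [0..<Suc k]) \<in> measurable \<mu> (count_space UNIV)"
proof -
  have sp: "space \<mu> = UNIV" using sets_eq_imp_space_eq[OF assms] by (simp add: sin_tree_space_def space_PiM)
  have comp: "{\<tau> \<in> space \<mu>. \<tau> i = x} \<in> sets \<mu>" for i x
  proof -
    have "(\<lambda>\<tau>. \<tau> i) \<in> measurable sin_tree_space (count_space UNIV)"
      unfolding sin_tree_space_def by (rule measurable_component_singleton) simp
    then have "(\<lambda>\<tau>. \<tau> i) \<in> measurable \<mu> (count_space UNIV)"
      unfolding measurable_cong_sets[OF assms refl] .
    from measurable_sets[OF this, of "{x}"] show ?thesis by (simp add: vimage_def Int_def conj_commute)
  qed
  have ctbl: "countable (UNIV :: rtree option list set)"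
    using countable_lists[OF countable_rtree_option] by simp
  show ?thesis
  proof (rule measurable_count_space_eq_countable[OF ctbl, THEN iffD2], intro conjI ballI)
    show "(\<lambda>\<tau>. map (\<lambda>i. Some (\<tau> i)) [0..<Suc k]) \<in> space \<mu> \<rightarrow> UNIV" by simp
    fix xs :: "rtree option list"
    show "(\<lambda>\<tau>. map (\<lambda>i. Some (\<tau> i)) [0..<Suc k]) -` {xs} \<inter> space \<mu> \<in> sets \<mu>"
    proof (cases "\<exists>s. xs = map (\<lambda>i. Some (s i)) [0..<Suc k]")
      case True
      then obtain s where s: "xs = map (\<lambda>i. Some (s i)) [0..<Suc k]" by blast
      have "(\<lambda>\<tau>. map (\<lambda>i. Some (\<tau> i)) [0..<Suc k]) -` {xs} \<inter> space \<mu> = {\<tau> \<in> space \<mu>. \<forall>i\<in>{0..<Suc k}. \<tau> i = s i}"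
        unfolding s by (auto simp del: upt_Suc)
      also have "... \<in> sets \<mu>" by (rule sets.sets_Collect_finite_All[OF comp]) simp
      finally show ?thesis .
    next
      case False
      then have "(\<lambda>\<tau>. map (\<lambda>i. Some (\<tau> i)) [0..<Suc k]) -` {xs} \<inter> space \<mu> = {}" by blast
      then show ?thesis by simp
    qed
  qed
qed

lemma sin_fringe_law_prob:
  assumes "prob_space \<mu>" "sets \<mu> = sets sin_tree_space"
  shows "prob_space (sin_fringe_law \<mu> k)" "sets (sin_fringe_law \<mu> k) = UNIV"
  unfolding sin_fringe_law_def
  by (rule prob_space.prob_space_distr[OF assms(1) measurable_prefix[OF assms(2)]]) simp

lemma sin_fringe_law_atom:
  assumes "sets \<mu> = sets sin_tree_space"
  shows "measure (sin_fringe_law \<mu> k) {map (\<lambda>i. Some (s i)) [0..<Suc k]} = measure \<mu> {\<tau> \<in> space \<mu>. \<forall>j\<le>k. \<tau> j = s j}"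
    and "\<nexists>s. xs = map (\<lambda>i. Some (s i)) [0..<Suc k] ==> measure (sin_fringe_law \<mu> k) {xs} = 0"
proof -
  have m: "measure (sin_fringe_law \<mu> k) {xs} = measure \<mu> ((\<lambda>\<tau>. map (\<lambda>i. Some (\<tau> i)) [0..<Suc k]) -` {xs} \<inter> space \<mu>)" for xs
    unfolding sin_fringe_law_def by (rule measure_distr[OF measurable_prefix[OF assms]]) simp
  have "(\<lambda>\<tau>. map (\<lambda>i. Some (\<tau> i)) [0..<Suc k]) -` {map (\<lambda>i. Some (s i)) [0..<Suc k]} \<inter> space \<mu> = {\<tau> \<in> space \<mu>. \<forall>j\<le>k. \<tau> j = s j}"
    by (auto simp: less_Suc_eq_le simp del: upt_Suc)
  then show "measure (sin_fringe_law \<mu> k) {map (\<lambda>i. Some (s i)) [0..<Suc k]} = measure \<mu> {\<tau> \<in> space \<mu>. \<forall>j\<le>k. \<tau> j = s j}"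
    unfolding m by simp
  assume "\<nexists>s. xs = map (\<lambda>i. Some (s i)) [0..<Suc k]"
  then have "(\<lambda>\<tau>. map (\<lambda>i. Some (\<tau> i)) [0..<Suc k]) -` {xs} \<inter> space \<mu> = {}" by blast
  then show "measure (sin_fringe_law \<mu> k) {xs} = 0" unfolding m by simp
qed

text \<open>The law of each finite initial segment is discrete and prescribed, and these laws determine a measure on the
product space.\<close>

lemma sin_tree_law_unique:
  assumes \<mu>: "sin_tree_law (measure_pmf (map_pmf Some w)) \<mu>" and \<nu>: "sin_tree_law (measure_pmf (map_pmf Some w)) \<nu>"
  shows "\<mu> = \<nu>"
proof -
  note M = \<mu>[unfolded sin_tree_law_iff] and N = \<nu>[unfolded sin_tree_law_iff]
  have sM: "sets \<mu> = sets sin_tree_space" and sN: "sets \<nu> = sets sin_tree_space" using M N by blast+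
  have pM: "prob_space \<mu>" and pN: "prob_space \<nu>" using M N by blast+
  have spM: "space \<mu> = UNIV" "space \<nu> = UNIV"
    using sets_eq_imp_space_eq[OF sM] sets_eq_imp_space_eq[OF sN] by (simp_all add: sin_tree_space_def space_PiM)
  have fr: "sin_fringe_law \<mu> k = sin_fringe_law \<nu> k" for k
  proof (rule measure_eqI_countable[where A = UNIV])
    show "countable (UNIV :: rtree option list set)" using countable_lists[OF countable_rtree_option] by simp
    fix xs :: "rtree option list"
    have "measure (sin_fringe_law \<mu> k) {xs} = measure (sin_fringe_law \<nu> k) {xs}"
    proof (cases "\<exists>s. xs = map (\<lambda>i. Some (s i)) [0..<Suc k]")
      case True
      then obtain s where s: "xs = map (\<lambda>i. Some (s i)) [0..<Suc k]" by blast
      show ?thesis unfolding s sin_fringe_law_atom(1)[OF sM] sin_fringe_law_atom(1)[OF sN] using M N by simp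
    qed (simp add: sin_fringe_law_atom(2)[OF sM] sin_fringe_law_atom(2)[OF sN])
    then show "emeasure (sin_fringe_law \<mu> k) {xs} = emeasure (sin_fringe_law \<nu> k) {xs}"
      using prob_space.finite_measure[OF sin_fringe_law_prob(1)[OF pM sM]] prob_space.finite_measure[OF sin_fringe_law_prob(1)[OF pN sN]]
      by (simp add: finite_measure.emeasure_eq_measure)
  qed (simp_all add: sin_fringe_law_def)
  show ?thesis
  proof (rule measure_eqI_PiM_infinite[where I = UNIV and M = "\<lambda>_. count_space UNIV"])
    show "sets \<mu> = sets (\<Pi>\<^sub>M i\<in>UNIV. count_space UNIV)" "sets \<nu> = sets (\<Pi>\<^sub>M i\<in>UNIV. count_space UNIV)"
      using sM sN by (simp_all add: sin_tree_space_def)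
    show "finite_measure \<mu>" using pM by (rule prob_space.finite_measure)
    fix A :: "nat => rtree set" and J :: "nat set" assume J: "finite J"
    obtain k where k: "\<forall>j\<in>J. j <= k" using J finite_nat_set_iff_bounded_le by blast
    let ?Y = "{xs :: rtree option list. \<forall>j\<in>J. xs ! j \<in> Some ` A j}"
    have box: "prod_emb UNIV (\<lambda>_. count_space UNIV) J (Pi\<^sub>E J A)
      = (\<lambda>\<tau>. map (\<lambda>i. Some (\<tau> i)) [0..<Suc k]) -` ?Y"
    proof (intro set_eqI)
      fix \<tau> :: sin_tree
      have "map (\<lambda>i. Some (\<tau> i)) [0..<Suc k] ! j = Some (\<tau> j)" if "j \<in> J" for j
        using k that by (subst nth_map) (auto simp: less_Suc_eq_le simp del: upt_Suc)
      then show "\<tau> \<in> prod_emb UNIV (\<lambda>_. count_space UNIV) J (Pi\<^sub>E J A) \<longleftrightarrow> \<tau> \<in> (\<lambda>\<tau>. map (\<lambda>i. Some (\<tau> i)) [0..<Suc k]) -` ?Y"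
        unfolding prod_emb_def by (simp add: PiE_iff image_iff del: upt_Suc)
    qed
    have "emeasure (sin_fringe_law \<mu> k) ?Y = emeasure \<mu> (prod_emb UNIV (\<lambda>_. count_space UNIV) J (Pi\<^sub>E J A))"
      unfolding sin_fringe_law_def box by (subst emeasure_distr[OF measurable_prefix[OF sM]]) (simp_all add: spM)
    moreover have "emeasure (sin_fringe_law \<nu> k) ?Y = emeasure \<nu> (prod_emb UNIV (\<lambda>_. count_space UNIV) J (Pi\<^sub>E J A))"
      unfolding sin_fringe_law_def box by (subst emeasure_distr[OF measurable_prefix[OF sN]]) (simp_all add: spM)
    ultimately show "emeasure \<mu> (prod_emb UNIV (\<lambda>_. count_space UNIV) J (Pi\<^sub>E J A)) = emeasure \<nu> (prod_emb UNIV (\<lambda>_. count_space UNIV) J (Pi\<^sub>E J A))"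
      unfolding fr by simp
  qed
qed

locale fringe_pmf =
  fixes w :: "rtree pmf"
  assumes fringe: "(\<integral>\<^sup>+s. ennreal (real (count (subtrees s) t)) \<partial>measure_pmf w) = ennreal (pmf w t)"
begin

text \<open>A tree of probability zero is almost surely not the subtree of any child of the root.\<close>

lemma fringe_zero:
  assumes "pmf w t = 0"
  shows "pmf w s * real (count (subtrees s) t) = 0"
proof -
  have "(\<integral>\<^sup>+s. ennreal (real (count (subtrees s) t)) \<partial>measure_pmf w) = 0" using fringe[of t] assms by simp
  then have "AE s in measure_pmf w. ennreal (real (count (subtrees s) t)) = 0"
    by (subst (asm) nn_integral_0_iff_AE) simp_all
  then have "\<forall>s\<in>set_pmf w. count (subtrees s) t = 0" by (simp add: AE_measure_pmf_iff)
  then show ?thesis by (cases "s \<in> set_pmf w") (simp_all add: pmf_eq_0_set_pmf)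
qed

definition graft :: "rtree => rtree => rtree" where
  "graft m s = Node (add_mset m (subtrees s))"

text \<open>The law of the next tree on the path, given the tree \<open>m\<close> built so far. If \<open>m\<close> has probability zero, any
law will do.\<close>

definition step_pmf :: "rtree => rtree pmf" where
  "step_pmf m = (if pmf w m = 0 then return_pmf m
    else embed_pmf (\<lambda>s. pmf w (graft m s) * real (count (subtrees (graft m s)) m) / pmf w m))"

text \<open>The total mass is one by the fringe property of \<open>m\<close>, after reindexing along the injection \<open>graft m\<close>.\<close>

lemma pmf_step:
  assumes "pmf w m ~= 0"
  shows "pmf (step_pmf m) s = pmf w (graft m s) * real (count (subtrees (graft m s)) m) / pmf w m"
proof -
  let ?h = "\<lambda>u. pmf w u * real (count (subtrees u) m) / pmf w m"
  have inj: "inj (graft m)"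
    by (rule injI) (auto simp: graft_def intro: rtree.expand)
  have out: "?h u = 0" if "u \<notin> range (graft m)" for u
  proof -
    have "m \<notin># subtrees u"
    proof
      assume "m \<in># subtrees u"
      then have "graft m (Node (subtrees u - {#m#})) = u" by (simp add: graft_def)
      then show False using that by (metis rangeI)
    qed
    then show ?thesis by (simp add: not_in_iff)
  qed
  have "(\<integral>\<^sup>+s. ennreal (?h (graft m s)) \<partial>count_space UNIV) = (\<integral>\<^sup>+u. ennreal (?h u) \<partial>count_space (range (graft m)))"
    by (rule nn_integral_bij_count_space) (simp add: bij_betw_def inj)
  also have "... = (\<integral>\<^sup>+u. ennreal (?h u) * indicator (range (graft m)) u \<partial>count_space UNIV)"
    by (simp add: nn_integral_count_space_indicator)
  also have "... = (\<integral>\<^sup>+u. ennreal (pmf w u) * ennreal (real (count (subtrees u) m)) / ennreal (pmf w m) \<partial>count_space UNIV)"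
  proof (rule nn_integral_cong)
    fix u
    have pos: "0 < pmf w m" using assms by (simp add: less_le)
    show "ennreal (?h u) * indicator (range (graft m)) u = ennreal (pmf w u) * ennreal (real (count (subtrees u) m)) / ennreal (pmf w m)"
    proof (cases "u \<in> range (graft m)")
      case True
      then show ?thesis using pos by (simp add: ennreal_mult' divide_ennreal[symmetric])
    next
      case False
      have "ennreal (?h u) = ennreal (pmf w u) * ennreal (real (count (subtrees u) m)) / ennreal (pmf w m)"
        using pos by (simp add: ennreal_mult' divide_ennreal[symmetric])
      then show ?thesis using out[OF False] False by simp
    qed
  qed
  also have "... = (\<integral>\<^sup>+u. ennreal (real (count (subtrees u) m)) \<partial>measure_pmf w) / ennreal (pmf w m)"
    unfolding nn_integral_measure_pmf by (rule nn_integral_divide) simp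
  also have "... = 1" unfolding fringe using assms by (intro ennreal_divide_self) (auto simp: less_le)
  finally have "(\<integral>\<^sup>+s. ennreal (?h (graft m s)) \<partial>count_space UNIV) = 1" .
  then show ?thesis unfolding step_pmf_def using assms by (simp add: pmf_embed_pmf)
qed

definition kern :: "nat => sin_tree => rtree measure" where
  "kern i \<tau> = measure_pmf (case i of 0 => w | Suc j => step_pmf (monotone_rep \<tau> j))"

lemma PiM_prefix: "PiM {0..<i::nat} (\<lambda>_. count_space (UNIV :: rtree set)) = count_space ({0..<i} \<rightarrow>\<^sub>E UNIV)"
  by (rule count_space_PiM_finite) (simp_all add: countable_rtree)

sublocale IT: Ionescu_Tulcea kern "\<lambda>_. count_space UNIV"
proof (rule Ionescu_Tulcea.intro)
  show "kern i \<in> measurable (PiM {0..<i} (\<lambda>_. count_space UNIV)) (subprob_algebra (count_space UNIV))" for i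
    unfolding PiM_prefix
    by (auto simp: space_subprob_algebra kern_def intro!: measure_pmf.subprob_space_axioms)
  show "prob_space (kern i x)" for i x unfolding kern_def by (rule prob_space_measure_pmf)
qed

text \<open>The transition probabilities telescope to the prescribed weight of the path.\<close>

lemma C_atom:
  "emeasure (IT.C 0 (Suc i) (\<lambda>_. undefined)) {restrict s {0..<Suc i}}
    = ennreal (pmf w (monotone_rep s i) * path_weight (monotone_rep s) i)"
proof -
  let ?u = "\<lambda>_::nat. undefined :: rtree"
  let ?M = "\<lambda>i. PiM {0..<i} (\<lambda>_. count_space (UNIV :: rtree set))"
  have u: "?u \<in> space (?M 0)" by (simp add: space_PiM)
  have atom: "{restrict s {0..<i}} \<in> sets (?M i)" for i unfolding PiM_prefix by auto
  have step: "emeasure (IT.C 0 (Suc i) ?u) {restrict s {0..<Suc i}}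
     = emeasure (IT.C 0 i ?u) {restrict s {0..<i}} * emeasure (kern i s) {s i}" for i
  proof -
    have sp: "space (IT.C 0 i ?u) = space (?M i)" using IT.space_C[OF u, of i] by simp
    have sc: "sets (IT.C 0 i ?u) = sets (?M i)" using IT.sets_C[OF u, of i] by simp
    have kc: "kern i (restrict s {0..<i}) = kern i s"
    proof (cases i)
      case (Suc j)
      have "monotone_rep (restrict s {0..<i}) j = monotone_rep s j"
        by (rule monotone_rep_cong) (simp add: Suc)
      then show ?thesis unfolding kern_def Suc by simp
    qed (simp add: kern_def)
    have "emeasure (IT.C 0 (Suc i) ?u) {restrict s {0..<Suc i}} = (\<integral>\<^sup>+x. emeasure (IT.eP i x) {restrict s {0..<Suc i}} \<partial>IT.C 0 i ?u)"
      unfolding IT.C.simps add_0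
    proof (rule emeasure_bind)
      show "space (IT.C 0 i ?u) ~= {}" unfolding sp by (simp add: space_PiM PiE_eq_empty_iff)
      show "IT.eP i \<in> measurable (IT.C 0 i ?u) (subprob_algebra (?M (Suc i)))"
        unfolding measurable_cong_sets[OF sc refl] by (rule IT.measurable_eP)
      show "{restrict s {0..<Suc i}} \<in> sets (?M (Suc i))" by (rule atom)
    qed
    also have "... = (\<integral>\<^sup>+x. emeasure (kern i s) {s i} * indicator {restrict s {0..<i}} x \<partial>IT.C 0 i ?u)"
    proof (rule nn_integral_cong)
      fix x assume "x \<in> space (IT.C 0 i ?u)"
      then have x: "x \<in> space (?M i)" unfolding sp .
      then have ext: "x \<in> extensional {0..<i}" by (simp add: space_PiM PiE_iff)
      have iff: "x(i := y) = restrict s {0..<Suc i} \<longleftrightarrow> x = restrict s {0..<i} & y = s i" for y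
      proof
        assume e: "x(i := y) = restrict s {0..<Suc i}"
        have "x j = restrict s {0..<i} j" for j
          using fun_cong[OF e, of j] ext by (cases "j < i") (auto simp: extensional_def)
        then show "x = restrict s {0..<i} & y = s i" using fun_cong[OF e, of i] by auto
      next
        assume "x = restrict s {0..<i} & y = s i"
        then show "x(i := y) = restrict s {0..<Suc i}" by (auto simp: fun_eq_iff)
      qed
      have "emeasure (IT.eP i x) {restrict s {0..<Suc i}}
        = emeasure (kern i x) ((\<lambda>y. x(i := y)) -` {restrict s {0..<Suc i}} \<inter> space (count_space UNIV))"
        by (rule IT.emeasure_eP[OF x atom])
      also have "(\<lambda>y. x(i := y)) -` {restrict s {0..<Suc i}} \<inter> space (count_space UNIV) = (if x = restrict s {0..<i} then {s i} else {})"
        using iff by auto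
      finally have F: "emeasure (IT.eP i x) {restrict s {0..<Suc i}} = emeasure (kern i x) (if x = restrict s {0..<i} then {s i} else {})" .
      show "emeasure (IT.eP i x) {restrict s {0..<Suc i}} = emeasure (kern i s) {s i} * indicator {restrict s {0..<i}} x"
      proof (cases "x = restrict s {0..<i}")
        case True
        show ?thesis unfolding F if_P[OF True] unfolding True kc by simp
      next
        case False
        then show ?thesis unfolding F if_not_P[OF False] by simp
      qed
    qed
    also have "... = emeasure (kern i s) {s i} * emeasure (IT.C 0 i ?u) {restrict s {0..<i}}"
      by (rule nn_integral_cmult_indicator) (simp only: sc atom)
    finally show ?thesis by (simp add: mult.commute)
  qed
  show ?thesis
  proof (induction i)
    case 0
    have "emeasure (IT.C 0 0 ?u) {restrict s {0..<0}} = 1"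
      using atom[of 0] by (simp add: restrict_def)
    then show ?case unfolding step[of 0] by (simp add: kern_def emeasure_pmf_single)
  next
    case (Suc i)
    let ?m = "monotone_rep s i" and ?m' = "monotone_rep s (Suc i)"
    let ?q = "real (count (subtrees ?m') ?m)"
    have g: "graft ?m (s (Suc i)) = ?m'" by (simp add: graft_def)
    have pw: "path_weight (monotone_rep s) (Suc i) = path_weight (monotone_rep s) i * ?q"
      by (subst prod.nat_ivl_Suc') simp_all
    have "emeasure (IT.C 0 (Suc (Suc i)) ?u) {restrict s {0..<Suc (Suc i)}}
       = ennreal (pmf w ?m * path_weight (monotone_rep s) i) * ennreal (pmf (step_pmf ?m) (s (Suc i)))"
      unfolding step[of "Suc i"] Suc.IH by (simp add: kern_def emeasure_pmf_single)
    also have "... = ennreal (pmf w ?m * path_weight (monotone_rep s) i * pmf (step_pmf ?m) (s (Suc i)))"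
      by (intro ennreal_mult[symmetric] mult_nonneg_nonneg prod_nonneg) auto
    also have "pmf w ?m * path_weight (monotone_rep s) i * pmf (step_pmf ?m) (s (Suc i)) = pmf w ?m' * path_weight (monotone_rep s) (Suc i)"
    proof (cases "pmf w ?m = 0")
      case True
      from fringe_zero[OF this, of ?m'] True show ?thesis unfolding pw by (simp only: mult_zero_left mult.left_commute[of "pmf w ?m'"] mult_zero_right)
    next
      case False
      then show ?thesis unfolding pmf_step[OF False] g pw by simp
    qed
    finally show ?case .
  qed
qed

lemma sin_tree_law_exists: "sin_tree_law (measure_pmf (map_pmf Some w)) IT.PF.lim"
  unfolding sin_tree_law_iff
proof (intro conjI allI)
  show "prob_space IT.PF.lim"
  proof (rule prob_spaceI)
    have e: "prod_emb UNIV (\<lambda>_. count_space UNIV) {} {\<lambda>_. undefined} = space IT.PF.lim"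
      using IT.PF.space_lim by (simp add: prod_emb_def space_PiM vimage_def restrict_def)
    interpret C: prob_space "IT.CI {}" by (rule IT.PF.prob_space_P) simp_all
    have X: "{\<lambda>_. undefined} \<in> sets (PiM {} (\<lambda>_. count_space (UNIV :: rtree set)))"
      using sets.top[of "PiM {} (\<lambda>_. count_space (UNIV :: rtree set))"] by (simp add: space_PiM)
    have "emeasure IT.PF.lim (space IT.PF.lim) = emeasure (IT.CI {}) {\<lambda>_. undefined}"
      unfolding e[symmetric] by (rule IT.lim) (use X in simp_all)
    also have "... = emeasure (IT.CI {}) (space (IT.CI {}))"
      by (simp add: IT.CI_def space_PiM)
    finally show "emeasure IT.PF.lim (space IT.PF.lim) = 1" using C.emeasure_space_1 by simp
  qed
  show sets: "sets IT.PF.lim = sets sin_tree_space" unfolding sin_tree_space_def by (rule IT.PF.sets_lim)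
  fix i and s :: sin_tree
  let ?J = "{0..<Suc i}"
  let ?X = "{restrict s ?J}"
  have X: "?X \<in> sets (PiM ?J (\<lambda>_. count_space UNIV))" unfolding PiM_prefix by auto
  have sp: "space IT.PF.lim = UNIV" using sets_eq_imp_space_eq[OF sets] by (simp add: sin_tree_space_def space_PiM)
  have "prod_emb UNIV (\<lambda>_. count_space UNIV) ?J ?X = {\<tau> \<in> space IT.PF.lim. \<forall>j\<le>i. \<tau> j = s j}"
  proof -
    have "restrict \<tau> ?J = restrict s ?J \<longleftrightarrow> (\<forall>j\<le>i. \<tau> j = s j)" for \<tau>
    proof
      assume e: "restrict \<tau> ?J = restrict s ?J"
      show "\<forall>j\<le>i. \<tau> j = s j"
      proof (intro allI impI)
        fix j assume "j <= i"
        then show "\<tau> j = s j" using fun_cong[OF e, of j] by simp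
      qed
    qed (auto simp: fun_eq_iff)
    then show ?thesis unfolding prod_emb_def sp by auto
  qed
  moreover have "emeasure IT.PF.lim (prod_emb UNIV (\<lambda>_. count_space UNIV) ?J ?X) = emeasure (IT.CI ?J) ?X"
    by (rule IT.lim) (use X in simp_all)
  moreover have "emeasure (IT.CI ?J) ?X = emeasure (IT.C 0 (Suc i) (\<lambda>_. undefined)) (prod_emb ?J (\<lambda>_. count_space UNIV) ?J ?X)"
    by (rule IT.emeasure_CI[OF subset_refl X])
  moreover have "prod_emb ?J (\<lambda>_. count_space UNIV) ?J ?X = ?X"
    by (rule prod_emb_id) auto
  ultimately have "emeasure IT.PF.lim {\<tau> \<in> space IT.PF.lim. \<forall>j\<le>i. \<tau> j = s j} = ennreal (pmf w (monotone_rep s i) * path_weight (monotone_rep s) i)"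
    using C_atom[of i s] by simp
  then show "measure IT.PF.lim {\<tau> \<in> space IT.PF.lim. \<forall>j\<le>i. \<tau> j = s j} = pmf w (monotone_rep s i) * path_weight (monotone_rep s) i"
    unfolding measure_def by (simp add: prod_nonneg)
qed

end

section \<open>Convergence\<close>

lemma finite_set_large_measure:
  assumes L: "prob_space L" "sets L = UNIV" and c: "countable (UNIV :: 'x set)" and e: "\<eta> > 0"
  obtains G :: "'x set" where "finite G" "measure L G >= 1 - \<eta>"
proof -
  interpret L: prob_space L by (rule L)
  let ?A = "\<lambda>i. {x :: 'x. to_nat_on UNIV x < i}"
  have sp: "space L = UNIV" using sets.top[of L] sets.space_closed[of L] L(2) by blast
  have fin: "finite (?A i)" for i
    by (rule finite_imageD[of "to_nat_on UNIV"])
       (auto intro!: finite_subset[of _ "{..<i}"] inj_on_subset[OF inj_on_to_nat_on[OF c]])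
  have "(\<lambda>i. measure L (?A i)) \<longlonglongrightarrow> measure L (\<Union>i. ?A i)"
    by (rule L.finite_Lim_measure_incseq) (auto simp: L(2) incseq_def)
  moreover have "(\<Union>i. ?A i) = space L" unfolding sp by auto
  ultimately have "(\<lambda>i. measure L (?A i)) \<longlonglongrightarrow> 1" using L.prob_space by simp
  then have "\<forall>\<^sub>F i in sequentially. 1 - \<eta> < measure L (?A i)"
    by (rule order_tendstoD) (use e in simp)
  then have "\<exists>i. 1 - \<eta> < measure L (?A i)" by (rule eventually_happens'[OF sequentially_bot])
  then obtain i where "1 - \<eta> < measure L (?A i)" ..
  from that[OF fin less_imp_le[OF this]] show ?thesis .
qed

context reinforcement begin

lemma conv_hist_transfer:
  assumes R: "reinforced_pa_trees \<delta> M A" and X: "conv_hist X c"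
    and Y: "\<And>n \<omega>. \<omega> \<in> space M ==> Y n \<omega> = X n (restr n (\<lambda>j. A j \<omega>))"
  shows "conv_in_prob M Y c"
  unfolding conv_in_prob_def
proof (intro conjI allI impI)
  fix n
  have "(\<lambda>\<omega>. X n (restr n (\<lambda>j. A j \<omega>))) \<in> borel_measurable M"
    by (rule measurable_compose[OF restr_measurable(1)[OF R]]) simp
  then show "Y n \<in> borel_measurable M"
    using measurable_cong[of M "Y n" "\<lambda>\<omega>. X n (restr n (\<lambda>j. A j \<omega>))"] Y by blast
next
  fix \<epsilon> :: real assume e: "\<epsilon> > 0"
  have "measure M {\<omega> \<in> space M. \<bar>Y n \<omega> - c\<bar> > \<epsilon>} = measure_pmf.prob (hist n) {a. \<bar>X n a - c\<bar> > \<epsilon>}" for n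
  proof -
    have "{\<omega> \<in> space M. \<bar>Y n \<omega> - c\<bar> > \<epsilon>} = {\<omega> \<in> space M. \<bar>X n (restr n (\<lambda>j. A j \<omega>)) - c\<bar> > \<epsilon>}"
      using Y by (intro Collect_cong conj_cong) simp_all
    then show ?thesis using prob_eq_hist[OF R, of "\<lambda>a. \<bar>X n a - c\<bar> > \<epsilon>" n] by simp
  qed
  then show "(\<lambda>n. measure M {\<omega> \<in> space M. \<bar>Y n \<omega> - c\<bar> > \<epsilon>}) \<longlonglongrightarrow> 0"
    using X e unfolding conv_hist_def by simp
qed

lemma conv_hist_perturb:
  assumes X: "conv_hist X c" and d: "\<delta>' \<longlonglongrightarrow> 0"
    and le: "\<And>n a. n >= 1 ==> history n a ==> \<bar>Y n a - X n a\<bar> <= \<delta>' n"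
  shows "conv_hist Y c"
  unfolding conv_hist_def
proof (intro allI impI)
  fix \<epsilon> :: real assume e: "\<epsilon> > 0"
  have "\<forall>\<^sub>F n in sequentially. \<delta>' n < \<epsilon> / 2" using order_tendstoD(2)[OF d, of "\<epsilon> / 2"] e by simp
  then have ev: "\<forall>\<^sub>F n in sequentially. measure_pmf.prob (hist n) {a. \<bar>Y n a - c\<bar> > \<epsilon>} <= measure_pmf.prob (hist n) {a. \<bar>X n a - c\<bar> > \<epsilon> / 2}"
    using eventually_ge_at_top[of 1]
  proof eventually_elim
    case (elim n)
    show ?case
    proof (rule measure_pmf.finite_measure_mono_AE)
      show "AE a in measure_pmf (hist n). a \<in> {a. \<bar>Y n a - c\<bar> > \<epsilon>} --> a \<in> {a. \<bar>X n a - c\<bar> > \<epsilon> / 2}"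
        unfolding AE_measure_pmf_iff mem_Collect_eq
      proof (intro ballI impI)
        fix a assume "a \<in> set_pmf (hist n)" and Y: "\<epsilon> < \<bar>Y n a - c\<bar>"
        then have "\<bar>Y n a - X n a\<bar> <= \<delta>' n" using le elim history_hist by blast
        then show "\<epsilon> / 2 < \<bar>X n a - c\<bar>" using Y elim by linarith
      qed
    qed simp
  qed
  have lim: "(\<lambda>n. measure_pmf.prob (hist n) {a. \<bar>X n a - c\<bar> > \<epsilon> / 2}) \<longlonglongrightarrow> 0"
    using X[unfolded conv_hist_def, rule_format, of "\<epsilon> / 2"] e by (simp only: half_gt_zero)
  show "(\<lambda>n. measure_pmf.prob (hist n) {a. \<bar>Y n a - c\<bar> > \<epsilon>}) \<longlonglongrightarrow> 0"
    by (rule tendsto_sandwich[OF _ ev tendsto_const lim]) simp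
qed

lemma clen_kids: "length (subs (ptree_of a n v)) = card (kids a n v)"
  unfolding ptree_of_subs kids_def using distinct_card[OF distinct_ch, of a n v] by simp

text \<open>A vertex other than the root has one more neighbour than it has children. The exceptional root and the
normalisation by \<open>n\<close> instead of \<open>n + 1\<close> cost \<open>1 / n\<close> each.\<close>

lemma degree_count_approx:
  assumes a: "history n a" and n: "n >= 1" and k: "k >= 1"
  shows "\<bar>real (degree_count a n k) / real n
    - real (card {v \<in> {0..n}. length (subs (ptree_of a n v)) = k - 1}) / real (n + 1)\<bar> <= 2 / real n"
proof -
  let ?D = "{v \<in> {0..n}. tree_degree a n v = k}" and ?C = "{v \<in> {0..n}. length (subs (ptree_of a n v)) = k - 1}"
  have aj: "\<forall>j\<ge>1. a j < j" using historyD[OF a] by blast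
  have iff: "tree_degree a n v = k \<longleftrightarrow> length (subs (ptree_of a n v)) = k - 1" if "v ~= 0" "v <= n" for v
    using tree_degree_children[OF aj, of v n] that k unfolding clen_kids kids_def by auto
  have "?D \<subseteq> insert 0 ?C" "?C \<subseteq> insert 0 ?D" using iff by auto
  then have "card ?D <= card (insert 0 ?C)" "card ?C <= card (insert 0 ?D)" by (auto intro!: card_mono)
  then have "card ?D <= Suc (card ?C)" "card ?C <= Suc (card ?D)"
  proof -
    have "card (insert 0 A) <= Suc (card A)" if "finite A" for A :: "nat set"
      using that by (simp add: card_insert_if)
    from this[of ?C] this[of ?D]
    have "card (insert 0 ?C) <= Suc (card ?C)" "card (insert 0 ?D) <= Suc (card ?D)" by simp_all
    then show "card ?D <= Suc (card ?C)" "card ?C <= Suc (card ?D)"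
      using \<open>card ?D <= card (insert 0 ?C)\<close> \<open>card ?C <= card (insert 0 ?D)\<close> by linarith+
  qed
  then have d: "\<bar>real (card ?D) - real (card ?C)\<bar> <= 1" by linarith
  have "card ?C <= card {0..n}" by (intro card_mono) auto
  then have c: "real (card ?C) <= real (n + 1)" by simp
  have main: "\<bar>x / m - y / (m + 1)\<bar> <= 2 / m" if "\<bar>x - y\<bar> <= 1" "0 <= y" "y <= m + 1" "m > 0" for x y m :: real
  proof -
    have "x / m - y / (m + 1) = ((x - y) + y / (m + 1)) / m"
      using that by (simp add: field_simps)
    moreover have "0 <= y / (m + 1)" "y / (m + 1) <= 1" using that by auto
    then have "\<bar>(x - y) + y / (m + 1)\<bar> <= 2" using that by linarith
    ultimately show ?thesis using that by (simp add: divide_right_mono)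
  qed
  show ?thesis unfolding degree_count_def using main[OF d _ _, of "real n"] c n by (simp add: add.commute)
qed

lemma degree_count_restr:
  assumes "n >= 1"
  shows "degree_count (restr n a) n k = degree_count a n k"
proof -
  have "tree_edges (restr n a) n = tree_edges a n"
    unfolding tree_edges_def using assms by (intro image_cong) (auto simp: restr_def)
  then show ?thesis unfolding degree_count_def tree_degree_def by simp
qed

end

context branching begin

text \<open>The frequency of a given tuple is a constant multiple of the frequency of a class, and its limit is the
probability of the tuple for the sin-tree; sets of atoms of large mass exist by countability.\<close>

lemma fringe_conv:
  assumes \<mu>: "sin_tree_law (BP_law B X S) \<mu>" and b: "\<And>x. \<bar>f x\<bar> <= b"
  shows "conv_hist (\<lambda>n a. (\<Sum>v\<in>{0..n}. f (fringe_of k a n v)) / real (n + 1)) (\<integral>x. f x \<partial>sin_fringe_law \<mu> k)"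
proof -
  note m = \<mu>[unfolded BP_law_cl sin_tree_law_iff]
  have p: "prob_space \<mu>" and s: "sets \<mu> = sets sin_tree_space" using m by blast+
  have atoms: "measure \<mu> {\<tau> \<in> space \<mu>. \<forall>j\<le>k. \<tau> j = s j} = pmf cl (monotone_rep s k) * path_weight (monotone_rep s) k" for s
    using m by blast
  let ?L = "sin_fringe_law \<mu> k"
  note L = sin_fringe_law_prob[OF p s, of k]
  show ?thesis
  proof (rule conv_hist_expectation[OF L b])
    fix \<eta> :: real assume e: "\<eta> > 0"
    have ctbl: "countable (UNIV :: rtree option list set)" using countable_lists[OF countable_rtree_option] by simp
    obtain G where G: "finite G" "measure ?L G >= 1 - \<eta>"
      by (rule finite_set_large_measure[OF L ctbl e])
    let ?G = "{x \<in> G. \<exists>s. x = map (\<lambda>i. Some (s i)) [0..<Suc k]}"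
    interpret L: prob_space ?L by (rule L)
    have "measure ?L G = (\<Sum>x\<in>G. measure ?L {x})"
      by (rule L.finite_measure_eq_sum_singleton[OF G(1)]) (simp add: L(2))
    also have "... = (\<Sum>x\<in>?G. measure ?L {x})"
      by (rule sum.mono_neutral_right[OF G(1)]) (use sin_fringe_law_atom(2)[OF s] in auto)
    also have "... = measure ?L ?G"
      by (rule L.finite_measure_eq_sum_singleton[symmetric]) (use G(1) L(2) in simp_all)
    finally have mG: "measure ?L ?G >= 1 - \<eta>" using G(2) by simp
    have "conv_hist (freq (fringe_of k) x) (measure ?L {x})" if "x \<in> ?G" for x
    proof -
      obtain s' where x: "x = map (\<lambda>i. Some (s' i)) [0..<Suc k]" using \<open>x \<in> ?G\<close> by blast
      show ?thesis
        unfolding x sin_fringe_law_atom(1)[OF s] atoms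
        by (rule conv_hist_cong[OF conv_hist_scale[OF clsv_conv]]) (rule freq_fringe[symmetric])
    qed
    then show "\<exists>G. finite G & measure ?L G >= 1 - \<eta> & (\<forall>x\<in>G. conv_hist (freq (fringe_of k) x) (measure ?L {x}))"
      using mG G(1) by (intro exI[of _ ?G]) simp
  qed
qed

lemma extended_fringe_conv_BP:
  assumes R: "reinforced_pa_trees \<delta> M A" and \<mu>: "sin_tree_law (BP_law B X S) \<mu>"
  shows "extended_fringe_conv M A \<mu>"
  unfolding extended_fringe_conv_def weak_conv_in_prob_def
proof (intro allI impI)
  fix k and f :: "rtree option list => real" assume "bounded (range f)"
  then obtain b where b: "\<And>x. \<bar>f x\<bar> <= b" unfolding bounded_iff by auto
  show "conv_in_prob M (\<lambda>n \<omega>. \<integral>x. f x \<partial>empirical_fringe (\<lambda>j. A j \<omega>) n k) (\<integral>x. f x \<partial>sin_fringe_law \<mu> k)"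
  proof (rule conv_hist_transfer[OF R fringe_conv[OF \<mu> b]])
    fix n \<omega> assume w: "\<omega> \<in> space M"
    have aj: "\<forall>j\<ge>1. A j \<omega> < j"
    proof (intro allI impI)
      fix j :: nat assume "j >= 1"
      then obtain i where j: "j = i + 1" by (cases j) auto
      have "A (i + 1) \<omega> <= i" using R w unfolding reinforced_pa_trees_def by blast
      then show "A j \<omega> < j" unfolding j by simp
    qed
    have "(\<integral>x. f x \<partial>empirical_fringe (\<lambda>j. A j \<omega>) n k) = (\<Sum>v\<in>{0..n}. f (fringe_upto {0..n} 0 (\<lambda>j. A j \<omega>) v k)) / real (card {0..n})"
      unfolding empirical_fringe_def by (simp add: integral_pmf_of_set)
    also have "(\<Sum>v\<in>{0..n}. f (fringe_upto {0..n} 0 (\<lambda>j. A j \<omega>) v k)) = (\<Sum>v\<in>{0..n}. f (fringe_of k (restr n (\<lambda>j. A j \<omega>)) n v))"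
      by (intro sum.cong refl arg_cong[where f = f] fringe_upto_restr aj) simp
    finally show "(\<integral>x. f x \<partial>empirical_fringe (\<lambda>j. A j \<omega>) n k) = (\<Sum>v\<in>{0..n}. f (fringe_of k (restr n (\<lambda>j. A j \<omega>)) n v)) / real (n + 1)"
      by simp
  qed
qed

lemma degree_conv:
  assumes R: "reinforced_pa_trees \<delta> M A" and k: "k >= 1"
  shows "conv_in_prob M (\<lambda>n \<omega>. real (degree_count (\<lambda>j. A j \<omega>) n k) / real n) (enn2real (degree_prob (k - 1)))"
proof (rule conv_hist_transfer[OF R])
  let ?f = "indicator {t. clen t = k - 1} :: ptree => real"
  let ?X = "\<lambda>n a. real (card {v \<in> {0..n}. clen (ptree_of a n v) = k - 1}) / real (n + 1)"
  have "measure_pmf.expectation U ?f = measure (measure_pmf U) {t. clen t = k - 1}" by simp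
  also have "... = enn2real (degree_prob (k - 1))" using clen_law[of "k - 1"] by (simp add: measure_def)
  finally have lim: "measure_pmf.expectation U ?f = enn2real (degree_prob (k - 1))" .
  have "conv_hist (\<lambda>n a. (\<Sum>v\<in>{0..n}. ?f (ptree_of a n v)) / real (n + 1)) (enn2real (degree_prob (k - 1)))"
    unfolding lim[symmetric] by (rule average_conv[of _ 1]) simp
  moreover have "(\<Sum>v\<in>{0..n}. ?f (ptree_of a n v)) = real (card {v \<in> {0..n}. clen (ptree_of a n v) = k - 1})" for a n
    by (simp add: indicator_def sum.If_cases Int_def)
  ultimately have X: "conv_hist ?X (enn2real (degree_prob (k - 1)))" by simp
  show "conv_hist (\<lambda>n a. real (degree_count a n k) / real n) (enn2real (degree_prob (k - 1)))"
  proof (rule conv_hist_perturb[OF X])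
    show "(\<lambda>n. 2 / real n) \<longlonglongrightarrow> 0" by (rule lim_const_over_n)
  qed (rule degree_count_approx[OF _ _ k])
  fix n \<omega>
  show "real (degree_count (\<lambda>j. A j \<omega>) n k) / real n = real (degree_count (restr n (\<lambda>j. A j \<omega>)) n k) / real n"
    by (cases "n >= 1") (simp_all add: degree_count_restr not_less_eq_eq)
qed

end

theorem theorem2p2:
  fixes \<delta> :: real
    and M :: "'a measure" and A :: "nat \<Rightarrow> 'a \<Rightarrow> nat"
    and B :: "'b measure" and X :: "nat list \<Rightarrow> nat \<Rightarrow> 'b \<Rightarrow> real" and S :: "'b \<Rightarrow> real"
    and P :: "'c measure" and E :: "nat \<Rightarrow> 'c \<Rightarrow> real" and T :: "'c \<Rightarrow> real"
  assumes "\<delta> > -1"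
    and "reinforced_pa_trees \<delta> M A"
    and "BP_realisation \<delta> B X S"
    and "interarrivals_with_exp \<delta> P E T"
  shows "fringe_distribution (BP_law B X S)
    \<and> (\<exists>!\<mu>. sin_tree_law (BP_law B X S) \<mu>)
    \<and> (\<forall>\<mu>. sin_tree_law (BP_law B X S) \<mu> \<longrightarrow> extended_fringe_conv M A \<mu>)
    \<and> (\<forall>k\<ge>1. conv_in_prob M (\<lambda>n \<omega>. real (degree_count (\<lambda>j. A j \<omega>) n k) / real n)
                 (limit_degree_prob P E T k))"
proof -
  interpret reinforcement \<delta> by unfold_locales (rule assms(1))
  interpret prob_space B using assms(3) unfolding BP_realisation_def by blast
  interpret branching \<delta> B X S by unfold_locales (rule assms(3))
  interpret F: fringe_pmf cl by unfold_locales (rule child_count_eq)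
  show ?thesis
  proof (intro conjI allI impI)
    show "fringe_distribution (BP_law B X S)" by (rule fringe_distribution_BP)
    show "\<exists>!\<mu>. sin_tree_law (BP_law B X S) \<mu>"
      unfolding BP_law_cl
    proof (rule ex1I)
      show "sin_tree_law (measure_pmf (map_pmf Some cl)) F.IT.PF.lim" by (rule F.sin_tree_law_exists)
      show "\<mu> = F.IT.PF.lim" if "sin_tree_law (measure_pmf (map_pmf Some cl)) \<mu>" for \<mu>
        by (rule sin_tree_law_unique[OF that F.sin_tree_law_exists])
    qed
    show "extended_fringe_conv M A \<mu>" if "sin_tree_law (BP_law B X S) \<mu>" for \<mu>
      by (rule extended_fringe_conv_BP[OF assms(2) that])
    show "conv_in_prob M (\<lambda>n \<omega>. real (degree_count (\<lambda>j. A j \<omega>) n k) / real n) (limit_degree_prob P E T k)"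
      if "k \<ge> 1" for k
      unfolding limit_degree_prob_eq[OF assms(4) that] by (rule degree_conv[OF assms(2) that])
  qed
qed

end
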